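(* Let $f$ be a measurable function on $\mathbb R_+$ and $t>0$ be such that its Laplace transform $\mathscr L(f)(t+is)$ is in $L^1$ as a function of $s\in\mathbb R$. Let $M_q$ be an elliptically degenerating family of hyperbolic Riemann surfaces of finite volume converging to $M_\infty$, and let $x,y$ be points bounded away from the developing cusps. Then for every $T>0$, $$\lim_{q\to\infty}\frac1{2\pi i}\int_{t-i\infty}^{t+i\infty}K_{M_q}(z,x,y)\mathscr L(f)(z)e^{Tz}\frac{dz}{z}=\frac1{2\pi i}\int_{t-i\infty}^{t+i\infty}K_{M_\infty}(z,x,y)\mathscr L(f)(z)e^{Tz}\frac{dz}{z},$$ and the convergence is uniform for $(x,y)$ in compact subsets of $M_\infty\times M_\infty$.
   Context: $\mathscr L(f)(z)=\int_0^\infty f(u)e^{-zu}du$. $\mathbb H$ is the hyperbolic upper half-plane; for complex $z$ with $\mathrm{Re}\,z>0$, $K_{\mathbb H}(z,\rho)=\frac{\sqrt2e^{-z/4}}{(4\pi z)^{3/2}}\int_\rho^\infty\frac{ue^{-u^2/4z}\,du}{\sqrt{\cosh u-\cosh\rho}}$ ($\rho>0$ hyperbolic distance) and for $R=\Gamma\backslash\mathbb H$ the heat kernel is $K_R(z,x,y)=\sum_{\gamma\in\Gamma}K_{\mathbb H}(z,d(\tilde x,\gamma\tilde y))$. For an integer $q\ge2$, $C_q$ is the infinite hyperbolic cone $\{(\rho,\theta):\rho>0,0\le\theta<2\pi\}$ with metric $d\rho^2+q^{-2}\sinh^2\rho\,d\theta^2$, $C_{q,\varepsilon}=\{\rho<\cosh^{-1}(1+\varepsilon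 q/2\pi)\}$; $C_\infty$ is the cusp $\{x+iy:y>0\}$ mod $x\mapsto x+1$ with metric $(dx^2+dy^2)/y^2$, $C_{\infty,\varepsilon}=\{y>2\varepsilon\}$. For $q=(q_1,\dots,q_m)$, $C_q,C_{q,\varepsilon}$ are disjoint unions; $q\to\infty$ means all $q_k\to\infty$. An elliptically degenerating family is a family $M_q=\Gamma_q\backslash\mathbb H$ of finite-volume hyperbolic surfaces such that (a) for every $\varepsilon<1/2$, $C_{q,\varepsilon}$ embeds isometrically in $M_q$ as neighbourhoods of $m$ cone points of orders $q_1,\dots,q_m$; (b) as $q\to\infty$, $M_q$ converges to a complete finite-volume hyperbolic surface $M_\infty$ containing $m$ copies of $C_{\infty,\varepsilon}$ (the developing cusps, limits of $C_{q,\varepsilon}$), the geometry of $M_q\setminus C_{q,\varepsilon}$ converging to that of $M_\infty\setminus(m\times C_{\infty,\varepsilon})$, with points outside the cone neighbourhoods identified across the family. "Bounded away from the developing cusps" means lying in $M_q\setminus C_{q,\varepsilon}$ for some fixed $\varepsilon$.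
   Formalization: The cusp neighbourhood C_{∞,ε} is taken as {y > 1/ε} instead of {y > 2ε}: C_{q,ε} has area ε, so its limit is {y > 1/ε}, while {y > 2ε} has area 1/(2ε), which is not that limit for any ε < 1/2 and is unbounded as ε → 0. *)

theory Defs
  imports "HOL-Analysis.Analysis" "HOL-Algebra.Bij"
begin

definition upper :: "complex set" where
  "upper = {z. 0 < Im z}"

definition hdist :: "complex \<Rightarrow> complex \<Rightarrow> real" where
  "hdist z w = arcosh (1 + (cmod (z - w))\<^sup>2 / (2 * Im z * Im w))"

definition hyp_area :: "complex measure" where
  "hyp_area = density lborel (\<lambda>z. ennreal (indicator upper z / (Im z)\<^sup>2))"

text \<open>Elements of the group PSL(2,R) are taken as maps, so that a matrix and its negative give the
  same element; the maps are restricted to the half-plane to make them elements of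
  \<^const>\<open>BijGroup\<close>.\<close>

definition PSL2R :: "(complex \<Rightarrow> complex) set" where
  "PSL2R = {restrict (\<lambda>z. (of_real a * z + of_real b) / (of_real c * z + of_real d)) upper
             | a b c d :: real. a * d - b * c = 1}"

definition fuchsian :: "(complex \<Rightarrow> complex) set \<Rightarrow> bool" where
  "fuchsian \<Gamma> \<longleftrightarrow> subgroup \<Gamma> (BijGroup upper) \<and> \<Gamma> \<subseteq> PSL2R \<and>
     (\<forall>K. compact K \<and> K \<subseteq> upper \<longrightarrow> finite {\<gamma> \<in> \<Gamma>. \<gamma> ` K \<inter> K \<noteq> {}})"

text \<open>The points of the quotient surface are the orbits. Elliptic elements are allowed; the surface
  then has cone points.\<close>

definition surf :: "(complex \<Rightarrow> complex) set \<Rightarrow> complex set set" where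
  "surf \<Gamma> = (\<lambda>z. (\<lambda>\<gamma>. \<gamma> z) ` \<Gamma>) ` upper"

definition qdist :: "complex set \<Rightarrow> complex set \<Rightarrow> real" where
  "qdist X Y = Inf {hdist x y | x y. x \<in> X \<and> y \<in> Y}"

text \<open>The locale \<^locale>\<open>Metric_space\<close> demands nonnegativity also outside the carrier, hence the
  value 0 there.\<close>

definition surf_top :: "(complex \<Rightarrow> complex) set \<Rightarrow> complex set topology" where
  "surf_top \<Gamma> = Metric_space.mtopology (surf \<Gamma>)
     (\<lambda>X Y. if X \<in> surf \<Gamma> \<and> Y \<in> surf \<Gamma> then qdist X Y else 0)"

text \<open>Some Borel fundamental domain (one point in each orbit) has finite area.\<close>

definition finite_volume :: "(complex \<Rightarrow> complex) set \<Rightarrow> bool" where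
  "finite_volume \<Gamma> \<longleftrightarrow> (\<exists>F \<in> sets borel. F \<subseteq> upper \<and>
     (\<forall>X \<in> surf \<Gamma>. \<exists>!z. z \<in> X \<inter> F) \<and> emeasure hyp_area F < \<infinity>)"

definition lift_pt :: "complex set \<Rightarrow> complex" where
  "lift_pt X = (SOME z. z \<in> X)"

definition cone_order :: "(complex \<Rightarrow> complex) set \<Rightarrow> complex set \<Rightarrow> nat" where
  "cone_order \<Gamma> X = card {\<gamma> \<in> \<Gamma>. \<gamma> (lift_pt X) = lift_pt X}"

definition heat_H :: "complex \<Rightarrow> real \<Rightarrow> complex" where
  "heat_H z \<rho> = of_real (sqrt 2) * exp (- z / 4) / (4 * of_real pi * z) powr (3 / 2) *
     (LINT u:{\<rho><..}|lborel.
        of_real u * exp (- (of_real u)\<^sup>2 / (4 * z)) / of_real (sqrt (cosh u - cosh \<rho>)))"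

definition heat_kernel ::
  "(complex \<Rightarrow> complex) set \<Rightarrow> complex \<Rightarrow> complex set \<Rightarrow> complex set \<Rightarrow> complex" where
  "heat_kernel \<Gamma> z X Y = (\<Sum>\<^sub>\<infinity>\<gamma>\<in>\<Gamma>. heat_H z (hdist (lift_pt X) (\<gamma> (lift_pt Y))))"

text \<open>The cone and the cusp are given by coordinates: polar coordinates \<open>(\<rho>, \<theta>)\<close>, with \<open>\<theta>\<close> running
  through the reals modulo \<open>2\<pi>\<close>, and points of the half-plane modulo \<open>z \<mapsto> z + 1\<close>. Accordingly, a map
  from (an open part of) the cone or cusp into a surface is a function on an open coordinate domain
  \<open>D\<close> that is compatible with an identification \<open>E\<close>. The metric tensor is the function \<open>g\<close>:
  \<open>g p v\<close> is the squared length of the tangent vector \<open>v\<close> at \<open>p\<close>. An isometric embedding is an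
  injective map for which the distance on the surface has \<open>g\<close> as its infinitesimal form.\<close>

definition isometric_embedding ::
  "('p::real_normed_vector \<Rightarrow> 'p \<Rightarrow> real) \<Rightarrow> 'p set \<Rightarrow> ('p \<Rightarrow> 'p \<Rightarrow> bool) \<Rightarrow>
   (complex \<Rightarrow> complex) set \<Rightarrow> ('p \<Rightarrow> complex set) \<Rightarrow> bool" where
  "isometric_embedding g D E \<Gamma> \<iota> \<longleftrightarrow> \<iota> ` D \<subseteq> surf \<Gamma> \<and>
     (\<forall>p \<in> D. \<forall>p' \<in> D. \<iota> p = \<iota> p' \<longleftrightarrow> E p p') \<and>
     (\<forall>p \<in> D. ((\<lambda>p'. qdist (\<iota> p) (\<iota> p') / sqrt (g p (p' - p))) \<longlongrightarrow> 1) (at p))"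

definition cone_tensor :: "nat \<Rightarrow> real \<times> real \<Rightarrow> real \<times> real \<Rightarrow> real" where
  "cone_tensor n p v = (fst v)\<^sup>2 + (sinh (fst p))\<^sup>2 / (real n)\<^sup>2 * (snd v)\<^sup>2"

definition cone_ident :: "real \<times> real \<Rightarrow> real \<times> real \<Rightarrow> bool" where
  "cone_ident p p' \<longleftrightarrow> fst p = fst p' \<and> (\<exists>n::int. snd p' = snd p + 2 * pi * of_int n)"

definition cone_dom :: "nat \<Rightarrow> real \<Rightarrow> (real \<times> real) set" where
  "cone_dom n \<epsilon> = {(\<rho>, \<theta>). 0 < \<rho> \<and> \<rho> < arcosh (1 + \<epsilon> * real n / (2 * pi))}"

definition cusp_tensor :: "complex \<Rightarrow> complex \<Rightarrow> real" where
  "cusp_tensor z v = ((Re v)\<^sup>2 + (Im v)\<^sup>2) / (Im z)\<^sup>2"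

definition cusp_ident :: "complex \<Rightarrow> complex \<Rightarrow> bool" where
  "cusp_ident z w \<longleftrightarrow> (\<exists>n::int. w = z + of_int n)"

text \<open>The part of the cone described by \<^const>\<open>cone_dom\<close> has area \<open>\<epsilon>\<close> and its boundary length tends
  to \<open>\<epsilon>\<close> as the order grows. Its limit is thus the part of the cusp of area \<open>\<epsilon>\<close>, above the horocycle
  \<open>Im z = 1 / \<epsilon>\<close>.\<close>

definition cusp_dom :: "real \<Rightarrow> complex set" where
  "cusp_dom \<epsilon> = {z. 1 / \<epsilon> < Im z}"

text \<open>\<open>Q\<close> is the set of multi-orders occurring in the family; in this filter all of them tend to
  infinity.\<close>

definition orders_to_infinity :: "('m \<Rightarrow> nat) set \<Rightarrow> ('m \<Rightarrow> nat) filter" where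
  "orders_to_infinity Q = (INF N::nat. principal {q \<in> Q. \<forall>k. N \<le> q k})"

text \<open>The apex is not in the coordinate domain of the cone; it belongs to the neighbourhood.\<close>

definition cone_nbhds ::
  "(('m \<Rightarrow> nat) \<Rightarrow> 'm \<Rightarrow> complex set) \<Rightarrow> (('m \<Rightarrow> nat) \<Rightarrow> 'm \<Rightarrow> real \<times> real \<Rightarrow> complex set) \<Rightarrow>
   ('m \<Rightarrow> nat) \<Rightarrow> real \<Rightarrow> 'm \<Rightarrow> complex set set" where
  "cone_nbhds apex \<kappa> q \<epsilon> k = insert (apex q k) (\<kappa> q k ` cone_dom (q k) \<epsilon>)"

text \<open>\<open>M\<^sub>q\<close> is the quotient by \<open>\<Gamma> q\<close>, \<open>M\<^sub>\<infinity>\<close> the one by \<open>\<Gamma>_inf\<close>; \<open>\<kappa> q k\<close> and \<open>\<sigma> k\<close> embed the cones and the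
  developing cusps, indexed by the finite type \<open>'m\<close>. The map \<open>\<phi> q\<close> identifies the points of \<open>M\<^sub>\<infinity>\<close>
  with points of \<open>M\<^sub>q\<close>; every point of \<open>M\<^sub>\<infinity>\<close> is outside the developing cusps for small \<open>\<epsilon>\<close>.
  Convergence of the geometry means that the maps \<open>\<phi> q\<close> are locally bi-Lipschitz, with constants
  tending to 1 uniformly on compact sets (for diffeomorphisms: the metric tensors converge
  uniformly on compact sets).\<close>

locale elliptically_degenerating =
  fixes Q :: "('m::finite \<Rightarrow> nat) set"
    and \<Gamma> :: "('m \<Rightarrow> nat) \<Rightarrow> (complex \<Rightarrow> complex) set"
    and \<Gamma>_inf :: "(complex \<Rightarrow> complex) set"
    and apex :: "('m \<Rightarrow> nat) \<Rightarrow> 'm \<Rightarrow> complex set"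
    and \<kappa> :: "('m \<Rightarrow> nat) \<Rightarrow> 'm \<Rightarrow> real \<times> real \<Rightarrow> complex set"
    and \<sigma> :: "'m \<Rightarrow> complex \<Rightarrow> complex set"
    and \<phi> :: "('m \<Rightarrow> nat) \<Rightarrow> complex set \<Rightarrow> complex set"
  assumes orders: "\<And>q k. q \<in> Q \<Longrightarrow> 2 \<le> q k"
    and fuchsian_family: "\<And>q. q \<in> Q \<Longrightarrow> fuchsian (\<Gamma> q) \<and> finite_volume (\<Gamma> q)"
    and fuchsian_limit: "fuchsian \<Gamma>_inf \<and> finite_volume \<Gamma>_inf"
    and apex: "\<And>q k. q \<in> Q \<Longrightarrow> apex q k \<in> surf (\<Gamma> q) \<and> cone_order (\<Gamma> q) (apex q k) = q k"
    and cone_embedding: "\<And>q k \<epsilon>. q \<in> Q \<Longrightarrow> 0 < \<epsilon> \<Longrightarrow> \<epsilon> < 1/2 \<Longrightarrow>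
      isometric_embedding (cone_tensor (q k)) (cone_dom (q k) \<epsilon>) cone_ident (\<Gamma> q) (\<kappa> q k)"
    and cone_apex: "\<And>q k \<theta>. q \<in> Q \<Longrightarrow>
      ((\<lambda>\<rho>. qdist (apex q k) (\<kappa> q k (\<rho>, \<theta>))) \<longlongrightarrow> 0) (at_right 0)"
    and cone_open: "\<And>q k \<epsilon>. q \<in> Q \<Longrightarrow> 0 < \<epsilon> \<Longrightarrow> \<epsilon> < 1/2 \<Longrightarrow>
      openin (surf_top (\<Gamma> q)) (cone_nbhds apex \<kappa> q \<epsilon> k)"
    and cone_disjoint: "\<And>q j k \<epsilon>. q \<in> Q \<Longrightarrow> 0 < \<epsilon> \<Longrightarrow> \<epsilon> < 1/2 \<Longrightarrow> j \<noteq> k \<Longrightarrow>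
      cone_nbhds apex \<kappa> q \<epsilon> j \<inter> cone_nbhds apex \<kappa> q \<epsilon> k = {}"
    and cusp_embedding: "\<And>k \<epsilon>. 0 < \<epsilon> \<Longrightarrow> \<epsilon> < 1/2 \<Longrightarrow>
      isometric_embedding cusp_tensor (cusp_dom \<epsilon>) cusp_ident \<Gamma>_inf (\<sigma> k)"
    and cusp_disjoint: "\<And>j k \<epsilon>. 0 < \<epsilon> \<Longrightarrow> \<epsilon> < 1/2 \<Longrightarrow> j \<noteq> k \<Longrightarrow>
      \<sigma> j ` cusp_dom \<epsilon> \<inter> \<sigma> k ` cusp_dom \<epsilon> = {}"
    and identification: "\<And>q \<epsilon>. q \<in> Q \<Longrightarrow> 0 < \<epsilon> \<Longrightarrow> \<epsilon> < 1/2 \<Longrightarrow>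
      homeomorphic_map
        (subtopology (surf_top \<Gamma>_inf) (surf \<Gamma>_inf - (\<Union>k. \<sigma> k ` cusp_dom \<epsilon>)))
        (subtopology (surf_top (\<Gamma> q)) (surf (\<Gamma> q) - (\<Union>k. cone_nbhds apex \<kappa> q \<epsilon> k)))
        (\<phi> q)"
    and geometry: "\<And>K \<delta>. compactin (surf_top \<Gamma>_inf) K \<Longrightarrow> 0 < \<delta> \<Longrightarrow>
      \<forall>\<^sub>F q in orders_to_infinity Q. \<forall>X \<in> K. \<exists>r>0. \<forall>Y \<in> surf \<Gamma>_inf. \<forall>Z \<in> surf \<Gamma>_inf.
        qdist X Y < r \<longrightarrow> qdist X Z < r \<longrightarrow>
          (1 - \<delta>) * qdist Y Z \<le> qdist (\<phi> q Y) (\<phi> q Z) \<and>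
          qdist (\<phi> q Y) (\<phi> q Z) \<le> (1 + \<delta>) * qdist Y Z"

definition laplace :: "(real \<Rightarrow> complex) \<Rightarrow> complex \<Rightarrow> complex" where
  "laplace f z = (LINT u:{0<..}|lebesgue. f u * exp (- z * of_real u))"

definition vline_integrable :: "real \<Rightarrow> (complex \<Rightarrow> complex) \<Rightarrow> bool" where
  "vline_integrable t G \<longleftrightarrow> integrable lborel (\<lambda>s. G (Complex t s))"

text \<open>The second factor \<open>\<i>\<close> is the derivative of the parametrization \<open>s \<mapsto> t + \<i>s\<close>.\<close>

definition vline_integral :: "real \<Rightarrow> (complex \<Rightarrow> complex) \<Rightarrow> complex" where
  "vline_integral t G = 1 / (2 * of_real pi * \<i>) * (LINT s|lborel. G (Complex t s) * \<i>)"

definition heat_integrand ::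
  "(real \<Rightarrow> complex) \<Rightarrow> real \<Rightarrow> (complex \<Rightarrow> complex) set \<Rightarrow> complex set \<Rightarrow> complex set \<Rightarrow>
   complex \<Rightarrow> complex" where
  "heat_integrand f T \<Gamma> X Y z = heat_kernel \<Gamma> z X Y * laplace f z * exp (of_real T * z) / z"

end

theory Submission
  imports Defs "HOL-Probability.Probability" "HOL-Complex_Analysis.Great_Picard"
begin

text \<open>On the line Re z = t the integrand is a heat kernel times an integrable function of s =
  Im z, namely L(f)(t + i s), times exp (T z) / z, which is bounded there. The theorem is therefore
  an instance of dominated convergence, and it needs two facts about heat kernels: a bound that does
  not depend on s and is uniform along the family, and convergence for each single z, with the two
  points allowed to move.

  The bound. \<open>heat_kernel_diagonal_bound\<close> estimates |K(z,x,y)| by the mean of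
  |K(t,x,x)| and |K(t,y,y)|, where t = Re z. Its source is the semigroup law: K(z,x,y) is the
  integral over the surface of K(z/2,x,w) K(z/2,w,y), while the integral of |K(z/2,x,w)|^2 is a
  multiple of K(t,x,x). On the half-plane, integration over horocycles is an Abel transform. It
  carries the heat kernel to a Gaussian (\<open>Abel_KC\<close>) and convolution to convolution on
  the line (\<open>Abel_hprofile\<close>), and it is injective (\<open>Abel_injective\<close>); so
  the semigroup laws reduce to two Gaussian integrals (\<open>gauss_conv_same\<close>,
  \<open>gauss_conv_cnj\<close>). They pass to the quotient by unfolding
  (\<open>fold_product\<close>).

  The convergence. The identification maps are locally almost isometric. Lifting of paths makes them
  almost isometric on balls of any fixed radius, and onto such balls (\<open>near_isom\<close>).
  Cover M_q by the half-plane with \<i> over the image of a base point and return to M_inf by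
  inverting the identification. By an Arzela-Ascoli argument a subsequence of these maps converges
  to a map J from the half-plane to M_inf (\<open>limit_exists\<close>) which does not increase
  distances and has lifts at exact distance. Such a submetry is the orbit projection of
  \<open>\<Gamma>_inf\<close> up to an isometry A of the half-plane
  (\<open>global_isometry\<close>). In these coordinates the groups converge: limits of their
  elements belong to the limit group (\<open>Mat_limit\<close>), every element of the limit group is
  such a limit (\<open>approximating_elements\<close>), and, because there are no small non-trivial
  elements (\<open>no_small_elements\<close>), the elements of bounded displacement are eventually
  exactly the approximating ones (\<open>exhaustion\<close>). So the sums defining the heat kernels
  converge term by term. Their tails are uniformly small by \<open>packing\<close>, which bounds the
  sum of cosh^-2 of the distances to an orbit through the number of elements that move a point by at
  most 2; \<open>exhaustion\<close> bounds that number along the sequence.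

  Uniformity. Passing to subsequences is harmless, since the last argument is by contradiction
  (\<open>vline_uniform\<close>): a failure of uniform convergence gives multi-orders tending to
  infinity and pairs of points of the compact set, which may be taken convergent. The continuity of
  the limit integral in the two points, which is needed there, is the same convergence applied to
  the constant family.\<close>

lemma upper_iff [simp]: "z \<in> upper \<longleftrightarrow> 0 < Im z"
  by (simp add: upper_def)

section \<open>The hyperbolic plane in hyperboloid and polar coordinates\<close>

lemma cosh_hdist:
  assumes "z \<in> upper" "w \<in> upper"
  shows "cosh (hdist z w) = 1 + (cmod (z - w))\<^sup>2 / (2 * Im z * Im w)"
  unfolding hdist_def using assms by (intro cosh_arcosh_real) auto

lemma hdist_nonneg [simp]: "z \<in> upper \<Longrightarrow> w \<in> upper \<Longrightarrow> 0 \<le> hdist z w"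
  unfolding hdist_def by (intro arcosh_nonneg_real) auto

lemma hdist_commute: "hdist z w = hdist w z"
  by (simp add: hdist_def norm_minus_commute mult_ac)

lemma hdist_self [simp]: "hdist z z = 0"
  by (simp add: hdist_def)

lemma hdist_eq_0_iff [simp]: "z \<in> upper \<Longrightarrow> w \<in> upper \<Longrightarrow> hdist z w = 0 \<longleftrightarrow> z = w"
  unfolding hdist_def by (subst arcosh_eq_0_iff_real) auto

lemma cosh_le_iff_nonneg: "0 \<le> x \<Longrightarrow> 0 \<le> y \<Longrightarrow> cosh x \<le> cosh y \<longleftrightarrow> x \<le> (y::real)"
  by (rule cosh_real_nonneg_le_iff)

text \<open>\<open>hT\<close> and \<open>hX\<close> are the time and space coordinates of the
  hyperboloid model centred at \<i>. In them cosh of the distance is a Lorentz product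
  (\<open>cosh_hdist_hX\<close>), so that metric questions become linear algebra in the
  plane.\<close>

definition hT :: "complex \<Rightarrow> real" where
  "hT p = ((cmod p)\<^sup>2 + 1) / (2 * Im p)"

definition hX :: "complex \<Rightarrow> complex" where
  "hX p = Complex (((cmod p)\<^sup>2 - 1) / (2 * Im p)) (Re p / Im p)"

text \<open>The inverse of \<open>hX\<close>. Since hT - Re hX is 1 / Im p, the height is recovered
  from \<open>hX\<close> alone once \<open>hT\<close> is replaced by its value on the
  hyperboloid.\<close>

definition hpt :: "complex \<Rightarrow> complex" where
  "hpt X = (let y = 1 / (sqrt (1 + (cmod X)\<^sup>2) - Re X) in Complex (Im X * y) y)"

lemma cosh_hdist_hX:
  assumes "p \<in> upper" "p' \<in> upper"
  shows "cosh (hdist p p') = hT p * hT p' - hX p \<bullet> hX p'"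
  using assms unfolding cosh_hdist[OF assms] hT_def hX_def
  by (simp add: inner_complex_def cmod_power2 field_simps) (simp add: power2_eq_square algebra_simps)

lemma norm_hX:
  assumes "p \<in> upper"
  shows "(cmod (hX p))\<^sup>2 = (hT p)\<^sup>2 - 1"
  using assms unfolding hT_def hX_def
  by (simp add: cmod_power2 field_simps) (simp add: power2_eq_square algebra_simps)

lemma hT_pos: "p \<in> upper \<Longrightarrow> 0 < hT p"
  unfolding hT_def by (simp add: add_nonneg_pos)

lemma hT_eq: "p \<in> upper \<Longrightarrow> hT p = sqrt (1 + (cmod (hX p))\<^sup>2)"
  using norm_hX hT_pos by (simp add: real_sqrt_unique[symmetric] less_imp_le)

lemma hT_minus_Re: "p \<in> upper \<Longrightarrow> hT p - Re (hX p) = 1 / Im p"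
  by (simp add: hT_def hX_def field_simps)

lemma hpt_hX [simp]: assumes "p \<in> upper" shows "hpt (hX p) = p"
proof -
  have "sqrt (1 + (cmod (hX p))\<^sup>2) - Re (hX p) = 1 / Im p"
    using hT_minus_Re[OF assms] hT_eq[OF assms] by simp
  then show ?thesis using assms by (simp add: hpt_def Let_def hX_def complex_eq_iff)
qed

lemma sqrt_minus_Re_pos: "0 < sqrt (1 + (cmod X)\<^sup>2) - Re X"
proof -
  have "Re X \<le> cmod X" by (rule complex_Re_le_cmod)
  also have "\<dots> < sqrt (1 + (cmod X)\<^sup>2)" by (rule real_less_rsqrt) simp
  finally show ?thesis by simp
qed

lemma hpt_upper [simp]: "hpt X \<in> upper"
  using sqrt_minus_Re_pos[of X] by (simp add: hpt_def Let_def)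

lemma hX_hpt [simp]: "hX (hpt X) = X"
proof -
  define t where "t = sqrt (1 + (cmod X)\<^sup>2)"
  define s where "s = t - Re X"
  have s: "0 < s" using sqrt_minus_Re_pos[of X] by (simp add: s_def t_def)
  have t2: "t\<^sup>2 = 1 + (Re X)\<^sup>2 + (Im X)\<^sup>2"
    by (simp add: t_def cmod_power2)
  have p: "hpt X = Complex (Im X * (1/s)) (1/s)" by (simp add: hpt_def Let_def s_def t_def)
  have "(Im X)\<^sup>2 + 1 - s\<^sup>2 = 2 * s * Re X"
    using t2 by (simp add: s_def power2_eq_square algebra_simps)
  then have "(((Im X/s)\<^sup>2 + (1/s)\<^sup>2) - 1) / (2/s) = Re X"
    using s by (simp add: field_simps power2_eq_square)
  then show ?thesis using s by (simp add: p hX_def complex_eq_iff cmod_power2)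
qed

lemma hT_hpt: "hT (hpt X) = sqrt (1 + (cmod X)\<^sup>2)"
  using hT_eq[OF hpt_upper] by simp

lemma hX_i [simp]: "hX \<i> = 0" and hT_i [simp]: "hT \<i> = 1"
  by (simp_all add: hX_def hT_def complex_eq_iff)

lemma cosh_hdist_i: "p \<in> upper \<Longrightarrow> cosh (hdist \<i> p) = hT p"
  by (subst cosh_hdist_hX) auto

lemma norm_hX_sinh: assumes "p \<in> upper" shows "cmod (hX p) = sinh (hdist \<i> p)"
proof -
  have "(cmod (hX p))\<^sup>2 = (sinh (hdist \<i> p))\<^sup>2"
    using norm_hX[OF assms] cosh_hdist_i[OF assms] by (simp add: cosh_square_eq[symmetric] sinh_square_eq)
  moreover have "0 \<le> sinh (hdist \<i> p)" using assms by simp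
  ultimately show ?thesis using power2_eq_iff_nonneg norm_ge_zero by blast
qed

text \<open>Geodesic polar coordinates about \<i>. Negative radii are allowed, so for a fixed unit
  vector \<open>u\<close> the radius runs along a whole geodesic
  (\<open>hdist_hpolar_radial\<close>).\<close>

definition hpolar :: "real \<Rightarrow> complex \<Rightarrow> complex" where
  "hpolar r u = hpt (of_real (sinh r) * u)"

lemma hpolar_upper [simp]: "hpolar r u \<in> upper"
  by (simp add: hpolar_def del: upper_iff)

lemma hpolar_Im_pos [simp]: "0 < Im (hpolar r u)"
  using hpolar_upper by simp

lemma cosh_hdist_hpolar:
  assumes "cmod u = 1" "cmod v = 1"
  shows "cosh (hdist (hpolar r u) (hpolar s v)) = cosh r * cosh s - sinh r * sinh s * (u \<bullet> v)"
proof -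
  have "sqrt (1 + (sinh r)\<^sup>2) = cosh r" for r :: real
    by (metis cosh_real_nonneg cosh_square_eq add.commute real_sqrt_abs abs_of_nonneg)
  then have "hT (hpolar r u) = cosh r" "hT (hpolar s v) = cosh s"
    using assms by (simp_all add: hpolar_def hT_hpt norm_mult power_mult_distrib)
  then show ?thesis
    by (simp add: cosh_hdist_hX del: upper_iff) (simp add: hpolar_def inner_complex_def algebra_simps)
qed

lemma hpolar_0 [simp]: "hpolar 0 u = \<i>"
  using hpt_hX[of \<i>] by (simp add: hpolar_def)

lemma hdist_eqI:
  assumes "z \<in> upper" "w \<in> upper" "0 \<le> r" "cosh (hdist z w) = cosh r"
  shows "hdist z w = r"
  using assms by (metis arcosh_cosh_real hdist_nonneg)

lemma hdist_i_hpolar: "cmod u = 1 \<Longrightarrow> 0 \<le> r \<Longrightarrow> hdist \<i> (hpolar r u) = r"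
  by (rule hdist_eqI) (use cosh_hdist_hpolar[of u u 0 r] in auto)

lemma hpolar_exists:
  assumes "p \<in> upper"
  shows "\<exists>u. cmod u = 1 \<and> p = hpolar (hdist \<i> p) u"
proof (cases "hX p = 0")
  case True
  then have "sinh (hdist \<i> p) = 0" using norm_hX_sinh[OF assms] by simp
  then show ?thesis using hpt_hX[OF assms] True by (intro exI[of _ 1]) (simp add: hpolar_def)
next
  case False
  define u where "u = hX p / of_real (cmod (hX p))"
  have "cmod u = 1" using False by (simp add: u_def norm_divide)
  moreover have "p = hpolar (hdist \<i> p) u"
    using False by (simp add: hpolar_def u_def norm_hX_sinh[OF assms, symmetric] hpt_hX[OF assms])
  ultimately show ?thesis by blast
qed

lemma hdist_hpolar_radial:
  assumes "cmod u = 1"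
  shows "hdist (hpolar r u) (hpolar s u) = \<bar>r - s\<bar>"
proof (rule hdist_eqI)
  have "u \<bullet> u = 1" using assms by (simp add: dot_square_norm)
  then have "cosh (hdist (hpolar r u) (hpolar s u)) = cosh (r - s)"
    using cosh_hdist_hpolar[OF assms assms, of r s] by (simp add: cosh_diff)
  then show "cosh (hdist (hpolar r u) (hpolar s u)) = cosh \<bar>r - s\<bar>" by simp
qed auto

section \<open>Moebius maps, the triangle inequality and geodesics\<close>

type_synonym mat4 = "real \<times> real \<times> real \<times> real"

text \<open>Matrices are quadruples of reals, so that norm, convergence and compactness are those of
  a finite-dimensional space. Unlike the elements of a group, \<open>mob\<close> is not restricted
  to the half-plane.\<close>

definition SL2 :: "mat4 set" where
  "SL2 = {(a, b, c, d). a * d - b * c = 1}"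

fun mob :: "mat4 \<Rightarrow> complex \<Rightarrow> complex" where
  "mob (a, b, c, d) z = (of_real a * z + of_real b) / (of_real c * z + of_real d)"

fun mmul :: "mat4 \<Rightarrow> mat4 \<Rightarrow> mat4" where
  "mmul (a, b, c, d) (a', b', c', d') =
     (a * a' + b * c', a * b' + b * d', c * a' + d * c', c * b' + d * d')"

fun minv :: "mat4 \<Rightarrow> mat4" where
  "minv (a, b, c, d) = (d, -b, -c, a)"

lemma SL2_iff [simp]: "(a, b, c, d) \<in> SL2 \<longleftrightarrow> a * d - b * c = 1"
  by (simp add: SL2_def)

lemma mob_denom_nz:
  assumes "a * d - b * c = (1::real)" "0 < Im z"
  shows "of_real c * z + of_real d \<noteq> (0::complex)"
proof
  assume h: "of_real c * z + of_real d = 0"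
  then have "Im (of_real c * z + of_real d) = 0" "Re (of_real c * z + of_real d) = 0" by auto
  then have "c = 0" "d = 0" using assms by auto
  then show False using assms by simp
qed

lemma Im_mob:
  assumes "a * d - b * c = 1" "0 < Im z"
  shows "Im (mob (a, b, c, d) z) = Im z / (cmod (of_real c * z + of_real d))\<^sup>2"
proof -
  define D where "D = of_real c * z + of_real d"
  have nz: "D \<noteq> 0" using mob_denom_nz[OF assms] by (simp add: D_def)
  have "Im ((of_real a * z + of_real b) * cnj D) = (a * d - b * c) * Im z"
    by (simp add: D_def algebra_simps)
  then have "Im ((of_real a * z + of_real b) / D) = Im z / (cmod D)\<^sup>2"
    using assms(1) by (subst complex_div_cnj) (simp add: Im_divide_of_real flip: of_real_power)
  then show ?thesis by (simp add: D_def)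
qed

lemma mob_upper: assumes "g \<in> SL2" "z \<in> upper" shows "mob g z \<in> upper"
proof -
  obtain a b c d where g: "g = (a, b, c, d)" by (cases g)
  show ?thesis using assms mob_denom_nz[of a d b c z] Im_mob[of a d b c z] by (simp add: g del: mob.simps)
qed

lemma mob_diff:
  assumes "a * d - b * c = 1" "0 < Im z" "0 < Im w"
  shows "mob (a, b, c, d) z - mob (a, b, c, d) w
     = (z - w) / ((of_real c * z + of_real d) * (of_real c * w + of_real d))"
proof -
  have nz: "of_real c * z + of_real d \<noteq> 0" "of_real c * w + of_real d \<noteq> 0"
    using mob_denom_nz assms by blast+
  have "(of_real a * z + of_real b) * (of_real c * w + of_real d)
      - (of_real a * w + of_real b) * (of_real c * z + of_real d) = of_real (a * d - b * c) * (z - w)"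
    by (simp add: algebra_simps)
  then show ?thesis using nz assms(1) by (simp add: diff_frac_eq)
qed

lemma hdist_mob:
  assumes "g \<in> SL2" "z \<in> upper" "w \<in> upper"
  shows "hdist (mob g z) (mob g w) = hdist z w"
proof -
  obtain a b c d where g: "g = (a, b, c, d)" by (cases g)
  have h: "a * d - b * c = 1" "0 < Im z" "0 < Im w" using assms by (auto simp: g)
  have nz: "of_real c * z + of_real d \<noteq> 0" "of_real c * w + of_real d \<noteq> 0"
    using mob_denom_nz h by blast+
  define D E where "D = cmod (of_real c * z + of_real d)" and "E = cmod (of_real c * w + of_real d)"
  have DE: "D > 0" "E > 0" using nz by (auto simp: D_def E_def)
  have "(cmod (mob g z - mob g w))\<^sup>2 / (2 * Im (mob g z) * Im (mob g w))
      = (cmod (z - w) / (D * E))\<^sup>2 / (2 * (Im z / D\<^sup>2) * (Im w / E\<^sup>2))"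
    unfolding g mob_diff[OF h] Im_mob[OF h(1,2)] Im_mob[OF h(1,3)] D_def E_def
    by (simp add: norm_divide norm_mult)
  also have "\<dots> = (cmod (z - w))\<^sup>2 / (2 * Im z * Im w)"
    using DE h by (simp add: power_divide power_mult_distrib field_simps)
  finally have "(cmod (mob g z - mob g w))\<^sup>2 / (2 * Im (mob g z) * Im (mob g w)) = (cmod (z - w))\<^sup>2 / (2 * Im z * Im w)" .
  then show ?thesis by (simp add: hdist_def)
qed

lemma mmul_SL2: "g \<in> SL2 \<Longrightarrow> h \<in> SL2 \<Longrightarrow> mmul g h \<in> SL2"
proof -
  assume a: "g \<in> SL2" "h \<in> SL2"
  obtain a b c d where g: "g = (a, b, c, d)" by (cases g)
  obtain a' b' c' d' where h: "h = (a', b', c', d')" by (cases h)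
  have "(a * d - b * c) * (a' * d' - b' * c') = 1" using a by (simp add: g h)
  then show ?thesis by (simp add: g h algebra_simps)
qed

lemma minv_SL2: "g \<in> SL2 \<Longrightarrow> minv g \<in> SL2"
  by (cases g) (simp add: algebra_simps)

lemma mob_mmul:
  assumes "g \<in> SL2" "h \<in> SL2" "z \<in> upper"
  shows "mob (mmul g h) z = mob g (mob h z)"
proof -
  obtain a b c d where g: "g = (a, b, c, d)" by (cases g)
  obtain a' b' c' d' where h: "h = (a', b', c', d')" by (cases h)
  have u: "mob h z \<in> upper" using mob_upper assms by blast
  have 1: "of_real c' * z + of_real d' \<noteq> 0" using assms mob_denom_nz[of a' d' b' c' z] by (simp add: h)
  have 2: "of_real c * mob h z + of_real d \<noteq> 0" using assms mob_denom_nz[of a d b c "mob h z"] u by (simp add: g)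
  show ?thesis using 1 2 by (simp add: g h) (simp add: divide_simps, simp add: algebra_simps)
qed

lemma mob_one [simp]: "mob (1, 0, 0, 1) z = z" by simp

lemma one_SL2 [simp]: "(1, 0, 0, 1) \<in> SL2" by simp

lemma mmul_minv: "g \<in> SL2 \<Longrightarrow> mmul g (minv g) = (1, 0, 0, 1)" "g \<in> SL2 \<Longrightarrow> mmul (minv g) g = (1, 0, 0, 1)"
  by (cases g; simp add: algebra_simps)+

lemma mob_minv:
  assumes "g \<in> SL2" "z \<in> upper"
  shows "mob g (mob (minv g) z) = z" "mob (minv g) (mob g z) = z"
  using mob_mmul[OF assms(1) minv_SL2[OF assms(1)] assms(2)] mob_mmul[OF minv_SL2[OF assms(1)] assms]
    mmul_minv[OF assms(1)] by auto

text \<open>The upper triangular matrix that carries \<i> to \<open>w\<close>. It reduces statements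
  about a point to the point \<i>, and later it is the frame in which a surface is seen from a
  chosen point.\<close>

definition aff :: "complex \<Rightarrow> mat4" where
  "aff w = (sqrt (Im w), Re w / sqrt (Im w), 0, 1 / sqrt (Im w))"

lemma aff_SL2 [simp]: "w \<in> upper \<Longrightarrow> aff w \<in> SL2"
  by (simp add: aff_def)

lemma mob_aff: assumes "w \<in> upper" shows "mob (aff w) z = of_real (Im w) * z + of_real (Re w)"
proof -
  have "sqrt (Im w) \<noteq> 0" using assms by simp
  moreover have "complex_of_real (sqrt (Im w)) * of_real (sqrt (Im w)) = of_real (Im w)"
    using assms by (metis of_real_mult real_sqrt_mult_self abs_of_pos upper_iff)
  ultimately show ?thesis unfolding aff_def by (simp add: field_simps)
qed

lemma mob_aff_i: "w \<in> upper \<Longrightarrow> mob (aff w) \<i> = w"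
  by (simp add: mob_aff complex_eq_iff)

text \<open>With the middle point moved to \<i>, Cauchy-Schwarz in the Lorentz product bounds cosh
  of the distance of the outer points by cosh of the sum of their distances from \<i>.\<close>

lemma hdist_triangle:
  assumes "x \<in> upper" "y \<in> upper" "z \<in> upper"
  shows "hdist x z \<le> hdist x y + hdist y z"
proof -
  have main: "hdist p q \<le> hdist \<i> p + hdist \<i> q" if p: "p \<in> upper" and q: "q \<in> upper" for p q
  proof -
    have "- (hX p \<bullet> hX q) \<le> cmod (hX p) * cmod (hX q)"
      using Cauchy_Schwarz_ineq2[of "hX p" "hX q"] by linarith
    then have "cosh (hdist p q) \<le> cosh (hdist \<i> p + hdist \<i> q)"
      using p q by (simp add: cosh_hdist_hX[OF p q] cosh_add cosh_hdist_i norm_hX_sinh del: upper_iff)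
    then show ?thesis using p q by (subst (asm) cosh_le_iff_nonneg) auto
  qed
  let ?g = "minv (aff y)"
  have g: "?g \<in> SL2" using assms minv_SL2 by simp
  have i: "mob ?g y = \<i>" using mob_minv(2)[of "aff y" \<i>] assms mob_aff_i by auto
  have "hdist x z = hdist (mob ?g x) (mob ?g z)" using hdist_mob[OF g] assms by simp
  also have "\<dots> \<le> hdist (mob ?g y) (mob ?g x) + hdist (mob ?g y) (mob ?g z)"
    unfolding i by (rule main) (use mob_upper[OF g] assms in auto)
  also have "\<dots> = hdist x y + hdist y z" using hdist_mob[OF g] assms by (simp add: hdist_commute)
  finally show ?thesis .
qed

lemma hgeodesic:
  assumes "x \<in> upper" "y \<in> upper"
  obtains c where "\<And>s. c s \<in> upper" "\<And>s t. hdist (c s) (c t) = \<bar>s - t\<bar>" "c 0 = x" "c (hdist x y) = y"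
proof -
  let ?g = "minv (aff x)"
  have g: "aff x \<in> SL2" "?g \<in> SL2" using assms minv_SL2 by simp_all
  have gx: "mob ?g x = \<i>" using mob_minv(2)[of "aff x" \<i>] assms mob_aff_i by auto
  have gy: "mob ?g y \<in> upper" using mob_upper[OF g(2)] assms by blast
  obtain u where u: "cmod u = 1" "mob ?g y = hpolar (hdist \<i> (mob ?g y)) u" using hpolar_exists[OF gy] by blast
  have d: "hdist \<i> (mob ?g y) = hdist x y" using hdist_mob[OF g(2) assms] gx by simp
  show ?thesis
  proof (rule that[of "\<lambda>s. mob (aff x) (hpolar s u)"])
    show "mob (aff x) (hpolar s u) \<in> upper" for s by (rule mob_upper[OF g(1) hpolar_upper])
    show "hdist (mob (aff x) (hpolar s u)) (mob (aff x) (hpolar t u)) = \<bar>s - t\<bar>" for s t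
      by (subst hdist_mob[OF g(1) hpolar_upper hpolar_upper]) (rule hdist_hpolar_radial[OF u(1)])
    show "mob (aff x) (hpolar 0 u) = x" using assms mob_aff_i by simp
    show "mob (aff x) (hpolar (hdist x y) u) = y" using u(2) d mob_minv(1)[OF g(1) assms(2)] by simp
  qed
qed

section \<open>Hyperbolic and Euclidean topology\<close>

lemma tendsto_hdist:
  assumes "(f \<longlongrightarrow> a) F" "(g \<longlongrightarrow> b) F" "a \<in> upper" "b \<in> upper"
    "\<forall>\<^sub>F n in F. f n \<in> upper" "\<forall>\<^sub>F n in F. g n \<in> upper"
  shows "((\<lambda>n. hdist (f n) (g n)) \<longlongrightarrow> hdist a b) F"
  unfolding hdist_def
proof (rule tendsto_arcosh_strong)
  show "((\<lambda>n. 1 + (cmod (f n - g n))\<^sup>2 / (2 * Im (f n) * Im (g n))) \<longlongrightarrow>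
      1 + (cmod (a - b))\<^sup>2 / (2 * Im a * Im b)) F"
    using assms by (auto intro!: tendsto_intros)
  show "\<forall>\<^sub>F n in F. 1 \<le> 1 + (cmod (f n - g n))\<^sup>2 / (2 * Im (f n) * Im (g n))"
    using assms(5,6) by eventually_elim simp
  show "1 \<le> 1 + (cmod (a - b))\<^sup>2 / (2 * Im a * Im b)" using assms(3,4) by simp
qed

text \<open>This bound and \<open>cmod_le_hdist\<close> control the Euclidean position of a point at
  bounded distance from \<open>z\<close>. With the two points exchanged it also keeps such points
  away from the real axis; together this makes hyperbolic balls compact.\<close>

lemma Im_le_hdist:
  assumes "z \<in> upper" "w \<in> upper"
  shows "Im w \<le> 2 * Im z * cosh (hdist z w)"
proof -
  have "(Im z - Im w)\<^sup>2 \<le> (cmod (z - w))\<^sup>2" by (simp add: cmod_power2)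
  moreover have "(cmod (z - w))\<^sup>2 = 2 * Im z * Im w * (cosh (hdist z w) - 1)"
    using assms unfolding cosh_hdist[OF assms] by simp
  ultimately have "(Im z)\<^sup>2 + (Im w)\<^sup>2 \<le> 2 * Im z * Im w * cosh (hdist z w)"
    by (simp add: power2_eq_square algebra_simps)
  then have "Im w * Im w \<le> Im w * (2 * Im z * cosh (hdist z w))"
    by (smt (verit) power2_eq_square mult.commute mult.left_commute zero_le_power2)
  then show ?thesis using assms by simp
qed

lemma cmod_le_hdist:
  assumes "z \<in> upper" "w \<in> upper"
  shows "(cmod (z - w))\<^sup>2 \<le> 4 * (Im z)\<^sup>2 * cosh (hdist z w) * (cosh (hdist z w) - 1)"
proof -
  have "(cmod (z - w))\<^sup>2 = 2 * Im z * (cosh (hdist z w) - 1) * Im w"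
    using assms unfolding cosh_hdist[OF assms] by simp
  also have "\<dots> \<le> 2 * Im z * (cosh (hdist z w) - 1) * (2 * Im z * cosh (hdist z w))"
    using assms Im_le_hdist[OF assms] cosh_real_ge_1[of "hdist z w"]
    by (intro mult_left_mono mult_nonneg_nonneg) auto
  finally show ?thesis by (simp add: power2_eq_square algebra_simps)
qed

lemma hdist_tendsto_0:
  assumes "((\<lambda>n. hdist a (f n)) \<longlongrightarrow> 0) F" "a \<in> upper" "\<forall>\<^sub>F n in F. f n \<in> upper"
  shows "(f \<longlongrightarrow> a) F"
proof -
  have c: "((\<lambda>n. cosh (hdist a (f n))) \<longlongrightarrow> cosh 0) F"
    by (rule tendsto_cosh[OF assms(1)])
  have "((\<lambda>n. 4 * (Im a)\<^sup>2 * cosh (hdist a (f n)) * (cosh (hdist a (f n)) - 1)) \<longlongrightarrow> 4 * (Im a)\<^sup>2 * cosh 0 * (cosh 0 - 1)) F"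
    by (intro tendsto_intros c)
  then have l: "((\<lambda>n. 4 * (Im a)\<^sup>2 * cosh (hdist a (f n)) * (cosh (hdist a (f n)) - 1)) \<longlongrightarrow> 0) F" by simp
  have "((\<lambda>n. (cmod (a - f n))\<^sup>2) \<longlongrightarrow> 0) F"
  proof (rule tendsto_sandwich[OF _ _ tendsto_const l])
    show "\<forall>\<^sub>F n in F. (cmod (a - f n))\<^sup>2 \<le> 4 * (Im a)\<^sup>2 * cosh (hdist a (f n)) * (cosh (hdist a (f n)) - 1)"
      using assms(3) by eventually_elim (rule cmod_le_hdist[OF assms(2)])
  qed simp
  then have "((\<lambda>n. sqrt ((cmod (a - f n))\<^sup>2)) \<longlongrightarrow> sqrt 0) F" by (rule tendsto_real_sqrt)
  then have "((\<lambda>n. cmod (a - f n)) \<longlongrightarrow> 0) F" by simp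
  then have "((\<lambda>n. a - f n) \<longlongrightarrow> 0) F" by (rule tendsto_norm_zero_cancel)
  then have "((\<lambda>n. a - (a - f n)) \<longlongrightarrow> a - 0) F" by (intro tendsto_intros)
  then show ?thesis by simp
qed

definition hcball :: "complex \<Rightarrow> real \<Rightarrow> complex set" where
  "hcball z R = {w \<in> upper. hdist z w \<le> R}"

lemma compact_hcball:
  assumes "z \<in> upper"
  shows "compact (hcball z R)"
proof -
  have "bounded (hcball z R)"
  proof (rule boundedI[where B = "cmod z + 2 * Im z * cosh R"])
    fix w assume w: "w \<in> hcball z R"
    then have wu: "w \<in> upper" and d: "hdist z w \<le> R" by (auto simp: hcball_def)
    have "0 \<le> R" using d hdist_nonneg[OF assms wu] by linarith
    then have ch: "cosh (hdist z w) \<le> cosh R" using d assms wu by (subst cosh_le_iff_nonneg) auto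
    have "(cmod (z - w))\<^sup>2 \<le> 4 * (Im z)\<^sup>2 * cosh (hdist z w) * (cosh (hdist z w) - 1)"
      by (rule cmod_le_hdist[OF assms wu])
    also have "\<dots> \<le> 4 * (Im z)\<^sup>2 * cosh R * cosh R"
      using ch cosh_real_ge_1[of "hdist z w"] cosh_real_ge_1[of R] by (intro mult_mono) auto
    also have "\<dots> = (2 * Im z * cosh R)\<^sup>2" by (simp add: power2_eq_square)
    finally have "cmod (z - w) \<le> 2 * Im z * cosh R"
      using assms cosh_real_ge_1[of R] by (intro power2_le_imp_le[of "cmod (z-w)"]) auto
    then show "norm w \<le> cmod z + 2 * Im z * cosh R"
      using norm_triangle_ineq4[of z "z - w"] by simp
  qed
  moreover have "closed (hcball z R)"
  proof (rule closed_sequential_limits[THEN iffD2], intro allI impI, elim conjE)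
    fix x l assume x: "\<forall>n. x n \<in> hcball z R" and l: "x \<longlonglongrightarrow> l"
    have xu: "x n \<in> upper" and xd: "hdist z (x n) \<le> R" for n using x by (auto simp: hcball_def)
    have lb: "Im z / (2 * cosh R) \<le> Im (x n)" for n
    proof -
      have "0 \<le> R" using xd[of n] hdist_nonneg[OF assms xu[of n]] by linarith
      then have "cosh (hdist z (x n)) \<le> cosh R" using xd[of n] assms xu[of n] by (subst cosh_le_iff_nonneg) auto
      then have "Im z \<le> 2 * Im (x n) * cosh R"
        using Im_le_hdist[OF xu[of n] assms] xu[of n]
        by (smt (verit) hdist_commute mult_left_mono upper_iff)
      then show ?thesis using cosh_real_ge_1[of R] by (simp add: field_simps)
    qed
    have "Im z / (2 * cosh R) \<le> Im l"
      by (rule LIMSEQ_le_const[OF tendsto_Im[OF l]]) (use lb in auto)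
    moreover have "0 < Im z / (2 * cosh R)" using assms cosh_real_ge_1[of R] by simp
    ultimately have lu: "l \<in> upper" by simp
    have "(\<lambda>n. hdist z (x n)) \<longlonglongrightarrow> hdist z l"
      by (rule tendsto_hdist) (use xu lu l assms in auto)
    then have "hdist z l \<le> R" by (rule LIMSEQ_le_const2) (use xd in auto)
    then show "l \<in> hcball z R" using lu by (simp add: hcball_def)
  qed
  ultimately show ?thesis by (simp add: compact_eq_bounded_closed)
qed

lemma hdist_bounded_subseq:
  fixes f :: "nat \<Rightarrow> complex"
  assumes "z \<in> upper" "\<And>n. f n \<in> upper" "\<And>n. hdist z (f n) \<le> R"
  obtains l r where "l \<in> upper" "strict_mono (r :: nat \<Rightarrow> nat)" "(\<lambda>n. f (r n)) \<longlonglongrightarrow> l"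
proof -
  have "\<forall>n. f n \<in> hcball z R" using assms by (simp add: hcball_def)
  then obtain l r where "l \<in> hcball z R" "strict_mono (r :: nat \<Rightarrow> nat)" "(f \<circ> r) \<longlonglongrightarrow> l"
    using compact_hcball[OF assms(1), of R] unfolding compact_def by blast
  then show ?thesis using that[of l r] by (auto simp: hcball_def o_def)
qed

section \<open>Quotient surfaces as metric spaces\<close>

definition orb :: "(complex \<Rightarrow> complex) set \<Rightarrow> complex \<Rightarrow> complex set" where
  "orb \<Gamma> z = (\<lambda>\<gamma>. \<gamma> z) ` \<Gamma>"

lemma surf_eq: "surf \<Gamma> = orb \<Gamma> ` upper"
  by (simp add: surf_def orb_def)

locale fuchsian_group =
  fixes \<Gamma> :: "(complex \<Rightarrow> complex) set"
  assumes fuchsian: "fuchsian \<Gamma>"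
begin

lemma subgroup: "subgroup \<Gamma> (BijGroup upper)"
  using fuchsian by (simp add: fuchsian_def)

lemma mob_rep:
  assumes "\<gamma> \<in> \<Gamma>"
  obtains g where "g \<in> SL2" "\<And>z. z \<in> upper \<Longrightarrow> \<gamma> z = mob g z"
proof -
  have "\<gamma> \<in> PSL2R" using fuchsian assms by (auto simp: fuchsian_def)
  then obtain a b c d where "a * d - b * c = 1"
    "\<gamma> = restrict (\<lambda>z. (of_real a * z + of_real b) / (of_real c * z + of_real d)) upper"
    by (auto simp: PSL2R_def)
  then show ?thesis by (intro that[of "(a, b, c, d)"]) auto
qed

lemma in_upper: "\<gamma> \<in> \<Gamma> \<Longrightarrow> z \<in> upper \<Longrightarrow> \<gamma> z \<in> upper"
  by (metis mob_rep mob_upper)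

lemma hdist_inv [simp]: "\<gamma> \<in> \<Gamma> \<Longrightarrow> z \<in> upper \<Longrightarrow> w \<in> upper \<Longrightarrow> hdist (\<gamma> z) (\<gamma> w) = hdist z w"
  by (metis mob_rep hdist_mob)

lemma in_Bij: "\<gamma> \<in> \<Gamma> \<Longrightarrow> \<gamma> \<in> Bij upper"
  using subgroup.subset[OF subgroup] by (auto simp: BijGroup_def)

lemma id_in: "restrict (\<lambda>z. z) upper \<in> \<Gamma>"
  using subgroup.one_closed[OF subgroup] by (simp add: BijGroup_def)

lemma compose_in: "\<gamma> \<in> \<Gamma> \<Longrightarrow> \<delta> \<in> \<Gamma> \<Longrightarrow> compose upper \<gamma> \<delta> \<in> \<Gamma>"
  using subgroup.m_closed[OF subgroup, of \<gamma> \<delta>] in_Bij by (simp add: BijGroup_def)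

lemma compose_apply: "z \<in> upper \<Longrightarrow> compose upper \<gamma> \<delta> z = \<gamma> (\<delta> z)"
  by (simp add: compose_eq del: upper_iff)

lemma group_ext:
  assumes "\<gamma> \<in> \<Gamma>" "\<delta> \<in> \<Gamma>" "\<And>z. z \<in> upper \<Longrightarrow> \<gamma> z = \<delta> z"
  shows "\<gamma> = \<delta>"
  using in_Bij[OF assms(1)] in_Bij[OF assms(2)] assms(3)
  by (auto simp: Bij_def intro!: extensionalityI[where A = upper])

definition ginv :: "(complex \<Rightarrow> complex) \<Rightarrow> complex \<Rightarrow> complex" where
  "ginv \<gamma> = m_inv (BijGroup upper) \<gamma>"

lemma ginv_in: "\<gamma> \<in> \<Gamma> \<Longrightarrow> ginv \<gamma> \<in> \<Gamma>"
  unfolding ginv_def by (rule subgroup.m_inv_closed[OF subgroup])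

lemma ginv_left: assumes "\<gamma> \<in> \<Gamma>" "z \<in> upper" shows "ginv \<gamma> (\<gamma> z) = z"
proof -
  have c: "\<gamma> \<in> carrier (BijGroup upper)" using subgroup.subset[OF subgroup] assms by blast
  have "ginv \<gamma> \<otimes>\<^bsub>BijGroup upper\<^esub> \<gamma> = \<one>\<^bsub>BijGroup upper\<^esub>"
    unfolding ginv_def by (rule group.l_inv[OF group_BijGroup c])
  then have "compose upper (ginv \<gamma>) \<gamma> = restrict (\<lambda>z. z) upper"
    using in_Bij[OF assms(1)] in_Bij[OF ginv_in[OF assms(1)]] by (simp add: BijGroup_def)
  then have "compose upper (ginv \<gamma>) \<gamma> z = restrict (\<lambda>z. z) upper z" by simp
  then show ?thesis using assms(2) by (simp add: compose_apply del: upper_iff)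
qed

lemma ginv_right: assumes "\<gamma> \<in> \<Gamma>" "z \<in> upper" shows "\<gamma> (ginv \<gamma> z) = z"
proof -
  have "hdist (\<gamma> (ginv \<gamma> z)) z = hdist (ginv \<gamma> (\<gamma> (ginv \<gamma> z))) (ginv \<gamma> z)"
    using assms ginv_in in_upper by (metis hdist_inv)
  also have "\<dots> = 0" using ginv_left assms ginv_in in_upper by simp
  finally show ?thesis using assms ginv_in in_upper hdist_eq_0_iff by metis
qed

lemma ginv_ginv: "\<gamma> \<in> \<Gamma> \<Longrightarrow> ginv (ginv \<gamma>) = \<gamma>"
  by (rule group_ext) (metis ginv_in ginv_left ginv_right in_upper)+

lemma bij_ginv: "bij_betw ginv \<Gamma> \<Gamma>"
  by (rule bij_betwI[where g = ginv]) (auto simp: ginv_in ginv_ginv)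

lemma bij_compose_right: assumes d: "\<delta> \<in> \<Gamma>" shows "bij_betw (\<lambda>\<gamma>. compose upper \<gamma> \<delta>) \<Gamma> \<Gamma>"
proof (rule bij_betwI[where g = "\<lambda>\<gamma>. compose upper \<gamma> (ginv \<delta>)"])
  show "(\<lambda>\<gamma>. compose upper \<gamma> \<delta>) \<in> \<Gamma> \<rightarrow> \<Gamma>" "(\<lambda>\<gamma>. compose upper \<gamma> (ginv \<delta>)) \<in> \<Gamma> \<rightarrow> \<Gamma>"
    using compose_in ginv_in d by auto
  show "compose upper (compose upper \<gamma> \<delta>) (ginv \<delta>) = \<gamma>" if "\<gamma> \<in> \<Gamma>" for \<gamma>
    by (rule group_ext) (use that d in \<open>auto simp: compose_in ginv_in compose_apply ginv_right in_upper simp del: upper_iff\<close>)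
  show "compose upper (compose upper \<gamma> (ginv \<delta>)) \<delta> = \<gamma>" if "\<gamma> \<in> \<Gamma>" for \<gamma>
    by (rule group_ext) (use that d in \<open>auto simp: compose_in ginv_in compose_apply ginv_left in_upper simp del: upper_iff\<close>)
qed

lemma bij_compose_left: assumes d: "\<delta> \<in> \<Gamma>" shows "bij_betw (\<lambda>\<gamma>. compose upper \<delta> \<gamma>) \<Gamma> \<Gamma>"
proof (rule bij_betwI[where g = "\<lambda>\<gamma>. compose upper (ginv \<delta>) \<gamma>"])
  show "(\<lambda>\<gamma>. compose upper \<delta> \<gamma>) \<in> \<Gamma> \<rightarrow> \<Gamma>" "(\<lambda>\<gamma>. compose upper (ginv \<delta>) \<gamma>) \<in> \<Gamma> \<rightarrow> \<Gamma>"
    using compose_in ginv_in d by auto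
  show "compose upper (ginv \<delta>) (compose upper \<delta> \<gamma>) = \<gamma>" if "\<gamma> \<in> \<Gamma>" for \<gamma>
    by (rule group_ext) (use that d in \<open>auto simp: compose_in ginv_in compose_apply ginv_left in_upper simp del: upper_iff\<close>)
  show "compose upper \<delta> (compose upper (ginv \<delta>) \<gamma>) = \<gamma>" if "\<gamma> \<in> \<Gamma>" for \<gamma>
    by (rule group_ext) (use that d in \<open>auto simp: compose_in ginv_in compose_apply ginv_right in_upper simp del: upper_iff\<close>)
qed

lemma finite_near:
  assumes "z \<in> upper" "w \<in> upper"
  shows "finite {\<gamma> \<in> \<Gamma>. hdist z (\<gamma> w) \<le> R}"
proof -
  let ?K = "insert w (hcball z R)"
  have "compact ?K" "?K \<subseteq> upper" using compact_hcball[OF assms(1)] assms by (auto simp: hcball_def)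
  then have "finite {\<gamma> \<in> \<Gamma>. \<gamma> ` ?K \<inter> ?K \<noteq> {}}" using fuchsian unfolding fuchsian_def by blast
  moreover have "{\<gamma> \<in> \<Gamma>. hdist z (\<gamma> w) \<le> R} \<subseteq> {\<gamma> \<in> \<Gamma>. \<gamma> ` ?K \<inter> ?K \<noteq> {}}"
    using in_upper assms by (auto simp: hcball_def simp del: upper_iff)
  ultimately show ?thesis by (rule rev_finite_subset)
qed

lemma countable_group: "countable \<Gamma>"
proof -
  have "\<Gamma> = (\<Union>n::nat. {\<gamma> \<in> \<Gamma>. hdist \<i> (\<gamma> \<i>) \<le> real n})"
    by (auto simp: real_arch_simple)
  moreover have "finite {\<gamma> \<in> \<Gamma>. hdist \<i> (\<gamma> \<i>) \<le> real n}" for n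
    by (rule finite_near) auto
  then have "countable (\<Union>n::nat. {\<gamma> \<in> \<Gamma>. hdist \<i> (\<gamma> \<i>) \<le> real n})"
    by (intro countable_UN) (simp_all add: countable_finite)
  ultimately show ?thesis by simp
qed

lemma orb_self: "z \<in> upper \<Longrightarrow> z \<in> orb \<Gamma> z"
  unfolding orb_def by (rule image_eqI[OF _ id_in]) simp

lemma orb_subset: "z \<in> upper \<Longrightarrow> orb \<Gamma> z \<subseteq> upper"
  unfolding orb_def using in_upper by blast

lemma orb_in_surf [simp]: "z \<in> upper \<Longrightarrow> orb \<Gamma> z \<in> surf \<Gamma>"
  by (simp add: surf_eq)

lemma orb_apply: assumes "\<gamma> \<in> \<Gamma>" "z \<in> upper" shows "orb \<Gamma> (\<gamma> z) = orb \<Gamma> z"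
proof -
  have "orb \<Gamma> (\<gamma> z) = (\<lambda>\<delta>. \<delta> z) ` ((\<lambda>\<delta>. compose upper \<delta> \<gamma>) ` \<Gamma>)"
    unfolding orb_def image_image using assms by (simp add: compose_apply del: upper_iff)
  then show ?thesis using bij_compose_right[OF assms(1)] by (simp add: bij_betw_def orb_def)
qed

lemma orb_eq: "z \<in> upper \<Longrightarrow> w \<in> orb \<Gamma> z \<Longrightarrow> orb \<Gamma> w = orb \<Gamma> z"
  using orb_apply by (auto simp: orb_def[of \<Gamma> z])

lemma surf_orb: assumes "X \<in> surf \<Gamma>" "z \<in> X" shows "z \<in> upper \<and> X = orb \<Gamma> z"
proof -
  obtain w where w: "w \<in> upper" "X = orb \<Gamma> w" using assms(1) by (auto simp: surf_eq)
  then show ?thesis using orb_eq[OF w(1)] orb_subset[OF w(1)] assms(2) by (metis subsetD)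
qed

lemma lift_pt: assumes "X \<in> surf \<Gamma>" shows "lift_pt X \<in> upper" "orb \<Gamma> (lift_pt X) = X"
proof -
  obtain w where w: "w \<in> upper" "X = orb \<Gamma> w" using assms(1) by (auto simp: surf_eq)
  have "lift_pt X \<in> X" unfolding lift_pt_def by (rule someI[of _ w]) (use w orb_self in metis)
  then show "lift_pt X \<in> upper" "orb \<Gamma> (lift_pt X) = X" using surf_orb[OF assms] by auto
qed

text \<open>By invariance it is enough to vary the second lift, and only finitely many elements
  bring \<open>w\<close> within \<open>hdist z w\<close> of \<open>z\<close>; so the infimum is a
  minimum.\<close>

lemma qdist_attained:
  assumes "z \<in> upper" "w \<in> upper"
  shows "\<exists>\<gamma>\<in>\<Gamma>. qdist (orb \<Gamma> z) (orb \<Gamma> w) = hdist z (\<gamma> w) \<and> (\<forall>\<delta>\<in>\<Gamma>. hdist z (\<gamma> w) \<le> hdist z (\<delta> w))"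
proof -
  let ?A = "{\<gamma> \<in> \<Gamma>. hdist z (\<gamma> w) \<le> hdist z w}"
  have "restrict (\<lambda>z. z) upper \<in> ?A" using id_in assms by simp
  then have ne: "?A \<noteq> {}" by blast
  let ?D = "(\<lambda>\<gamma>. hdist z (\<gamma> w)) ` ?A"
  have fin: "finite ?D" by (rule finite_imageI[OF finite_near[OF assms]])
  have "Min ?D \<in> ?D" by (rule Min_in[OF fin]) (use ne in simp)
  then obtain \<gamma> where g1: "\<gamma> \<in> ?A" "Min ?D = hdist z (\<gamma> w)" by (elim imageE)
  have g2: "\<forall>\<delta>\<in>?A. hdist z (\<gamma> w) \<le> hdist z (\<delta> w)"
    unfolding g1(2)[symmetric] by (intro ballI Min_le[OF fin] imageI)
  note g = g1(1) g2
  have min: "hdist z (\<gamma> w) \<le> hdist z (\<delta> w)" if "\<delta> \<in> \<Gamma>" for \<delta>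
    using g that by (cases "\<delta> \<in> ?A") auto
  have "qdist (orb \<Gamma> z) (orb \<Gamma> w) = hdist z (\<gamma> w)"
    unfolding qdist_def
  proof (rule cInf_eq_minimum)
    show "hdist z (\<gamma> w) \<in> {hdist x y |x y. x \<in> orb \<Gamma> z \<and> y \<in> orb \<Gamma> w}"
      using g orb_self[OF assms(1)] by (auto simp: orb_def)
    fix t assume "t \<in> {hdist x y |x y. x \<in> orb \<Gamma> z \<and> y \<in> orb \<Gamma> w}"
    then obtain \<alpha> \<beta> where ab: "\<alpha> \<in> \<Gamma>" "\<beta> \<in> \<Gamma>" "t = hdist (\<alpha> z) (\<beta> w)" by (auto simp: orb_def)
    have "t = hdist (ginv \<alpha> (\<alpha> z)) (ginv \<alpha> (\<beta> w))" using ab assms ginv_in in_upper by (metis hdist_inv)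
    also have "\<dots> = hdist z (compose upper (ginv \<alpha>) \<beta> w)" using ab assms by (simp add: ginv_left compose_apply del: upper_iff)
    finally show "hdist z (\<gamma> w) \<le> t" using min compose_in ginv_in ab by metis
  qed
  then show ?thesis using g min by blast
qed

lemma qdist_le: assumes "z \<in> upper" "w \<in> upper" shows "qdist (orb \<Gamma> z) (orb \<Gamma> w) \<le> hdist z w"
proof -
  obtain \<gamma> where g: "qdist (orb \<Gamma> z) (orb \<Gamma> w) = hdist z (\<gamma> w)" "\<forall>\<delta>\<in>\<Gamma>. hdist z (\<gamma> w) \<le> hdist z (\<delta> w)"
    using qdist_attained[OF assms] by blast
  have "hdist z (\<gamma> w) \<le> hdist z (restrict (\<lambda>z. z) upper w)" by (rule bspec[OF g(2) id_in])
  then show ?thesis using assms g(1) by simp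
qed

text \<open>The projection to the quotient is a submetry: a lift of the second point exists at
  exactly the quotient distance from a given lift of the first. This is the property that survives
  in the limit (\<open>submetry\<close>).\<close>

lemma qdist_lift:
  assumes "z \<in> upper" "Y \<in> surf \<Gamma>"
  obtains w where "w \<in> upper" "orb \<Gamma> w = Y" "hdist z w = qdist (orb \<Gamma> z) Y"
proof -
  obtain w0 where w0: "w0 \<in> upper" "Y = orb \<Gamma> w0" using assms(2) by (auto simp: surf_eq)
  obtain \<gamma> where "\<gamma> \<in> \<Gamma>" "qdist (orb \<Gamma> z) (orb \<Gamma> w0) = hdist z (\<gamma> w0)" using qdist_attained[OF assms(1) w0(1)] by blast
  then show ?thesis using that[of "\<gamma> w0"] w0 in_upper orb_apply by auto
qed

lemma qdist_nonneg: assumes "X \<in> surf \<Gamma>" "Y \<in> surf \<Gamma>" shows "0 \<le> qdist X Y"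
proof -
  obtain w where w: "w \<in> upper" "hdist (lift_pt X) w = qdist X Y"
    using qdist_lift[OF lift_pt(1)[OF assms(1)] assms(2)] unfolding lift_pt(2)[OF assms(1)] by blast
  then show ?thesis using hdist_nonneg[OF lift_pt(1)[OF assms(1)] w(1)] by simp
qed

lemma qdist_commute: "qdist X Y = qdist Y X"
proof -
  have "{hdist x y |x y. x \<in> X \<and> y \<in> Y} = {hdist x y |x y. x \<in> Y \<and> y \<in> X}" using hdist_commute by blast
  then show ?thesis by (simp add: qdist_def)
qed

lemma qdist_eq_0: assumes "X \<in> surf \<Gamma>" "Y \<in> surf \<Gamma>" shows "qdist X Y = 0 \<longleftrightarrow> X = Y"
proof
  assume "qdist X Y = 0"
  moreover obtain w where w: "w \<in> upper" "orb \<Gamma> w = Y" "hdist (lift_pt X) w = qdist X Y"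
    using qdist_lift[OF lift_pt(1)[OF assms(1)] assms(2)] unfolding lift_pt(2)[OF assms(1)] by blast
  ultimately have "lift_pt X = w" using hdist_eq_0_iff[OF lift_pt(1)[OF assms(1)] w(1)] by simp
  then show "X = Y" using w(2) lift_pt(2)[OF assms(1)] by simp
next
  assume "X = Y"
  then have "qdist X Y \<le> 0"
    using qdist_le[OF lift_pt(1)[OF assms(1)] lift_pt(1)[OF assms(1)]] unfolding lift_pt(2)[OF assms(1)] by simp
  then show "qdist X Y = 0" using qdist_nonneg[OF assms] by simp
qed

lemma qdist_triangle:
  assumes "X \<in> surf \<Gamma>" "Y \<in> surf \<Gamma>" "Z \<in> surf \<Gamma>"
  shows "qdist X Z \<le> qdist X Y + qdist Y Z"
proof -
  have x: "lift_pt X \<in> upper" "orb \<Gamma> (lift_pt X) = X" using lift_pt assms by auto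
  obtain y where y: "y \<in> upper" "orb \<Gamma> y = Y" "hdist (lift_pt X) y = qdist X Y"
    using qdist_lift[OF x(1) assms(2)] x(2) by auto
  obtain z where z: "z \<in> upper" "orb \<Gamma> z = Z" "hdist y z = qdist Y Z"
    using qdist_lift[OF y(1) assms(3)] y(2) by auto
  have "qdist X Z \<le> hdist (lift_pt X) z" using qdist_le[OF x(1) z(1)] x z by simp
  also have "\<dots> \<le> qdist X Y + qdist Y Z" using hdist_triangle[OF x(1) y(1) z(1)] y z by simp
  finally show ?thesis .
qed

sublocale ms: Metric_space "surf \<Gamma>" "\<lambda>X Y. if X \<in> surf \<Gamma> \<and> Y \<in> surf \<Gamma> then qdist X Y else 0"
  by unfold_locales (auto simp: qdist_nonneg qdist_commute qdist_eq_0 qdist_triangle)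

lemma surf_top_eq: "surf_top \<Gamma> = ms.mtopology"
  by (simp add: surf_top_def)

lemma topspace_surf_top [simp]: "topspace (surf_top \<Gamma>) = surf \<Gamma>"
  by (simp add: surf_top_eq)

lemma limitin_surf_top:
  assumes "\<And>n. f n \<in> surf \<Gamma>"
  shows "limitin (surf_top \<Gamma>) f l F \<longleftrightarrow> l \<in> surf \<Gamma> \<and> ((\<lambda>n. qdist (f n) l) \<longlongrightarrow> 0) F"
  unfolding surf_top_eq ms.limitin_metric_dist_null using assms by auto

lemma openin_surf_top:
  "openin (surf_top \<Gamma>) U \<longleftrightarrow> U \<subseteq> surf \<Gamma> \<and> (\<forall>X\<in>U. \<exists>r>0. \<forall>Y\<in>surf \<Gamma>. qdist X Y < r \<longrightarrow> Y \<in> U)"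
  unfolding surf_top_eq ms.openin_mtopology
proof (rule conj_cong[OF refl])
  assume U: "U \<subseteq> surf \<Gamma>"
  have "ms.mball X r \<subseteq> U \<longleftrightarrow> (\<forall>Y\<in>surf \<Gamma>. qdist X Y < r \<longrightarrow> Y \<in> U)" if "X \<in> U" for X r
    using that U by (auto simp: ms.mball_def)
  then show "(\<forall>X. X \<in> U \<longrightarrow> (\<exists>r>0. ms.mball X r \<subseteq> U)) \<longleftrightarrow>
      (\<forall>X\<in>U. \<exists>r>0. \<forall>Y\<in>surf \<Gamma>. qdist X Y < r \<longrightarrow> Y \<in> U)"
    by (simp add: Ball_def)
qed

lemma compactin_seq:
  assumes "compactin (surf_top \<Gamma>) K" "\<And>n::nat. f n \<in> K"
  obtains l r where "l \<in> K" "strict_mono (r :: nat \<Rightarrow> nat)" "(\<lambda>n. qdist (f (r n)) l) \<longlonglongrightarrow> 0"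
proof -
  have K: "K \<subseteq> surf \<Gamma>" using compactin_subset_topspace[OF assms(1)] by simp
  obtain l r where lr: "l \<in> K" "strict_mono (r :: nat \<Rightarrow> nat)" "limitin (surf_top \<Gamma>) (f \<circ> r) l sequentially"
    using assms(1)[unfolded surf_top_eq ms.compactin_sequentially, THEN conjunct2, rule_format, of f] assms(2)
    unfolding surf_top_eq by blast
  moreover have "(f \<circ> r) n \<in> surf \<Gamma>" for n using K assms(2) by auto
  ultimately show ?thesis using limitin_surf_top[of "f \<circ> r" l sequentially] that by auto
qed

definition qcball :: "complex set \<Rightarrow> real \<Rightarrow> complex set set" where
  "qcball X R = {Y \<in> surf \<Gamma>. qdist X Y \<le> R}"

text \<open>The quotient is a proper metric space: lifts at exact distance from one lift of
  \<open>X\<close> stay in a compact ball of the half-plane.\<close>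

lemma qdist_bounded_subseq:
  fixes f :: "nat \<Rightarrow> complex set"
  assumes X: "X \<in> surf \<Gamma>" and f: "\<And>n. f n \<in> surf \<Gamma>" "\<And>n. qdist X (f n) \<le> R"
  obtains l r where "l \<in> surf \<Gamma>" "strict_mono (r :: nat \<Rightarrow> nat)" "(\<lambda>n. qdist (f (r n)) l) \<longlonglongrightarrow> 0"
proof -
  have "\<exists>w. w \<in> upper \<and> orb \<Gamma> w = f n \<and> hdist (lift_pt X) w = qdist X (f n)" for n
    using qdist_lift[OF lift_pt(1)[OF X] f(1)[of n]] unfolding lift_pt(2)[OF X] by blast
  then obtain w where w: "\<And>n. w n \<in> upper" "\<And>n. orb \<Gamma> (w n) = f n" "\<And>n. hdist (lift_pt X) (w n) = qdist X (f n)"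
    by metis
  obtain l r where l: "l \<in> upper" "strict_mono (r :: nat \<Rightarrow> nat)" "(\<lambda>n. w (r n)) \<longlonglongrightarrow> l"
  proof (rule hdist_bounded_subseq[of "lift_pt X" w R])
    show "hdist (lift_pt X) (w n) \<le> R" for n using w(3) f(2) by simp
  qed (use w(1) lift_pt(1)[OF X] in blast)+
  have "(\<lambda>n. hdist (w (r n)) l) \<longlonglongrightarrow> hdist l l"
    by (intro tendsto_hdist l(3) tendsto_const l(1) always_eventually allI w(1))
  then have lim: "(\<lambda>n. hdist (w (r n)) l) \<longlonglongrightarrow> 0" by simp
  have "(\<lambda>n. qdist (f (r n)) (orb \<Gamma> l)) \<longlonglongrightarrow> 0"
  proof (rule tendsto_sandwich[OF _ _ tendsto_const lim])
    show "\<forall>\<^sub>F n in sequentially. 0 \<le> qdist (f (r n)) (orb \<Gamma> l)"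
      using qdist_nonneg[OF f(1) orb_in_surf[OF l(1)]] by simp
    show "\<forall>\<^sub>F n in sequentially. qdist (f (r n)) (orb \<Gamma> l) \<le> hdist (w (r n)) l"
      using qdist_le[OF w(1) l(1)] by (simp add: w(2))
  qed
  then show ?thesis using that[OF orb_in_surf[OF l(1)] l(2)] by simp
qed

lemma compactin_qcball:
  assumes X: "X \<in> surf \<Gamma>"
  shows "compactin (surf_top \<Gamma>) (qcball X R)"
  unfolding surf_top_eq ms.compactin_sequentially
proof (intro conjI allI impI)
  show "qcball X R \<subseteq> surf \<Gamma>" by (auto simp: qcball_def)
  fix f :: "nat \<Rightarrow> complex set" assume "range f \<subseteq> qcball X R"
  then have f: "f n \<in> surf \<Gamma>" "qdist X (f n) \<le> R" for n by (auto simp: qcball_def)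
  obtain l r where l: "l \<in> surf \<Gamma>" "strict_mono (r :: nat \<Rightarrow> nat)" "(\<lambda>n. qdist (f (r n)) l) \<longlonglongrightarrow> 0"
    by (rule qdist_bounded_subseq[OF X f])
  have "qdist X l - R \<le> qdist (f (r n)) l" for n
    using qdist_triangle[OF X f(1)[of "r n"] l(1)] f(2)[of "r n"] by linarith
  then have "qdist X l - R \<le> 0" by (intro LIMSEQ_le_const[OF l(3)]) auto
  moreover have "limitin ms.mtopology (f \<circ> r) l sequentially"
    using limitin_surf_top[of "f \<circ> r" l sequentially] l f by (simp add: surf_top_eq)
  ultimately show "\<exists>l r. l \<in> qcball X R \<and> strict_mono r \<and> limitin ms.mtopology (f \<circ> r) l sequentially"
    using l by (auto simp: qcball_def)
qed

end

section \<open>From local to global almost isometries\<close>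

text \<open>Bolzano's bisection principle turns a pointwise Lipschitz bound into a global one.\<close>

lemma Lipschitz_local_to_global:
  fixes D :: "real \<Rightarrow> real \<Rightarrow> real"
  assumes "a \<le> b"
    and tri: "\<And>x y z. a \<le> x \<Longrightarrow> x \<le> y \<Longrightarrow> y \<le> z \<Longrightarrow> z \<le> b \<Longrightarrow> D x z \<le> D x y + D y z"
    and loc: "\<And>x. a \<le> x \<Longrightarrow> x \<le> b \<Longrightarrow> \<exists>r>0. \<forall>u v. a \<le> u \<and> u \<le> x \<and> x \<le> v \<and> v \<le> b \<and> v - u < r \<longrightarrow> D u v \<le> L * (v - u)"
  shows "D a b \<le> L * (b - a)"
proof -
  define P where "P u v \<longleftrightarrow> (a \<le> u \<longrightarrow> u \<le> v \<longrightarrow> v \<le> b \<longrightarrow> D u v \<le> L * (v - u))" for u v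
  have "P a b"
  proof (rule Bolzano[OF assms(1)])
    fix u v w assume h: "P u v" "P v w" "u \<le> v" "v \<le> w"
    show "P u w" unfolding P_def
    proof (intro impI)
      assume "a \<le> u" "u \<le> w" "w \<le> b"
      then have "D u w \<le> D u v + D v w" using h by (intro tri) auto
      also have "\<dots> \<le> L * (v - u) + L * (w - v)" using h \<open>a \<le> u\<close> \<open>w \<le> b\<close> by (intro add_mono) (auto simp: P_def)
      finally show "D u w \<le> L * (w - u)" by (simp add: algebra_simps)
    qed
  next
    fix x assume "a \<le> x" "x \<le> b"
    then obtain r where r: "r > 0" "\<forall>u v. a \<le> u \<and> u \<le> x \<and> x \<le> v \<and> v \<le> b \<and> v - u < r \<longrightarrow> D u v \<le> L * (v - u)"
      using loc by blast
    then show "\<exists>d>0. \<forall>a b. a \<le> x \<and> x \<le> b \<and> b - a < d \<longrightarrow> P a b"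
      by (intro exI[of _ r]) (simp add: P_def)
  qed
  then show ?thesis using assms(1) by (simp add: P_def)
qed

context fuchsian_group
begin

text \<open>A shortest path in the quotient is the projection of a geodesic. It is kept as a
  geodesic \<open>c\<close> of the half-plane, where distances along it are explicit.\<close>

lemma qdist_orb_le:
  assumes "X \<in> surf \<Gamma>" "Y \<in> surf \<Gamma>"
  obtains c where "\<And>s. c s \<in> upper" "\<And>s t. hdist (c s) (c t) = \<bar>s - t\<bar>"
    "orb \<Gamma> (c 0) = X" "orb \<Gamma> (c (qdist X Y)) = Y"
proof -
  obtain w where w: "w \<in> upper" "orb \<Gamma> w = Y" "hdist (lift_pt X) w = qdist X Y"
    using qdist_lift[OF lift_pt(1)[OF assms(1)] assms(2)] unfolding lift_pt(2)[OF assms(1)] by blast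
  obtain c where c: "\<And>s. c s \<in> upper" "\<And>s t. hdist (c s) (c t) = \<bar>s - t\<bar>"
      "c 0 = lift_pt X" "c (hdist (lift_pt X) w) = w"
    using hgeodesic[OF lift_pt(1)[OF assms(1)] w(1)] by blast
  show ?thesis by (rule that[OF c(1,2)]) (use c(3,4) w lift_pt(2)[OF assms(1)] in auto)
qed

lemma qdist_self [simp]: "X \<in> surf \<Gamma> \<Longrightarrow> qdist X X = 0"
  by (simp add: qdist_eq_0)

lemma qdist_lim_unique:
  assumes "l \<in> surf \<Gamma>" "m \<in> surf \<Gamma>" "\<And>n::nat. f n \<in> surf \<Gamma>"
    "(\<lambda>n. qdist (f n) l) \<longlonglongrightarrow> 0" "(\<lambda>n. qdist (f n) m) \<longlonglongrightarrow> 0"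
  shows "l = m"
proof -
  have "(\<lambda>n. qdist (f n) l + qdist (f n) m) \<longlonglongrightarrow> 0 + 0" by (intro tendsto_add assms)
  moreover have "qdist l m \<le> qdist (f n) l + qdist (f n) m" for n
    using qdist_triangle[OF assms(1) assms(3)[of n] assms(2)] qdist_commute[of l "f n"] by simp
  ultimately have "qdist l m \<le> 0 + 0" by (intro LIMSEQ_le_const) auto
  then have "qdist l m = 0" using qdist_nonneg[OF assms(1,2)] by simp
  then show ?thesis using qdist_eq_0[OF assms(1,2)] by simp
qed

end

text \<open>The form in which geometric convergence is used later. The second clause makes
  \<open>\<phi>\<close> onto the ball about \<open>\<phi> p\<close>, with preimages near
  \<open>p\<close>, so that \<open>\<phi>\<close> can be inverted on this ball.\<close>

definition near_isom ::
  "(complex \<Rightarrow> complex) set \<Rightarrow> (complex \<Rightarrow> complex) set \<Rightarrow> (complex set \<Rightarrow> complex set) \<Rightarrow> complex set \<Rightarrow> real \<Rightarrow> real \<Rightarrow> bool" where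
  "near_isom G H \<phi> p R \<delta> \<longleftrightarrow>
     (\<forall>X\<in>surf G. \<forall>Y\<in>surf G. qdist p X \<le> R \<longrightarrow> qdist p Y \<le> R \<longrightarrow>
        (1 - \<delta>) * qdist X Y \<le> qdist (\<phi> X) (\<phi> Y) \<and> qdist (\<phi> X) (\<phi> Y) \<le> (1 + \<delta>) * qdist X Y) \<and>
     (\<forall>Y\<in>surf H. qdist (\<phi> p) Y \<le> R \<longrightarrow> (\<exists>Z\<in>surf G. \<phi> Z = Y \<and> qdist p Z \<le> 2 * qdist (\<phi> p) Y))"

locale local_near_isom =
  N: fuchsian_group G + M: fuchsian_group H for G H +
  fixes \<phi> :: "complex set \<Rightarrow> complex set" and p :: "complex set" and R \<delta> :: real
  assumes p: "p \<in> surf G" and delta: "0 < \<delta>" "\<delta> < 1"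
    and maps: "\<And>X. X \<in> surf G \<Longrightarrow> \<phi> X \<in> surf H"
    and inj: "inj_on \<phi> (surf G)"
    and inv_cont: "\<And>X e. X \<in> surf G \<Longrightarrow> 0 < e \<Longrightarrow>
      \<exists>r>0. \<forall>Y\<in>surf H. qdist (\<phi> X) Y < r \<longrightarrow> (\<exists>Z\<in>surf G. \<phi> Z = Y \<and> qdist X Z < e)"
    and bilip: "\<And>X. X \<in> surf G \<Longrightarrow> qdist p X \<le> R \<Longrightarrow>
      \<exists>r>0. \<forall>Y\<in>surf G. \<forall>Z\<in>surf G. qdist X Y < r \<longrightarrow> qdist X Z < r \<longrightarrow>
        (1 - \<delta>) * qdist Y Z \<le> qdist (\<phi> Y) (\<phi> Z) \<and> qdist (\<phi> Y) (\<phi> Z) \<le> (1 + \<delta>) * qdist Y Z"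
begin

text \<open>A shortest geodesic from \<open>X\<close> to \<open>Y\<close> stays in the ball where
  the local bound holds, and the local bounds add up along it.\<close>

lemma upper_bound:
  assumes X: "X \<in> surf G" "Y \<in> surf G" and R: "qdist p X + qdist X Y \<le> R"
  shows "qdist (\<phi> X) (\<phi> Y) \<le> (1 + \<delta>) * qdist X Y"
proof -
  obtain c where c: "\<And>s. c s \<in> upper" "\<And>s t. hdist (c s) (c t) = \<bar>s - t\<bar>"
    "orb G (c 0) = X" "orb G (c (qdist X Y)) = Y" using N.qdist_orb_le[OF X] by blast
  have cs: "orb G (c s) \<in> surf G" for s using c(1) N.orb_in_surf by simp
  have cd: "qdist (orb G (c s)) (orb G (c t)) \<le> \<bar>s - t\<bar>" for s t
    using N.qdist_le[OF c(1) c(1), of s t] c(2) by simp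
  have "qdist (\<phi> (orb G (c 0))) (\<phi> (orb G (c (qdist X Y)))) \<le> (1 + \<delta>) * (qdist X Y - 0)"
  proof (rule Lipschitz_local_to_global[where D = "\<lambda>s t. qdist (\<phi> (orb G (c s))) (\<phi> (orb G (c t)))"])
    show "0 \<le> qdist X Y" by (rule N.qdist_nonneg[OF X])
    show "qdist (\<phi> (orb G (c x))) (\<phi> (orb G (c z)))
       \<le> qdist (\<phi> (orb G (c x))) (\<phi> (orb G (c y))) + qdist (\<phi> (orb G (c y))) (\<phi> (orb G (c z)))" for x y z
      by (intro M.qdist_triangle maps cs)
    fix s assume s: "0 \<le> s" "s \<le> qdist X Y"
    have "qdist p (orb G (c s)) \<le> qdist p X + qdist X (orb G (c s))" by (intro N.qdist_triangle p X cs)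
    also have "qdist X (orb G (c s)) \<le> s" using cd[of 0 s] c(3) s by simp
    finally have "qdist p (orb G (c s)) \<le> R" using R s by linarith
    from bilip[OF cs this] obtain r where r: "r > 0"
      "\<forall>Y\<in>surf G. \<forall>Z\<in>surf G. qdist (orb G (c s)) Y < r \<longrightarrow> qdist (orb G (c s)) Z < r \<longrightarrow>
        (1 - \<delta>) * qdist Y Z \<le> qdist (\<phi> Y) (\<phi> Z) \<and> qdist (\<phi> Y) (\<phi> Z) \<le> (1 + \<delta>) * qdist Y Z"
      by blast
    show "\<exists>r>0. \<forall>u v. 0 \<le> u \<and> u \<le> s \<and> s \<le> v \<and> v \<le> qdist X Y \<and> v - u < r \<longrightarrow>
        qdist (\<phi> (orb G (c u))) (\<phi> (orb G (c v))) \<le> (1 + \<delta>) * (v - u)"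
    proof (intro exI[of _ r] conjI r(1) allI impI)
      fix u v assume h: "0 \<le> u \<and> u \<le> s \<and> s \<le> v \<and> v \<le> qdist X Y \<and> v - u < r"
      have "qdist (orb G (c s)) (orb G (c u)) < r" "qdist (orb G (c s)) (orb G (c v)) < r"
        using cd[of s u] cd[of s v] h by linarith+
      then have "qdist (\<phi> (orb G (c u))) (\<phi> (orb G (c v))) \<le> (1 + \<delta>) * qdist (orb G (c u)) (orb G (c v))"
        using r(2) cs by blast
      also have "\<dots> \<le> (1 + \<delta>) * (v - u)"
        using cd[of u v] h delta by (intro mult_left_mono) auto
      finally show "qdist (\<phi> (orb G (c u))) (\<phi> (orb G (c v))) \<le> (1 + \<delta>) * (v - u)" .
    qed
  qed
  then show ?thesis using c(3,4) by simp
qed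

text \<open>Continuity method. The set of parameters \<open>s\<close> for which \<open>c s\<close>
  has a preimage within \<open>s / (1 - \<delta>)\<close> of \<open>X\<close> contains its supremum,
  by compactness of balls. It extends to the right of any of its members below \<open>l\<close>:
  \<open>inv_cont\<close> supplies a preimage, and the lower Lipschitz bound keeps it close
  enough.\<close>

lemma lift_path:
  assumes X: "X \<in> surf G" and c: "\<And>s. c s \<in> upper" "\<And>s t. hdist (c s) (c t) = \<bar>s - t\<bar>"
    "orb H (c 0) = \<phi> X" and l: "0 \<le> l" "qdist p X + l / (1 - \<delta>) \<le> R"
  shows "\<exists>Z\<in>surf G. \<phi> Z = orb H (c l) \<and> qdist X Z \<le> l / (1 - \<delta>)"
proof -
  define lifts where "lifts s Z \<longleftrightarrow> Z \<in> surf G \<and> \<phi> Z = orb H (c s) \<and> qdist X Z \<le> s / (1 - \<delta>)" for s Z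
  define S where "S = {s. 0 \<le> s \<and> s \<le> l \<and> (\<exists>Z. lifts s Z)}"
  define m where "m = Sup S"
  have cs: "orb H (c s) \<in> surf H" for s using c(1) M.orb_in_surf by simp
  have cd: "qdist (orb H (c s)) (orb H (c t)) \<le> \<bar>s - t\<bar>" for s t
    using M.qdist_le[OF c(1) c(1), of s t] c(2) by simp
  have d1: "0 < 1 - \<delta>" using delta by simp
  have S0: "0 \<in> S" using X c(3) l(1) by (auto simp: S_def lifts_def intro!: exI[of _ X])
  have bdd: "bdd_above S" by (rule bdd_aboveI[of _ l]) (simp add: S_def)
  have m0: "0 \<le> m" unfolding m_def by (rule cSup_upper[OF S0 bdd])
  have ml: "m \<le> l" unfolding m_def by (rule cSup_least) (use S0 in \<open>auto simp: S_def\<close>)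
  have "m \<in> closure S" unfolding m_def by (rule closure_contains_Sup[OF _ bdd]) (use S0 in blast)
  then obtain u where u: "\<And>n. u n \<in> S" "u \<longlonglongrightarrow> m" unfolding closure_sequential by blast
  then have "\<forall>n. \<exists>Z. lifts (u n) Z" by (auto simp: S_def)
  then obtain z where z: "\<And>n. lifts (u n) (z n)" by metis
  have zu: "z n \<in> surf G" "\<phi> (z n) = orb H (c (u n))" and zd: "qdist X (z n) \<le> u n / (1 - \<delta>)" for n
    using z[of n] by (auto simp: lifts_def)
  have zl: "qdist X (z n) \<le> l / (1 - \<delta>)" for n
    using zd[of n] u(1)[of n] divide_right_mono[of "u n" l "1 - \<delta>"] d1 by (auto simp: S_def)
  obtain Z r where Z: "Z \<in> surf G" "strict_mono (r :: nat \<Rightarrow> nat)" "(\<lambda>n. qdist (z (r n)) Z) \<longlonglongrightarrow> 0"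
    by (rule N.qdist_bounded_subseq[OF X zu(1) zl])
  have ur: "(\<lambda>n. u (r n)) \<longlonglongrightarrow> m" using LIMSEQ_subseq_LIMSEQ[OF u(2) Z(2)] by (simp add: o_def)
  have XZ: "qdist X Z \<le> m / (1 - \<delta>)"
  proof (rule LIMSEQ_le_const)
    show "(\<lambda>n. u (r n) / (1 - \<delta>) + qdist (z (r n)) Z) \<longlonglongrightarrow> m / (1 - \<delta>)"
      using tendsto_add[OF tendsto_divide[OF ur tendsto_const, of "1 - \<delta>"] Z(3)] d1 by simp
    have "qdist X Z \<le> u (r n) / (1 - \<delta>) + qdist (z (r n)) Z" for n
      using N.qdist_triangle[OF X zu(1)[of "r n"] Z(1)] zd[of "r n"] by linarith
    then show "\<exists>N. \<forall>n\<ge>N. qdist X Z \<le> u (r n) / (1 - \<delta>) + qdist (z (r n)) Z" by blast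
  qed
  moreover have "m / (1 - \<delta>) \<le> l / (1 - \<delta>)" using ml d1 by (intro divide_right_mono) auto
  ultimately have "qdist p Z \<le> R" using N.qdist_triangle[OF p X Z(1)] l by linarith
  from bilip[OF Z(1) this] obtain e where e: "e > 0" "\<forall>Y\<in>surf G. \<forall>W\<in>surf G. qdist Z Y < e \<longrightarrow> qdist Z W < e \<longrightarrow>
      (1 - \<delta>) * qdist Y W \<le> qdist (\<phi> Y) (\<phi> W) \<and> qdist (\<phi> Y) (\<phi> W) \<le> (1 + \<delta>) * qdist Y W" by blast
  have ZZ: "qdist Z Z < e" using e(1) Z(1) by simp
  \<comment> \<open>\<open>\<phi> Z\<close> and \<open>orb H (c m)\<close> are limits of one
    sequence: the first by the upper Lipschitz bound near \<open>Z\<close>, the second because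
    \<open>c\<close> is a geodesic.\<close>
  have lim1: "(\<lambda>n. qdist (orb H (c (u (r n)))) (\<phi> Z)) \<longlonglongrightarrow> 0"
  proof (rule tendsto_sandwich[OF _ _ tendsto_const])
    show "\<forall>\<^sub>F n in sequentially. 0 \<le> qdist (orb H (c (u (r n)))) (\<phi> Z)"
      using M.qdist_nonneg[OF cs maps[OF Z(1)]] by simp
    show "\<forall>\<^sub>F n in sequentially. qdist (orb H (c (u (r n)))) (\<phi> Z) \<le> (1 + \<delta>) * qdist (z (r n)) Z"
      using order_tendstoD(2)[OF Z(3) e(1)]
    proof eventually_elim
      case (elim n)
      then have "qdist Z (z (r n)) < e" using N.qdist_commute by simp
      then show ?case using e(2) zu(1)[of "r n"] Z(1) ZZ unfolding zu(2)[symmetric] by blast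
    qed
    show "(\<lambda>n. (1 + \<delta>) * qdist (z (r n)) Z) \<longlonglongrightarrow> 0" using tendsto_mult_right_zero[OF Z(3)] by simp
  qed
  have lim2: "(\<lambda>n. qdist (orb H (c (u (r n)))) (orb H (c m))) \<longlonglongrightarrow> 0"
  proof (rule tendsto_sandwich[OF _ _ tendsto_const])
    show "\<forall>\<^sub>F n in sequentially. 0 \<le> qdist (orb H (c (u (r n)))) (orb H (c m))"
      using M.qdist_nonneg[OF cs cs] by simp
    show "\<forall>\<^sub>F n in sequentially. qdist (orb H (c (u (r n)))) (orb H (c m)) \<le> \<bar>u (r n) - m\<bar>"
      using cd by simp
    show "(\<lambda>n. \<bar>u (r n) - m\<bar>) \<longlonglongrightarrow> 0" using LIM_zero[OF ur] tendsto_rabs_zero by blast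
  qed
  have \<phi>Z: "\<phi> Z = orb H (c m)" by (rule M.qdist_lim_unique[OF maps[OF Z(1)] cs cs lim1 lim2])
  \<comment> \<open>Otherwise the lift could be continued from \<open>Z\<close> by a small step
    \<open>h\<close>, beyond the supremum.\<close>
  have "m = l"
  proof (rule ccontr)
    assume "m \<noteq> l"
    then have mll: "m < l" using ml by simp
    from inv_cont[OF Z(1) e(1)] obtain \<rho> where \<rho>: "\<rho> > 0"
      "\<forall>Y\<in>surf H. qdist (\<phi> Z) Y < \<rho> \<longrightarrow> (\<exists>W\<in>surf G. \<phi> W = Y \<and> qdist Z W < e)" by blast
    define h where "h = min (l - m) (\<rho> / 2)"
    have h: "0 < h" "m + h \<le> l" "h < \<rho>" using mll \<rho>(1) by (auto simp: h_def)
    have hd: "qdist (\<phi> Z) (orb H (c (m + h))) \<le> h" using cd[of m "m + h"] h by (simp add: \<phi>Z)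
    then obtain W where W: "W \<in> surf G" "\<phi> W = orb H (c (m + h))" "qdist Z W < e"
      using \<rho>(2) cs[of "m + h"] le_less_trans[OF hd h(3)] by blast
    have "(1 - \<delta>) * qdist Z W \<le> qdist (\<phi> Z) (\<phi> W)" using e(2) Z(1) W(1,3) ZZ by blast
    then have "(1 - \<delta>) * qdist Z W \<le> h" unfolding W(2) using hd by linarith
    then have "qdist Z W \<le> h / (1 - \<delta>)" using d1 by (simp add: field_simps)
    then have "qdist X W \<le> (m + h) / (1 - \<delta>)"
      using N.qdist_triangle[OF X Z(1) W(1)] XZ by (simp add: add_divide_distrib)
    then have "m + h \<in> S" using W h m0 by (auto simp: S_def lifts_def)
    then have "m + h \<le> m" unfolding m_def by (rule cSup_upper[OF _ bdd])
    then show False using h(1) by simp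
  qed
  then show ?thesis using Z(1) \<phi>Z XZ by blast
qed

text \<open>For the lower bound the geodesic from \<open>\<phi> X\<close> to \<open>\<phi> Y\<close>
  is lifted from \<open>X\<close>; its end point is a preimage of \<open>\<phi> Y\<close>, hence
  \<open>Y\<close> by injectivity. The factor 7 is the room this takes: the image distance is at
  most (3/2) * 2 * R0, lifting at most doubles it, and the lift starts within R0 of
  \<open>p\<close>.\<close>

lemma near_isom:
  assumes R0: "0 \<le> R0" "7 * R0 \<le> R" and d: "\<delta> \<le> 1 / 2"
  shows "near_isom G H \<phi> p R0 \<delta>"
proof -
  have d1: "0 < 1 - \<delta>" using delta by simp
  have dbl: "l / (1 - \<delta>) \<le> 2 * l" if "0 \<le> l" for l
  proof -
    have "1 * l \<le> (2 * (1 - \<delta>)) * l" by (rule mult_right_mono) (use d that in auto)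
    then show ?thesis using d1 by (simp add: field_simps)
  qed
  have "(1 - \<delta>) * qdist X Y \<le> qdist (\<phi> X) (\<phi> Y) \<and> qdist (\<phi> X) (\<phi> Y) \<le> (1 + \<delta>) * qdist X Y"
    if X: "X \<in> surf G" "Y \<in> surf G" "qdist p X \<le> R0" "qdist p Y \<le> R0" for X Y
  proof
    have 1: "qdist X Y \<le> 2 * R0" using N.qdist_triangle[OF X(1) p X(2)] N.qdist_commute[of X p] X by simp
    show 2: "qdist (\<phi> X) (\<phi> Y) \<le> (1 + \<delta>) * qdist X Y" by (rule upper_bound[OF X(1,2)]) (use 1 X R0 in linarith)
    define l where "l = qdist (\<phi> X) (\<phi> Y)"
    have l0: "0 \<le> l" unfolding l_def by (rule M.qdist_nonneg[OF maps[OF X(1)] maps[OF X(2)]])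
    have "(1 + \<delta>) * qdist X Y \<le> (3 / 2) * (2 * R0)"
      by (rule mult_mono) (use 1 d R0 N.qdist_nonneg[OF X(1,2)] in auto)
    then have l3: "l \<le> 3 * R0" using 2 by (simp add: l_def)
    obtain c where c: "\<And>s. c s \<in> upper" "\<And>s t. hdist (c s) (c t) = \<bar>s - t\<bar>"
      "orb H (c 0) = \<phi> X" "orb H (c l) = \<phi> Y" unfolding l_def using M.qdist_orb_le[OF maps[OF X(1)] maps[OF X(2)]] by blast
    have "qdist p X + l / (1 - \<delta>) \<le> R" using dbl[OF l0] l3 X(3) R0 by linarith
    from lift_path[OF X(1) c(1,2,3) l0 this] obtain Z where Z: "Z \<in> surf G" "\<phi> Z = \<phi> Y" "qdist X Z \<le> l / (1 - \<delta>)"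
      using c(4) by auto
    then have "Z = Y" using inj X(2) by (auto dest: inj_onD)
    then show "(1 - \<delta>) * qdist X Y \<le> qdist (\<phi> X) (\<phi> Y)" using Z(3) d1 by (simp add: l_def field_simps)
  qed
  moreover have "\<exists>Z\<in>surf G. \<phi> Z = Y \<and> qdist p Z \<le> 2 * qdist (\<phi> p) Y" if Y: "Y \<in> surf H" "qdist (\<phi> p) Y \<le> R0" for Y
  proof -
    define l where "l = qdist (\<phi> p) Y"
    have l0: "0 \<le> l" unfolding l_def by (rule M.qdist_nonneg[OF maps[OF p] Y(1)])
    obtain c where c: "\<And>s. c s \<in> upper" "\<And>s t. hdist (c s) (c t) = \<bar>s - t\<bar>"
      "orb H (c 0) = \<phi> p" "orb H (c l) = Y" unfolding l_def using M.qdist_orb_le[OF maps[OF p] Y(1)] by blast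
    have 0: "l / (1 - \<delta>) \<le> 2 * l" by (rule dbl[OF l0])
    then have 1: "l / (1 - \<delta>) \<le> 2 * R0" using Y(2) by (simp add: l_def)
    have "qdist p p + l / (1 - \<delta>) \<le> R" using 1 R0 p by simp
    from lift_path[OF p c(1,2,3) l0 this] obtain Z where "Z \<in> surf G" "\<phi> Z = Y" "qdist p Z \<le> l / (1 - \<delta>)"
      using c(4) by auto
    then show ?thesis using 0 unfolding l_def by force
  qed
  ultimately show ?thesis unfolding near_isom_def by blast
qed

end

section \<open>The identification maps of a degenerating family\<close>

lemma eventually_orders_to_infinity:
  "eventually P (orders_to_infinity Q) \<longleftrightarrow> (\<exists>N. \<forall>q\<in>Q. (\<forall>k. N \<le> q k) \<longrightarrow> P q)"
proof -
  have "eventually P (orders_to_infinity Q) \<longleftrightarrow> (\<exists>N\<in>UNIV. eventually P (principal {q \<in> Q. \<forall>k. N \<le> q k}))"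
    unfolding orders_to_infinity_def
  proof (rule eventually_INF_base)
    fix a b :: nat
    show "\<exists>x\<in>UNIV. principal {q \<in> Q. \<forall>k. x \<le> q k} \<le> inf (principal {q \<in> Q. \<forall>k. a \<le> q k}) (principal {q \<in> Q. \<forall>k. b \<le> q k})"
      by (intro bexI[of _ "max a b"]) auto
  qed simp
  then show ?thesis unfolding eventually_principal by blast
qed

lemma cusp_dom_mono: "0 < e' \<Longrightarrow> e' \<le> e \<Longrightarrow> cusp_dom e' \<subseteq> cusp_dom e"
  using frac_le[of 1 1 e' e] by (auto simp: cusp_dom_def)

lemma cone_dom_bound_mono:
  assumes "0 < e'" "e' < e" "0 < n"
  shows "arcosh (1 + e' * real n / (2 * pi)) < arcosh (1 + e * real n / (2 * pi))"
proof (subst arcosh_less_iff_real)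
  show "1 + e' * real n / (2 * pi) < 1 + e * real n / (2 * pi)"
    using assms by (simp add: divide_strict_right_mono)
qed (use assms in auto)

lemma cone_ident_normalize:
  obtains \<theta>' where "0 \<le> \<theta>'" "\<theta>' \<le> 2 * pi" "cone_ident (\<rho>, \<theta>) (\<rho>, \<theta>')"
proof -
  define m where "m = \<lfloor>\<theta> / (2 * pi)\<rfloor>"
  have 1: "of_int m \<le> \<theta> / (2 * pi)" "\<theta> / (2 * pi) < of_int m + 1" unfolding m_def by linarith+
  have 2: "of_int m * (2 * pi) \<le> \<theta>" using 1(1) by (simp add: field_simps)
  have 3: "\<theta> < (of_int m + 1) * (2 * pi)" using 1(2) by (simp add: field_simps)
  show ?thesis
    by (rule that[of "\<theta> - 2 * pi * of_int m"])
      (use 2 3 in \<open>auto simp: cone_ident_def algebra_simps intro!: exI[of _ "- m"]\<close>)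
qed

context elliptically_degenerating
begin

lemma fg_inf: "fuchsian_group \<Gamma>_inf"
  using fuchsian_limit by unfold_locales simp

lemma fg: "q \<in> Q \<Longrightarrow> fuchsian_group (\<Gamma> q)"
  using fuchsian_family by unfold_locales simp

definition thick :: "real \<Rightarrow> complex set set" where
  "thick \<epsilon> = surf \<Gamma>_inf - (\<Union>k. \<sigma> k ` cusp_dom \<epsilon>)"

definition cone_compl :: "('m \<Rightarrow> nat) \<Rightarrow> real \<Rightarrow> complex set set" where
  "cone_compl q \<epsilon> = surf (\<Gamma> q) - (\<Union>k. cone_nbhds apex \<kappa> q \<epsilon> k)"

lemma thick_antimono: "0 < e' \<Longrightarrow> e' \<le> e \<Longrightarrow> thick e \<subseteq> thick e'"
  using cusp_dom_mono[of e' e] by (auto simp: thick_def)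

text \<open>The preimages of a point in a cusp all have the same height, because
  \<open>cusp_ident\<close> only shifts horizontally. A cusp neighbourhood that starts above this
  height misses the point, and there are finitely many cusps.\<close>

lemma thick_exhaust:
  assumes "X \<in> surf \<Gamma>_inf"
  obtains \<epsilon> where "0 < \<epsilon>" "\<epsilon> < 1 / 2" "X \<in> thick \<epsilon>"
proof -
  have "\<exists>e>0. e \<le> 1 / 4 \<and> X \<notin> \<sigma> k ` cusp_dom e" for k
  proof (cases "X \<in> \<sigma> k ` cusp_dom (1 / 4)")
    case False then show ?thesis by (intro exI[of _ "1 / 4"]) auto
  next
    case True
    then obtain z where z: "z \<in> cusp_dom (1 / 4)" "X = \<sigma> k z" by blast
    then have Im: "4 < Im z" by (simp add: cusp_dom_def)
    define e where "e = 1 / (Im z + 1)"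
    have e: "0 < e" "e \<le> 1 / 4" using Im by (auto simp: e_def field_simps)
    have "X \<notin> \<sigma> k ` cusp_dom e"
    proof
      assume "X \<in> \<sigma> k ` cusp_dom e"
      then obtain w where w: "w \<in> cusp_dom e" "X = \<sigma> k w" by blast
      then have "w \<in> cusp_dom (1 / 4)" using cusp_dom_mono[OF e] by blast
      moreover have "\<sigma> k z = \<sigma> k w" using z(2) w(2) by simp
      ultimately have "cusp_ident z w"
        using cusp_embedding[of "1 / 4" k] z(1) unfolding isometric_embedding_def by auto
      then have "Im w = Im z" by (auto simp: cusp_ident_def)
      moreover have "Im z + 1 < Im w" using w(1) Im by (simp add: cusp_dom_def e_def)
      ultimately show False by simp
    qed
    then show ?thesis using e by blast
  qed
  then obtain e where e: "\<And>k. 0 < e k" "\<And>k. e k \<le> 1 / 4" "\<And>k. X \<notin> \<sigma> k ` cusp_dom (e k)" by metis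
  define \<epsilon> where "\<epsilon> = Min (range e)"
  have le: "\<epsilon> \<le> e k" for k unfolding \<epsilon>_def by (rule Min_le) auto
  have pos: "0 < \<epsilon>" unfolding \<epsilon>_def using e(1) by (subst Min_gr_iff) auto
  have "\<epsilon> < 1 / 2" using le[of undefined] e(2)[of undefined] by simp
  moreover have "X \<in> thick \<epsilon>" using assms e(3) cusp_dom_mono[OF pos le] by (auto simp: thick_def)
  ultimately show ?thesis using that pos by blast
qed

lemma \<kappa>_in_surf:
  assumes "q \<in> Q" "0 < \<epsilon>" "\<epsilon> < 1 / 2" "p \<in> cone_dom (q k) \<epsilon>"
  shows "\<kappa> q k p \<in> surf (\<Gamma> q)"
  using cone_embedding[OF assms(1-3)] assms(4) unfolding isometric_embedding_def by blast

text \<open>The ratio of distance to tangent length tends to 1; the constant 2 is a crude bound that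
  suffices for the continuity arguments.\<close>

lemma \<kappa>_local:
  assumes "q \<in> Q" "0 < \<epsilon>" "\<epsilon> < 1 / 2" "p \<in> cone_dom (q k) \<epsilon>"
  shows "\<exists>r>0. \<forall>p'. dist p' p < r \<longrightarrow> qdist (\<kappa> q k p) (\<kappa> q k p') \<le> 2 * sqrt (cone_tensor (q k) p (p' - p))"
proof -
  interpret fuchsian_group "\<Gamma> q" by (rule fg[OF assms(1)])
  have "((\<lambda>p'. qdist (\<kappa> q k p) (\<kappa> q k p') / sqrt (cone_tensor (q k) p (p' - p))) \<longlongrightarrow> 1) (at p)"
    using cone_embedding[OF assms(1-3)] assms(4) unfolding isometric_embedding_def by blast
  then have "\<forall>\<^sub>F p' in at p. qdist (\<kappa> q k p) (\<kappa> q k p') / sqrt (cone_tensor (q k) p (p' - p)) < 2"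
    by (rule order_tendstoD) simp
  then obtain r where r: "r > 0" "\<And>p'. p' \<noteq> p \<Longrightarrow> dist p' p < r \<Longrightarrow>
      qdist (\<kappa> q k p) (\<kappa> q k p') / sqrt (cone_tensor (q k) p (p' - p)) < 2"
    by (auto simp: eventually_at)
  have "qdist (\<kappa> q k p) (\<kappa> q k p') \<le> 2 * sqrt (cone_tensor (q k) p (p' - p))" if d: "dist p' p < r" for p'
  proof (cases "p' = p")
    case True then show ?thesis using \<kappa>_in_surf[OF assms] by (simp add: cone_tensor_def)
  next
    case False
    have s: "0 < sinh (fst p)" using assms(4) by (auto simp: cone_dom_def)
    have n: "0 < real (q k)" using orders[OF assms(1), of k] by simp
    have "fst (p' - p) \<noteq> 0 \<or> snd (p' - p) \<noteq> 0" using False by (auto simp: prod_eq_iff)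
    then have "0 < (fst (p' - p))\<^sup>2 \<or> 0 < (sinh (fst p))\<^sup>2 / (real (q k))\<^sup>2 * (snd (p' - p))\<^sup>2"
      using s n by (metis zero_less_power2 divide_pos_pos mult_pos_pos less_numeral_extra(3))
    moreover have "0 \<le> (fst (p' - p))\<^sup>2" "0 \<le> (sinh (fst p))\<^sup>2 / (real (q k))\<^sup>2 * (snd (p' - p))\<^sup>2" by simp_all
    ultimately have "0 < cone_tensor (q k) p (p' - p)" unfolding cone_tensor_def by linarith
    then show ?thesis using r(2)[OF False d] by (simp add: field_simps)
  qed
  then show ?thesis using r(1) by blast
qed

text \<open>\<open>cone_apex\<close> gives convergence to the apex along single rays only. A bound
  for the length of circles about the apex makes it uniform in the angle.\<close>

lemma \<kappa>_circle:
  assumes q: "q \<in> Q" "0 < \<epsilon>" "\<epsilon> < 1 / 2" and p: "(\<rho>, 0) \<in> cone_dom (q k) \<epsilon>" and \<theta>: "0 \<le> \<theta>"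
  shows "qdist (\<kappa> q k (\<rho>, 0)) (\<kappa> q k (\<rho>, \<theta>)) \<le> 2 * (sinh \<rho> / real (q k)) * \<theta>"
proof -
  interpret fuchsian_group "\<Gamma> q" by (rule fg[OF q(1)])
  have pd: "(\<rho>, x) \<in> cone_dom (q k) \<epsilon>" for x using p by (simp add: cone_dom_def)
  have s: "0 < sinh \<rho>" using p by (auto simp: cone_dom_def)
  have cs: "\<kappa> q k (\<rho>, x) \<in> surf (\<Gamma> q)" for x by (rule \<kappa>_in_surf[OF q pd])
  have "qdist (\<kappa> q k (\<rho>, 0)) (\<kappa> q k (\<rho>, \<theta>)) \<le> 2 * (sinh \<rho> / real (q k)) * (\<theta> - 0)"
  proof (rule Lipschitz_local_to_global[where D = "\<lambda>s t. qdist (\<kappa> q k (\<rho>, s)) (\<kappa> q k (\<rho>, t))", OF \<theta>])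
    show "qdist (\<kappa> q k (\<rho>, x)) (\<kappa> q k (\<rho>, z)) \<le> qdist (\<kappa> q k (\<rho>, x)) (\<kappa> q k (\<rho>, y)) + qdist (\<kappa> q k (\<rho>, y)) (\<kappa> q k (\<rho>, z))"
      for x y z by (intro qdist_triangle cs)
    fix x :: real
    obtain r where r: "r > 0" "\<forall>p'. dist p' (\<rho>, x) < r \<longrightarrow> qdist (\<kappa> q k (\<rho>, x)) (\<kappa> q k p') \<le> 2 * sqrt (cone_tensor (q k) (\<rho>, x) (p' - (\<rho>, x)))"
      using \<kappa>_local[OF q pd, of x] by blast
    have near: "qdist (\<kappa> q k (\<rho>, x)) (\<kappa> q k (\<rho>, y)) \<le> 2 * (sinh \<rho> / real (q k)) * \<bar>y - x\<bar>" if "\<bar>y - x\<bar> < r" for y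
    proof -
      have "dist (\<rho>, y) (\<rho>, x) < r" using that by (simp add: dist_Pair_Pair dist_real_def)
      then have "qdist (\<kappa> q k (\<rho>, x)) (\<kappa> q k (\<rho>, y)) \<le> 2 * sqrt (cone_tensor (q k) (\<rho>, x) ((\<rho>, y) - (\<rho>, x)))"
        using r(2) by blast
      also have "cone_tensor (q k) (\<rho>, x) ((\<rho>, y) - (\<rho>, x)) = (sinh \<rho> / real (q k) * \<bar>y - x\<bar>)\<^sup>2"
        by (simp add: cone_tensor_def power_mult_distrib power_divide)
      also have "sqrt \<dots> = sinh \<rho> / real (q k) * \<bar>y - x\<bar>" using s by (intro real_sqrt_unique) auto
      finally show ?thesis by simp
    qed
    show "\<exists>r>0. \<forall>u v. 0 \<le> u \<and> u \<le> x \<and> x \<le> v \<and> v \<le> \<theta> \<and> v - u < r \<longrightarrow>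
        qdist (\<kappa> q k (\<rho>, u)) (\<kappa> q k (\<rho>, v)) \<le> 2 * (sinh \<rho> / real (q k)) * (v - u)"
    proof (intro exI[of _ r] conjI r(1) allI impI)
      fix u v assume h: "0 \<le> u \<and> u \<le> x \<and> x \<le> v \<and> v \<le> \<theta> \<and> v - u < r"
      have "qdist (\<kappa> q k (\<rho>, u)) (\<kappa> q k (\<rho>, v)) \<le> qdist (\<kappa> q k (\<rho>, x)) (\<kappa> q k (\<rho>, u)) + qdist (\<kappa> q k (\<rho>, x)) (\<kappa> q k (\<rho>, v))"
        using qdist_triangle[OF cs[of u] cs[of x] cs[of v]] qdist_commute[of "\<kappa> q k (\<rho>, u)" "\<kappa> q k (\<rho>, x)"] by simp
      also have "\<dots> \<le> 2 * (sinh \<rho> / real (q k)) * \<bar>u - x\<bar> + 2 * (sinh \<rho> / real (q k)) * \<bar>v - x\<bar>"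
        using h by (intro add_mono near) auto
      also have "\<dots> = 2 * (sinh \<rho> / real (q k)) * (\<bar>u - x\<bar> + \<bar>v - x\<bar>)" by (simp add: distrib_left)
      also have "\<bar>u - x\<bar> + \<bar>v - x\<bar> = v - u" using h by auto
      finally show "qdist (\<kappa> q k (\<rho>, u)) (\<kappa> q k (\<rho>, v)) \<le> 2 * (sinh \<rho> / real (q k)) * (v - u)" .
    qed
  qed
  then show ?thesis by simp
qed

text \<open>A smaller closed cone is compact, hence its complement is a neighbourhood of every point
  outside the larger open cone.\<close>

lemma cone_nbhds_separated:
  assumes q: "q \<in> Q" and e: "0 < e'" "e' < e" "e < 1 / 2" and X: "X \<in> surf (\<Gamma> q)" "X \<notin> cone_nbhds apex \<kappa> q e k"
  shows "\<exists>r>0. \<forall>Y\<in>surf (\<Gamma> q). qdist X Y < r \<longrightarrow> Y \<notin> cone_nbhds apex \<kappa> q e' k"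
proof (rule ccontr)
  assume neg: "\<not> ?thesis"
  interpret fuchsian_group "\<Gamma> q" by (rule fg[OF q])
  have n: "0 < q k" using orders[OF q, of k] by simp
  have ap: "apex q k \<in> surf (\<Gamma> q)" using apex[OF q] by blast
  have Xap: "X \<noteq> apex q k" using X(2) by (auto simp: cone_nbhds_def)
  then have dap: "0 < qdist X (apex q k)" using qdist_nonneg[OF X(1) ap] qdist_eq_0[OF X(1) ap] by simp
  define \<rho>m where "\<rho>m = arcosh (1 + e' * real (q k) / (2 * pi))"
  have \<rho>m: "\<rho>m < arcosh (1 + e * real (q k) / (2 * pi))" unfolding \<rho>m_def by (rule cone_dom_bound_mono[OF e(1,2) n])
  \<comment> \<open>Points of the smaller cone that approach \<open>X\<close> are taken closer to
    \<open>X\<close> than the apex is, so they have polar coordinates; their angles are reduced to a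
    compact interval.\<close>
  have "\<exists>\<rho> \<theta>. 0 < \<rho> \<and> \<rho> \<le> \<rho>m \<and> 0 \<le> \<theta> \<and> \<theta> \<le> 2 * pi \<and> qdist X (\<kappa> q k (\<rho>, \<theta>)) < 1 / real (Suc j)" for j
  proof -
    have "0 < min (1 / real (Suc j)) (qdist X (apex q k))" using dap by simp
    then obtain Y where Y: "Y \<in> surf (\<Gamma> q)" "qdist X Y < min (1 / real (Suc j)) (qdist X (apex q k))"
        "Y \<in> cone_nbhds apex \<kappa> q e' k" using neg by blast
    then have "Y \<noteq> apex q k" by auto
    then obtain p where p: "p \<in> cone_dom (q k) e'" "Y = \<kappa> q k p" using Y(3) by (auto simp: cone_nbhds_def)
    obtain \<theta>' where t: "0 \<le> \<theta>'" "\<theta>' \<le> 2 * pi" "cone_ident (fst p, snd p) (fst p, \<theta>')" by (rule cone_ident_normalize)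
    have p2: "(fst p, \<theta>') \<in> cone_dom (q k) e'" using p(1) by (auto simp: cone_dom_def)
    have e2: "e' < 1 / 2" using e by simp
    have "\<kappa> q k p = \<kappa> q k (fst p, \<theta>')"
      using cone_embedding[OF q e(1) e2] p(1) p2 t(3) unfolding isometric_embedding_def by simp
    then show ?thesis using p Y(2) t
      by (intro exI[of _ "fst p"] exI[of _ \<theta>']) (auto simp: cone_dom_def \<rho>m_def)
  qed
  then obtain \<rho> \<theta> where s: "\<And>j. 0 < \<rho> j" "\<And>j. \<rho> j \<le> \<rho>m" "\<And>j. 0 \<le> \<theta> j" "\<And>j. \<theta> j \<le> 2 * pi"
      "\<And>j. qdist X (\<kappa> q k (\<rho> j, \<theta> j)) < 1 / real (Suc j)" by metis
  have "compact ({0..\<rho>m} \<times> {0..2 * pi})" by (intro compact_Times compact_Icc)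
  moreover have "\<forall>j. (\<rho> j, \<theta> j) \<in> {0..\<rho>m} \<times> {0..2 * pi}" using s by (auto simp: less_imp_le)
  ultimately obtain l r where l: "l \<in> {0..\<rho>m} \<times> {0..2 * pi}" "strict_mono (r :: nat \<Rightarrow> nat)" "((\<lambda>j. (\<rho> j, \<theta> j)) \<circ> r) \<longlonglongrightarrow> l"
    unfolding compact_def by (elim allE[where x = "\<lambda>j. (\<rho> j, \<theta> j)"]) blast
  have lim: "(\<lambda>j. (\<rho> (r j), \<theta> (r j))) \<longlonglongrightarrow> l" using l(3) by (simp add: o_def)
  define Y where "Y j = \<kappa> q k (\<rho> (r j), \<theta> (r j))" for j
  have inD: "(\<rho> j, x) \<in> cone_dom (q k) e" for j x using s(1,2)[of j] \<rho>m by (simp add: cone_dom_def)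
  have Ys: "Y j \<in> surf (\<Gamma> q)" for j unfolding Y_def by (rule \<kappa>_in_surf[OF q _ e(3) inD]) (use e in simp)
  have e0: "0 < e" using e by simp
  have YX: "(\<lambda>j. qdist (Y j) X) \<longlonglongrightarrow> 0"
  proof (rule tendsto_sandwich[OF _ _ tendsto_const])
    show "\<forall>\<^sub>F j in sequentially. 0 \<le> qdist (Y j) X" using qdist_nonneg[OF Ys X(1)] by simp
    show "\<forall>\<^sub>F j in sequentially. qdist (Y j) X \<le> 1 / real (Suc (r j))"
      using s(5) qdist_commute by (auto simp: Y_def less_imp_le)
    show "(\<lambda>j. 1 / real (Suc (r j))) \<longlonglongrightarrow> 0"
      using LIMSEQ_subseq_LIMSEQ[OF LIMSEQ_Suc[OF lim_const_over_n[of 1]] l(2)] by (simp add: o_def)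
  qed
  have \<rho>l: "(\<lambda>j. \<rho> (r j)) \<longlonglongrightarrow> fst l" using tendsto_fst[OF lim] by simp
  \<comment> \<open>The limit of the polar coordinates either lies in the domain of the larger cone,
    which then contains \<open>X\<close>, or has radius 0, and then \<open>X\<close> is the
    apex.\<close>
  show False
  proof (cases "fst l = 0")
    case False
    then have lD: "l \<in> cone_dom (q k) e" using l(1) \<rho>m by (auto simp: cone_dom_def)
    obtain d where d: "d > 0" "\<forall>p'. dist p' l < d \<longrightarrow> qdist (\<kappa> q k l) (\<kappa> q k p') \<le> 2 * sqrt (cone_tensor (q k) l (p' - l))"
      using \<kappa>_local[OF q e0 e(3) lD] by blast
    have Yl: "(\<lambda>j. qdist (Y j) (\<kappa> q k l)) \<longlonglongrightarrow> 0"
    proof (rule tendsto_sandwich[OF _ _ tendsto_const])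
      show "\<forall>\<^sub>F j in sequentially. 0 \<le> qdist (Y j) (\<kappa> q k l)"
        using qdist_nonneg[OF Ys \<kappa>_in_surf[OF q e0 e(3) lD]] by simp
      have "\<forall>\<^sub>F j in sequentially. dist (\<rho> (r j), \<theta> (r j)) l < d" using lim d(1) by (rule tendstoD)
      then show "\<forall>\<^sub>F j in sequentially. qdist (Y j) (\<kappa> q k l) \<le> 2 * sqrt (cone_tensor (q k) l ((\<rho> (r j), \<theta> (r j)) - l))"
        by eventually_elim (use d(2) in \<open>simp add: Y_def qdist_commute\<close>)
      have "(\<lambda>j. 2 * sqrt (cone_tensor (q k) l ((\<rho> (r j), \<theta> (r j)) - l))) \<longlonglongrightarrow> 2 * sqrt (cone_tensor (q k) l (l - l))"
        unfolding cone_tensor_def by (intro tendsto_intros lim)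
      then show "(\<lambda>j. 2 * sqrt (cone_tensor (q k) l ((\<rho> (r j), \<theta> (r j)) - l))) \<longlonglongrightarrow> 0" by (simp add: cone_tensor_def)
    qed
    have "X = \<kappa> q k l" by (rule qdist_lim_unique[OF X(1) \<kappa>_in_surf[OF q e0 e(3) lD] Ys YX Yl])
    then show False using X(2) lD by (simp add: cone_nbhds_def)
  next
    case True
    have at: "filterlim (\<lambda>j. \<rho> (r j)) (at_right 0) sequentially"
      unfolding filterlim_at using \<rho>l True s(1) s(1)[THEN less_imp_neq, symmetric] by (auto intro!: always_eventually)
    have 1: "(\<lambda>j. qdist (apex q k) (\<kappa> q k (\<rho> (r j), 0))) \<longlonglongrightarrow> 0"
      using filterlim_compose[OF cone_apex[OF q, of k 0] at] .
    have 2: "(\<lambda>j. 2 * (sinh (\<rho> (r j)) / real (q k)) * (2 * pi)) \<longlonglongrightarrow> 2 * (sinh (fst l) / real (q k)) * (2 * pi)"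
      by (intro tendsto_intros \<rho>l) (use n in simp)
    have 3: "(\<lambda>j. qdist (apex q k) (\<kappa> q k (\<rho> (r j), 0)) + 2 * (sinh (\<rho> (r j)) / real (q k)) * (2 * pi)) \<longlonglongrightarrow> 0"
      using tendsto_add[OF 1 2] True by simp
    have Yl: "(\<lambda>j. qdist (Y j) (apex q k)) \<longlonglongrightarrow> 0"
    proof (rule tendsto_sandwich[OF _ _ tendsto_const 3])
      show "\<forall>\<^sub>F j in sequentially. 0 \<le> qdist (Y j) (apex q k)" using qdist_nonneg[OF Ys ap] by simp
      have "qdist (Y j) (apex q k) \<le> qdist (apex q k) (\<kappa> q k (\<rho> (r j), 0)) + 2 * (sinh (\<rho> (r j)) / real (q k)) * (2 * pi)" for j
      proof -
        have k0: "\<kappa> q k (\<rho> (r j), 0) \<in> surf (\<Gamma> q)" by (rule \<kappa>_in_surf[OF q e0 e(3) inD])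
        have "qdist (\<kappa> q k (\<rho> (r j), 0)) (Y j) \<le> 2 * (sinh (\<rho> (r j)) / real (q k)) * \<theta> (r j)"
          unfolding Y_def by (rule \<kappa>_circle[OF q e0 e(3) inD s(3)])
        also have "\<dots> \<le> 2 * (sinh (\<rho> (r j)) / real (q k)) * (2 * pi)"
          using s(1)[of "r j"] s(4)[of "r j"] by (intro mult_left_mono) auto
        finally show ?thesis using qdist_triangle[OF ap k0 Ys[of j]] qdist_commute[of "Y j" "apex q k"] by linarith
      qed
      then show "\<forall>\<^sub>F j in sequentially. qdist (Y j) (apex q k) \<le> qdist (apex q k) (\<kappa> q k (\<rho> (r j), 0)) + 2 * (sinh (\<rho> (r j)) / real (q k)) * (2 * pi)"
        by simp
    qed
    have "X = apex q k" by (rule qdist_lim_unique[OF X(1) ap Ys YX Yl])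
    then show False using Xap by simp
  qed
qed

lemma \<phi>_homeo:
  assumes "q \<in> Q" "0 < e" "e < 1 / 2"
  shows "homeomorphic_map (subtopology (surf_top \<Gamma>_inf) (thick e)) (subtopology (surf_top (\<Gamma> q)) (cone_compl q e)) (\<phi> q)"
  unfolding thick_def cone_compl_def by (rule identification[OF assms])

lemma topspace_thick: "topspace (subtopology (surf_top \<Gamma>_inf) (thick e)) = thick e"
  using fuchsian_group.topspace_surf_top[OF fg_inf] by (auto simp: thick_def)

lemma topspace_cone_compl: "q \<in> Q \<Longrightarrow> topspace (subtopology (surf_top (\<Gamma> q)) (cone_compl q e)) = cone_compl q e"
  using fuchsian_group.topspace_surf_top[OF fg] by (auto simp: cone_compl_def)

lemma \<phi>_image: assumes "q \<in> Q" "0 < e" "e < 1 / 2" shows "\<phi> q ` thick e = cone_compl q e"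
  using homeomorphic_imp_surjective_map[OF \<phi>_homeo[OF assms]]
  unfolding topspace_thick topspace_cone_compl[OF assms(1)] .

lemma \<phi>_in_surf: assumes "q \<in> Q" "X \<in> surf \<Gamma>_inf" shows "\<phi> q X \<in> surf (\<Gamma> q)"
proof -
  obtain e where e: "0 < e" "e < 1 / 2" "X \<in> thick e" using thick_exhaust[OF assms(2)] by blast
  then have "\<phi> q X \<in> cone_compl q e" using \<phi>_image[OF assms(1) e(1,2)] by blast
  then show ?thesis by (simp add: cone_compl_def)
qed

lemma inj_\<phi>: assumes q: "q \<in> Q" shows "inj_on (\<phi> q) (surf \<Gamma>_inf)"
proof (rule inj_onI)
  fix X Y assume h: "X \<in> surf \<Gamma>_inf" "Y \<in> surf \<Gamma>_inf" "\<phi> q X = \<phi> q Y"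
  obtain e where e: "0 < e" "e < 1 / 2" "X \<in> thick e" using thick_exhaust[OF h(1)] by blast
  obtain e' where e': "0 < e'" "e' < 1 / 2" "Y \<in> thick e'" using thick_exhaust[OF h(2)] by blast
  define m where "m = min e e'"
  have m: "0 < m" "m < 1 / 2" "m \<le> e" "m \<le> e'" using e e' by (auto simp: m_def)
  have XY: "X \<in> thick m" "Y \<in> thick m" using thick_antimono[OF m(1,3)] thick_antimono[OF m(1,4)] e e' by auto
  have "inj_on (\<phi> q) (thick m)" using homeomorphic_imp_injective_map[OF \<phi>_homeo[OF q m(1,2)]] unfolding topspace_thick .
  then show "X = Y" using XY h(3) by (auto dest: inj_onD)
qed

text \<open>The homeomorphism gives images that are open only relative to the complement of the
  cones. For a smaller \<epsilon> this complement is a neighbourhood of \<open>\<phi> q X\<close> by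
  \<open>cone_nbhds_separated\<close>, so the images are neighbourhoods in the whole
  surface.\<close>

lemma \<phi>_inv_cont:
  assumes q: "q \<in> Q" and X: "X \<in> surf \<Gamma>_inf" and e: "0 < e"
  shows "\<exists>r>0. \<forall>Y\<in>surf (\<Gamma> q). qdist (\<phi> q X) Y < r \<longrightarrow> (\<exists>Z\<in>surf \<Gamma>_inf. \<phi> q Z = Y \<and> qdist X Z < e)"
proof -
  interpret N: fuchsian_group \<Gamma>_inf by (rule fg_inf)
  interpret M: fuchsian_group "\<Gamma> q" by (rule fg[OF q])
  obtain \<epsilon> where \<epsilon>: "0 < \<epsilon>" "\<epsilon> < 1 / 2" "X \<in> thick \<epsilon>" using thick_exhaust[OF X] by blast
  define \<epsilon>' where "\<epsilon>' = \<epsilon> / 2"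
  have \<epsilon>': "0 < \<epsilon>'" "\<epsilon>' < \<epsilon>" "\<epsilon>' < 1 / 2" using \<epsilon> by (auto simp: \<epsilon>'_def)
  have pX: "\<phi> q X \<in> surf (\<Gamma> q)" by (rule \<phi>_in_surf[OF q X])
  have "\<phi> q X \<in> cone_compl q \<epsilon>" using \<phi>_image[OF q \<epsilon>(1,2)] \<epsilon>(3) by blast
  then have "\<phi> q X \<notin> cone_nbhds apex \<kappa> q \<epsilon> k" for k by (auto simp: cone_compl_def)
  then have "\<exists>r>0. \<forall>Y\<in>surf (\<Gamma> q). qdist (\<phi> q X) Y < r \<longrightarrow> Y \<notin> cone_nbhds apex \<kappa> q \<epsilon>' k" for k
    using cone_nbhds_separated[OF q \<epsilon>'(1,2) \<epsilon>(2) pX] by blast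
  then obtain r where r: "\<And>k. 0 < r k" "\<And>k Y. Y \<in> surf (\<Gamma> q) \<Longrightarrow> qdist (\<phi> q X) Y < r k \<Longrightarrow> Y \<notin> cone_nbhds apex \<kappa> q \<epsilon>' k"
    by metis
  define r1 where "r1 = Min (range r)"
  have r1: "0 < r1" "\<And>k. r1 \<le> r k" unfolding r1_def using r(1) by (subst Min_gr_iff) auto
  define U where "U = {Z \<in> thick \<epsilon>'. qdist X Z < e}"
  have "openin (surf_top \<Gamma>_inf) {Z \<in> surf \<Gamma>_inf. qdist X Z < e}"
    unfolding N.openin_surf_top
  proof (intro conjI ballI)
    fix Z assume Z: "Z \<in> {Z \<in> surf \<Gamma>_inf. qdist X Z < e}"
    show "\<exists>r>0. \<forall>Y\<in>surf \<Gamma>_inf. qdist Z Y < r \<longrightarrow> Y \<in> {Z \<in> surf \<Gamma>_inf. qdist X Z < e}"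
    proof (intro exI[of _ "e - qdist X Z"] conjI ballI impI)
      fix Y assume "Y \<in> surf \<Gamma>_inf" "qdist Z Y < e - qdist X Z"
      then show "Y \<in> {Z \<in> surf \<Gamma>_inf. qdist X Z < e}" using N.qdist_triangle[OF X _ , of Z Y] Z by auto
    qed (use Z in simp)
  qed auto
  moreover have "U = {Z \<in> surf \<Gamma>_inf. qdist X Z < e} \<inter> thick \<epsilon>'" by (auto simp: U_def thick_def)
  ultimately have "openin (subtopology (surf_top \<Gamma>_inf) (thick \<epsilon>')) U" unfolding openin_subtopology by blast
  then have "openin (subtopology (surf_top (\<Gamma> q)) (cone_compl q \<epsilon>')) (\<phi> q ` U)"
    using homeomorphic_imp_open_map[OF \<phi>_homeo[OF q \<epsilon>'(1,3)]] by (simp add: open_map_def)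
  then obtain O' where O': "openin (surf_top (\<Gamma> q)) O'" "\<phi> q ` U = O' \<inter> cone_compl q \<epsilon>'"
    unfolding openin_subtopology by blast
  have "X \<in> U" using subsetD[OF thick_antimono[OF \<epsilon>'(1) less_imp_le[OF \<epsilon>'(2)]] \<epsilon>(3)] X e by (auto simp: U_def)
  then have "\<phi> q X \<in> O'" using O'(2) by blast
  then obtain r2 where r2: "r2 > 0" "\<forall>Y\<in>surf (\<Gamma> q). qdist (\<phi> q X) Y < r2 \<longrightarrow> Y \<in> O'"
    using O'(1) unfolding M.openin_surf_top by blast
  show ?thesis
  proof (intro exI[of _ "min r1 r2"] conjI ballI impI)
    fix Y assume Y: "Y \<in> surf (\<Gamma> q)" "qdist (\<phi> q X) Y < min r1 r2"
    have "Y \<notin> cone_nbhds apex \<kappa> q \<epsilon>' k" for k using r(2)[OF Y(1), of k] r1(2)[of k] Y(2) by simp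
    then have "Y \<in> cone_compl q \<epsilon>'" using Y(1) by (auto simp: cone_compl_def)
    moreover have "Y \<in> O'" using r2(2) Y by simp
    ultimately have "Y \<in> \<phi> q ` U" using O'(2) by blast
    then show "\<exists>Z\<in>surf \<Gamma>_inf. \<phi> q Z = Y \<and> qdist X Z < e" by (auto simp: U_def thick_def)
  qed (use r1 r2 in simp)
qed

lemma eventually_near_isom:
  assumes p: "p \<in> surf \<Gamma>_inf" and \<delta>: "0 < \<delta>" "\<delta> \<le> 1 / 2" and R: "0 \<le> R"
  shows "\<forall>\<^sub>F q in orders_to_infinity Q. near_isom \<Gamma>_inf (\<Gamma> q) (\<phi> q) p R \<delta>"
proof -
  interpret N: fuchsian_group \<Gamma>_inf by (rule fg_inf)
  have "\<forall>\<^sub>F q in orders_to_infinity Q. q \<in> Q" unfolding eventually_orders_to_infinity by blast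
  \<comment> \<open>The radius \<open>7 * R\<close> is what the passage from local to global bounds
    requires for a conclusion on radius \<open>R\<close>.\<close>
  moreover have "\<forall>\<^sub>F q in orders_to_infinity Q. \<forall>X \<in> N.qcball p (7 * R). \<exists>r>0. \<forall>Y \<in> surf \<Gamma>_inf. \<forall>Z \<in> surf \<Gamma>_inf.
        qdist X Y < r \<longrightarrow> qdist X Z < r \<longrightarrow>
          (1 - \<delta>) * qdist Y Z \<le> qdist (\<phi> q Y) (\<phi> q Z) \<and>
          qdist (\<phi> q Y) (\<phi> q Z) \<le> (1 + \<delta>) * qdist Y Z"
    by (rule geometry[OF N.compactin_qcball[OF p] \<delta>(1)])
  ultimately show ?thesis
  proof eventually_elim
    case (elim q)
    interpret M: fuchsian_group "\<Gamma> q" by (rule fg[OF elim(1)])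
    interpret local_near_isom \<Gamma>_inf "\<Gamma> q" "\<phi> q" p "7 * R" \<delta>
    proof unfold_locales
      fix X assume "X \<in> surf \<Gamma>_inf" "qdist p X \<le> 7 * R"
      then have "X \<in> N.qcball p (7 * R)" by (simp add: N.qcball_def)
      then show "\<exists>r>0. \<forall>Y\<in>surf \<Gamma>_inf. \<forall>Z\<in>surf \<Gamma>_inf. qdist X Y < r \<longrightarrow> qdist X Z < r \<longrightarrow>
          (1 - \<delta>) * qdist Y Z \<le> qdist (\<phi> q Y) (\<phi> q Z) \<and> qdist (\<phi> q Y) (\<phi> q Z) \<le> (1 + \<delta>) * qdist Y Z"
        using elim(2) by blast
    qed (use p \<delta> \<phi>_in_surf[OF elim(1)] inj_\<phi>[OF elim(1)] \<phi>_inv_cont[OF elim(1)] in auto)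
    show ?case by (rule near_isom) (use R \<delta> in auto)
  qed
qed

end

section \<open>Isometries of the half-plane and their rigidity\<close>

definition hiso :: "(complex \<Rightarrow> complex) \<Rightarrow> bool" where
  "hiso A \<longleftrightarrow> bij_betw A upper upper \<and> (\<forall>z\<in>upper. \<forall>w\<in>upper. hdist (A z) (A w) = hdist z w)"

lemma hisoI:
  assumes "\<And>z. z \<in> upper \<Longrightarrow> A z \<in> upper" "\<And>z w. z \<in> upper \<Longrightarrow> w \<in> upper \<Longrightarrow> hdist (A z) (A w) = hdist z w"
    "\<And>w. w \<in> upper \<Longrightarrow> \<exists>z\<in>upper. A z = w"
  shows "hiso A"
proof -
  have "inj_on A upper"
  proof (rule inj_onI)
    fix z w assume zw: "z \<in> upper" "w \<in> upper" "A z = A w"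
    then have "hdist z w = 0" using assms(2)[OF zw(1,2)] by simp
    then show "z = w" using zw by simp
  qed
  then show ?thesis using assms unfolding hiso_def bij_betw_def by blast
qed

lemma hiso_upper: "hiso A \<Longrightarrow> z \<in> upper \<Longrightarrow> A z \<in> upper"
  by (auto simp: hiso_def dest: bij_betwE simp del: upper_iff)

lemma hiso_hdist: "hiso A \<Longrightarrow> z \<in> upper \<Longrightarrow> w \<in> upper \<Longrightarrow> hdist (A z) (A w) = hdist z w"
  by (simp add: hiso_def del: upper_iff)

lemma hiso_surj: assumes "hiso A" "w \<in> upper" obtains z where "z \<in> upper" "A z = w"
proof -
  have "w \<in> A ` upper" using assms unfolding hiso_def bij_betw_def by blast
  then show ?thesis using that by blast
qed

lemma hiso_compose: assumes "hiso A" "hiso B" shows "hiso (\<lambda>z. A (B z))"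
proof (rule hisoI)
  show "A (B z) \<in> upper" if "z \<in> upper" for z using that hiso_upper assms by blast
  show "hdist (A (B z)) (A (B w)) = hdist z w" if "z \<in> upper" "w \<in> upper" for z w
    using that hiso_hdist[OF assms(1)] hiso_hdist[OF assms(2)] hiso_upper[OF assms(2)] by simp
  fix w assume "w \<in> upper"
  then obtain z where z: "z \<in> upper" "A z = w" using hiso_surj[OF assms(1)] by blast
  then obtain y where "y \<in> upper" "B y = z" using hiso_surj[OF assms(2)] by blast
  then show "\<exists>z\<in>upper. A (B z) = w" using z by blast
qed

lemma hiso_inverse:
  assumes "hiso A"
  shows "\<exists>B. hiso B \<and> (\<forall>z\<in>upper. A (B z) = z) \<and> (\<forall>z\<in>upper. B (A z) = z)"
proof -
  define B where "B = inv_into upper A"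
  have b: "bij_betw A upper upper" using assms by (simp add: hiso_def)
  have AB: "A (B z) = z" if "z \<in> upper" for z
    using b that unfolding B_def by (simp add: bij_betw_def f_inv_into_f)
  have BA: "B (A z) = z" if "z \<in> upper" for z
    using b that unfolding B_def by (simp add: bij_betw_def inv_into_f_f)
  have Bu: "B z \<in> upper" if "z \<in> upper" for z
    using b that unfolding B_def by (metis bij_betw_def inv_into_into)
  have "hiso B"
  proof (rule hisoI)
    show "hdist (B z) (B w) = hdist z w" if "z \<in> upper" "w \<in> upper" for z w
      using hiso_hdist[OF assms Bu[OF that(1)] Bu[OF that(2)]] AB that by simp
    show "\<exists>z\<in>upper. B z = w" if "w \<in> upper" for w
      using BA[OF that] hiso_upper[OF assms that] by blast
  qed (rule Bu)
  then show ?thesis using AB BA by blast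
qed

lemma hiso_mob: assumes "g \<in> SL2" shows "hiso (mob g)"
proof (rule hisoI)
  show "\<exists>z\<in>upper. mob g z = w" if "w \<in> upper" for w
    using mob_minv(1)[OF assms that] mob_upper[OF minv_SL2[OF assms] that] by blast
qed (use mob_upper[OF assms] hdist_mob[OF assms] in auto)

text \<open>With the ball centred at \<i>, cosh of the distance from \<open>P\<close> to
  \<open>q\<close> is the Lorentz product of their coordinates. The choice \<open>q = \<i>\<close>
  determines \<open>hT P\<close>, and points in the directions 1 and \<i> determine the two
  coordinates of \<open>hX P\<close>.\<close>

lemma equidistant_imp_eq:
  assumes x: "x \<in> upper" "0 < s" and p: "p \<in> upper" "p' \<in> upper"
    and eq: "\<And>q. q \<in> upper \<Longrightarrow> hdist x q < s \<Longrightarrow> hdist p q = hdist p' q"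
  shows "p = p'"
proof -
  let ?g = "minv (aff x)"
  have g: "aff x \<in> SL2" "?g \<in> SL2" using x minv_SL2 by simp_all
  define P P' where "P = mob ?g p" and "P' = mob ?g p'"
  have PP: "P \<in> upper" "P' \<in> upper" using mob_upper[OF g(2)] p by (auto simp: P_def P'_def simp del: upper_iff)
  have iu: "\<i> \<in> upper" by simp
  have eq': "hT P * hT q - hX P \<bullet> hX q = hT P' * hT q - hX P' \<bullet> hX q" if q: "q \<in> upper" "hdist \<i> q < s" for q
  proof -
    have u: "mob (aff x) q \<in> upper" by (rule mob_upper[OF g(1) q(1)])
    have "hdist x (mob (aff x) q) = hdist \<i> q" using hdist_mob[OF g(1) iu q(1)] mob_aff_i[OF x(1)] by simp
    then have "hdist p (mob (aff x) q) = hdist p' (mob (aff x) q)" using eq[OF u] q(2) by simp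
    then have "hdist P q = hdist P' q"
      using hdist_mob[OF g(2) p(1) u] hdist_mob[OF g(2) p(2) u] mob_minv(2)[OF g(1) q(1)] by (simp add: P_def P'_def)
    then show ?thesis using cosh_hdist_hX[OF PP(1) q(1)] cosh_hdist_hX[OF PP(2) q(1)] by simp
  qed
  have T: "hT P = hT P'" using eq'[OF iu] x(2) by simp
  have "hX P \<bullet> u = hX P' \<bullet> u" if u: "cmod u = 1" for u
  proof -
    have "hdist \<i> (hpolar (s / 2) u) < s" using hdist_i_hpolar[OF u, of "s/2"] x(2) by simp
    then have "hX P \<bullet> hX (hpolar (s / 2) u) = hX P' \<bullet> hX (hpolar (s / 2) u)" using eq'[OF hpolar_upper] T by simp
    then have "hX P \<bullet> (sinh (s / 2) *\<^sub>R u) = hX P' \<bullet> (sinh (s / 2) *\<^sub>R u)" by (simp add: hpolar_def scaleR_conv_of_real)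
    then show ?thesis using x(2) by simp
  qed
  note u = this
  have "Re (hX P) = Re (hX P')" using u[of 1] by (simp add: inner_complex_def)
  moreover have "Im (hX P) = Im (hX P')" using u[of \<i>] by (simp add: inner_complex_def)
  ultimately have "hX P = hX P'" by (rule complex_eqI)
  then have "P = P'" using arg_cong[of "hX P" "hX P'" hpt] hpt_hX[OF PP(1)] hpt_hX[OF PP(2)] by metis
  then have "mob (aff x) (mob ?g p) = mob (aff x) (mob ?g p')" by (simp only: P_def P'_def)
  then show ?thesis using mob_minv(1)[OF g(1) p(1)] mob_minv(1)[OF g(1) p(2)] by metis
qed

text \<open>\<open>A\<close> and \<open>B\<close> have the same image of the ball, and
  \<open>A y\<close> and \<open>B y\<close> have the same distances to all its points.\<close>

lemma hiso_eq_of_eq_on_ball: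
  assumes A: "hiso A" "hiso B" and x: "x \<in> upper" "0 < s"
    and eq: "\<And>y. y \<in> upper \<Longrightarrow> hdist x y < s \<Longrightarrow> A y = B y" and y: "y \<in> upper"
  shows "A y = B y"
proof (rule equidistant_imp_eq[OF hiso_upper[OF A(1) x(1)] x(2) hiso_upper[OF A(1) y] hiso_upper[OF A(2) y]])
  fix q assume q: "q \<in> upper" "hdist (A x) q < s"
  obtain z where z: "z \<in> upper" "A z = q" using hiso_surj[OF A(1) q(1)] by blast
  have "hdist x z < s" using hiso_hdist[OF A(1) x(1) z(1)] z(2) q(2) by simp
  then have "A z = B z" using eq[OF z(1)] by simp
  then show "hdist (A y) q = hdist (B y) q"
    using hiso_hdist[OF A(1) y z(1)] hiso_hdist[OF A(2) y z(1)] z(2) by simp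
qed

lemma unit_eq_of_inner:
  fixes a b :: complex
  assumes "cmod a = 1" "cmod b = 1"
  shows "1 \<le> a \<bullet> b \<Longrightarrow> a = b"
proof -
  assume "1 \<le> a \<bullet> b"
  moreover have "a \<bullet> a = 1" "b \<bullet> b = 1" using assms by (simp_all add: dot_square_norm)
  ultimately have "(a - b) \<bullet> (a - b) \<le> 0" by (simp add: inner_diff_left inner_diff_right inner_commute)
  then have "(a - b) \<bullet> (a - b) = 0" using inner_ge_zero[of "a - b"] by linarith
  then show "a = b" by simp
qed

text \<open>A linear isometry of the space coordinate preserves \<open>hT\<close> and the Lorentz
  product. The orthonormal pair may have either orientation, so the isometries obtained here need
  not be Moebius maps, and \<open>hiso\<close> is a purely metric notion.\<close>

lemma orthogonal_hiso:
  assumes a: "cmod a = 1" "cmod b = 1" "a \<bullet> b = 0"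
  shows "hiso (\<lambda>q. hpt (Re (hX q) *\<^sub>R a + Im (hX q) *\<^sub>R b))"
proof -
  define L where "L X = Re X *\<^sub>R a + Im X *\<^sub>R b" for X
  have aa: "a \<bullet> a = 1" "b \<bullet> b = 1" "b \<bullet> a = 0" using a by (simp_all add: dot_square_norm inner_commute)
  have inn: "L X \<bullet> L Y = X \<bullet> Y" for X Y
    unfolding L_def inner_add_left inner_add_right inner_scaleR_left inner_scaleR_right aa a(3)
    by (simp add: inner_complex_def)
  have nL: "cmod (L X) = cmod X" for X using inn[of X X] by (simp add: norm_eq_sqrt_inner)
  have lin: "linear L" unfolding L_def by (rule linearI) (simp_all add: algebra_simps)
  have "inj L"
    using lin nL by (metis linear_injective_0 norm_eq_zero)
  then have surj: "surj L" by (rule linear_inj_imp_surj[OF lin])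
  have "hiso (\<lambda>q. hpt (L (hX q)))"
  proof (rule hisoI)
    fix z w assume zw: "z \<in> upper" "w \<in> upper"
    have "cosh (hdist (hpt (L (hX z))) (hpt (L (hX w)))) = cosh (hdist z w)"
      unfolding cosh_hdist_hX[OF hpt_upper hpt_upper] cosh_hdist_hX[OF zw] hX_hpt hT_hpt inn nL
      using hT_eq zw by simp
    then show "hdist (hpt (L (hX z))) (hpt (L (hX w))) = hdist z w"
      by (intro hdist_eqI hpt_upper hdist_nonneg zw)
  next
    fix w assume w: "w \<in> upper"
    obtain X where X: "L X = hX w" using surj by (metis surjD)
    then have "hpt (L (hX (hpt X))) = w" using w by simp
    then show "\<exists>z\<in>upper. hpt (L (hX z)) = w" using hpt_upper by blast
  qed (rule hpt_upper)
  then show ?thesis by (simp add: L_def)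
qed

text \<open>What is known about a limit of covering maps: it does not increase distances and has
  lifts at exact distance. The aim is \<open>global_isometry\<close>, by which such a map is the
  orbit projection up to an isometry of the half-plane.\<close>

locale submetry = fuchsian_group G for G +
  fixes J :: "complex \<Rightarrow> complex set"
  assumes J_surf: "\<And>w. w \<in> upper \<Longrightarrow> J w \<in> surf G"
    and J_Lip: "\<And>w w'. w \<in> upper \<Longrightarrow> w' \<in> upper \<Longrightarrow> qdist (J w) (J w') \<le> hdist w w'"
    and J_lift: "\<And>w X. w \<in> upper \<Longrightarrow> X \<in> surf G \<Longrightarrow> \<exists>w'\<in>upper. J w' = X \<and> hdist w w' = qdist (J w) X"

section \<open>Points with trivial stabiliser, and submetries as coverings\<close>

context fuchsian_group
begin

definition regular :: "complex \<Rightarrow> bool" where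
  "regular x \<longleftrightarrow> x \<in> upper \<and> (\<forall>\<gamma>\<in>\<Gamma>. \<gamma> x = x \<longrightarrow> (\<forall>z\<in>upper. \<gamma> z = z))"

text \<open>Let 4 s be the smallest displacement of \<open>x\<close> by an element that moves it,
  capped at 1. For two points within s of \<open>x\<close> such an element puts them at least 2 s
  apart, so it cannot improve on their distance; the elements that fix \<open>x\<close> act
  trivially.\<close>

lemma regular_isometric_ball:
  assumes "regular x"
  shows "\<exists>s>0. \<forall>y\<in>upper. \<forall>y'\<in>upper. hdist x y \<le> s \<longrightarrow> hdist x y' \<le> s \<longrightarrow>
    qdist (orb \<Gamma> y) (orb \<Gamma> y') = hdist y y'"
proof -
  have x: "x \<in> upper" using assms by (simp add: regular_def)
  define F where "F = {\<gamma> \<in> \<Gamma>. hdist x (\<gamma> x) \<le> 1 \<and> \<gamma> x \<noteq> x}"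
  have "F \<subseteq> {\<gamma> \<in> \<Gamma>. hdist x (\<gamma> x) \<le> 1}" by (auto simp: F_def)
  then have finF: "finite F" using finite_near[OF x x, of 1] by (rule finite_subset)
  define D where "D = insert 1 ((\<lambda>\<gamma>. hdist x (\<gamma> x)) ` F)"
  define s where "s = Min D / 4"
  have finD: "finite D" using finF by (simp add: D_def)
  have posD: "0 < d" if d: "d \<in> D" for d
  proof (cases "d = 1")
    case False
    then obtain \<gamma> where g: "\<gamma> \<in> F" "d = hdist x (\<gamma> x)" using d by (auto simp: D_def)
    then have gu: "\<gamma> x \<in> upper" "\<gamma> x \<noteq> x" using in_upper[OF _ x] by (auto simp: F_def simp del: upper_iff)
    then have "hdist x (\<gamma> x) \<noteq> 0" using hdist_eq_0_iff[OF x gu(1)] by simp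
    then show ?thesis using hdist_nonneg[OF x gu(1)] g(2) by simp
  qed simp
  have "Min D \<in> D" by (rule Min_in[OF finD]) (simp add: D_def)
  then have s: "0 < s" using posD by (simp add: s_def)
  have s1: "4 * s \<le> 1" unfolding s_def using Min_le[OF finD, of 1] by (simp add: D_def)
  have far: "4 * s \<le> hdist x (\<gamma> x)" if "\<gamma> \<in> \<Gamma>" "\<gamma> x \<noteq> x" for \<gamma>
  proof (cases "hdist x (\<gamma> x) \<le> 1")
    case True
    then have "hdist x (\<gamma> x) \<in> D" using that by (simp add: D_def F_def)
    then show ?thesis unfolding s_def using Min_le[OF finD] by simp
  next
    case False then show ?thesis using s1 by simp
  qed
  show ?thesis
  proof (intro exI[of _ s] conjI s ballI impI)
    fix y y' assume y: "y \<in> upper" "y' \<in> upper" "hdist x y \<le> s" "hdist x y' \<le> s"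
    obtain \<gamma> where g: "\<gamma> \<in> \<Gamma>" "qdist (orb \<Gamma> y) (orb \<Gamma> y') = hdist y (\<gamma> y')"
      using qdist_attained[OF y(1,2)] by blast
    have le: "qdist (orb \<Gamma> y) (orb \<Gamma> y') \<le> hdist y y'" by (rule qdist_le[OF y(1,2)])
    have yy: "hdist y y' \<le> 2 * s" using hdist_triangle[OF y(1) x y(2)] y(3,4) by (simp add: hdist_commute[of y x])
    show "qdist (orb \<Gamma> y) (orb \<Gamma> y') = hdist y y'"
    proof (cases "\<gamma> x = x")
      case True
      then have "\<gamma> y' = y'" using assms g(1) y(2) unfolding regular_def by blast
      then show ?thesis using g(2) by simp
    next
      case False
      have gu: "\<gamma> x \<in> upper" "\<gamma> y' \<in> upper" using in_upper[OF g(1)] x y by blast+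
      have "hdist x (\<gamma> x) \<le> hdist x y + hdist y (\<gamma> y') + hdist (\<gamma> y') (\<gamma> x)"
        using hdist_triangle[OF x y(1) gu(1)] hdist_triangle[OF y(1) gu(2,1)] by linarith
      also have "hdist (\<gamma> y') (\<gamma> x) = hdist x y'" using hdist_inv[OF g(1) y(2) x] by (simp add: hdist_commute)
      finally have "2 * s \<le> hdist y (\<gamma> y')" using far[OF g(1) False] y(3,4) by linarith
      then show ?thesis using le yy g(2) by simp
    qed
  qed
qed

text \<open>Fixed points are roots of a real quadratic. The sum of two different roots in the upper
  half-plane has positive imaginary part, which makes all coefficients vanish.\<close>

lemma fixed_point_unique:
  assumes "\<gamma> \<in> \<Gamma>" "y \<in> upper" "y' \<in> upper" "\<gamma> y = y" "\<gamma> y' = y'" "y \<noteq> y'" "z \<in> upper"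
  shows "\<gamma> z = z"
proof -
  obtain g where g: "g \<in> SL2" "\<And>z. z \<in> upper \<Longrightarrow> \<gamma> z = mob g z" by (rule mob_rep[OF assms(1)]) blast
  obtain a b c d where abcd: "g = (a, b, c, d)" by (cases g)
  have det: "a * d - b * c = 1" using g(1) by (simp add: abcd)
  have quad: "of_real c * u * u + (of_real d - of_real a) * u - of_real b = 0" if u: "u \<in> upper" "\<gamma> u = u" for u
  proof -
    have "mob (a, b, c, d) u = u" using g(2)[OF u(1)] u(2) abcd by simp
    moreover have "of_real c * u + of_real d \<noteq> (0::complex)" using mob_denom_nz[OF det] u(1) by simp
    ultimately have "of_real a * u + of_real b = u * (of_real c * u + of_real d)" by (simp add: field_simps)
    then show ?thesis by (simp add: algebra_simps)
  qed
  have "(y - y') * (of_real c * (y + y') + (of_real d - of_real a)) =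
      (of_real c * y * y + (of_real d - of_real a) * y - of_real b) - (of_real c * y' * y' + (of_real d - of_real a) * y' - of_real b)"
    by (simp add: algebra_simps)
  then have "(y - y') * (of_real c * (y + y') + (of_real d - of_real a)) = 0"
    using quad[OF assms(2,4)] quad[OF assms(3,5)] by simp
  then have e: "of_real c * (y + y') + (of_real d - of_real a) = 0" using assms(6) by simp
  then have "Im (of_real c * (y + y') + (of_real d - of_real a)) = 0" by simp
  then have "c * (Im y + Im y') = 0" by simp
  then have c: "c = 0" using assms(2,3) by simp
  then have da: "d = a" using e by simp
  then have b: "b = 0" using quad[OF assms(2,4)] c by simp
  have "a \<noteq> 0" using det c da by auto
  then show ?thesis using g(2)[OF assms(7)] by (simp add: abcd c da b)
qed

lemma countable_singular: "countable {y \<in> upper. \<not> regular y}"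
proof -
  have "{y \<in> upper. \<not> regular y} \<subseteq> (\<Union>\<gamma>\<in>\<Gamma>. {y \<in> upper. \<gamma> y = y \<and> (\<exists>z\<in>upper. \<gamma> z \<noteq> z)})"
    by (auto simp: regular_def simp del: upper_iff)
  moreover have "countable {y \<in> upper. \<gamma> y = y \<and> (\<exists>z\<in>upper. \<gamma> z \<noteq> z)}" (is "countable ?S") if "\<gamma> \<in> \<Gamma>" for \<gamma>
  proof (cases "?S = {}")
    case False
    then obtain y where y: "y \<in> ?S" by blast
    then have "?S \<subseteq> {y}" using fixed_point_unique[OF that] by blast
    then show ?thesis by (rule countable_subset) simp
  next
    case True
    then show ?thesis by (simp only: countable_empty)
  qed
  then have "countable (\<Union>\<gamma>\<in>\<Gamma>. {y \<in> upper. \<gamma> y = y \<and> (\<exists>z\<in>upper. \<gamma> z \<noteq> z)})"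
    by (intro countable_UN countable_group)
  ultimately show ?thesis by (rule countable_subset)
qed

end

lemma open_upper: "open upper"
  unfolding upper_def by (rule open_halfspace_Im_gt)

lemma open_hball: assumes "x \<in> upper" shows "open {y \<in> upper. hdist x y < e}"
proof -
  have "continuous_on upper (hdist x)"
    unfolding continuous_on_def
  proof
    fix y assume y: "y \<in> upper"
    show "(hdist x \<longlongrightarrow> hdist x y) (at y within upper)"
      by (rule tendsto_hdist[OF tendsto_const tendsto_ident_at assms y])
        (use assms in \<open>auto simp: eventually_at_filter\<close>)
  qed
  then have "open (upper \<inter> hdist x -` {..<e})"
    using open_upper by (intro continuous_open_preimage) auto
  moreover have "upper \<inter> hdist x -` {..<e} = {y \<in> upper. hdist x y < e}" by auto
  ultimately show ?thesis by simp
qed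

lemma upper_not_collinear: "\<not> collinear upper"
proof -
  have "upper \<noteq> {}" by (metis empty_iff hpt_upper)
  then show ?thesis by (simp add: collinear_aff_dim aff_dim_open[OF open_upper])
qed

lemma convex_upper: "convex upper"
  unfolding upper_def by (rule convex_halfspace_Im_gt)

context fuchsian_group
begin

lemma regular_dense:
  assumes "x \<in> upper" "0 < e"
  obtains y where "regular y" "hdist x y < e"
proof -
  have "open {y \<in> upper. hdist x y < e}" by (rule open_hball[OF assms(1)])
  moreover have "{y \<in> upper. hdist x y < e} \<noteq> {}" using assms hdist_self[of x] by (metis (mono_tags, lifting) empty_iff mem_Collect_eq)
  ultimately have "uncountable {y \<in> upper. hdist x y < e}"
    by (meson countable_subset open_contains_ball ex_in_conv uncountable_ball)
  then have "\<not> {y \<in> upper. hdist x y < e} \<subseteq> {y \<in> upper. \<not> regular y}"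
    using countable_singular countable_subset by blast
  then show ?thesis using that by blast
qed

text \<open>A convex planar set remains connected when countably many points are removed; so charts
  at regular points can be continued from one to another.\<close>

lemma regular_connected: "connected {y. regular y}"
proof -
  have "{y. regular y} = upper - {y \<in> upper. \<not> regular y}" by (auto simp: regular_def simp del: upper_iff)
  then show ?thesis
    using connected_convex_diff_countable[OF convex_upper upper_not_collinear countable_singular] by simp
qed

end

context submetry
begin

text \<open>Around a regular point the horizontal lifts of the geodesics through it form an isometric copy
  of a ball: lifting increases the angles between directions, and also those with the opposite
  directions, so it preserves them.\<close>

lemma local_isometry:
  assumes reg: "regular x" and s: "0 < s"
    and inj: "\<And>y y'. y \<in> upper \<Longrightarrow> y' \<in> upper \<Longrightarrow> hdist x y \<le> s \<Longrightarrow> hdist x y' \<le> s \<Longrightarrow>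
      qdist (orb G y) (orb G y') = hdist y y'"
    and w: "w \<in> upper" "J w = orb G x"
  shows "\<exists>A. hiso A \<and> A x = w \<and> (\<forall>y\<in>upper. hdist x y < s \<longrightarrow> J (A y) = orb G y)"
proof -
  have x: "x \<in> upper" using reg by (simp add: regular_def)
  have ax: "aff x \<in> SL2" "aff w \<in> SL2" using x w by auto
  define Y where "Y r v = mob (aff x) (hpolar r v)" for r v
  define W where "W r v = mob (aff w) (hpolar r v)" for r v
  have YW: "Y r v \<in> upper" "W r v \<in> upper" for r v
    unfolding Y_def W_def using mob_upper[OF ax(1) hpolar_upper] mob_upper[OF ax(2) hpolar_upper] by blast+
  have dY: "hdist (Y r v) (Y r' v') = hdist (hpolar r v) (hpolar r' v')" for r v r' v'
    unfolding Y_def by (rule hdist_mob[OF ax(1) hpolar_upper hpolar_upper])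
  have dW: "hdist (W r v) (W r' v') = hdist (hpolar r v) (hpolar r' v')" for r v r' v'
    unfolding W_def by (rule hdist_mob[OF ax(2) hpolar_upper hpolar_upper])
  have Y0: "Y 0 v = x" "W 0 v = w" for v unfolding Y_def W_def hpolar_0 using mob_aff_i x w by auto
  have dx: "hdist x (Y r v) = r" if "cmod v = 1" "0 \<le> r" for r v
    using dY[of 0 v r v] hdist_i_hpolar[OF that] by (simp add: Y0)
  \<comment> \<open>The lift of \<open>Y r v\<close> at exact distance r from \<open>w\<close> is
    again written in polar coordinates about \<open>w\<close>; its direction will be called
    \<open>U r v\<close>.\<close>
  have "\<exists>u. cmod u = 1 \<and> J (W r u) = orb G (Y r v)" if v: "cmod v = 1" "0 \<le> r" "r \<le> s" for r v
  proof -
    obtain p where p: "p \<in> upper" "J p = orb G (Y r v)" "hdist w p = qdist (J w) (orb G (Y r v))"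
      using J_lift[OF w(1) orb_in_surf[OF YW(1)]] by blast
    have "qdist (orb G x) (orb G (Y r v)) = r" using inj[OF x YW(1)] dx[OF v(1,2)] v s by simp
    then have dp: "hdist w p = r" using p(3) w(2) by simp
    define p0 where "p0 = mob (minv (aff w)) p"
    have p0: "p0 \<in> upper" "mob (aff w) p0 = p"
      using mob_upper[OF minv_SL2[OF ax(2)] p(1)] mob_minv(1)[OF ax(2) p(1)] by (auto simp: p0_def)
    have "hdist \<i> p0 = hdist (mob (aff w) \<i>) (mob (aff w) p0)" by (rule hdist_mob[symmetric, OF ax(2) _ p0(1)]) simp
    then have "hdist \<i> p0 = r" using p0(2) mob_aff_i[OF w(1)] dp by simp
    then obtain u where "cmod u = 1" "p0 = hpolar r u" using hpolar_exists[OF p0(1)] by blast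
    then show ?thesis using p p0 by (auto simp: W_def)
  qed
  note ex = this
  define U where "U r v = (SOME u. cmod u = 1 \<and> J (W r u) = orb G (Y r v))" for r v
  have U: "\<And>r v. cmod v = 1 \<Longrightarrow> 0 \<le> r \<Longrightarrow> r \<le> s \<Longrightarrow> cmod (U r v) = 1"
      "\<And>r v. cmod v = 1 \<Longrightarrow> 0 \<le> r \<Longrightarrow> r \<le> s \<Longrightarrow> J (W r (U r v)) = orb G (Y r v)"
    unfolding U_def using someI_ex[OF ex] by simp_all
  have expand: "U r v \<bullet> U r' v' \<le> v \<bullet> v'"
    if v: "cmod v = 1" "cmod v' = 1" "0 < r" "r \<le> s" "0 < r'" "r' \<le> s" for r v r' v'
  proof -
    note a = U(1)[OF v(1) less_imp_le[OF v(3)] v(4)] U(1)[OF v(2) less_imp_le[OF v(5)] v(6)]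
    note b = U(2)[OF v(1) less_imp_le[OF v(3)] v(4)] U(2)[OF v(2) less_imp_le[OF v(5)] v(6)]
    have "hdist (Y r v) (Y r' v') = qdist (orb G (Y r v)) (orb G (Y r' v'))"
      using inj[OF YW(1) YW(1)] dx v by simp
    also have "\<dots> \<le> hdist (W r (U r v)) (W r' (U r' v'))" using J_Lip[OF YW(2) YW(2)] b by metis
    finally have "hdist (hpolar r v) (hpolar r' v') \<le> hdist (hpolar r (U r v)) (hpolar r' (U r' v'))"
      unfolding dY dW .
    then have "cosh (hdist (hpolar r v) (hpolar r' v')) \<le> cosh (hdist (hpolar r (U r v)) (hpolar r' (U r' v')))"
      by (subst cosh_le_iff_nonneg) auto
    then have "(sinh r * sinh r') * (U r v \<bullet> U r' v') \<le> (sinh r * sinh r') * (v \<bullet> v')"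
      unfolding cosh_hdist_hpolar[OF v(1,2)] cosh_hdist_hpolar[OF a] by simp
    moreover have "0 < sinh r * sinh r'" using v by simp
    ultimately show ?thesis by (metis mult_le_cancel_left_pos)
  qed
  \<comment> \<open>The lifts of opposite directions have inner product at most -1 and are therefore
    opposite. Applying \<open>expand\<close> to \<open>- v'\<close> then gives the reverse
    inequality.\<close>
  have opp: "U r (- v) = - U r' v" if v: "cmod v = 1" "0 < r" "r \<le> s" "0 < r'" "r' \<le> s" for r v r'
  proof (rule unit_eq_of_inner)
    have "U r (- v) \<bullet> U r' v \<le> (- v) \<bullet> v" using v by (intro expand) auto
    also have "\<dots> = -1" using v by (simp add: dot_square_norm)
    finally show "1 \<le> U r (- v) \<bullet> - U r' v" by simp
  qed (use U(1) v in auto)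
  have pres: "U r v \<bullet> U r' v' = v \<bullet> v'"
    if v: "cmod v = 1" "cmod v' = 1" "0 < r" "r \<le> s" "0 < r'" "r' \<le> s" for r v r' v'
  proof (rule antisym[OF expand[OF v]])
    have "U r v \<bullet> U r' (- v') \<le> v \<bullet> (- v')" using v by (intro expand) auto
    then show "v \<bullet> v' \<le> U r v \<bullet> U r' v'" using opp[OF v(2,5,6,5,6)] by simp
  qed
  \<comment> \<open>Equality of inner products for one direction at two radii shows that the lifted
    direction does not depend on the radius, so one linear isometry describes all lifts.\<close>
  have const: "U r v = U s v" if v: "cmod v = 1" "0 < r" "r \<le> s" for r v
    using pres[OF v(1) v(1) v(2,3) s order_refl] v U(1) s
    by (intro unit_eq_of_inner) (auto simp: dot_square_norm)
  define a b where "a = U s 1" and "b = U s \<i>"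
  have ab: "cmod a = 1" "cmod b = 1" "a \<bullet> b = 0"
    using U(1)[of 1 s] U(1)[of \<i> s] pres[of 1 \<i> s s] s by (auto simp: a_def b_def inner_complex_def)
  have lin: "U s v = Re v *\<^sub>R a + Im v *\<^sub>R b" if v: "cmod v = 1" for v
  proof (rule unit_eq_of_inner)
    have "U s v \<bullet> a = Re v" "U s v \<bullet> b = Im v"
      using pres[OF v _ s order_refl s order_refl, of 1] pres[OF v _ s order_refl s order_refl, of \<i>]
      by (auto simp: a_def b_def inner_complex_def)
    then have "U s v \<bullet> (Re v *\<^sub>R a + Im v *\<^sub>R b) = (Re v)\<^sup>2 + (Im v)\<^sup>2"
      by (simp add: inner_add_right power2_eq_square)
    also have "\<dots> = 1" using v by (metis cmod_power2 one_power2)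
    finally show "1 \<le> U s v \<bullet> (Re v *\<^sub>R a + Im v *\<^sub>R b)" by simp
    have "(Re v *\<^sub>R a + Im v *\<^sub>R b) \<bullet> (Re v *\<^sub>R a + Im v *\<^sub>R b) = (Re v)\<^sup>2 * (a \<bullet> a) + (Im v)\<^sup>2 * (b \<bullet> b) + 2 * Re v * Im v * (a \<bullet> b)"
      by (simp add: inner_add_left inner_add_right inner_commute power2_eq_square algebra_simps)
    also have "\<dots> = 1" using ab v cmod_power2[of v] by (simp add: dot_square_norm)
    finally show "cmod (Re v *\<^sub>R a + Im v *\<^sub>R b) = 1" by (simp add: norm_eq_sqrt_inner)
  qed (use U(1) v s in auto)
  define A0 where "A0 q = hpt (Re (hX q) *\<^sub>R a + Im (hX q) *\<^sub>R b)" for q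
  have A0: "hiso A0" using orthogonal_hiso[OF ab] by (simp add: A0_def[abs_def])
  have A0p: "A0 (hpolar r v) = hpolar r (Re v *\<^sub>R a + Im v *\<^sub>R b)" for r v
    by (simp add: A0_def hpolar_def algebra_simps scaleR_conv_of_real)
  define A where "A y = mob (aff w) (A0 (mob (minv (aff x)) y))" for y
  have mi: "mob (minv (aff x)) x = \<i>" using mob_minv(2)[OF ax(1), of \<i>] mob_aff_i[OF x] by simp
  show ?thesis
  proof (intro exI[of _ A] conjI ballI impI)
    show "hiso A" unfolding A_def
      by (rule hiso_compose[OF hiso_mob[OF ax(2)] hiso_compose[OF A0 hiso_mob[OF minv_SL2[OF ax(1)]]]])
    show Ax: "A x = w" unfolding A_def mi using A0p[of 0 1] mob_aff_i[OF w(1)] by simp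
    fix y assume y: "y \<in> upper" "hdist x y < s"
    define q where "q = mob (minv (aff x)) y"
    have q: "q \<in> upper" "mob (aff x) q = y"
      using mob_upper[OF minv_SL2[OF ax(1)] y(1)] mob_minv(1)[OF ax(1) y(1)] by (auto simp: q_def)
    have dq: "hdist \<i> q = hdist x y"
      using hdist_mob[OF minv_SL2[OF ax(1)] x y(1)] mi by (simp add: q_def)
    obtain v where v: "cmod v = 1" "q = hpolar (hdist x y) v" using hpolar_exists[OF q(1)] unfolding dq by blast
    show "J (A y) = orb G y"
    proof (cases "hdist x y = 0")
      case True
      then have "y = x" using x y by simp
      then show ?thesis using Ax w by simp
    next
      case False
      then have r: "0 < hdist x y" using hdist_nonneg[OF x y(1)] by simp
      have "A y = W (hdist x y) (U (hdist x y) v)"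
        unfolding A_def q_def[symmetric] v(2) A0p W_def using const[OF v(1) r] lin[OF v(1)] y(2) v(2) by simp
      moreover have "y = Y (hdist x y) v" using q(2) v(2) by (simp add: Y_def)
      ultimately show ?thesis using U(2)[OF v(1), of "hdist x y"] r y(2) by simp
    qed
  qed
qed

text \<open>A local chart A at one regular point is rigid, and the relation between J, A and the
  orbits is continued over the connected set of regular points. The remaining points follow by
  density and the Lipschitz bound.\<close>

lemma global_isometry: "\<exists>A. hiso A \<and> (\<forall>y\<in>upper. J (A y) = orb G y)"
proof -
  obtain x0 where x0: "regular x0" using regular_dense[of \<i> 1] by auto
  then have x0u: "x0 \<in> upper" by (simp add: regular_def)
  obtain w0 where w0: "w0 \<in> upper" "J w0 = orb G x0" using J_lift[of \<i> "orb G x0"] x0u by auto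
  obtain s0 where s0: "0 < s0" "\<And>y y'. y \<in> upper \<Longrightarrow> y' \<in> upper \<Longrightarrow> hdist x0 y \<le> s0 \<Longrightarrow> hdist x0 y' \<le> s0 \<Longrightarrow>
    qdist (orb G y) (orb G y') = hdist y y'" using regular_isometric_ball[OF x0] by auto
  obtain A where A: "hiso A" "A x0 = w0" "\<And>y. y \<in> upper \<Longrightarrow> hdist x0 y < s0 \<Longrightarrow> J (A y) = orb G y"
    using local_isometry[OF x0 s0 w0] by auto
  define P where "P y \<longleftrightarrow> (\<exists>s>0. \<forall>y'\<in>upper. hdist y y' < s \<longrightarrow> J (A y') = orb G y')" for y
  have "P y" if "regular y" for y
  proof (rule connected_induction_simple[OF regular_connected, of x0 y P])
    show "P x0" unfolding P_def using A(3) s0(1) by blast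
    fix a assume "a \<in> {y. regular y}"
    then have ra: "regular a" by simp
    then have a: "a \<in> upper" by (simp add: regular_def)
    obtain s where s: "0 < s" "\<And>y y'. y \<in> upper \<Longrightarrow> y' \<in> upper \<Longrightarrow> hdist a y \<le> s \<Longrightarrow> hdist a y' \<le> s \<Longrightarrow>
      qdist (orb G y) (orb G y') = hdist y y'" using regular_isometric_ball[OF ra] by auto
    have orb_inj: "y = y'" if "y \<in> upper" "y' \<in> upper" "hdist a y \<le> s" "hdist a y' \<le> s" "orb G y = orb G y'" for y y'
    proof -
      have "hdist y y' = 0" using s(2)[OF that(1-4)] that(5) qdist_self[OF orb_in_surf[OF that(2)]] by simp
      then show ?thesis using that by simp
    qed
    define T where "T = {y. regular y} \<inter> {y \<in> upper. hdist a y < s / 4}"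
    show "\<exists>T. openin (top_of_set {y. regular y}) T \<and> a \<in> T \<and> (\<forall>x\<in>T. \<forall>y\<in>T. P x \<longrightarrow> P y)"
    proof (intro exI[of _ T] conjI ballI impI)
      show "openin (top_of_set {y. regular y}) T" unfolding T_def by (rule openin_open_Int[OF open_hball[OF a]])
      show "a \<in> T" using ra a s(1) by (simp add: T_def)
      fix x y assume x: "x \<in> T" and y: "y \<in> T" and Px: "P x"
      have xu: "x \<in> upper" "hdist a x < s / 4" using x by (auto simp: T_def simp del: upper_iff)
      obtain t where t: "t > 0" "\<And>y'. y' \<in> upper \<Longrightarrow> hdist x y' < t \<Longrightarrow> J (A y') = orb G y'" using Px unfolding P_def by blast
      have Ax: "A x \<in> upper" by (rule hiso_upper[OF A(1) xu(1)])
      have JAx: "J (A x) = orb G x" using t xu by simp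
      \<comment> \<open>The chart at \<open>a\<close> is based at a lift of \<open>a\<close> at
        exact distance from \<open>A x\<close>, so that \<open>A x\<close> lies well inside the
        image of the ball about \<open>a\<close>.\<close>
      obtain w where w: "w \<in> upper" "J w = orb G a" "hdist (A x) w = qdist (orb G x) (orb G a)"
        using J_lift[OF Ax orb_in_surf[OF a]] JAx by auto
      have dw: "hdist (A x) w < s / 4" using w(3) s(2)[OF xu(1) a] xu s(1) by (simp add: hdist_commute)
      obtain A' where A': "hiso A'" "A' a = w" "\<And>y. y \<in> upper \<Longrightarrow> hdist a y < s \<Longrightarrow> J (A' y) = orb G y"
        using local_isometry[OF ra s w(1,2)] by auto
      \<comment> \<open>Near \<open>x\<close> both maps are lifts of the orbit projection, and
        orbits are distinguished inside the ball about \<open>a\<close>. So they agree near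
        \<open>x\<close>, and by rigidity everywhere.\<close>
      have near: "A x' = A' x'" if x': "x' \<in> upper" "hdist x x' < min t (s / 4)" for x'
      proof -
        have Ax': "A x' \<in> upper" by (rule hiso_upper[OF A(1) x'(1)])
        obtain x'' where x'': "x'' \<in> upper" "A' x'' = A x'" using hiso_surj[OF A'(1) Ax'] by blast
        have "hdist a x'' = hdist w (A x')" using hiso_hdist[OF A'(1) a x''(1)] x''(2) A'(2) by simp
        also have "\<dots> \<le> hdist w (A x) + hdist (A x) (A x')" by (rule hdist_triangle[OF w(1) Ax Ax'])
        also have "\<dots> < s / 4 + s / 4" using dw x'(2) hiso_hdist[OF A(1) xu(1) x'(1)] by (simp add: hdist_commute)
        finally have d'': "hdist a x'' < s" using s(1) by simp
        have d': "hdist a x' < s" using hdist_triangle[OF a xu(1) x'(1)] xu(2) x'(2) s(1) by simp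
        have "orb G x'' = J (A x')" using A'(3)[OF x''(1) d''] x''(2) by simp
        also have "\<dots> = orb G x'" using t(2) x' by simp
        finally have "x'' = x'" using d' d'' x' x'' by (intro orb_inj) auto
        then show ?thesis using x''(2) by simp
      qed
      have "A z = A' z" if "z \<in> upper" for z
        by (rule hiso_eq_of_eq_on_ball[where s = "min t (s / 4)", OF A(1) A'(1) xu(1) _ near that]) (use t s in auto)
      then have on_ball: "J (A y') = orb G y'" if "y' \<in> upper" "hdist a y' < s" for y' using A'(3) that by simp
      have yu: "y \<in> upper" "hdist a y < s / 4" using y by (auto simp: T_def simp del: upper_iff)
      have "J (A y') = orb G y'" if "y' \<in> upper" "hdist y y' < s / 4" for y'
        using hdist_triangle[OF a yu(1) that(1)] yu(2) that s(1) by (intro on_ball) auto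
      then show "P y" unfolding P_def using s(1) by (intro exI[of _ "s / 4"]) auto
    qed
  qed (simp_all add: x0 that)
  note reg0 = this
  have reg: "J (A y) = orb G y" if y: "regular y" for y
  proof -
    have yu: "y \<in> upper" using y by (simp add: regular_def)
    obtain s where "s > 0" "\<forall>y'\<in>upper. hdist y y' < s \<longrightarrow> J (A y') = orb G y'"
      using reg0[OF y] unfolding P_def by blast
    then show ?thesis using yu by simp
  qed
  have "J (A y) = orb G y" if y: "y \<in> upper" for y
  proof -
    have Ay: "A y \<in> upper" by (rule hiso_upper[OF A(1) y])
    have "qdist (J (A y)) (orb G y) \<le> 0 + e" if e: "0 < e" for e
    proof -
      obtain y' where y': "regular y'" "hdist y y' < e / 2" using regular_dense[OF y, of "e / 2"] e by auto
      then have yu: "y' \<in> upper" by (simp add: regular_def)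
      have "qdist (J (A y)) (orb G y) \<le> qdist (J (A y)) (J (A y')) + qdist (J (A y')) (orb G y)"
        by (intro qdist_triangle J_surf orb_in_surf y hiso_upper[OF A(1)] yu)
      also have "qdist (J (A y)) (J (A y')) \<le> hdist y y'"
        using J_Lip[OF Ay hiso_upper[OF A(1) yu]] hiso_hdist[OF A(1) y yu] by simp
      also have "qdist (J (A y')) (orb G y) \<le> hdist y y'"
        using reg[OF y'(1)] qdist_le[OF yu y] by (simp add: hdist_commute)
      finally show ?thesis using y'(2) by simp
    qed
    then have "qdist (J (A y)) (orb G y) \<le> 0" by (rule field_le_epsilon)
    then have "qdist (J (A y)) (orb G y) = 0" using qdist_nonneg[OF J_surf[OF Ay] orb_in_surf[OF y]] by simp
    then show ?thesis using qdist_eq_0[OF J_surf[OF Ay] orb_in_surf[OF y]] by simp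
  qed
  then show ?thesis using A(1) by blast
qed

end

context fuchsian_group
begin

text \<open>Compose \<open>B\<close> with a group element that brings \<open>B x\<close> back to a
  regular point \<open>x\<close>. The result fixes \<open>x\<close> and preserves orbits, hence
  fixes an isometric ball about \<open>x\<close> pointwise, and is the identity by rigidity.\<close>

lemma orbit_preserving_in_group:
  assumes B: "hiso B" "\<And>y. y \<in> upper \<Longrightarrow> orb \<Gamma> (B y) = orb \<Gamma> y"
  shows "\<exists>\<gamma>\<in>\<Gamma>. \<forall>y\<in>upper. B y = \<gamma> y"
proof -
  obtain x where x: "regular x" using regular_dense[of \<i> 1] by auto
  then have xu: "x \<in> upper" by (simp add: regular_def)
  obtain s where s: "0 < s" "\<And>y y'. y \<in> upper \<Longrightarrow> y' \<in> upper \<Longrightarrow> hdist x y \<le> s \<Longrightarrow> hdist x y' \<le> s \<Longrightarrow>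
    qdist (orb \<Gamma> y) (orb \<Gamma> y') = hdist y y'" using regular_isometric_ball[OF x] by auto
  have "B x \<in> orb \<Gamma> x" using orb_self[OF hiso_upper[OF B(1) xu]] B(2)[OF xu] by simp
  then obtain \<gamma> where g: "\<gamma> \<in> \<Gamma>" "B x = \<gamma> x" by (auto simp: orb_def)
  obtain m where m: "m \<in> SL2" "\<And>z. z \<in> upper \<Longrightarrow> ginv \<gamma> z = mob m z" by (rule mob_rep[OF ginv_in[OF g(1)]]) blast
  define C where "C y = mob m (B y)" for y
  have C: "hiso C" unfolding C_def by (rule hiso_compose[OF hiso_mob[OF m(1)] B(1)])
  have Ceq: "C y = ginv \<gamma> (B y)" if "y \<in> upper" for y using m(2)[OF hiso_upper[OF B(1) that]] by (simp add: C_def)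
  have Cx: "C x = x" using Ceq[OF xu] g ginv_left[OF g(1) xu] by simp
  have Corb: "orb \<Gamma> (C y) = orb \<Gamma> y" if "y \<in> upper" for y
    using Ceq[OF that] orb_apply[OF ginv_in[OF g(1)] hiso_upper[OF B(1) that]] B(2)[OF that] by simp
  have id: "hiso (\<lambda>y. y)" by (rule hisoI) auto
  have "C y = y" if y: "y \<in> upper" for y
  proof (rule hiso_eq_of_eq_on_ball[OF C id xu s(1) _ y])
    fix z assume z: "z \<in> upper" "hdist x z < s"
    have Cz: "C z \<in> upper" by (rule hiso_upper[OF C z(1)])
    have "hdist x (C z) = hdist x z" using hiso_hdist[OF C xu z(1)] Cx by simp
    then have "hdist (C z) z = qdist (orb \<Gamma> (C z)) (orb \<Gamma> z)" using s(2)[OF Cz z(1)] z(2) by simp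
    also have "\<dots> = 0" using Corb[OF z(1)] z(1) by simp
    finally show "C z = z" using Cz z(1) by simp
  qed
  then have "B y = \<gamma> y" if "y \<in> upper" for y
    using Ceq[OF that] ginv_right[OF g(1) hiso_upper[OF B(1) that]] that by simp
  then show ?thesis using g(1) by blast
qed

end

section \<open>Limits of the developing maps\<close>

lemma tendsto_of_ratio:
  fixes a b :: "nat \<Rightarrow> real"
  assumes lim: "a \<longlonglongrightarrow> l" and nn: "\<And>j. 0 \<le> a j"
    and ev: "\<And>\<delta>. 0 < \<delta> \<Longrightarrow> \<delta> \<le> 1 / 2 \<Longrightarrow> \<forall>\<^sub>F j in sequentially. (1 - \<delta>) * a j \<le> b j \<and> b j \<le> (1 + \<delta>) * a j"
  shows "b \<longlonglongrightarrow> l"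
proof (rule tendstoI)
  fix e :: real assume e: "0 < e"
  have l: "0 \<le> l" by (rule LIMSEQ_le_const[OF lim]) (use nn in auto)
  define \<delta> where "\<delta> = min (1 / 2) (e / (2 * (l + 1)))"
  have \<delta>1: "0 < \<delta>" using e l by (simp add: \<delta>_def)
  have \<delta>2: "\<delta> \<le> 1 / 2" unfolding \<delta>_def by (rule min.cobounded1)
  note \<delta> = \<delta>1 \<delta>2
  have \<delta>e: "\<delta> * (l + 1) \<le> e / 2"
  proof -
    have "\<delta> * (l + 1) \<le> e / (2 * (l + 1)) * (l + 1)" using l by (intro mult_right_mono) (auto simp: \<delta>_def)
    also have "\<dots> = e / 2" using l by (simp add: divide_simps)
    finally show ?thesis .
  qed
  have "\<forall>\<^sub>F j in sequentially. dist (a j) l < min 1 (e / 2)" by (rule tendstoD[OF lim]) (use e in simp)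
  with ev[OF \<delta>] show "\<forall>\<^sub>F j in sequentially. dist (b j) l < e"
  proof eventually_elim
    case (elim j)
    then have 1: "a j < l + 1" "\<bar>a j - l\<bar> < e / 2" by (auto simp: dist_real_def)
    have "\<delta> * a j \<le> \<delta> * (l + 1)" using 1 \<delta> by (intro mult_left_mono) auto
    moreover have "b j - a j \<le> \<delta> * a j" "a j - b j \<le> \<delta> * a j" using elim by (auto simp: algebra_simps)
    ultimately have "\<bar>b j - a j\<bar> \<le> e / 2" using \<delta>e by linarith
    then show ?case using 1 unfolding dist_real_def by linarith
  qed
qed

text \<open>The covering of the quotient by the half-plane, normalised so that \<i> lies over
  \<open>X\<close>.\<close>

definition dev_orb :: "(complex \<Rightarrow> complex) set \<Rightarrow> complex set \<Rightarrow> complex \<Rightarrow> complex set" where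
  "dev_orb H X w = orb H (mob (aff (lift_pt X)) w)"

definition dev_back :: "(complex \<Rightarrow> complex) set \<Rightarrow> (complex \<Rightarrow> complex) set \<Rightarrow> (complex set \<Rightarrow> complex set) \<Rightarrow> complex set \<Rightarrow> complex \<Rightarrow> complex set" where
  "dev_back G H \<phi> p w =
    (if \<exists>Z\<in>surf G. \<phi> Z = dev_orb H (\<phi> p) w \<and> qdist p Z \<le> 2 * hdist \<i> w
     then SOME Z. Z \<in> surf G \<and> \<phi> Z = dev_orb H (\<phi> p) w \<and> qdist p Z \<le> 2 * hdist \<i> w else p)"

locale near_isom_seq = N: fuchsian_group G for G +
  fixes H :: "nat \<Rightarrow> (complex \<Rightarrow> complex) set" and \<phi> :: "nat \<Rightarrow> complex set \<Rightarrow> complex set" and p :: "complex set"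
  assumes p: "p \<in> surf G"
    and fH: "\<And>j. fuchsian_group (H j)"
    and maps: "\<And>j X. X \<in> surf G \<Longrightarrow> \<phi> j X \<in> surf (H j)"
    and near: "\<And>\<delta> R. 0 < \<delta> \<Longrightarrow> \<delta> \<le> 1 / 2 \<Longrightarrow> 0 \<le> R \<Longrightarrow> \<forall>\<^sub>F j in sequentially. near_isom G (H j) (\<phi> j) p R \<delta>"
begin

abbreviation "P j w \<equiv> dev_orb (H j) (\<phi> j p) w"
abbreviation "Z j w \<equiv> dev_back G (H j) (\<phi> j) p w"
text \<open>The surface determines its group only up to conjugation. The map \<open>frame\<close>
  below selects the conjugate in which \<i> lies over \<open>\<phi> j p\<close>.\<close>

definition "c j = lift_pt (\<phi> j p)"

abbreviation "frame j \<equiv> mob (aff (c j))"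

lemma c_upper: "c j \<in> upper" and orb_c: "orb (H j) (c j) = \<phi> j p"
  unfolding c_def using fuchsian_group.lift_pt[OF fH maps[OF p]] by auto

lemma aff_c: "aff (c j) \<in> SL2"
  using c_upper by (simp del: upper_iff)

lemma P_eq: "P j w = orb (H j) (frame j w)"
  by (simp add: dev_orb_def c_def)

lemma P_surf: "w \<in> upper \<Longrightarrow> P j w \<in> surf (H j)"
  unfolding P_eq by (rule fuchsian_group.orb_in_surf[OF fH mob_upper[OF aff_c]])

lemma P_le: assumes "w \<in> upper" "w' \<in> upper" shows "qdist (P j w) (P j w') \<le> hdist w w'"
  unfolding P_eq
  using fuchsian_group.qdist_le[OF fH mob_upper[OF aff_c assms(1)] mob_upper[OF aff_c assms(2)], of j j j] hdist_mob[OF aff_c[of j] assms]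
  by simp

lemma P_i: "P j \<i> = \<phi> j p"
  unfolding P_eq mob_aff_i[OF c_upper] by (rule orb_c)

lemma Z_surf: assumes "w \<in> upper" shows "Z j w \<in> surf G" and "qdist p (Z j w) \<le> 2 * hdist \<i> w"
proof -
  have "Z j w \<in> surf G \<and> qdist p (Z j w) \<le> 2 * hdist \<i> w"
  proof (cases "\<exists>Z\<in>surf G. \<phi> j Z = P j w \<and> qdist p Z \<le> 2 * hdist \<i> w")
    case True
    then have "\<exists>Z. Z \<in> surf G \<and> \<phi> j Z = P j w \<and> qdist p Z \<le> 2 * hdist \<i> w" by blast
    from someI_ex[OF this] show ?thesis using True by (simp add: dev_back_def)
  next
    case False
    then have "Z j w = p" unfolding dev_back_def by (rule if_not_P)
    then show ?thesis using p assms by simp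
  qed
  then show "Z j w \<in> surf G" "qdist p (Z j w) \<le> 2 * hdist \<i> w" by auto
qed

text \<open>For \<open>w\<close> within \<open>R\<close> of \<i> the point \<open>Z j w\<close> is
  within \<open>2 * R\<close> of \<open>p\<close>; hence the almost isometry is asked for on twice
  the radius.\<close>

lemma eventually_Z:
  assumes \<delta>: "0 < \<delta>" "\<delta> \<le> 1 / 2" and R: "0 \<le> R"
  shows "\<forall>\<^sub>F j in sequentially. (\<forall>w\<in>upper. hdist \<i> w \<le> R \<longrightarrow> \<phi> j (Z j w) = P j w) \<and>
    (\<forall>X\<in>surf G. \<forall>Y\<in>surf G. qdist p X \<le> 2 * R \<longrightarrow> qdist p Y \<le> 2 * R \<longrightarrow>
        (1 - \<delta>) * qdist X Y \<le> qdist (\<phi> j X) (\<phi> j Y) \<and> qdist (\<phi> j X) (\<phi> j Y) \<le> (1 + \<delta>) * qdist X Y)"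
proof -
  have R2: "0 \<le> 2 * R" using R by simp
  show ?thesis using near[OF \<delta> R2]
  proof eventually_elim
    case (elim j)
    have "\<phi> j (Z j w) = P j w" if w: "w \<in> upper" "hdist \<i> w \<le> R" for w
    proof -
      have iu: "\<i> \<in> upper" by simp
      have "qdist (P j \<i>) (P j w) \<le> hdist \<i> w" by (rule P_le[OF iu w(1)])
      then have d: "qdist (\<phi> j p) (P j w) \<le> hdist \<i> w" by (simp add: P_i)
      then have "qdist (\<phi> j p) (P j w) \<le> 2 * R" using w R by simp
      then have "\<exists>Z\<in>surf G. \<phi> j Z = P j w \<and> qdist p Z \<le> 2 * qdist (\<phi> j p) (P j w)"
        using elim P_surf[OF w(1)] unfolding near_isom_def by blast
      then obtain Z0 where Z0: "Z0 \<in> surf G" "\<phi> j Z0 = P j w" "qdist p Z0 \<le> 2 * hdist \<i> w" using d by force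
      then have ex: "\<exists>Z. Z \<in> surf G \<and> \<phi> j Z = P j w \<and> qdist p Z \<le> 2 * hdist \<i> w" by blast
      then have "Z j w = (SOME Z. Z \<in> surf G \<and> \<phi> j Z = P j w \<and> qdist p Z \<le> 2 * hdist \<i> w)"
        unfolding dev_back_def by (intro if_P) blast
      then show ?thesis using someI_ex[OF ex] by simp
    qed
    then show ?case using elim unfolding near_isom_def by blast
  qed
qed

lemma Z_Lip:
  assumes "0 \<le> R"
  shows "\<forall>\<^sub>F j in sequentially. \<forall>w\<in>upper. \<forall>w'\<in>upper. hdist \<i> w \<le> R \<longrightarrow> hdist \<i> w' \<le> R \<longrightarrow>
    qdist (Z j w) (Z j w') \<le> 2 * hdist w w'"
proof -
  have half: "0 < (1/2::real)" "(1/2::real) \<le> 1/2" by simp_all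
  show ?thesis using eventually_Z[OF half assms]
  proof eventually_elim
    case (elim j)
    show ?case
    proof (intro ballI impI)
      fix w w' assume w: "w \<in> upper" "w' \<in> upper" "hdist \<i> w \<le> R" "hdist \<i> w' \<le> R"
      have "qdist p (Z j w) \<le> 2 * R" "qdist p (Z j w') \<le> 2 * R" using Z_surf(2)[OF w(1), of j] Z_surf(2)[OF w(2), of j] w by auto
      then have "(1 - 1/2) * qdist (Z j w) (Z j w') \<le> qdist (\<phi> j (Z j w)) (\<phi> j (Z j w'))"
        using elim Z_surf(1)[OF w(1), of j] Z_surf(1)[OF w(2), of j] by blast
      also have "\<dots> \<le> hdist w w'" using elim w P_le[OF w(1,2), of j] by simp
      finally show "qdist (Z j w) (Z j w') \<le> 2 * hdist w w'" by simp
    qed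
  qed
qed

end

locale near_isom_lim = near_isom_seq +
  fixes J :: "complex \<Rightarrow> complex set"
  assumes J_surf: "\<And>w. w \<in> upper \<Longrightarrow> J w \<in> surf G"
    and J_lim: "\<And>w. w \<in> upper \<Longrightarrow> (\<lambda>j. qdist (Z j w) (J w)) \<longlonglongrightarrow> 0"

lemma eventually_subseq: "strict_mono (k :: nat \<Rightarrow> nat) \<Longrightarrow> eventually P sequentially \<Longrightarrow> \<forall>\<^sub>F n in sequentially. P (k n)"
  using eventually_compose_filterlim filterlim_subseq by blast

context near_isom_seq
begin

lemma subseq: assumes "strict_mono (k :: nat \<Rightarrow> nat)" shows "near_isom_seq G (\<lambda>n. H (k n)) (\<lambda>n. \<phi> (k n)) p"
proof unfold_locales
  show "\<forall>\<^sub>F n in sequentially. near_isom G (H (k n)) (\<phi> (k n)) p R \<delta>" if "0 < \<delta>" "\<delta> \<le> 1 / 2" "0 \<le> R" for \<delta> R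
    by (rule eventually_subseq[OF assms near[OF that]])
  show "fuchsian (H (k n))" for n using fH[of "k n"] by (simp add: fuchsian_group_def)
qed (use p maps in auto)

text \<open>Arzela-Ascoli: a diagonal subsequence converges on a countable dense set, and the common
  Lipschitz constant 2 of \<open>Z_Lip\<close> extends the convergence to all points.\<close>

lemma limit_exists: "\<exists>k J. strict_mono k \<and> near_isom_lim G (\<lambda>n. H (k n)) (\<lambda>n. \<phi> (k n)) p J"
proof -
  obtain D where D: "countable D" "D \<subseteq> upper" "upper \<subseteq> closure D"
    using separable[of upper] by metis
  have "\<exists>w'. w' \<in> upper \<and> orb G w' = Z j w \<and> hdist (lift_pt p) w' \<le> 2 * hdist \<i> w" if w: "w \<in> upper" for j w
  proof -
    obtain w' where "w' \<in> upper" "orb G w' = Z j w" "hdist (lift_pt p) w' = qdist p (Z j w)"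
      using N.qdist_lift[OF N.lift_pt(1)[OF p] Z_surf(1)[OF w]] unfolding N.lift_pt(2)[OF p] by metis
    then show ?thesis using Z_surf(2)[OF w, of j] by auto
  qed
  note ex = this
  define l where "l j w = (SOME w'. w' \<in> upper \<and> orb G w' = Z j w \<and> hdist (lift_pt p) w' \<le> 2 * hdist \<i> w)" for j w
  have l: "\<And>j w. w \<in> upper \<Longrightarrow> l j w \<in> upper" "\<And>j w. w \<in> upper \<Longrightarrow> orb G (l j w) = Z j w"
      "\<And>j w. w \<in> upper \<Longrightarrow> hdist (lift_pt p) (l j w) \<le> 2 * hdist \<i> w"
    unfolding l_def using someI_ex[OF ex] by simp_all
  have pu: "lift_pt p \<in> upper" by (rule N.lift_pt(1)[OF p])
  have "\<exists>K>0. \<forall>x\<in>hcball (lift_pt p) (2 * hdist \<i> w). cmod x \<le> K" for w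
    using compact_imp_bounded[OF compact_hcball[OF pu]] by (simp add: bounded_pos)
  then obtain K where K: "\<And>w. 0 < K w" "\<And>w x. x \<in> hcball (lift_pt p) (2 * hdist \<i> w) \<Longrightarrow> cmod x \<le> K w" by metis
  have lK: "cmod (l j w) \<le> K w" if "w \<in> upper" for j w
    using l(1,3)[OF that, of j] by (intro K(2)) (simp add: hcball_def)
  \<comment> \<open>The diagonal argument is applied to sequences bounded by 1, hence the division
    by the bound \<open>K w\<close> of the lifts.\<close>
  have nrm: "norm (l j w / of_real (K w)) \<le> 1" if "w \<in> D" for j w
    using lK[of w j] K(1)[of w] D(2) that by (auto simp: norm_divide)
  have "\<exists>k. strict_mono (k :: nat \<Rightarrow> nat) \<and> (\<forall>w\<in>D. \<exists>L. (\<lambda>n. l (k n) w / of_real (K w)) \<longlonglongrightarrow> L)"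
    by (rule function_convergent_subsequence[OF D(1), of "\<lambda>j w. l j w / of_real (K w)" 1]) (use nrm in blast)+
  then obtain k where k: "strict_mono (k :: nat \<Rightarrow> nat)" "\<And>w. w \<in> D \<Longrightarrow> \<exists>L. (\<lambda>n. l (k n) w / of_real (K w)) \<longlonglongrightarrow> L"
    by blast
  have limD: "\<exists>X\<in>surf G. (\<lambda>n. qdist (Z (k n) w) X) \<longlonglongrightarrow> 0" if w: "w \<in> D" for w
  proof -
    have wu: "w \<in> upper" using D w by blast
    obtain L where "(\<lambda>n. l (k n) w / of_real (K w)) \<longlonglongrightarrow> L" using k(2)[OF w] by blast
    then have "(\<lambda>n. (l (k n) w / of_real (K w)) * of_real (K w)) \<longlonglongrightarrow> L * of_real (K w)" by (intro tendsto_intros)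
    moreover have "(l (k n) w / of_real (K w)) * of_real (K w) = l (k n) w" for n using K(1)[of w] by simp
    ultimately have L: "(\<lambda>n. l (k n) w) \<longlonglongrightarrow> L * of_real (K w)" by simp
    have "closed (hcball (lift_pt p) (2 * hdist \<i> w))" by (rule compact_imp_closed[OF compact_hcball[OF pu]])
    then have "L * of_real (K w) \<in> hcball (lift_pt p) (2 * hdist \<i> w)"
      by (rule closed_sequentially[OF _ _ L]) (use l(1,3)[OF wu] in \<open>simp add: hcball_def\<close>)
    then have Lu: "L * of_real (K w) \<in> upper" by (simp add: hcball_def)
    have d: "(\<lambda>n. hdist (l (k n) w) (L * of_real (K w))) \<longlonglongrightarrow> hdist (L * of_real (K w)) (L * of_real (K w))"
      by (intro tendsto_hdist L tendsto_const Lu always_eventually allI l(1) wu)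
    have "(\<lambda>n. qdist (Z (k n) w) (orb G (L * of_real (K w)))) \<longlonglongrightarrow> 0"
    proof (rule tendsto_sandwich[OF _ _ tendsto_const])
      show "(\<lambda>n. hdist (l (k n) w) (L * of_real (K w))) \<longlonglongrightarrow> 0" using d by simp
      show "\<forall>\<^sub>F n in sequentially. 0 \<le> qdist (Z (k n) w) (orb G (L * of_real (K w)))"
        using N.qdist_nonneg[OF Z_surf(1)[OF wu] N.orb_in_surf[OF Lu]] by simp
      show "\<forall>\<^sub>F n in sequentially. qdist (Z (k n) w) (orb G (L * of_real (K w))) \<le> hdist (l (k n) w) (L * of_real (K w))"
        using N.qdist_le[OF l(1)[OF wu] Lu] by (simp add: l(2)[OF wu])
    qed
    then show ?thesis using N.orb_in_surf[OF Lu] by blast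
  qed
  \<comment> \<open>For general \<open>w\<close> a cluster point \<open>X\<close> exists because the
    surface is proper; comparison with a nearby point of \<open>D\<close>, where the whole sequence
    converges, shows that \<open>X\<close> is the limit.\<close>
  have lim: "\<exists>X\<in>surf G. (\<lambda>n. qdist (Z (k n) w) X) \<longlonglongrightarrow> 0" if w: "w \<in> upper" for w
  proof -
    obtain X r where X: "X \<in> surf G" "strict_mono (r :: nat \<Rightarrow> nat)" "(\<lambda>n. qdist (Z (k (r n)) w) X) \<longlonglongrightarrow> 0"
      by (rule N.qdist_bounded_subseq[OF p Z_surf(1)[OF w] Z_surf(2)[OF w], of "\<lambda>n. k n"])
    have "(\<lambda>n. qdist (Z (k n) w) X) \<longlonglongrightarrow> 0"
    proof (rule tendstoI)
      fix e :: real assume e: "0 < e"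
      define e' where "e' = e / 8"
      have e': "0 < e'" using e by (simp add: e'_def)
      have "w \<in> closure D" using D w by blast
      moreover have "open {y \<in> upper. hdist w y < e'}" "w \<in> {y \<in> upper. hdist w y < e'}" using open_hball[OF w] w e' by auto
      ultimately obtain w' where w': "w' \<in> D" "hdist w w' < e'"
        by (metis (no_types, lifting) closure_iff_nhds_not_empty disjoint_iff mem_Collect_eq subset_refl)
      have w'u: "w' \<in> upper" using D w' by blast
      obtain X' where X': "X' \<in> surf G" "(\<lambda>n. qdist (Z (k n) w') X') \<longlonglongrightarrow> 0" using limD[OF w'(1)] by blast
      define R where "R = max (hdist \<i> w) (hdist \<i> w')"
      have R: "0 \<le> R" "hdist \<i> w \<le> R" "hdist \<i> w' \<le> R" using hdist_nonneg[of \<i> w] w by (auto simp: R_def le_max_iff_disj)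
      have ev1: "\<forall>\<^sub>F n in sequentially. qdist (Z (k n) w) (Z (k n) w') \<le> 2 * hdist w w'"
        using eventually_subseq[OF k(1) Z_Lip[OF R(1)]] by eventually_elim (use R w w'u in blast)
      have ev2: "\<forall>\<^sub>F n in sequentially. qdist (Z (k n) w') X' < e'" by (rule order_tendstoD(2)[OF X'(2) e'])
      have ev3: "\<forall>\<^sub>F n in sequentially. qdist (Z (k n) w) X' < 3 * e'" using ev1 ev2
      proof eventually_elim
        case (elim n)
        then show ?case using N.qdist_triangle[OF Z_surf(1)[OF w] Z_surf(1)[OF w'u] X'(1), of "k n" "k n"] w'(2) by linarith
      qed
      have "\<forall>\<^sub>F n in sequentially. qdist (Z (k (r n)) w) X < e' \<and> qdist (Z (k (r n)) w) X' < 3 * e'"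
        using order_tendstoD(2)[OF X(3) e'] eventually_subseq[OF X(2) ev3] by eventually_elim simp
      then obtain n where n: "qdist (Z (k (r n)) w) X < e'" "qdist (Z (k (r n)) w) X' < 3 * e'"
        using eventually_happens'[OF sequentially_bot] by blast
      have XX: "qdist X' X < 4 * e'"
        using N.qdist_triangle[OF X'(1) Z_surf(1)[OF w, of "k (r n)"] X(1)] n N.qdist_commute[of X'] by simp
      show "\<forall>\<^sub>F n in sequentially. dist (qdist (Z (k n) w) X) 0 < e" using ev3
      proof eventually_elim
        case (elim n)
        have "qdist (Z (k n) w) X < 8 * e'"
          using N.qdist_triangle[OF Z_surf(1)[OF w, of "k n"] X'(1) X(1)] elim XX e' by linarith
        then show ?case using N.qdist_nonneg[OF Z_surf(1)[OF w, of "k n"] X(1)] by (simp add: e'_def)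
      qed
    qed
    then show ?thesis using X(1) by blast
  qed
  then have "\<exists>J. \<forall>w\<in>upper. J w \<in> surf G \<and> (\<lambda>n. qdist (Z (k n) w) (J w)) \<longlonglongrightarrow> 0" by (intro bchoice) blast
  then obtain J where J: "\<And>w. w \<in> upper \<Longrightarrow> J w \<in> surf G" "\<And>w. w \<in> upper \<Longrightarrow> (\<lambda>n. qdist (Z (k n) w) (J w)) \<longlonglongrightarrow> 0" by blast
  have "near_isom_lim G (\<lambda>n. H (k n)) (\<lambda>n. \<phi> (k n)) p J"
    unfolding near_isom_lim_def near_isom_lim_axioms_def using subseq[OF k(1)] J by blast
  then show ?thesis using k(1) by blast
qed

end

context near_isom_lim
begin

lemma Z_lim: assumes "w \<in> upper" "X \<in> surf G" shows "(\<lambda>j. qdist (Z j w) X) \<longlonglongrightarrow> qdist (J w) X"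
proof -
  have "\<bar>qdist (Z j w) X - qdist (J w) X\<bar> \<le> qdist (Z j w) (J w)" for j
    using N.qdist_triangle[OF Z_surf(1)[OF assms(1), of j] J_surf[OF assms(1)] assms(2)]
      N.qdist_triangle[OF J_surf[OF assms(1)] Z_surf(1)[OF assms(1), of j] assms(2)] N.qdist_commute[of "J w" "Z j w"]
    by (simp add: abs_le_iff)
  then have "(\<lambda>j. qdist (Z j w) X - qdist (J w) X) \<longlonglongrightarrow> 0"
    by (intro Lim_null_comparison[OF _ J_lim[OF assms(1)]]) simp
  then show ?thesis by (rule LIM_zero_cancel)
qed

lemma Z_lim2: assumes "w \<in> upper" "w' \<in> upper" shows "(\<lambda>j. qdist (Z j w) (Z j w')) \<longlonglongrightarrow> qdist (J w) (J w')"
proof -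
  have lim: "(\<lambda>j. qdist (Z j w) (J w) + qdist (Z j w') (J w')) \<longlonglongrightarrow> 0"
    using tendsto_add[OF J_lim[OF assms(1)] J_lim[OF assms(2)]] by simp
  have "\<bar>qdist (Z j w) (Z j w') - qdist (J w) (J w')\<bar> \<le> qdist (Z j w) (J w) + qdist (Z j w') (J w')" for j
    using N.qdist_triangle[OF Z_surf(1)[OF assms(1), of j] J_surf[OF assms(1)] Z_surf(1)[OF assms(2), of j]]
      N.qdist_triangle[OF J_surf[OF assms(1)] J_surf[OF assms(2)] Z_surf(1)[OF assms(2), of j]]
      N.qdist_triangle[OF J_surf[OF assms(1)] Z_surf(1)[OF assms(1), of j] J_surf[OF assms(2)]]
      N.qdist_triangle[OF Z_surf(1)[OF assms(1), of j] Z_surf(1)[OF assms(2), of j] J_surf[OF assms(2)]]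
      N.qdist_commute[of "J w" "Z j w"] N.qdist_commute[of "J w'" "Z j w'"]
    by (simp add: abs_le_iff)
  then have "(\<lambda>j. qdist (Z j w) (Z j w') - qdist (J w) (J w')) \<longlonglongrightarrow> 0"
    by (intro Lim_null_comparison[OF _ lim]) simp
  then show ?thesis by (rule LIM_zero_cancel)
qed

text \<open>Eventually \<open>P j w\<close> is \<open>\<phi> j (Z j w)\<close>, and
  \<open>\<phi> j\<close> distorts the distance from \<open>Z j w\<close> to \<open>X\<close> by a
  factor that tends to 1.\<close>

lemma P_lim: assumes w: "w \<in> upper" and X: "X \<in> surf G" shows "(\<lambda>j. qdist (P j w) (\<phi> j X)) \<longlonglongrightarrow> qdist (J w) X"
proof (rule tendsto_of_ratio[OF Z_lim[OF assms]])
  show "0 \<le> qdist (Z j w) X" for j by (rule N.qdist_nonneg[OF Z_surf(1)[OF w] X])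
  fix \<delta> :: real assume \<delta>: "0 < \<delta>" "\<delta> \<le> 1 / 2"
  define R where "R = max (hdist \<i> w) (qdist p X)"
  have R: "0 \<le> R" "hdist \<i> w \<le> R" "qdist p X \<le> R" using hdist_nonneg[of \<i> w] w by (auto simp: R_def le_max_iff_disj)
  show "\<forall>\<^sub>F j in sequentially. (1 - \<delta>) * qdist (Z j w) X \<le> qdist (P j w) (\<phi> j X) \<and> qdist (P j w) (\<phi> j X) \<le> (1 + \<delta>) * qdist (Z j w) X"
    using eventually_Z[OF \<delta> R(1)]
  proof eventually_elim
    case (elim j)
    have "qdist p (Z j w) \<le> 2 * R" "qdist p X \<le> 2 * R" using Z_surf(2)[OF w, of j] R by auto
    then have "(1 - \<delta>) * qdist (Z j w) X \<le> qdist (\<phi> j (Z j w)) (\<phi> j X) \<and> qdist (\<phi> j (Z j w)) (\<phi> j X) \<le> (1 + \<delta>) * qdist (Z j w) X"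
      using elim Z_surf(1)[OF w, of j] X by blast
    then show ?case using elim w R by simp
  qed
qed

lemma P_lim2: assumes w: "w \<in> upper" "w' \<in> upper" shows "(\<lambda>j. qdist (P j w) (P j w')) \<longlonglongrightarrow> qdist (J w) (J w')"
proof (rule tendsto_of_ratio[OF Z_lim2[OF assms]])
  show "0 \<le> qdist (Z j w) (Z j w')" for j by (rule N.qdist_nonneg[OF Z_surf(1)[OF w(1)] Z_surf(1)[OF w(2)]])
  fix \<delta> :: real assume \<delta>: "0 < \<delta>" "\<delta> \<le> 1 / 2"
  define R where "R = max (hdist \<i> w) (hdist \<i> w')"
  have R: "0 \<le> R" "hdist \<i> w \<le> R" "hdist \<i> w' \<le> R" using hdist_nonneg[of \<i> w] w by (auto simp: R_def le_max_iff_disj)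
  show "\<forall>\<^sub>F j in sequentially. (1 - \<delta>) * qdist (Z j w) (Z j w') \<le> qdist (P j w) (P j w') \<and> qdist (P j w) (P j w') \<le> (1 + \<delta>) * qdist (Z j w) (Z j w')"
    using eventually_Z[OF \<delta> R(1)]
  proof eventually_elim
    case (elim j)
    have "qdist p (Z j w) \<le> 2 * R" "qdist p (Z j w') \<le> 2 * R" using Z_surf(2)[OF w(1), of j] Z_surf(2)[OF w(2), of j] R by auto
    then have "(1 - \<delta>) * qdist (Z j w) (Z j w') \<le> qdist (\<phi> j (Z j w)) (\<phi> j (Z j w')) \<and> qdist (\<phi> j (Z j w)) (\<phi> j (Z j w')) \<le> (1 + \<delta>) * qdist (Z j w) (Z j w')"
      using elim Z_surf(1)[OF w(1), of j] Z_surf(1)[OF w(2), of j] by blast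
    then show ?case using elim w R by simp
  qed
qed

lemma J_Lip: assumes "w \<in> upper" "w' \<in> upper" shows "qdist (J w) (J w') \<le> hdist w w'"
  by (rule LIMSEQ_le_const2[OF P_lim2[OF assms]]) (use P_le[OF assms] in auto)

text \<open>Limits of points with the same image agree on \<open>J\<close>.\<close>

lemma J_eq_of_P_eq:
  assumes "strict_mono (r :: nat \<Rightarrow> nat)" "\<And>j. v j \<in> upper" "v \<longlonglongrightarrow> w" "w \<in> upper" "w' \<in> upper"
    "\<And>j. P (r j) (v j) = P (r j) w'"
  shows "J w = J w'"
proof -
  have 1: "(\<lambda>j. qdist (P (r j) w) (P (r j) w')) \<longlonglongrightarrow> qdist (J w) (J w')"
    using LIMSEQ_subseq_LIMSEQ[OF P_lim2[OF assms(4,5)] assms(1)] by (simp add: o_def)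
  have "(\<lambda>j. hdist w (v j)) \<longlonglongrightarrow> hdist w w"
    by (intro tendsto_hdist assms tendsto_const always_eventually allI)
  then have "(\<lambda>j. hdist w (v j)) \<longlonglongrightarrow> 0" by simp
  then have "qdist (J w) (J w') \<le> 0"
  proof (rule LIMSEQ_le[OF 1])
    show "\<exists>N. \<forall>n\<ge>N. qdist (P (r n) w) (P (r n) w') \<le> hdist w (v n)"
      using P_le[OF assms(4) assms(2)] unfolding assms(6)[symmetric] by blast
  qed
  then have "qdist (J w) (J w') = 0" using N.qdist_nonneg[OF J_surf[OF assms(4)] J_surf[OF assms(5)]] by simp
  then show ?thesis using N.qdist_eq_0[OF J_surf[OF assms(4)] J_surf[OF assms(5)]] by simp
qed

text \<open>Each \<open>P j\<close> has lifts at exact distance. They stay in a ball because these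
  distances converge, and a cluster point of them is a lift for \<open>J\<close>.\<close>

lemma J_lift: assumes w: "w \<in> upper" and X: "X \<in> surf G" shows "\<exists>w'\<in>upper. J w' = X \<and> hdist w w' = qdist (J w) X"
proof -
  have "\<exists>v. v \<in> upper \<and> P j v = \<phi> j X \<and> hdist w v = qdist (P j w) (\<phi> j X)" for j
  proof -
    interpret M: fuchsian_group "H j" by (rule fH)
    obtain y where y: "y \<in> upper" "orb (H j) y = \<phi> j X" "hdist (frame j w) y = qdist (P j w) (\<phi> j X)"
      unfolding P_eq by (rule M.qdist_lift[OF mob_upper[OF aff_c w] maps[OF X]])
    define v where "v = mob (minv (aff (c j))) y"
    have v: "v \<in> upper" "frame j v = y"
      using mob_upper[OF minv_SL2[OF aff_c] y(1)] mob_minv(1)[OF aff_c y(1)] by (auto simp: v_def)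
    have "hdist w v = hdist (frame j w) y" using hdist_mob[OF aff_c[of j] w v(1)] v(2) by simp
    then show ?thesis using v y by (intro exI[of _ v]) (simp add: P_eq del: upper_iff)
  qed
  then obtain v where v: "\<And>j. v j \<in> upper" "\<And>j. P j (v j) = \<phi> j X" "\<And>j. hdist w (v j) = qdist (P j w) (\<phi> j X)" by metis
  have lim: "(\<lambda>j. hdist w (v j)) \<longlonglongrightarrow> qdist (J w) X" unfolding v(3) by (rule P_lim[OF assms])
  have "Bseq (\<lambda>j. hdist w (v j))" by (rule convergent_imp_Bseq) (use lim in \<open>auto simp: convergent_def\<close>)
  then obtain K where K: "\<And>j. norm (hdist w (v j)) \<le> K" by (auto simp: Bseq_def)
  have "hdist w (v j) \<le> K" for j using K[of j] by simp
  then obtain w' r where r: "w' \<in> upper" "strict_mono (r :: nat \<Rightarrow> nat)" "(\<lambda>j. v (r j)) \<longlonglongrightarrow> w'"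
    by (rule hdist_bounded_subseq[OF w v(1)])
  have d0: "(\<lambda>j. hdist w' (v (r j))) \<longlonglongrightarrow> hdist w' w'"
    by (intro tendsto_hdist r tendsto_const always_eventually allI v)
  then have d: "(\<lambda>j. hdist w' (v (r j))) \<longlonglongrightarrow> 0" by simp
  have "(\<lambda>j. qdist (P (r j) w') (\<phi> (r j) X)) \<longlonglongrightarrow> qdist (J w') X"
    using LIMSEQ_subseq_LIMSEQ[OF P_lim[OF r(1) X] r(2)] by (simp add: o_def)
  then have "qdist (J w') X \<le> 0"
  proof (rule LIMSEQ_le[OF _ d])
    show "\<exists>N. \<forall>n\<ge>N. qdist (P (r n) w') (\<phi> (r n) X) \<le> hdist w' (v (r n))"
      using P_le[OF r(1) v(1)] unfolding v(2)[symmetric] by blast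
  qed
  then have "qdist (J w') X = 0" using N.qdist_nonneg[OF J_surf[OF r(1)] X] by simp
  then have Jw': "J w' = X" using N.qdist_eq_0[OF J_surf[OF r(1)] X] by simp
  have "(\<lambda>j. hdist w (v (r j))) \<longlonglongrightarrow> hdist w w'"
    by (intro tendsto_hdist r tendsto_const always_eventually allI v w)
  moreover have "(\<lambda>j. hdist w (v (r j))) \<longlonglongrightarrow> qdist (J w) X"
    using LIMSEQ_subseq_LIMSEQ[OF lim r(2)] by (simp add: o_def)
  ultimately have "hdist w w' = qdist (J w) X" by (rule LIMSEQ_unique)
  then show ?thesis using Jw' r(1) by blast
qed

sublocale submetry G J
  by unfold_locales (use J_surf J_Lip J_lift in blast)+

end

section \<open>Convergence of the groups\<close>

definition comp1 :: "mat4 \<Rightarrow> real" where "comp1 g = fst g"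
definition comp2 :: "mat4 \<Rightarrow> real" where "comp2 g = fst (snd g)"
definition comp3 :: "mat4 \<Rightarrow> real" where "comp3 g = fst (snd (snd g))"
definition comp4 :: "mat4 \<Rightarrow> real" where "comp4 g = snd (snd (snd g))"

lemma comp_simps [simp]: "comp1 (a, b, c, d) = a" "comp2 (a, b, c, d) = b" "comp3 (a, b, c, d) = c" "comp4 (a, b, c, d) = d"
  by (simp_all add: comp1_def comp2_def comp3_def comp4_def)

lemma tendsto_comp:
  assumes "(f \<longlongrightarrow> g) F"
  shows "((\<lambda>n. comp1 (f n)) \<longlongrightarrow> comp1 g) F" "((\<lambda>n. comp2 (f n)) \<longlongrightarrow> comp2 g) F"
    "((\<lambda>n. comp3 (f n)) \<longlongrightarrow> comp3 g) F" "((\<lambda>n. comp4 (f n)) \<longlongrightarrow> comp4 g) F"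
  unfolding comp1_def comp2_def comp3_def comp4_def by (intro tendsto_fst tendsto_snd assms)+

lemma SL2_comp: "g \<in> SL2 \<longleftrightarrow> comp1 g * comp4 g - comp2 g * comp3 g = 1"
  by (cases g) simp

lemma mob_comp: "mob g z = (of_real (comp1 g) * z + of_real (comp2 g)) / (of_real (comp3 g) * z + of_real (comp4 g))"
  by (cases g) simp

lemma mat4_eqI: "comp1 g = comp1 h \<Longrightarrow> comp2 g = comp2 h \<Longrightarrow> comp3 g = comp3 h \<Longrightarrow> comp4 g = comp4 h \<Longrightarrow> g = (h :: mat4)"
  by (cases g; cases h) simp

lemma tendsto_mob:
  assumes "(f \<longlongrightarrow> g) F" "(w \<longlongrightarrow> z) F" "g \<in> SL2" "z \<in> upper"
  shows "((\<lambda>n. mob (f n) (w n)) \<longlongrightarrow> mob g z) F"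
proof -
  have "of_real (comp3 g) * z + of_real (comp4 g) \<noteq> (0::complex)"
    using mob_denom_nz[of "comp1 g" "comp4 g" "comp2 g" "comp3 g" z] assms(3,4) by (simp add: SL2_comp)
  then show ?thesis unfolding mob_comp by (intro tendsto_intros tendsto_comp assms)
qed

lemma SL2_limit:
  assumes "f \<longlonglongrightarrow> g" "\<And>n::nat. f n \<in> SL2"
  shows "g \<in> SL2"
proof -
  have "(\<lambda>n. comp1 (f n) * comp4 (f n) - comp2 (f n) * comp3 (f n)) \<longlonglongrightarrow> comp1 g * comp4 g - comp2 g * comp3 g"
    by (intro tendsto_intros tendsto_comp assms)
  then have "(\<lambda>n::nat. 1) \<longlonglongrightarrow> comp1 g * comp4 g - comp2 g * comp3 g" using assms(2) by (simp add: SL2_comp)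
  then show ?thesis unfolding SL2_comp by (simp add: LIMSEQ_const_iff)
qed

text \<open>The right-hand side is half the squared Hilbert-Schmidt norm. So bounded displacement
  means bounded norm (\<open>SL2_bounded_displacement\<close>), and sequences of bounded
  displacement have convergent subsequences (\<open>bounded_seq_SL2\<close>).\<close>

lemma cosh_hdist_mob_i:
  assumes "g \<in> SL2"
  shows "cosh (hdist \<i> (mob g \<i>)) = ((comp1 g)\<^sup>2 + (comp2 g)\<^sup>2 + (comp3 g)\<^sup>2 + (comp4 g)\<^sup>2) / 2"
proof -
  obtain a b c d where g: "g = (a, b, c, d)" by (cases g)
  have det: "a * d - b * c = 1" using assms by (simp add: g)
  have iu: "\<i> \<in> upper" by simp
  define D where "D = c\<^sup>2 + d\<^sup>2"
  have nD: "(cmod (of_real c * \<i> + of_real d))\<^sup>2 = D" by (simp add: cmod_power2 D_def)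
  have D: "0 < D" using mob_denom_nz[OF det, of \<i>] nD by (metis iu upper_iff zero_less_norm_iff zero_less_power)
  have nN: "(cmod (of_real a * \<i> + of_real b))\<^sup>2 = a\<^sup>2 + b\<^sup>2" by (simp add: cmod_power2)
  have 1: "Im (mob g \<i>) = 1 / D" using Im_mob[OF det, of \<i>] nD by (simp add: g)
  have 2: "(cmod (mob g \<i>))\<^sup>2 = (a\<^sup>2 + b\<^sup>2) / D" unfolding g by (simp add: norm_divide power_divide nD nN del: complex_i_mult_minus)
  have "cosh (hdist \<i> (mob g \<i>)) = hT (mob g \<i>)" by (rule cosh_hdist_i[OF mob_upper[OF assms iu]])
  also have "\<dots> = ((a\<^sup>2 + b\<^sup>2) / D + 1) / (2 / D)" by (simp add: hT_def 1 2)
  also have "\<dots> = (a\<^sup>2 + b\<^sup>2 + D) / 2" using D by (simp add: field_simps)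
  finally show ?thesis by (simp add: g D_def add.assoc)
qed

lemma norm_mat4: "norm (g :: mat4) = sqrt ((comp1 g)\<^sup>2 + (comp2 g)\<^sup>2 + (comp3 g)\<^sup>2 + (comp4 g)\<^sup>2)"
  by (cases g) (simp add: norm_Pair add.assoc)

lemma bounded_seq_SL2:
  fixes f :: "nat \<Rightarrow> mat4"
  assumes "\<And>n. f n \<in> SL2" "\<And>n. norm (f n) \<le> B"
  obtains g r where "g \<in> SL2" "strict_mono (r :: nat \<Rightarrow> nat)" "(\<lambda>n. f (r n)) \<longlonglongrightarrow> g"
proof -
  have "bounded (range f)" using assms(2) by (auto simp: bounded_iff)
  then obtain g r where gr: "strict_mono (r :: nat \<Rightarrow> nat)" "(f \<circ> r) \<longlonglongrightarrow> g"
    using bounded_imp_convergent_subsequence by blast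
  have "(\<lambda>n. f (r n)) \<longlonglongrightarrow> g" using gr(2) by (simp add: o_def)
  then show ?thesis using that SL2_limit[of "\<lambda>n. f (r n)" g] assms(1) gr(1) by blast
qed

lemma SL2_bounded_displacement:
  assumes "x \<in> upper" "y \<in> upper"
  shows "\<exists>B. \<forall>g\<in>SL2. hdist x (mob g y) \<le> R \<longrightarrow> norm g \<le> B"
proof (intro exI[of _ "sqrt (2 * cosh (hdist \<i> x + R + hdist y \<i>))"] ballI impI)
  fix g assume g: "g \<in> SL2" "hdist x (mob g y) \<le> R"
  have iu: "\<i> \<in> upper" by simp
  have gi: "mob g \<i> \<in> upper" "mob g y \<in> upper" using mob_upper[OF g(1)] iu assms by blast+
  have "hdist \<i> (mob g \<i>) \<le> hdist \<i> x + hdist x (mob g y) + hdist (mob g y) (mob g \<i>)"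
    using hdist_triangle[OF iu assms(1) gi(1)] hdist_triangle[OF assms(1) gi(2,1)] by linarith
  also have "\<dots> \<le> hdist \<i> x + R + hdist y \<i>" using g(2) hdist_mob[OF g(1) assms(2) iu] by simp
  finally have le: "hdist \<i> (mob g \<i>) \<le> hdist \<i> x + R + hdist y \<i>" .
  have "cosh (hdist \<i> (mob g \<i>)) \<le> cosh (hdist \<i> x + R + hdist y \<i>)"
    using le hdist_nonneg[OF iu gi(1)] by (subst cosh_le_iff_nonneg) auto
  then show "norm g \<le> sqrt (2 * cosh (hdist \<i> x + R + hdist y \<i>))"
    unfolding norm_mat4 using cosh_hdist_mob_i[OF g(1)] by simp
qed

definition mone :: mat4 where "mone = (1, 0, 0, 1)"
definition mneg :: "mat4 \<Rightarrow> mat4" where "mneg g = (- comp1 g, - comp2 g, - comp3 g, - comp4 g)"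
definition mdist :: "mat4 \<Rightarrow> real" where
  "mdist g = max (max \<bar>comp1 g - 1\<bar> \<bar>comp2 g\<bar>) (max \<bar>comp3 g\<bar> \<bar>comp4 g - 1\<bar>)"

lemma mdist_nonneg: "0 \<le> mdist g" by (auto simp: mdist_def le_max_iff_disj)

lemma mdist_eq_0: "mdist g = 0 \<longleftrightarrow> g = mone"
proof
  assume "mdist g = 0"
  then have "\<bar>comp1 g - 1\<bar> \<le> 0" "\<bar>comp2 g\<bar> \<le> 0" "\<bar>comp3 g\<bar> \<le> 0" "\<bar>comp4 g - 1\<bar> \<le> 0"
    unfolding mdist_def by (metis max.cobounded1 max.cobounded2 order_trans)+
  then show "g = mone" by (intro mat4_eqI) (auto simp: mone_def)
qed (simp add: mdist_def mone_def)

lemma tendsto_mdist: "(f \<longlongrightarrow> g) F \<Longrightarrow> ((\<lambda>n. mdist (f n)) \<longlongrightarrow> mdist g) F"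
  unfolding mdist_def by (intro tendsto_intros tendsto_comp)

text \<open>With g = 1 + n the square is 1 + 2 n + n^2, and every entry of n^2 is at most 2 m^2 for
  m = \<open>mdist g\<close>.\<close>

lemma mdist_mmul_self: "\<bar>mdist (mmul g g) - 2 * mdist g\<bar> \<le> 2 * (mdist g)\<^sup>2"
proof -
  obtain a b c d where g: "g = (a, b, c, d)" by (cases g)
  define p s m where "p = a - 1" and "s = d - 1" and "m = mdist g"
  have m: "\<bar>p\<bar> \<le> m" "\<bar>b\<bar> \<le> m" "\<bar>c\<bar> \<le> m" "\<bar>s\<bar> \<le> m" by (auto simp: m_def mdist_def g p_def s_def le_max_iff_disj)
  have m0: "0 \<le> m" using m(1) by linarith
  have bnd: "\<bar>x * y + z * w\<bar> \<le> 2 * m\<^sup>2" if "\<bar>x\<bar> \<le> m" "\<bar>y\<bar> \<le> m" "\<bar>z\<bar> \<le> m" "\<bar>w\<bar> \<le> m" for x y z w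
  proof -
    have "\<bar>x * y\<bar> \<le> m * m" "\<bar>z * w\<bar> \<le> m * m" unfolding abs_mult using that m0 by (auto intro: mult_mono)
    then show ?thesis unfolding power2_eq_square by linarith
  qed
  have 1: "a * a + b * c - 1 = 2 * p + (p * p + b * c)" "a * b + b * d = 2 * b + (p * b + b * s)"
    "c * a + d * c = 2 * c + (c * p + s * c)" "c * b + d * d - 1 = 2 * s + (c * b + s * s)"
    by (simp_all add: p_def s_def algebra_simps)
  have mm: "mdist (mmul g g) = max (max \<bar>a * a + b * c - 1\<bar> \<bar>a * b + b * d\<bar>) (max \<bar>c * a + d * c\<bar> \<bar>c * b + d * d - 1\<bar>)"
    by (simp add: g mdist_def)
  have mg: "m = max (max \<bar>p\<bar> \<bar>b\<bar>) (max \<bar>c\<bar> \<bar>s\<bar>)" by (simp add: m_def mdist_def g p_def s_def)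
  note b = bnd[OF m(1) m(1) m(2) m(3)] bnd[OF m(1) m(2) m(2) m(4)] bnd[OF m(3) m(1) m(4) m(3)] bnd[OF m(3) m(2) m(4) m(4)]
  have "\<bar>\<bar>2 * x + y\<bar> - 2 * \<bar>x\<bar>\<bar> \<le> \<bar>y\<bar>" for x y :: real by linarith
  then have "\<bar>\<bar>a * a + b * c - 1\<bar> - 2 * \<bar>p\<bar>\<bar> \<le> 2 * m\<^sup>2" "\<bar>\<bar>a * b + b * d\<bar> - 2 * \<bar>b\<bar>\<bar> \<le> 2 * m\<^sup>2"
    "\<bar>\<bar>c * a + d * c\<bar> - 2 * \<bar>c\<bar>\<bar> \<le> 2 * m\<^sup>2" "\<bar>\<bar>c * b + d * d - 1\<bar> - 2 * \<bar>s\<bar>\<bar> \<le> 2 * m\<^sup>2"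
    unfolding 1 using b by (meson order_trans)+
  note bounds = this
  have max_diff: "\<bar>max x y - max z w\<bar> \<le> K" if "\<bar>x - z\<bar> \<le> K" "\<bar>y - w\<bar> \<le> K" for x y z w K :: real
    using that by linarith
  have "2 * m = max (max (2 * \<bar>p\<bar>) (2 * \<bar>b\<bar>)) (max (2 * \<bar>c\<bar>) (2 * \<bar>s\<bar>))" unfolding mg by (simp add: max_def)
  then have "\<bar>mdist (mmul g g) - 2 * m\<bar> \<le> 2 * m\<^sup>2"
    unfolding mm by (simp only:) (intro max_diff bounds)
  then show ?thesis by (simp add: m_def)
qed

lemma mneg_SL2: "g \<in> SL2 \<Longrightarrow> mneg g \<in> SL2" by (simp add: SL2_comp mneg_def)

lemma mob_mneg: "mob (mneg g) z = mob g z"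
proof -
  have "mob (mneg g) z = (- (of_real (comp1 g) * z + of_real (comp2 g))) / (- (of_real (comp3 g) * z + of_real (comp4 g)))"
    by (simp add: mob_comp mneg_def)
  then show ?thesis by (simp only: minus_divide_divide mob_comp)
qed

lemma mob_eq_id:
  assumes "g \<in> SL2" "\<And>z. z \<in> upper \<Longrightarrow> mob g z = z"
  shows "g = mone \<or> g = mneg mone"
proof -
  obtain a b c d where g: "g = (a, b, c, d)" by (cases g)
  have det: "a * d - b * c = 1" using assms(1) by (simp add: g)
  have eq: "of_real a * z + of_real b = z * (of_real c * z + of_real d)" if "z \<in> upper" for z
    using assms(2)[OF that] mob_denom_nz[OF det, of z] that by (simp add: g field_simps)
  have 1: "a = d" "b = - c" using eq[of \<i>] by (auto simp: complex_eq_iff)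
  have "b = - 4 * c" using eq[of "2 * \<i>"] by (auto simp: complex_eq_iff)
  then have c: "c = 0" "b = 0" using 1 by auto
  then have "a * a = 1" using det 1 by simp
  then have "a = 1 \<or> a = - 1" by (simp add: square_eq_1_iff)
  then show ?thesis using 1 c by (auto simp: g mone_def mneg_def)
qed

lemma mdist_mneg_one: "mdist (mneg mone) = 2" by (simp add: mdist_def mneg_def mone_def)

locale near_isom_dev = near_isom_lim +
  fixes A :: "complex \<Rightarrow> complex"
  assumes A: "hiso A" and JA: "\<And>y. y \<in> upper \<Longrightarrow> J (A y) = orb G y"
begin

text \<open>The group \<open>H j\<close> seen in its frame. Both signs of a matrix occur
  (\<open>Mat_mneg\<close>), so the identity map has two representatives.\<close>

definition Mat :: "nat \<Rightarrow> mat4 set" where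
  "Mat j = {g \<in> SL2. \<exists>\<gamma>\<in>H j. \<forall>w\<in>upper. frame j (mob g w) = \<gamma> (frame j w)}"

lemma Mat_SL2: "g \<in> Mat j \<Longrightarrow> g \<in> SL2" by (simp add: Mat_def)

lemma Mat_rep:
  assumes "\<gamma> \<in> H j"
  shows "\<exists>g\<in>Mat j. \<forall>w\<in>upper. frame j (mob g w) = \<gamma> (frame j w)"
proof -
  obtain m where m: "m \<in> SL2" "\<And>z. z \<in> upper \<Longrightarrow> \<gamma> z = mob m z" by (rule fuchsian_group.mob_rep[OF fH assms]) blast
  define g where "g = mmul (minv (aff (c j))) (mmul m (aff (c j)))"
  have g: "g \<in> SL2" unfolding g_def by (intro mmul_SL2 minv_SL2 aff_c m)
  have "frame j (mob g w) = \<gamma> (frame j w)" if w: "w \<in> upper" for w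
  proof -
    have u: "frame j w \<in> upper" by (rule mob_upper[OF aff_c w])
    have "mob g w = mob (minv (aff (c j))) (mob m (frame j w))"
      unfolding g_def using mob_mmul[OF minv_SL2[OF aff_c] mmul_SL2[OF m(1) aff_c] w] mob_mmul[OF m(1) aff_c w] by simp
    then show ?thesis using mob_minv(1)[OF aff_c mob_upper[OF m(1) u]] m(2)[OF u] by simp
  qed
  then show ?thesis using g assms unfolding Mat_def by blast
qed

lemma Mat_P: assumes "g \<in> Mat j" "w \<in> upper" shows "P j (mob g w) = P j w"
proof -
  obtain \<gamma> where "\<gamma> \<in> H j" "frame j (mob g w) = \<gamma> (frame j w)" using assms unfolding Mat_def by blast
  then show ?thesis unfolding P_eq using fuchsian_group.orb_apply[OF fH _ mob_upper[OF aff_c assms(2)]] by simp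
qed

lemma Mat_mmul: assumes "g \<in> Mat j" "h \<in> Mat j" shows "mmul g h \<in> Mat j"
proof -
  interpret M: fuchsian_group "H j" by (rule fH)
  obtain \<gamma> where g: "g \<in> SL2" "\<gamma> \<in> H j" "\<And>w. w \<in> upper \<Longrightarrow> frame j (mob g w) = \<gamma> (frame j w)" using assms(1) unfolding Mat_def by blast
  obtain \<delta> where h: "h \<in> SL2" "\<delta> \<in> H j" "\<And>w. w \<in> upper \<Longrightarrow> frame j (mob h w) = \<delta> (frame j w)" using assms(2) unfolding Mat_def by blast
  have "frame j (mob (mmul g h) w) = compose upper \<gamma> \<delta> (frame j w)" if w: "w \<in> upper" for w
    using mob_mmul[OF g(1) h(1) w] g(3)[OF mob_upper[OF h(1) w]] h(3)[OF w] M.compose_apply[OF mob_upper[OF aff_c w], of \<gamma> \<delta>] by simp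
  then show ?thesis unfolding Mat_def using mmul_SL2[OF g(1) h(1)] M.compose_in[OF g(2) h(2)] by blast
qed

lemma Mat_minv: assumes "g \<in> Mat j" shows "minv g \<in> Mat j"
proof -
  interpret M: fuchsian_group "H j" by (rule fH)
  obtain \<gamma> where g: "g \<in> SL2" "\<gamma> \<in> H j" "\<And>w. w \<in> upper \<Longrightarrow> frame j (mob g w) = \<gamma> (frame j w)" using assms(1) unfolding Mat_def by blast
  have "frame j (mob (minv g) w) = M.ginv \<gamma> (frame j w)" if w: "w \<in> upper" for w
  proof -
    have u: "mob (minv g) w \<in> upper" by (rule mob_upper[OF minv_SL2[OF g(1)] w])
    have "frame j w = \<gamma> (frame j (mob (minv g) w))" using g(3)[OF u] mob_minv(1)[OF g(1) w] by simp
    then show ?thesis using M.ginv_left[OF g(2) mob_upper[OF aff_c u]] by simp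
  qed
  then show ?thesis unfolding Mat_def using minv_SL2[OF g(1)] M.ginv_in[OF g(2)] by blast
qed

lemma Mat_mneg: "g \<in> Mat j \<Longrightarrow> mneg g \<in> Mat j"
  unfolding Mat_def using mneg_SL2 by (auto simp: mob_mneg simp del: mob.simps)

text \<open>The matrices preserve \<open>P (r j)\<close>, so their limit preserves \<open>J\<close>.
  Conjugated by \<open>A\<close> it preserves the orbits of \<open>G\<close>, and
  \<open>orbit_preserving_in_group\<close> applies.\<close>

lemma Mat_limit:
  assumes r: "strict_mono (r :: nat \<Rightarrow> nat)" and g: "\<And>j. g j \<in> Mat (r j)" "g \<longlonglongrightarrow> g0"
  shows "g0 \<in> SL2" "\<exists>\<gamma>\<in>G. \<forall>y\<in>upper. mob g0 (A y) = A (\<gamma> y)"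
proof -
  show g0: "g0 \<in> SL2" by (rule SL2_limit[OF g(2)]) (rule Mat_SL2[OF g(1)])
  have Jg: "J (mob g0 w) = J w" if w: "w \<in> upper" for w
  proof (rule J_eq_of_P_eq[OF r, of "\<lambda>j. mob (g j) w"])
    show "(\<lambda>j. mob (g j) w) \<longlonglongrightarrow> mob g0 w" by (rule tendsto_mob[OF g(2) tendsto_const g0 w])
    show "P (r j) (mob (g j) w) = P (r j) w" for j by (rule Mat_P[OF g(1) w])
    show "mob (g j) w \<in> upper" for j by (rule mob_upper[OF Mat_SL2[OF g(1)] w])
  qed (rule mob_upper[OF g0 w] w)+
  obtain B where B: "hiso B" "\<And>z. z \<in> upper \<Longrightarrow> A (B z) = z" "\<And>z. z \<in> upper \<Longrightarrow> B (A z) = z"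
    using hiso_inverse[OF A] by blast
  have Au: "A y \<in> upper" "mob g0 (A y) \<in> upper" if "y \<in> upper" for y
    using hiso_upper[OF A that] mob_upper[OF g0 hiso_upper[OF A that]] by auto
  have "hiso (\<lambda>y. B (mob g0 (A y)))"
    by (rule hiso_compose[OF B(1) hiso_compose[OF hiso_mob[OF g0] A]])
  moreover have "orb G (B (mob g0 (A y))) = orb G y" if y: "y \<in> upper" for y
  proof -
    have "orb G (B (mob g0 (A y))) = J (A (B (mob g0 (A y))))" by (rule JA[symmetric, OF hiso_upper[OF B(1) Au(2)[OF y]]])
    also have "\<dots> = J (mob g0 (A y))" using B(2)[OF Au(2)[OF y]] by simp
    also have "\<dots> = orb G y" using Jg[OF Au(1)[OF y]] JA[OF y] by simp
    finally show ?thesis .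
  qed
  ultimately obtain \<gamma> where \<gamma>: "\<gamma> \<in> G" "\<forall>y\<in>upper. B (mob g0 (A y)) = \<gamma> y"
    using N.orbit_preserving_in_group by blast
  have "mob g0 (A y) = A (\<gamma> y)" if y: "y \<in> upper" for y
    using B(2)[OF Au(2)[OF y]] \<gamma>(2) y by metis
  then show "\<exists>\<gamma>\<in>G. \<forall>y\<in>upper. mob g0 (A y) = A (\<gamma> y)" using \<gamma>(1) by blast
qed

text \<open>A small non-trivial element would have a power of moderate size, by repeated squaring; such
  powers would accumulate at a small non-trivial element of the discrete limit group.\<close>

lemma no_small_elements:
  "\<exists>c0>0. \<forall>\<^sub>F j in sequentially. \<forall>g\<in>Mat j. mdist g \<le> c0 \<longrightarrow> g = mone"
proof -
  obtain y0 where y0: "N.regular y0" using N.regular_dense[of \<i> 1] by auto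
  then have y0u: "y0 \<in> upper" by (simp add: N.regular_def)
  obtain s where s: "s > 0" "\<And>y y'. y \<in> upper \<Longrightarrow> y' \<in> upper \<Longrightarrow> hdist y0 y \<le> s \<Longrightarrow> hdist y0 y' \<le> s \<Longrightarrow>
    qdist (orb G y) (orb G y') = hdist y y'" using N.regular_isometric_ball[OF y0] by auto
  have Au: "A y0 \<in> upper" by (rule hiso_upper[OF A y0u])
  \<comment> \<open>Continuity of the action at the identity matrix, by sequences: matrices this
    close to it move \<open>A y0\<close> by less than the radius of the isometric ball.\<close>
  have "\<exists>e>0. \<forall>g\<in>SL2. mdist g \<le> e \<longrightarrow> hdist (A y0) (mob g (A y0)) < s"
  proof (rule ccontr)
    assume neg: "\<not> ?thesis"
    have "\<exists>g\<in>SL2. mdist g \<le> 1 / real (Suc n) \<and> \<not> hdist (A y0) (mob g (A y0)) < s" for n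
      using neg by (metis of_nat_0_less_iff zero_less_Suc zero_less_divide_1_iff)
    then obtain g where g: "\<And>n. g n \<in> SL2" "\<And>n. mdist (g n) \<le> 1 / real (Suc n)" "\<And>n. \<not> hdist (A y0) (mob (g n) (A y0)) < s" by metis
    have lim: "(\<lambda>n. 1 / real (Suc n)) \<longlonglongrightarrow> 0" using LIMSEQ_Suc[OF lim_const_over_n[of 1]] by simp
    have md: "\<bar>comp1 (g n) - 1\<bar> \<le> mdist (g n)" "\<bar>comp2 (g n)\<bar> \<le> mdist (g n)" "\<bar>comp3 (g n)\<bar> \<le> mdist (g n)" "\<bar>comp4 (g n) - 1\<bar> \<le> mdist (g n)" for n
      by (auto simp: mdist_def le_max_iff_disj)
    have bnd: "norm (comp1 (g n) - 1) \<le> 1 / real (Suc n)" "norm (comp2 (g n)) \<le> 1 / real (Suc n)"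
        "norm (comp3 (g n)) \<le> 1 / real (Suc n)" "norm (comp4 (g n) - 1) \<le> 1 / real (Suc n)" for n
      using order_trans[OF md(1) g(2)[of n]] order_trans[OF md(2) g(2)[of n]] order_trans[OF md(3) g(2)[of n]] order_trans[OF md(4) g(2)[of n]]
      unfolding real_norm_def by blast+
    have "(\<lambda>n. comp1 (g n)) \<longlonglongrightarrow> 1" "(\<lambda>n. comp2 (g n)) \<longlonglongrightarrow> 0" "(\<lambda>n. comp3 (g n)) \<longlonglongrightarrow> 0" "(\<lambda>n. comp4 (g n)) \<longlonglongrightarrow> 1"
      using LIM_zero_cancel[OF Lim_null_comparison[OF always_eventually[OF allI[OF bnd(1)]] lim]]
        Lim_null_comparison[OF always_eventually[OF allI[OF bnd(2)]] lim]
        Lim_null_comparison[OF always_eventually[OF allI[OF bnd(3)]] lim]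
        LIM_zero_cancel[OF Lim_null_comparison[OF always_eventually[OF allI[OF bnd(4)]] lim]] by auto
    then have "(\<lambda>n. (comp1 (g n), comp2 (g n), comp3 (g n), comp4 (g n))) \<longlonglongrightarrow> (1, 0, 0, 1)" by (intro tendsto_Pair)
    then have "g \<longlonglongrightarrow> (1, 0, 0, 1)" by (simp add: comp1_def comp2_def comp3_def comp4_def)
    then have "(\<lambda>n. mob (g n) (A y0)) \<longlonglongrightarrow> mob (1, 0, 0, 1) (A y0)" by (intro tendsto_mob tendsto_const Au one_SL2)
    then have "(\<lambda>n. hdist (A y0) (mob (g n) (A y0))) \<longlonglongrightarrow> hdist (A y0) (A y0)"
      unfolding mob_one by (intro tendsto_hdist tendsto_const Au always_eventually allI mob_upper g(1))
    then have "(\<lambda>n. hdist (A y0) (mob (g n) (A y0))) \<longlonglongrightarrow> 0" by simp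
    from order_tendstoD(2)[OF this s(1)] have "\<exists>n. hdist (A y0) (mob (g n) (A y0)) < s"
      using eventually_happens'[OF sequentially_bot] by blast
    then show False using g(3) by blast
  qed
  then obtain e where e: "e > 0" "\<And>g. g \<in> SL2 \<Longrightarrow> mdist g \<le> e \<Longrightarrow> hdist (A y0) (mob g (A y0)) < s" by blast
  \<comment> \<open>As long as \<open>mdist\<close> is at most 1/4, squaring multiplies it by a
    factor between 3/2 and 5/2. So the first power beyond \<open>c0\<close> is at most
    \<open>3 * c0\<close>, and there \<open>e\<close> must still apply.\<close>
  define c0 where "c0 = min (1 / 4) (e / 3)"
  have c0: "0 < c0" "c0 \<le> 1 / 4" "3 * c0 \<le> e" using e(1) by (auto simp: c0_def)
  have "\<forall>\<^sub>F j in sequentially. \<forall>g\<in>Mat j. mdist g \<le> c0 \<longrightarrow> g = mone"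
  proof (rule ccontr)
    assume "\<not> ?thesis"
    from not_eventually_sequentiallyD[OF this] obtain r where r: "strict_mono (r :: nat \<Rightarrow> nat)"
      "\<And>n. \<exists>g\<in>Mat (r n). mdist g \<le> c0 \<and> g \<noteq> mone" by auto
    have "\<exists>h\<in>Mat (r n). c0 \<le> mdist h \<and> mdist h \<le> 3 * c0" for n
    proof -
      obtain g where g: "g \<in> Mat (r n)" "mdist g \<le> c0" "g \<noteq> mone" using r(2) by blast
      define sq where "sq k = ((\<lambda>h. mmul h h) ^^ k) g" for k
      have sq0: "sq 0 = g" and sqS: "sq (Suc k) = mmul (sq k) (sq k)" for k by (simp_all add: sq_def)
      have sqM: "sq k \<in> Mat (r n)" for k by (induction k) (simp_all add: sq0 sqS g(1) Mat_mmul)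
      have m0: "0 < mdist g" using mdist_nonneg[of g] mdist_eq_0[of g] g(3) by linarith
      have sqb: "mdist (sq (Suc k)) \<le> 3 * c0 \<and> (3 / 2) * mdist (sq k) \<le> mdist (sq (Suc k))" if "mdist (sq k) \<le> c0" for k
      proof -
        have "mdist (sq k) * mdist (sq k) \<le> mdist (sq k) * (1 / 4)" using that c0(2) mdist_nonneg[of "sq k"] by (intro mult_left_mono) auto
        then have "2 * (mdist (sq k))\<^sup>2 \<le> mdist (sq k) / 2" by (simp add: power2_eq_square)
        then show ?thesis using mdist_mmul_self[of "sq k"] that c0(1) unfolding sqS by linarith
      qed
      have "\<exists>k. c0 < mdist (sq k)"
      proof (rule ccontr)
        assume "\<nexists>k. c0 < mdist (sq k)"
        then have small: "mdist (sq k) \<le> c0" for k by (simp add: not_less)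
        have grow: "(3 / 2) ^ k * mdist g \<le> mdist (sq k)" for k
        proof (induction k)
          case (Suc k) then show ?case using sqb[OF small[of k]] by simp
        qed (simp add: sq0)
        obtain k where "c0 / mdist g < (3 / 2) ^ k" using real_arch_pow[of "3 / 2" "c0 / mdist g"] by auto
        then have "c0 < (3 / 2) ^ k * mdist g" using m0 by (simp add: field_simps)
        then show False using grow[of k] small[of k] by linarith
      qed
      then obtain k where k: "c0 < mdist (sq k)" "\<And>i. i < k \<Longrightarrow> \<not> c0 < mdist (sq i)"
        using exists_least_iff[of "\<lambda>k. c0 < mdist (sq k)"] by blast
      have "k \<noteq> 0" using k(1) g(2) sq0 by (metis not_less)
      then obtain i where i: "k = Suc i" using not0_implies_Suc by blast
      have "mdist (sq i) \<le> c0" using k(2)[of i] i by simp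
      from sqb[OF this] show ?thesis using k(1) sqM[of k] i by (intro bexI[of _ "sq k"]) auto
    qed
    then obtain h where h: "\<And>n. h n \<in> Mat (r n)" "\<And>n. c0 \<le> mdist (h n)" "\<And>n. mdist (h n) \<le> 3 * c0" by metis
    have "\<exists>B. \<forall>g\<in>SL2. hdist (A y0) (mob g (A y0)) \<le> s \<longrightarrow> norm g \<le> B" by (rule SL2_bounded_displacement[OF Au Au])
    then obtain B where B: "\<And>g. g \<in> SL2 \<Longrightarrow> hdist (A y0) (mob g (A y0)) \<le> s \<Longrightarrow> norm g \<le> B" by blast
    have "norm (h n) \<le> B" for n
    proof (rule B[OF Mat_SL2[OF h(1)]])
      have "mdist (h n) \<le> e" using h(3)[of n] c0(3) by linarith
      then show "hdist (A y0) (mob (h n) (A y0)) \<le> s" using e(2)[OF Mat_SL2[OF h(1)]] less_imp_le by blast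
    qed
    then obtain h0 r' where h0: "h0 \<in> SL2" "strict_mono (r' :: nat \<Rightarrow> nat)" "(\<lambda>n. h (r' n)) \<longlonglongrightarrow> h0"
      using bounded_seq_SL2[of h B, OF Mat_SL2[OF h(1)]] by blast
    have mono: "strict_mono (\<lambda>n. r (r' n))" using strict_mono_o[OF r(1) h0(2)] by (simp add: o_def)
    obtain \<gamma> where \<gamma>: "\<gamma> \<in> G" "\<forall>y\<in>upper. mob h0 (A y) = A (\<gamma> y)"
      using Mat_limit(2)[OF mono, of "\<lambda>n. h (r' n)" h0] h(1) h0(3) by blast
    have ml: "c0 \<le> mdist h0" "mdist h0 \<le> 3 * c0"
      using LIMSEQ_le_const[OF tendsto_mdist[OF h0(3)]] LIMSEQ_le_const2[OF tendsto_mdist[OF h0(3)]] h by auto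
    \<comment> \<open>The limit moves \<open>y0\<close> within its orbit by less than the isometric
      radius, so it fixes this regular point and acts trivially. Its matrix is then plus or minus
      the identity, with \<open>mdist\<close> 0 or 2, and not between \<open>c0\<close> and
      3/4.\<close>
    have \<gamma>u: "\<gamma> y0 \<in> upper" by (rule N.in_upper[OF \<gamma>(1) y0u])
    have "hdist (A y0) (A (\<gamma> y0)) < s" using e(2)[OF h0(1)] ml(2) c0(3) \<gamma>(2) y0u by simp
    then have d: "hdist y0 (\<gamma> y0) < s" using hiso_hdist[OF A y0u \<gamma>u] by simp
    have "hdist y0 (\<gamma> y0) = qdist (orb G y0) (orb G (\<gamma> y0))" using s(2)[OF y0u \<gamma>u] d s(1) y0u by simp
    also have "\<dots> = 0" using N.orb_apply[OF \<gamma>(1) y0u] y0u by simp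
    finally have "\<gamma> y0 = y0" using y0u \<gamma>u by simp
    then have \<gamma>id: "\<And>z. z \<in> upper \<Longrightarrow> \<gamma> z = z" using y0 \<gamma>(1) unfolding N.regular_def by blast
    have "mob h0 w = w" if wu: "w \<in> upper" for w
    proof -
      obtain y where y: "y \<in> upper" "A y = w" using hiso_surj[OF A wu] by blast
      then show ?thesis using \<gamma>(2) \<gamma>id[OF y(1)] by metis
    qed
    then have "h0 = mone \<or> h0 = mneg mone" by (rule mob_eq_id[OF h0(1)])
    then show False using ml c0 mdist_eq_0[of mone] mdist_mneg_one by auto
  qed
  then show ?thesis using c0(1) by blast
qed

lemma group_eq_of_regular:
  assumes "N.regular y0" "\<gamma> \<in> G" "\<sigma> \<in> G" "\<gamma> y0 = \<sigma> y0" shows "\<gamma> = \<sigma>"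
proof (rule N.group_ext[OF assms(2,3)])
  fix z assume z: "z \<in> upper"
  have y0u: "y0 \<in> upper" using assms(1) by (simp add: N.regular_def)
  define \<tau> where "\<tau> = compose upper (N.ginv \<sigma>) \<gamma>"
  have \<tau>: "\<tau> \<in> G" unfolding \<tau>_def by (rule N.compose_in[OF N.ginv_in[OF assms(3)] assms(2)])
  have "\<tau> y0 = y0" unfolding \<tau>_def using N.compose_apply[OF y0u, of "N.ginv \<sigma>" \<gamma>] assms(4) N.ginv_left[OF assms(3) y0u] by simp
  then have "\<tau> z = z" using assms(1) \<tau> z unfolding N.regular_def by blast
  then have "N.ginv \<sigma> (\<gamma> z) = z" unfolding \<tau>_def using N.compose_apply[OF z, of "N.ginv \<sigma>" \<gamma>] by simp
  then show "\<gamma> z = \<sigma> z" using N.ginv_right[OF assms(3) N.in_upper[OF assms(2) z]] by simp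
qed

text \<open>For a regular \<open>y0\<close> take the element of \<open>Mat j\<close> that brings
  \<open>A y0\<close> closest to \<open>A (\<sigma> y0)\<close>; the distance tends to 0 since both
  points have the same image under \<open>J\<close>. By \<open>Mat_limit\<close> every cluster point
  comes from an element of \<open>G\<close>, which agrees with \<open>\<sigma>\<close> at
  \<open>y0\<close> and therefore everywhere.\<close>

lemma approximating_elements:
  assumes \<sigma>: "\<sigma> \<in> G"
  shows "\<exists>g. (\<forall>j. g j \<in> Mat j) \<and> (\<forall>y\<in>upper. (\<lambda>j. mob (g j) (A y)) \<longlonglongrightarrow> A (\<sigma> y))"
proof -
  obtain y0 where y0: "N.regular y0" using N.regular_dense[of \<i> 1] by auto
  then have y0u: "y0 \<in> upper" by (simp add: N.regular_def)
  have \<sigma>u: "\<sigma> y0 \<in> upper" by (rule N.in_upper[OF \<sigma> y0u])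
  have Au: "A y0 \<in> upper" "A (\<sigma> y0) \<in> upper" by (rule hiso_upper[OF A y0u] hiso_upper[OF A \<sigma>u])+
  have JJ: "qdist (J (A (\<sigma> y0))) (J (A y0)) = 0" using JA[OF y0u] JA[OF \<sigma>u] N.orb_apply[OF \<sigma> y0u] y0u by simp
  have "\<exists>g\<in>Mat j. hdist (A (\<sigma> y0)) (mob g (A y0)) = qdist (P j (A (\<sigma> y0))) (P j (A y0))" for j
  proof -
    have u: "frame j (A (\<sigma> y0)) \<in> upper" "frame j (A y0) \<in> upper" using mob_upper[OF aff_c] Au by blast+
    obtain \<gamma> where \<gamma>: "\<gamma> \<in> H j" "qdist (P j (A (\<sigma> y0))) (P j (A y0)) = hdist (frame j (A (\<sigma> y0))) (\<gamma> (frame j (A y0)))"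
      unfolding P_eq using fuchsian_group.qdist_attained[OF fH u] by blast
    obtain g where g: "g \<in> Mat j" "\<forall>w\<in>upper. frame j (mob g w) = \<gamma> (frame j w)" using Mat_rep[OF \<gamma>(1)] by blast
    have "hdist (frame j (A (\<sigma> y0))) (frame j (mob g (A y0))) = hdist (A (\<sigma> y0)) (mob g (A y0))"
      by (rule hdist_mob[OF aff_c Au(2) mob_upper[OF Mat_SL2[OF g(1)] Au(1)]])
    then have "hdist (A (\<sigma> y0)) (mob g (A y0)) = qdist (P j (A (\<sigma> y0))) (P j (A y0))" using \<gamma>(2) g(2) Au(1) by simp
    then show ?thesis using g(1) by blast
  qed
  then obtain g where g: "\<And>j. g j \<in> Mat j" "\<And>j. hdist (A (\<sigma> y0)) (mob (g j) (A y0)) = qdist (P j (A (\<sigma> y0))) (P j (A y0))" by metis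
  have "(\<lambda>j. hdist (A (\<sigma> y0)) (mob (g j) (A y0))) \<longlonglongrightarrow> 0"
    unfolding g(2) using P_lim2[OF Au(2,1)] JJ by simp
  then have lim0: "(\<lambda>j. mob (g j) (A y0)) \<longlonglongrightarrow> A (\<sigma> y0)"
    by (rule hdist_tendsto_0[OF _ Au(2)]) (use mob_upper[OF Mat_SL2[OF g(1)] Au(1)] in simp)
  have bdd: "\<exists>K. \<forall>j. hdist (A (\<sigma> y0)) (mob (g j) (A y0)) \<le> K"
  proof -
    have "qdist (P j (A (\<sigma> y0))) (P j (A y0)) \<le> hdist (A (\<sigma> y0)) (A y0)" for j by (rule P_le[OF Au(2,1)])
    then show ?thesis unfolding g(2) by blast
  qed
  then obtain K where K: "\<And>j. hdist (A (\<sigma> y0)) (mob (g j) (A y0)) \<le> K" by blast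
  obtain B where B: "\<And>g. g \<in> SL2 \<Longrightarrow> hdist (A (\<sigma> y0)) (mob g (A y0)) \<le> K \<Longrightarrow> norm g \<le> B"
    using SL2_bounded_displacement[OF Au(2,1), of K] by blast
  have nB: "norm (g j) \<le> B" for j by (rule B[OF Mat_SL2[OF g(1)] K])
  have "(\<lambda>j. mob (g j) (A y)) \<longlonglongrightarrow> A (\<sigma> y)" if y: "y \<in> upper" for y
  proof (rule ccontr)
    assume "\<not> ?thesis"
    then obtain e where e: "e > 0" "\<not> (\<forall>\<^sub>F j in sequentially. dist (mob (g j) (A y)) (A (\<sigma> y)) < e)"
      unfolding tendsto_iff by blast
    from not_eventually_sequentiallyD[OF e(2)] obtain r where r: "strict_mono (r :: nat \<Rightarrow> nat)"
      "\<And>n. \<not> dist (mob (g (r n)) (A y)) (A (\<sigma> y)) < e" by blast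
    obtain g0 r' where g0: "g0 \<in> SL2" "strict_mono (r' :: nat \<Rightarrow> nat)" "(\<lambda>n. g (r (r' n))) \<longlonglongrightarrow> g0"
      using bounded_seq_SL2[of "\<lambda>n. g (r n)" B, OF Mat_SL2[OF g(1)] nB] by blast
    have mono: "strict_mono (\<lambda>n. r (r' n))" using strict_mono_o[OF r(1) g0(2)] by (simp add: o_def)
    obtain \<gamma> where \<gamma>: "\<gamma> \<in> G" "\<forall>y\<in>upper. mob g0 (A y) = A (\<gamma> y)"
      using Mat_limit(2)[OF mono, of "\<lambda>n. g (r (r' n))" g0] g(1) g0(3) by blast
    have "(\<lambda>n. mob (g (r (r' n))) (A y0)) \<longlonglongrightarrow> mob g0 (A y0)" by (rule tendsto_mob[OF g0(3) tendsto_const g0(1) Au(1)])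
    moreover have "(\<lambda>n. mob (g (r (r' n))) (A y0)) \<longlonglongrightarrow> A (\<sigma> y0)"
      using LIMSEQ_subseq_LIMSEQ[OF lim0 mono] by (simp add: o_def)
    ultimately have "mob g0 (A y0) = A (\<sigma> y0)" by (rule LIMSEQ_unique)
    then have "A (\<gamma> y0) = A (\<sigma> y0)" using \<gamma>(2) y0u by simp
    then have "hdist (\<gamma> y0) (\<sigma> y0) = 0" using hiso_hdist[OF A N.in_upper[OF \<gamma>(1) y0u] \<sigma>u] by simp
    then have "\<gamma> y0 = \<sigma> y0" using N.in_upper[OF \<gamma>(1) y0u] \<sigma>u by simp
    then have "\<gamma> = \<sigma>" by (rule group_eq_of_regular[OF y0 \<gamma>(1) \<sigma>])
    then have "mob g0 (A y) = A (\<sigma> y)" using \<gamma>(2) y by simp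
    then have "(\<lambda>n. mob (g (r (r' n))) (A y)) \<longlonglongrightarrow> A (\<sigma> y)"
      using tendsto_mob[OF g0(3) tendsto_const g0(1) hiso_upper[OF A y]] by simp
    then have "\<forall>\<^sub>F n in sequentially. dist (mob (g (r (r' n))) (A y)) (A (\<sigma> y)) < e" by (rule tendstoD[OF _ e(1)])
    then show False using r(2) eventually_happens'[OF sequentially_bot] by blast
  qed
  then show ?thesis using g(1) by blast
qed

definition appr :: "(complex \<Rightarrow> complex) \<Rightarrow> nat \<Rightarrow> mat4" where
  "appr \<sigma> = (SOME g. (\<forall>j. g j \<in> Mat j) \<and> (\<forall>y\<in>upper. (\<lambda>j. mob (g j) (A y)) \<longlonglongrightarrow> A (\<sigma> y)))"

lemma appr:
  assumes "\<sigma> \<in> G"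
  shows "appr \<sigma> j \<in> Mat j" "y \<in> upper \<Longrightarrow> (\<lambda>j. mob (appr \<sigma> j) (A y)) \<longlonglongrightarrow> A (\<sigma> y)"
  using someI_ex[OF approximating_elements[OF assms]] unfolding appr_def[symmetric] by blast+

text \<open>A sequence of counterexamples is bounded and clusters at the conjugate by
  \<open>A\<close> of some \<open>\<sigma>\<close> with \<open>hdist x (\<sigma> y) \<le> R\<close>;
  the matrices \<open>appr \<sigma>\<close> cluster at the same map. The quotient of the two tends
  to plus or minus the identity, and \<open>no_small_elements\<close> makes it equal to this
  eventually.\<close>

lemma exhaustion:
  assumes x: "x \<in> upper" "y \<in> upper" and u: "\<And>j. u j \<in> upper" "u \<longlonglongrightarrow> A x" and v: "\<And>j. v j \<in> upper" "v \<longlonglongrightarrow> A y"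
  shows "\<forall>\<^sub>F j in sequentially. \<forall>g\<in>Mat j. hdist (u j) (mob g (v j)) \<le> R \<longrightarrow>
     (\<exists>\<sigma>\<in>G. hdist x (\<sigma> y) \<le> R \<and> (\<forall>w\<in>upper. mob g w = mob (appr \<sigma> j) w))"
proof (rule ccontr)
  assume "\<not> ?thesis"
  from not_eventually_sequentiallyD[OF this] obtain r where r: "strict_mono (r :: nat \<Rightarrow> nat)"
    "\<And>n. \<exists>g\<in>Mat (r n). hdist (u (r n)) (mob g (v (r n))) \<le> R \<and>
       \<not> (\<exists>\<sigma>\<in>G. hdist x (\<sigma> y) \<le> R \<and> (\<forall>w\<in>upper. mob g w = mob (appr \<sigma> (r n)) w))" by auto
  then obtain g where g: "\<And>n. g n \<in> Mat (r n)" "\<And>n. hdist (u (r n)) (mob (g n) (v (r n))) \<le> R"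
    "\<And>n. \<not> (\<exists>\<sigma>\<in>G. hdist x (\<sigma> y) \<le> R \<and> (\<forall>w\<in>upper. mob (g n) w = mob (appr \<sigma> (r n)) w))" by metis
  have Ax: "A x \<in> upper" "A y \<in> upper" using hiso_upper[OF A] x by blast+
  have ulim: "(\<lambda>n. u (r n)) \<longlonglongrightarrow> A x" and vlim: "(\<lambda>n. v (r n)) \<longlonglongrightarrow> A y"
    using LIMSEQ_subseq_LIMSEQ[OF u(2) r(1)] LIMSEQ_subseq_LIMSEQ[OF v(2) r(1)] by (simp_all add: o_def)
  have "(\<lambda>n. hdist (A x) (u (r n)) + hdist (v (r n)) (A y)) \<longlonglongrightarrow> hdist (A x) (A x) + hdist (A y) (A y)"
    by (intro tendsto_add tendsto_hdist ulim vlim tendsto_const Ax always_eventually allI u v)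
  then have "Bseq (\<lambda>n. hdist (A x) (u (r n)) + hdist (v (r n)) (A y))" by (intro convergent_imp_Bseq) (auto simp: convergent_def)
  then obtain K where K: "\<And>n. norm (hdist (A x) (u (r n)) + hdist (v (r n)) (A y)) \<le> K" by (auto simp: Bseq_def)
  have gu: "mob (g n) w \<in> upper" if "w \<in> upper" for n w by (rule mob_upper[OF Mat_SL2[OF g(1)] that])
  have "hdist (A x) (mob (g n) (A y)) \<le> K + R" for n
  proof -
    have "hdist (A x) (mob (g n) (A y)) \<le> hdist (A x) (u (r n)) + hdist (u (r n)) (mob (g n) (v (r n))) + hdist (mob (g n) (v (r n))) (mob (g n) (A y))"
      using hdist_triangle[OF Ax(1) u(1)[of "r n"] gu[OF Ax(2), of n]]
        hdist_triangle[OF u(1)[of "r n"] gu[OF v(1)[of "r n"], of n] gu[OF Ax(2), of n]] by linarith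
    also have "hdist (mob (g n) (v (r n))) (mob (g n) (A y)) = hdist (v (r n)) (A y)" by (rule hdist_mob[OF Mat_SL2[OF g(1)] v(1) Ax(2)])
    finally show ?thesis using K[of n] g(2)[of n] by simp
  qed
  then have "\<exists>B. \<forall>n. norm (g n) \<le> B" using SL2_bounded_displacement[OF Ax, of "K + R"] Mat_SL2[OF g(1)] by blast
  then obtain B where "\<And>n. norm (g n) \<le> B" by blast
  then obtain g0 r1 where g0: "g0 \<in> SL2" "strict_mono (r1 :: nat \<Rightarrow> nat)" "(\<lambda>n. g (r1 n)) \<longlonglongrightarrow> g0"
    using bounded_seq_SL2[of g B, OF Mat_SL2[OF g(1)]] by blast
  have mono1: "strict_mono (\<lambda>n. r (r1 n))" using strict_mono_o[OF r(1) g0(2)] by (simp add: o_def)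
  obtain \<sigma> where \<sigma>: "\<sigma> \<in> G" "\<And>y. y \<in> upper \<Longrightarrow> mob g0 (A y) = A (\<sigma> y)"
    using Mat_limit(2)[OF mono1, of "\<lambda>n. g (r1 n)" g0] g(1) g0(3) by blast
  have \<sigma>y: "\<sigma> y \<in> upper" by (rule N.in_upper[OF \<sigma>(1) x(2)])
  have l1: "(\<lambda>n. u (r (r1 n))) \<longlonglongrightarrow> A x" "(\<lambda>n. v (r (r1 n))) \<longlonglongrightarrow> A y"
    using LIMSEQ_subseq_LIMSEQ[OF ulim g0(2)] LIMSEQ_subseq_LIMSEQ[OF vlim g0(2)] by (simp_all add: o_def)
  have l2: "(\<lambda>n. mob (g (r1 n)) (v (r (r1 n)))) \<longlonglongrightarrow> mob g0 (A y)" by (rule tendsto_mob[OF g0(3) l1(2) g0(1) Ax(2)])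
  have "(\<lambda>n. hdist (u (r (r1 n))) (mob (g (r1 n)) (v (r (r1 n))))) \<longlonglongrightarrow> hdist (A x) (mob g0 (A y))"
    by (intro tendsto_hdist l1 l2 Ax mob_upper[OF g0(1)] always_eventually allI u gu v)
  then have "hdist (A x) (mob g0 (A y)) \<le> R" by (rule LIMSEQ_le_const2) (use g(2) in blast)
  then have dR: "hdist x (\<sigma> y) \<le> R" using \<sigma>(2)[OF x(2)] hiso_hdist[OF A x(1) \<sigma>y] by simp
  define h where "h n = appr \<sigma> (r (r1 n))" for n
  have hM: "h n \<in> Mat (r (r1 n))" for n unfolding h_def by (rule appr(1)[OF \<sigma>(1)])
  have hlim: "(\<lambda>n. mob (h n) (A w)) \<longlonglongrightarrow> A (\<sigma> w)" if "w \<in> upper" for w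
    unfolding h_def using LIMSEQ_subseq_LIMSEQ[OF appr(2)[OF \<sigma>(1) that] mono1] by (simp add: o_def)
  have "(\<lambda>n. hdist (A (\<sigma> y)) (mob (h n) (A y))) \<longlonglongrightarrow> hdist (A (\<sigma> y)) (A (\<sigma> y))"
    by (intro tendsto_hdist hlim x tendsto_const hiso_upper[OF A] \<sigma>y always_eventually allI mob_upper[OF Mat_SL2[OF hM]])
  then have "Bseq (\<lambda>n. hdist (A (\<sigma> y)) (mob (h n) (A y)))" by (intro convergent_imp_Bseq) (auto simp: convergent_def)
  then obtain K' where K': "\<And>n. norm (hdist (A (\<sigma> y)) (mob (h n) (A y))) \<le> K'" by (auto simp: Bseq_def)
  have "hdist (A (\<sigma> y)) (mob (h n) (A y)) \<le> K'" for n using K'[of n] by simp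
  then have "\<exists>B. \<forall>n. norm (h n) \<le> B"
    using SL2_bounded_displacement[OF hiso_upper[OF A \<sigma>y] Ax(2), of K'] Mat_SL2[OF hM] by blast
  then obtain B' where "\<And>n. norm (h n) \<le> B'" by blast
  then obtain h0 r2 where h0: "h0 \<in> SL2" "strict_mono (r2 :: nat \<Rightarrow> nat)" "(\<lambda>n. h (r2 n)) \<longlonglongrightarrow> h0"
    using bounded_seq_SL2[of h B', OF Mat_SL2[OF hM]] by blast
  have h0A: "mob h0 (A w) = A (\<sigma> w)" if w: "w \<in> upper" for w
  proof (rule LIMSEQ_unique)
    show "(\<lambda>n. mob (h (r2 n)) (A w)) \<longlonglongrightarrow> mob h0 (A w)" by (rule tendsto_mob[OF h0(3) tendsto_const h0(1) hiso_upper[OF A w]])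
    show "(\<lambda>n. mob (h (r2 n)) (A w)) \<longlonglongrightarrow> A (\<sigma> w)" using LIMSEQ_subseq_LIMSEQ[OF hlim[OF w] h0(2)] by (simp add: o_def)
  qed
  have gh: "mob g0 w = mob h0 w" if w: "w \<in> upper" for w
  proof -
    obtain z where z: "z \<in> upper" "A z = w" using hiso_surj[OF A w] by blast
    then show ?thesis using h0A[OF z(1)] \<sigma>(2)[OF z(1)] by simp
  qed
  define k where "k n = mmul (minv (g (r1 (r2 n)))) (h (r2 n))" for n
  define k0 where "k0 = mmul (minv g0) h0"
  have kM: "k n \<in> Mat (r (r1 (r2 n)))" for n unfolding k_def by (rule Mat_mmul[OF Mat_minv[OF g(1)] hM])
  have glim: "(\<lambda>n. g (r1 (r2 n))) \<longlonglongrightarrow> g0" using LIMSEQ_subseq_LIMSEQ[OF g0(3) h0(2)] by (simp add: o_def)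
  have mm: "mmul (minv p) q = (comp4 p * comp1 q - comp2 p * comp3 q, comp4 p * comp2 q - comp2 p * comp4 q,
      comp1 p * comp3 q - comp3 p * comp1 q, comp1 p * comp4 q - comp3 p * comp2 q)" for p q
    by (cases p; cases q) simp
  have klim: "k \<longlonglongrightarrow> k0" unfolding k_def[abs_def] k0_def mm
    by (intro tendsto_Pair tendsto_diff tendsto_mult tendsto_comp glim h0(3))
  have k0S: "k0 \<in> SL2" unfolding k0_def by (rule mmul_SL2[OF minv_SL2[OF g0(1)] h0(1)])
  have "mob k0 w = w" if w: "w \<in> upper" for w
    unfolding k0_def mob_mmul[OF minv_SL2[OF g0(1)] h0(1) w] gh[OF w, symmetric] by (rule mob_minv(2)[OF g0(1) w])
  then have k0: "k0 = mone \<or> k0 = mneg mone" by (rule mob_eq_id[OF k0S])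
  obtain c0 where c0: "c0 > 0" "\<forall>\<^sub>F j in sequentially. \<forall>g\<in>Mat j. mdist g \<le> c0 \<longrightarrow> g = mone" using no_small_elements by blast
  have mono2: "strict_mono (\<lambda>n. r (r1 (r2 n)))" using strict_mono_o[OF mono1 h0(2)] by (simp add: o_def)
  \<comment> \<open>The sign is adjusted so that the quotient tends to \<open>mone\<close>.\<close>
  define k' where "k' n = (if k0 = mone then k n else mneg (k n))" for n
  have k'M: "k' n \<in> Mat (r (r1 (r2 n)))" for n using kM[of n] Mat_mneg[OF kM] by (simp add: k'_def)
  have "(\<lambda>n. mdist (k' n)) \<longlonglongrightarrow> 0"
  proof (cases "k0 = mone")
    case True
    then show ?thesis using tendsto_mdist[OF klim] mdist_eq_0[of mone] by (simp add: k'_def)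
  next
    case False
    have "(\<lambda>n. mneg (k n)) \<longlonglongrightarrow> mneg k0" unfolding mneg_def by (intro tendsto_Pair tendsto_minus tendsto_comp klim)
    moreover have "mneg k0 = mone" using k0 False by (simp add: mneg_def mone_def)
    ultimately show ?thesis using tendsto_mdist[of "\<lambda>n. mneg (k n)" mone] mdist_eq_0[of mone] False by (simp add: k'_def)
  qed
  from order_tendstoD(2)[OF this c0(1)] eventually_subseq[OF mono2 c0(2)]
  have "\<forall>\<^sub>F n in sequentially. k' n = mone" by eventually_elim (use k'M less_imp_le in blast)
  then obtain n where n: "k' n = mone" using eventually_happens'[OF sequentially_bot] by blast
  define m where "m = r1 (r2 n)"
  have "mob (g m) w = mob (appr \<sigma> (r m)) w" if w: "w \<in> upper" for w
  proof -
    have "mob (k n) w = mob (k' n) w" by (cases "k0 = mone") (simp_all add: k'_def mob_mneg del: mob.simps)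
    also have "\<dots> = w" unfolding n mone_def by (rule mob_one)
    finally have "mob (k n) w = w" .
    then have "mob (minv (g m)) (mob (appr \<sigma> (r m)) w) = w"
      unfolding k_def mob_mmul[OF minv_SL2[OF Mat_SL2[OF g(1)]] Mat_SL2[OF hM] w] by (simp add: h_def m_def del: mob.simps)
    then have "mob (g m) (mob (minv (g m)) (mob (appr \<sigma> (r m)) w)) = mob (g m) w" by (rule arg_cong)
    then show ?thesis using mob_minv(1)[OF Mat_SL2[OF g(1)] mob_upper[OF Mat_SL2[OF appr(1)[OF \<sigma>(1)]] w], of m "r m"] by simp
  qed
  then show False using g(3)[of m] \<sigma>(1) dR by blast
qed

end

section \<open>Hyperbolic area, its invariance, and packing of orbits\<close>

lemma measure_preservingI:
  assumes t: "t \<in> M \<rightarrow>\<^sub>M M"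
    and eq: "\<And>F. F \<in> borel_measurable M \<Longrightarrow> (\<integral>\<^sup>+x. F (t x) \<partial>M) = (\<integral>\<^sup>+x. F x \<partial>M)"
  shows "distr M M t = M"
proof (rule measure_eqI)
  fix A assume "A \<in> sets (distr M M t)"
  then have A: "A \<in> sets M" by simp
  have "emeasure (distr M M t) A = (\<integral>\<^sup>+x. indicator A x \<partial>distr M M t)" using A by simp
  also have "\<dots> = (\<integral>\<^sup>+x. indicator A (t x) \<partial>M)" by (rule nn_integral_distr[OF t]) (use A in simp)
  also have "\<dots> = (\<integral>\<^sup>+x. indicator A x \<partial>M)" by (rule eq) (use A in simp)
  also have "\<dots> = emeasure M A" using A by simp
  finally show "emeasure (distr M M t) A = emeasure M A" .
qed simp

abbreviation plane :: "(real \<times> real) measure" where "plane \<equiv> lborel \<Otimes>\<^sub>M lborel"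

lemma shear_preserves:
  assumes f[measurable]: "f \<in> borel_measurable borel"
  shows "distr plane plane (\<lambda>x. (fst x + f (snd x), snd x)) = plane"
proof (rule measure_preservingI)
  fix F :: "real \<times> real \<Rightarrow> ennreal" assume F[measurable]: "F \<in> borel_measurable plane"
  have "(\<integral>\<^sup>+x. F (fst x + f (snd x), snd x) \<partial>plane) = (\<integral>\<^sup>+s. (\<integral>\<^sup>+r. F (r + f s, s) \<partial>lborel) \<partial>lborel)"
    by (subst lborel_pair.nn_integral_snd[symmetric]) simp_all
  also have "\<dots> = (\<integral>\<^sup>+s. (\<integral>\<^sup>+r. F (r, s) \<partial>lborel) \<partial>lborel)"
  proof (rule nn_integral_cong)
    fix s :: real
    show "(\<integral>\<^sup>+r. F (r + f s, s) \<partial>lborel) = (\<integral>\<^sup>+r. F (r, s) \<partial>lborel)"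
      using nn_integral_real_affine[of "\<lambda>r. F (r, s)" 1 "f s"] by (simp add: add.commute)
  qed
  also have "\<dots> = (\<integral>\<^sup>+x. F x \<partial>plane)" by (rule lborel_pair.nn_integral_snd[OF F])
  finally show "(\<integral>\<^sup>+x. F (fst x + f (snd x), snd x) \<partial>plane) = (\<integral>\<^sup>+x. F x \<partial>plane)" .
qed measurable

lemma shift_preserves: "distr plane plane (\<lambda>x. (fst x, snd x + b)) = plane"
proof (rule measure_preservingI)
  fix F :: "real \<times> real \<Rightarrow> ennreal" assume F[measurable]: "F \<in> borel_measurable plane"
  have "(\<integral>\<^sup>+x. F (fst x, snd x + b) \<partial>plane) = (\<integral>\<^sup>+r. (\<integral>\<^sup>+s. F (r, s + b) \<partial>lborel) \<partial>lborel)"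
    by (subst lborel.nn_integral_fst[symmetric]) simp_all
  also have "\<dots> = (\<integral>\<^sup>+r. (\<integral>\<^sup>+s. F (r, s) \<partial>lborel) \<partial>lborel)"
  proof (rule nn_integral_cong)
    fix r :: real
    show "(\<integral>\<^sup>+s. F (r, s + b) \<partial>lborel) = (\<integral>\<^sup>+s. F (r, s) \<partial>lborel)"
      using nn_integral_real_affine[of "\<lambda>s. F (r, s)" 1 b] by (simp add: add.commute)
  qed
  also have "\<dots> = (\<integral>\<^sup>+x. F x \<partial>plane)" by (rule lborel.nn_integral_fst[OF F])
  finally show "(\<integral>\<^sup>+x. F (fst x, snd x + b) \<partial>plane) = (\<integral>\<^sup>+x. F x \<partial>plane)" .
qed measurable

lemma flip_preserves:
  assumes f[measurable]: "f \<in> borel_measurable borel"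
  shows "distr plane plane (\<lambda>x. (- fst x, f (fst x) - snd x)) = plane"
proof (rule measure_preservingI)
  fix F :: "real \<times> real \<Rightarrow> ennreal" assume F[measurable]: "F \<in> borel_measurable plane"
  have "(\<integral>\<^sup>+x. F (- fst x, f (fst x) - snd x) \<partial>plane) = (\<integral>\<^sup>+r. (\<integral>\<^sup>+s. F (- r, f r - s) \<partial>lborel) \<partial>lborel)"
    by (subst lborel.nn_integral_fst[symmetric]) simp_all
  also have "\<dots> = (\<integral>\<^sup>+r. (\<integral>\<^sup>+s. F (- r, s) \<partial>lborel) \<partial>lborel)"
  proof (rule nn_integral_cong)
    fix r :: real
    show "(\<integral>\<^sup>+s. F (- r, f r - s) \<partial>lborel) = (\<integral>\<^sup>+s. F (- r, s) \<partial>lborel)"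
      using nn_integral_real_affine[of "\<lambda>s. F (- r, s)" "-1" "f r"] by simp
  qed
  also have "\<dots> = (\<integral>\<^sup>+r. (\<integral>\<^sup>+s. F (r, s) \<partial>lborel) \<partial>lborel)"
    using nn_integral_real_affine[of "\<lambda>r. (\<integral>\<^sup>+s. F (r, s) \<partial>lborel)" "-1" 0] by simp
  also have "\<dots> = (\<integral>\<^sup>+x. F x \<partial>plane)" by (rule lborel.nn_integral_fst[OF F])
  finally show "(\<integral>\<^sup>+x. F (- fst x, f (fst x) - snd x) \<partial>plane) = (\<integral>\<^sup>+x. F x \<partial>plane)" .
qed measurable

text \<open>In the coordinates \<open>z = exp s * (\<tau> + \<i>)\<close> the hyperbolic area is Lebesgue measure, and
  translations, dilations and the inversion \<open>z \<mapsto> - 1 / z\<close> become shears, shifts and flips.\<close>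

definition hp :: "real \<times> real \<Rightarrow> complex" where
  "hp x = of_real (exp (snd x)) * (of_real (fst x) + \<i>)"

definition hm :: "complex measure" where
  "hm = distr plane borel hp"

lemma Im_hp [simp]: "Im (hp x) = exp (snd x)" and Re_hp [simp]: "Re (hp x) = exp (snd x) * fst x"
  by (simp_all add: hp_def)

lemma hp_upper [simp]: "hp x \<in> upper" by simp

lemma measurable_hp [measurable]: "hp \<in> borel_measurable plane"
  unfolding hp_def by measurable

lemma space_hm [simp]: "space hm = UNIV" and sets_hm [simp, measurable_cong]: "sets hm = sets borel"
  by (simp_all add: hm_def)

lemma measurable_mob [measurable]: "mob g \<in> borel_measurable borel"
proof -
  obtain a b c d where g: "g = (a, b, c, d)" by (cases g)
  have "mob g = (\<lambda>z. (of_real a * z + of_real b) / (of_real c * z + of_real d))" unfolding g by (rule ext) simp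
  then show ?thesis by simp
qed

lemma measurable_mob_hm [measurable]: "mob g \<in> hm \<rightarrow>\<^sub>M hm"
  using measurable_mob by (simp add: measurable_cong_sets[OF sets_hm sets_hm])

definition hm_inv :: "mat4 \<Rightarrow> bool" where
  "hm_inv g \<longleftrightarrow> distr plane borel (\<lambda>x. mob g (hp x)) = hm"

lemma hm_inv_mmul:
  assumes "hm_inv g" "hm_inv h" "g \<in> SL2" "h \<in> SL2"
  shows "hm_inv (mmul g h)"
proof -
  have "distr plane borel (\<lambda>x. mob (mmul g h) (hp x)) = distr plane borel (\<lambda>x. mob g (mob h (hp x)))"
    by (simp only: mob_mmul[OF assms(3,4) hp_upper])
  also have "\<dots> = distr (distr plane borel (\<lambda>x. mob h (hp x))) borel (mob g)"
    by (subst distr_distr) (simp_all add: o_def)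
  also have "\<dots> = distr plane borel (\<lambda>x. mob g (hp x))"
    using assms(2) unfolding hm_inv_def by (simp add: hm_def distr_distr o_def del: mob.simps)
  finally show ?thesis using assms(1) by (simp add: hm_inv_def)
qed

lemma hm_invI:
  assumes t: "distr plane plane t = plane" "t \<in> plane \<rightarrow>\<^sub>M plane" and eq: "\<And>x. mob g (hp x) = hp (t x)"
  shows "hm_inv g"
proof -
  have "distr plane borel (\<lambda>x. mob g (hp x)) = distr (distr plane plane t) borel hp"
    unfolding eq using t(2) by (subst distr_distr) (simp_all add: o_def)
  then show ?thesis by (simp add: hm_inv_def hm_def t(1))
qed

lemma hm_inv_translation: "hm_inv (1, b, 0, 1)"
proof (rule hm_invI[OF shear_preserves[of "\<lambda>s. b * exp (- s)"]])
  show "mob (1, b, 0, 1) (hp x) = hp (fst x + b * exp (- snd x), snd x)" for x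
    by (simp add: complex_eq_iff algebra_simps exp_minus)
qed simp_all

lemma hm_inv_dilation: assumes "a \<noteq> 0" shows "hm_inv (a, 0, 0, 1 / a)"
proof (rule hm_invI[OF shift_preserves[of "ln (a\<^sup>2)"]])
  fix x
  have "mob (a, 0, 0, 1 / a) (hp x) = of_real (a\<^sup>2) * hp x"
    using assms by (simp add: power2_eq_square field_simps)
  also have "of_real (a\<^sup>2) = complex_of_real (exp (ln (a\<^sup>2)))" using assms by (subst exp_ln) auto
  finally show "mob (a, 0, 0, 1 / a) (hp x) = hp (fst x, snd x + ln (a\<^sup>2))"
    by (simp add: hp_def exp_add)
qed simp

lemma hm_inv_inversion: "hm_inv (0, -1, 1, 0)"
proof (rule hm_invI[OF flip_preserves[of "\<lambda>r. - ln (1 + r\<^sup>2)"]])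
  fix x :: "real \<times> real"
  define Q where "Q = 1 + (fst x)\<^sup>2"
  have Q: "0 < Q" by (simp add: Q_def add_pos_nonneg)
  have "hp (- fst x, - ln Q - snd x) * hp x
      = of_real (exp (- ln Q - snd x) * exp (snd x)) * ((- of_real (fst x) + \<i>) * (of_real (fst x) + \<i>))"
    by (simp add: hp_def mult_ac)
  also have "exp (- ln Q - snd x) * exp (snd x) = 1 / Q" using Q by (simp add: exp_diff exp_minus inverse_eq_divide)
  also have "(- of_real (fst x) + \<i>) * (of_real (fst x) + \<i>) = - of_real Q"
    by (simp add: Q_def algebra_simps power2_eq_square)
  finally have "hp (- fst x, - ln Q - snd x) * hp x = - 1" using Q by simp
  moreover have "hp x \<noteq> 0" using hp_upper[of x] by (metis upper_iff less_irrefl zero_complex.sel(2))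
  ultimately show "mob (0, -1, 1, 0) (hp x) = hp (- fst x, - ln (1 + (fst x)\<^sup>2) - snd x)"
    by (simp add: Q_def field_simps)
qed simp_all

text \<open>Bruhat decomposition: an upper triangular matrix is a translation times a dilation, and
  every other matrix is such a product with one inversion inserted.\<close>

lemma hm_inv_SL2: assumes "g \<in> SL2" shows "hm_inv g"
proof -
  obtain a b c d where g: "g = (a, b, c, d)" by (cases g)
  have det: "a * d - b * c = 1" using assms by (simp add: g)
  show ?thesis
  proof (cases "c = 0")
    case True
    then have ad: "a * d = 1" using det by simp
    then have a0: "a \<noteq> 0" by auto
    then have "d = 1 / a" using ad by (simp add: nonzero_eq_divide_eq mult.commute)
    note a = a0 this
    have "g = mmul (1, a * b, 0, 1) (a, 0, 0, 1 / a)" using True a by (simp add: g)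
    then show ?thesis using a(1) by (simp only:) (intro hm_inv_mmul hm_inv_translation hm_inv_dilation; simp)
  next
    case False
    have eq: "g = mmul (1, a / c, 0, 1) (mmul (0, -1, 1, 0) (mmul (c, 0, 0, 1 / c) (1, d / c, 0, 1)))"
      using False det by (simp add: g field_simps)
    show ?thesis unfolding eq
      by (intro hm_inv_mmul hm_inv_translation hm_inv_dilation hm_inv_inversion mmul_SL2 False) (simp_all add: False)
  qed
qed

lemma distr_hm_mob: assumes "g \<in> SL2" shows "distr hm hm (mob g) = hm"
proof -
  have "distr hm hm (mob g) = distr hm borel (mob g)" by (rule distr_cong) simp_all
  also have "\<dots> = distr plane borel (\<lambda>x. mob g (hp x))" unfolding hm_def by (subst distr_distr) (simp_all add: o_def)
  finally show ?thesis using hm_inv_SL2[OF assms] by (simp add: hm_inv_def)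
qed

lemma nn_integral_hm_mob:
  assumes "g \<in> SL2" "F \<in> borel_measurable hm"
  shows "(\<integral>\<^sup>+w. F (mob g w) \<partial>hm) = (\<integral>\<^sup>+w. F w \<partial>hm)"
  using nn_integral_distr[of "mob g" hm hm F, OF measurable_mob_hm] assms(2) by (simp add: distr_hm_mob[OF assms(1)])

lemma integral_hm_mob:
  fixes F :: "complex \<Rightarrow> 'a :: {banach, second_countable_topology}"
  assumes "g \<in> SL2" "F \<in> borel_measurable hm"
  shows "(\<integral>w. F (mob g w) \<partial>hm) = (\<integral>w. F w \<partial>hm)"
  using integral_distr[OF measurable_mob_hm assms(2), of g] by (simp add: distr_hm_mob[OF assms(1)])

lemma AE_hm_upper: "AE w in hm. w \<in> upper"
  unfolding hm_def by (subst AE_distr_iff) (simp_all add: open_halfspace_Im_gt)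

text \<open>cosh of the hyperbolic distance (\<open>ch_cosh\<close>), as a rational expression that
  is measurable on the whole plane. The kernels below are functions of this variable.\<close>

definition ch :: "complex \<Rightarrow> complex \<Rightarrow> real" where
  "ch z w = 1 + (cmod (z - w))\<^sup>2 / (2 * Im z * Im w)"

lemma ch_cosh: "z \<in> upper \<Longrightarrow> w \<in> upper \<Longrightarrow> ch z w = cosh (hdist z w)"
  by (simp add: ch_def cosh_hdist)

lemma ch_ge_1: "z \<in> upper \<Longrightarrow> w \<in> upper \<Longrightarrow> 1 \<le> ch z w"
  by (simp add: ch_def)

lemma ch_commute: "ch z w = ch w z" by (simp add: ch_def norm_minus_commute mult_ac)

lemma ch_mob: "g \<in> SL2 \<Longrightarrow> z \<in> upper \<Longrightarrow> w \<in> upper \<Longrightarrow> ch (mob g z) (mob g w) = ch z w"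
  using ch_cosh hdist_mob mob_upper by metis

lemma measurable_ch [measurable (raw)]:
  assumes [measurable]: "f \<in> borel_measurable M" "g \<in> borel_measurable M"
  shows "(\<lambda>x. ch (f x) (g x)) \<in> borel_measurable M"
proof -
  have [measurable]: "(\<lambda>x. Im (f x)) \<in> borel_measurable M" "(\<lambda>x. Im (g x)) \<in> borel_measurable M"
    using assms by (simp_all add: borel_measurable_complex_iff)
  show ?thesis unfolding ch_def by measurable
qed

lemma ch_hp: "ch (hp x) (hp y) = cosh (snd x - snd y) + (exp (snd x) * fst x - exp (snd y) * fst y)\<^sup>2 * exp (- snd x - snd y) / 2"
proof -
  define a b where "a = exp (snd x)" and "b = exp (snd y)"
  have ab: "0 < a" "0 < b" by (auto simp: a_def b_def)
  have 1: "cosh (snd x - snd y) = (a / b + b / a) / 2" by (simp add: cosh_def exp_diff a_def b_def)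
  have 2: "exp (- snd x - snd y) = 1 / (a * b)" by (simp add: exp_diff exp_minus a_def b_def field_simps)
  have 3: "ch (hp x) (hp y) = 1 + ((a * fst x - b * fst y)\<^sup>2 + (a - b)\<^sup>2) / (2 * a * b)"
    by (simp add: ch_def cmod_power2 a_def b_def)
  show ?thesis unfolding 1 2 3 a_def[symmetric] b_def[symmetric] using ab
    by (simp add: field_simps) (simp add: power2_eq_square algebra_simps)
qed

lemma nn_integral_inverse_1_plus_square: "(\<integral>\<^sup>+x. ennreal (1 / (1 + x\<^sup>2)) \<partial>lborel) < \<infinity>"
proof -
  have "integrable lborel (\<lambda>x::real. 1 / (1 + x\<^sup>2))"
    using integrable_inverse_1_plus_square by (simp add: set_integrable_def inverse_eq_divide)
  then have "(\<integral>\<^sup>+x. ennreal (norm (1 / (1 + (x::real)\<^sup>2))) \<partial>lborel) < \<infinity>" unfolding integrable_iff_bounded by blast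
  moreover have "norm (1 / (1 + x\<^sup>2)) = 1 / (1 + x\<^sup>2)" for x :: real by (simp add: add_nonneg_nonneg)
  ultimately show ?thesis by simp
qed

lemma cosh_ge_quadratic: "1 + x\<^sup>2 / 2 \<le> cosh (x::real)"
proof -
  have "cosh x = 1 + 2 * (sinh (x / 2))\<^sup>2" using cosh_double[of "x / 2"] by (simp add: cosh_square_eq)
  moreover have "(x / 2)\<^sup>2 \<le> (sinh (x / 2))\<^sup>2"
  proof -
    have "\<bar>x / 2\<bar> \<le> sinh \<bar>x / 2\<bar>" using real_le_x_sinh[of "\<bar>x / 2\<bar>"] by (simp add: sinh_def exp_minus)
    moreover have "sinh \<bar>x / 2\<bar> = \<bar>sinh (x / 2)\<bar>" by (auto simp: abs_if)
    ultimately have "\<bar>x / 2\<bar> \<le> \<bar>sinh (x / 2)\<bar>" by (simp only:)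
    then show ?thesis by (rule abs_le_square_iff[THEN iffD1])
  qed
  ultimately show ?thesis by (simp add: power_divide)
qed

text \<open>For l = ln (1 + r^2) / 2 one has ch = exp l * cosh (s + l). The bound separates the
  variables after a shift of s, so 1 / ch^2 is dominated by a product of two Cauchy densities up to
  constants.\<close>

lemma ch_i_hp_ge: "(1 + (snd x + ln (1 + (fst x)\<^sup>2) / 2)\<^sup>2) * (1 + (fst x)\<^sup>2) \<le> (ch \<i> (hp x))\<^sup>2"
proof -
  define r s q where "r = fst x" and "s = snd x" and "q = 1 + (fst x)\<^sup>2"
  have q: "1 \<le> q" by (simp add: q_def)
  define l where "l = ln q / 2"
  have el: "exp l * exp l = q" using q by (simp add: l_def exp_add[symmetric])
  have "\<i> = hp (0, 0)" by (simp add: hp_def)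
  then have "ch \<i> (hp x) = cosh s + (exp s * r)\<^sup>2 * exp (- s) / 2" using ch_hp[of "(0,0)" x] by (simp add: r_def s_def)
  also have "\<dots> = (exp s * q + exp (- s)) / 2"
    by (simp add: cosh_def q_def r_def[symmetric] power2_eq_square exp_minus field_simps)
  also have "\<dots> = exp l * cosh (s + l)"
    unfolding el[symmetric] by (simp add: cosh_def field_simps flip: exp_add)
  finally have "(ch \<i> (hp x))\<^sup>2 = q * (cosh (s + l))\<^sup>2" using el by (simp add: power_mult_distrib power2_eq_square)
  moreover have "1 + (s + l)\<^sup>2 \<le> (cosh (s + l))\<^sup>2"
  proof -
    have "(1 + (s + l)\<^sup>2 / 2)\<^sup>2 \<le> (cosh (s + l))\<^sup>2" by (rule power_mono[OF cosh_ge_quadratic]) (simp add: add_nonneg_nonneg)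
    moreover have "(1 + (s + l)\<^sup>2 / 2)\<^sup>2 = 1 + (s + l)\<^sup>2 + ((s + l)\<^sup>2 / 2)\<^sup>2" by (simp add: power2_sum)
    ultimately show ?thesis by (smt (verit) zero_le_power2)
  qed
  ultimately have "(1 + (s + l)\<^sup>2) * q \<le> (ch \<i> (hp x))\<^sup>2" using q by (simp add: mult.commute)
  then show ?thesis by (simp add: l_def s_def q_def)
qed

definition area_const :: ennreal where
  "area_const = (\<integral>\<^sup>+w. ennreal (1 / (ch \<i> w)\<^sup>2) \<partial>hm)"

lemma area_const_finite: "area_const < \<infinity>"
proof -
  have le: "ennreal (1 / (ch \<i> (hp (r, s)))\<^sup>2) \<le> ennreal (1 / (1 + r\<^sup>2)) * ennreal (1 / (1 + (ln (1 + r\<^sup>2) / 2 + s)\<^sup>2))" for r s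
  proof -
    have p: "0 < (1 + (ln (1 + r\<^sup>2) / 2 + s)\<^sup>2) * (1 + r\<^sup>2)" by (intro mult_pos_pos add_pos_nonneg) auto
    have "(1 + (ln (1 + r\<^sup>2) / 2 + s)\<^sup>2) * (1 + r\<^sup>2) \<le> (ch \<i> (hp (r, s)))\<^sup>2"
      using ch_i_hp_ge[of "(r, s)"] by (simp add: add.commute)
    then have "1 / (ch \<i> (hp (r, s)))\<^sup>2 \<le> 1 / ((1 + (ln (1 + r\<^sup>2) / 2 + s)\<^sup>2) * (1 + r\<^sup>2))"
      using p by (intro frac_le) auto
    then show ?thesis by (subst ennreal_mult[symmetric]) (auto simp: mult.commute add_nonneg_nonneg intro: ennreal_leI)
  qed
  have "area_const = (\<integral>\<^sup>+x. ennreal (1 / (ch \<i> (hp x))\<^sup>2) \<partial>plane)"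
    unfolding area_const_def hm_def by (subst nn_integral_distr) simp_all
  also have "\<dots> = (\<integral>\<^sup>+r. (\<integral>\<^sup>+s. ennreal (1 / (ch \<i> (hp (r, s)))\<^sup>2) \<partial>lborel) \<partial>lborel)"
    by (subst lborel.nn_integral_fst[symmetric]) simp_all
  also have "\<dots> \<le> (\<integral>\<^sup>+r. (\<integral>\<^sup>+s. ennreal (1 / (1 + r\<^sup>2)) * ennreal (1 / (1 + (ln (1 + r\<^sup>2) / 2 + s)\<^sup>2)) \<partial>lborel) \<partial>lborel)"
    by (intro nn_integral_mono le)
  also have "\<dots> = (\<integral>\<^sup>+r. ennreal (1 / (1 + r\<^sup>2)) * (\<integral>\<^sup>+s. ennreal (1 / (1 + s\<^sup>2)) \<partial>lborel) \<partial>lborel)"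
  proof (rule nn_integral_cong)
    fix r :: real
    have "(\<integral>\<^sup>+s. ennreal (1 / (1 + (ln (1 + r\<^sup>2) / 2 + s)\<^sup>2)) \<partial>lborel) = (\<integral>\<^sup>+s. ennreal (1 / (1 + s\<^sup>2)) \<partial>lborel)"
      using nn_integral_real_affine[of "\<lambda>s. ennreal (1 / (1 + s\<^sup>2))" 1 "ln (1 + r\<^sup>2) / 2"] by simp
    then show "(\<integral>\<^sup>+s. ennreal (1 / (1 + r\<^sup>2)) * ennreal (1 / (1 + (ln (1 + r\<^sup>2) / 2 + s)\<^sup>2)) \<partial>lborel)
        = ennreal (1 / (1 + r\<^sup>2)) * (\<integral>\<^sup>+s. ennreal (1 / (1 + s\<^sup>2)) \<partial>lborel)"
      by (subst nn_integral_cmult) simp_all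
  qed
  also have "\<dots> = (\<integral>\<^sup>+r. ennreal (1 / (1 + r\<^sup>2)) \<partial>lborel) * (\<integral>\<^sup>+s. ennreal (1 / (1 + s\<^sup>2)) \<partial>lborel)"
    by (subst nn_integral_multc) simp_all
  also have "\<dots> < \<infinity>" using nn_integral_inverse_1_plus_square by (simp add: ennreal_mult_less_top)
  finally show ?thesis .
qed

lemma nn_integral_ch: assumes "u \<in> upper" shows "(\<integral>\<^sup>+w. ennreal (1 / (ch u w)\<^sup>2) \<partial>hm) = area_const"
proof -
  have "(\<integral>\<^sup>+w. ennreal (1 / (ch u w)\<^sup>2) \<partial>hm) = (\<integral>\<^sup>+w. ennreal (1 / (ch u (mob (aff u) w))\<^sup>2) \<partial>hm)"
    using nn_integral_hm_mob[OF aff_SL2[OF assms], of "\<lambda>w. ennreal (1 / (ch u w)\<^sup>2)"] by simp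
  also have "\<dots> = (\<integral>\<^sup>+w. ennreal (1 / (ch \<i> w)\<^sup>2) \<partial>hm)"
  proof (rule nn_integral_cong_AE, use AE_hm_upper in eventually_elim)
    case (elim w)
    then show ?case using ch_mob[OF aff_SL2[OF assms], of \<i> w] mob_aff_i[OF assms] by (simp del: mob.simps)
  qed
  finally show ?thesis by (simp add: area_const_def)
qed

text \<open>By Markov's inequality the sets where 1 / ch^2 is bounded below have finite measure. The
  zeros of \<open>ch \<i>\<close> lie outside the half-plane, form a null set and are added
  separately.\<close>

lemma sigma_finite_hm: "sigma_finite_measure hm"
proof
  have iu: "\<i> \<in> upper" by simp
  define A where "A n = {w \<in> space hm. 1 \<le> of_nat n * ennreal (1 / (ch \<i> w)\<^sup>2)}" for n :: nat
  have fin: "emeasure hm (A n) < \<infinity>" for n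
  proof -
    have "emeasure hm (A n) \<le> of_nat n * (\<integral>\<^sup>+w. ennreal (1 / (ch \<i> w)\<^sup>2) * indicator (space hm) w \<partial>hm)"
      unfolding A_def by (rule nn_integral_Markov_inequality) auto
    also have "\<dots> < \<infinity>" using nn_integral_ch[OF iu] area_const_finite of_nat_less_top[of n] by (simp add: ennreal_mult_less_top)
    finally show ?thesis .
  qed
  have "\<Union> (insert {w. ch \<i> w = 0} (range A)) = space hm"
  proof -
    have "w \<in> \<Union> (range A)" if "ch \<i> w \<noteq> 0" for w
    proof -
      obtain n :: nat where n: "(ch \<i> w)\<^sup>2 \<le> real n" using real_arch_simple by blast
      then have "1 \<le> real n * (1 / (ch \<i> w)\<^sup>2)" using that by (simp add: le_divide_eq)
      then have "ennreal 1 \<le> ennreal (real n) * ennreal (1 / (ch \<i> w)\<^sup>2)" unfolding ennreal_mult[symmetric, OF of_nat_0_le_iff zero_le_divide_1_iff[THEN iffD2, OF zero_le_power2]] by (rule ennreal_leI)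
      then show ?thesis by (auto simp: A_def ennreal_of_nat_eq_real_of_nat)
    qed
    then show ?thesis by auto
  qed
  moreover have "emeasure hm {w. ch \<i> w = 0} = 0"
  proof (rule AE_iff_measurable[THEN iffD1])
    show "AE w in hm. ch \<i> w \<noteq> 0" using AE_hm_upper by eventually_elim (use ch_ge_1[OF iu] in force)
  qed auto
  ultimately show "\<exists>A. countable A \<and> A \<subseteq> sets hm \<and> \<Union>A = space hm \<and> (\<forall>a\<in>A. emeasure hm a \<noteq> \<infinity>)"
    using fin by (intro exI[of _ "insert {w. ch \<i> w = 0} (range A)"]) (auto simp: A_def less_top)
qed

lemma hcball_sets [measurable]: "x \<in> upper \<Longrightarrow> hcball x R \<in> sets borel"
  using compact_imp_closed[OF compact_hcball] by simp

lemma emeasure_hcball: assumes "x \<in> upper" shows "emeasure hm (hcball x R) = emeasure hm (hcball \<i> R)"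
proof -
  have iu: "\<i> \<in> upper" by simp
  have "emeasure hm (hcball x R) = (\<integral>\<^sup>+w. indicator (hcball x R) w \<partial>hm)"
    using hcball_sets[OF assms] by simp
  also have "\<dots> = (\<integral>\<^sup>+w. indicator (hcball x R) (mob (aff x) w) \<partial>hm)"
    using nn_integral_hm_mob[OF aff_SL2[OF assms], of "\<lambda>w. indicator (hcball x R) w"] hcball_sets[OF assms] by simp
  also have "\<dots> = (\<integral>\<^sup>+w. indicator (hcball \<i> R) w \<partial>hm)"
  proof (rule nn_integral_cong_AE, use AE_hm_upper in eventually_elim)
    case (elim w)
    then show ?case
      using hdist_mob[OF aff_SL2[OF assms] iu elim] mob_aff_i[OF assms] mob_upper[OF aff_SL2[OF assms] elim]
      by (simp add: hcball_def indicator_def del: mob.simps)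
  qed
  also have "\<dots> = emeasure hm (hcball \<i> R)" using hcball_sets[OF iu] by simp
  finally show ?thesis .
qed

lemma emeasure_hcball_pos: "0 < emeasure hm (hcball \<i> 1)"
proof -
  define U where "U = {x. ch \<i> (hp x) < cosh 1}"
  have cont: "continuous_on UNIV (\<lambda>x. ch \<i> (hp x))"
    unfolding ch_def hp_def by (intro continuous_intros) simp_all
  have "open U" unfolding U_def by (rule open_Collect_less[OF cont continuous_on_const])
  moreover have "(0, 0) \<in> U"
  proof -
    have "hp (0, 0) = \<i>" by (simp add: hp_def)
    moreover have "1 < cosh (1::real)" using cosh_ge_quadratic[of 1] by simp
    ultimately show ?thesis by (simp add: U_def ch_def)
  qed
  ultimately obtain a b where ab: "cbox a b \<subseteq> U" "\<forall>i\<in>Basis. a \<bullet> i < b \<bullet> i" by (rule open_contains_cbox)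
  have "0 < (\<Prod>i\<in>Basis. (b - a) \<bullet> i)" using ab(2) by (intro prod_pos) (auto simp: inner_diff_left)
  then have "0 < emeasure lborel (box a b)"
    using ab(2) by (subst emeasure_lborel_box) (auto simp: less_imp_le)
  also have "\<dots> \<le> emeasure lborel U" using ab(1) box_subset_cbox[of a b] \<open>open U\<close> by (intro emeasure_mono) auto
  finally have "0 < emeasure plane U" by (simp add: lborel_prod)
  moreover have sub: "U \<subseteq> hp -` hcball \<i> 1 \<inter> space plane"
  proof
    fix x assume "x \<in> U"
    then have "cosh (hdist \<i> (hp x)) < cosh 1" using ch_cosh[of \<i> "hp x"] by (simp add: U_def)
    then have "hdist \<i> (hp x) \<le> 1" using hdist_nonneg[of \<i> "hp x"] by (metis cosh_le_iff_nonneg hp_upper less_imp_le upper_iff zero_le_one imaginary_unit.sel(2) zero_less_one)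
    then show "x \<in> hp -` hcball \<i> 1 \<inter> space plane" by (simp add: hcball_def space_pair_measure)
  qed
  moreover have m: "hp -` hcball \<i> 1 \<inter> space plane \<in> sets plane"
    by (rule measurable_sets[OF measurable_hp hcball_sets]) simp
  ultimately have "0 < emeasure plane (hp -` hcball \<i> 1 \<inter> space plane)"
    using emeasure_mono[OF sub m] by (simp add: less_le_trans)
  then show ?thesis unfolding hm_def by (subst emeasure_distr) (simp_all add: hcball_sets)
qed

text \<open>A Harnack-type bound, from cosh (a + b) <= cosh a * exp b.\<close>

lemma ch_near:
  assumes "u \<in> upper" "p \<in> upper" "w \<in> upper" "hdist p w \<le> r"
  shows "ch u w \<le> exp r * ch u p"
proof -
  have b: "0 \<le> hdist p w" using assms by simp
  have "hdist u w \<le> hdist u p + hdist p w" by (rule hdist_triangle[OF assms(1-3)])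
  then have "cosh (hdist u w) \<le> cosh (hdist u p + hdist p w)" using assms by (subst cosh_le_iff_nonneg) auto
  also have "\<dots> \<le> cosh (hdist u p) * (cosh (hdist p w) + sinh (hdist p w))"
    using b assms by (simp add: cosh_add distrib_left sinh_le_cosh_real mult_right_mono)
  also have "cosh (hdist p w) + sinh (hdist p w) = exp (hdist p w)" by (rule cosh_plus_sinh)
  also have "cosh (hdist u p) * exp (hdist p w) \<le> cosh (hdist u p) * exp r" using assms(4) by (intro mult_left_mono) auto
  finally show ?thesis using assms by (simp add: ch_cosh mult.commute)
qed

definition packing_const :: real where
  "packing_const = exp 2 * enn2real area_const / measure hm (hcball \<i> 1)"

text \<open>The unit balls about the points \<open>\<gamma> p\<close> cover each \<open>w\<close> at
  most N times: translated back by one of the elements concerned, the others move \<open>p\<close>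
  by at most 2. At the centre of such a ball 1 / ch^2 is at most exp 2 times its value at any point
  of the ball, so the sum is bounded by a multiple of the integral of 1 / ch^2.\<close>

lemma (in fuchsian_group) packing:
  assumes u: "u \<in> upper" and p: "p \<in> upper" and N: "card {\<gamma> \<in> \<Gamma>. hdist p (\<gamma> p) \<le> 2} \<le> N"
    and F: "finite F" "F \<subseteq> \<Gamma>"
  shows "(\<Sum>\<gamma>\<in>F. 1 / (ch u (\<gamma> p))\<^sup>2) \<le> real N * packing_const"
proof -
  define V where "V = emeasure hm (hcball \<i> 1)"
  define B where "B \<gamma> = hcball (\<gamma> p) 1" for \<gamma>
  have gu: "\<gamma> p \<in> upper" if "\<gamma> \<in> F" for \<gamma> using in_upper p F that by blast
  have Bs: "B \<gamma> \<in> sets hm" if "\<gamma> \<in> F" for \<gamma> unfolding B_def using hcball_sets[OF gu[OF that]] by simp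
  have mult: "real (card {\<gamma> \<in> F. w \<in> B \<gamma>}) \<le> real N" for w
  proof (cases "{\<gamma> \<in> F. w \<in> B \<gamma>} = {}")
    case False
    then obtain \<gamma>0 where g0: "\<gamma>0 \<in> F" "w \<in> B \<gamma>0" by blast
    have g0G: "\<gamma>0 \<in> \<Gamma>" using g0 F by blast
    have wu: "w \<in> upper" using g0 by (simp add: B_def hcball_def)
    let ?h = "\<lambda>\<gamma>. compose upper (ginv \<gamma>0) \<gamma>"
    have "inj_on ?h {\<gamma> \<in> F. w \<in> B \<gamma>}"
      using bij_compose_left[OF ginv_in[OF g0G]] F(2) unfolding bij_betw_def by (auto intro: inj_on_subset)
    moreover have "?h ` {\<gamma> \<in> F. w \<in> B \<gamma>} \<subseteq> {\<gamma> \<in> \<Gamma>. hdist p (\<gamma> p) \<le> 2}"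
    proof (rule image_subsetI)
      fix \<gamma> assume "\<gamma> \<in> {\<gamma> \<in> F. w \<in> B \<gamma>}"
      then have g: "\<gamma> \<in> F" "\<gamma> \<in> \<Gamma>" "w \<in> B \<gamma>" using F by auto
      have "hdist p (?h \<gamma> p) = hdist (ginv \<gamma>0 (\<gamma>0 p)) (ginv \<gamma>0 (\<gamma> p))"
        using compose_apply[OF p, of "ginv \<gamma>0" \<gamma>] ginv_left[OF g0G p] by simp
      also have "\<dots> = hdist (\<gamma>0 p) (\<gamma> p)" by (rule hdist_inv[OF ginv_in[OF g0G] gu[OF g0(1)] gu[OF g(1)]])
      also have "\<dots> \<le> hdist (\<gamma>0 p) w + hdist (\<gamma> p) w"
        using hdist_triangle[OF gu[OF g0(1)] wu gu[OF g(1)]] by (simp add: hdist_commute[of w])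
      also have "\<dots> \<le> 2" using g0(2) g(3) by (simp add: B_def hcball_def)
      finally show "?h \<gamma> \<in> {\<gamma> \<in> \<Gamma>. hdist p (\<gamma> p) \<le> 2}" using compose_in[OF ginv_in[OF g0G] g(2)] by simp
    qed
    ultimately have "card {\<gamma> \<in> F. w \<in> B \<gamma>} \<le> card {\<gamma> \<in> \<Gamma>. hdist p (\<gamma> p) \<le> 2}"
      by (rule card_inj_on_le[OF _ _ finite_near[OF p p]])
    then show ?thesis using N by simp
  next
    case True
    then show ?thesis by (simp only: card.empty)
  qed
  have one: "ennreal (1 / (ch u (\<gamma> p))\<^sup>2) * V \<le> (\<integral>\<^sup>+w. ennreal (exp 2 / (ch u w)\<^sup>2) * indicator (B \<gamma>) w \<partial>hm)" if g: "\<gamma> \<in> F" for \<gamma>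
  proof -
    have "V = emeasure hm (B \<gamma>)" unfolding V_def B_def by (rule emeasure_hcball[OF gu[OF g], symmetric])
    then have "ennreal (1 / (ch u (\<gamma> p))\<^sup>2) * V = (\<integral>\<^sup>+w. ennreal (1 / (ch u (\<gamma> p))\<^sup>2) * indicator (B \<gamma>) w \<partial>hm)"
      using Bs[OF g] by (simp add: nn_integral_cmult_indicator)
    also have "\<dots> \<le> (\<integral>\<^sup>+w. ennreal (exp 2 / (ch u w)\<^sup>2) * indicator (B \<gamma>) w \<partial>hm)"
    proof (rule nn_integral_mono)
      fix w
      show "ennreal (1 / (ch u (\<gamma> p))\<^sup>2) * indicator (B \<gamma>) w \<le> ennreal (exp 2 / (ch u w)\<^sup>2) * indicator (B \<gamma>) w"
      proof (cases "w \<in> B \<gamma>")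
        case True
        then have w: "w \<in> upper" "hdist (\<gamma> p) w \<le> 1" by (auto simp: B_def hcball_def)
        have c: "ch u w \<le> exp 1 * ch u (\<gamma> p)" by (rule ch_near[OF u gu[OF g] w])
        have pos: "0 < ch u w" "0 < ch u (\<gamma> p)" using ch_ge_1[OF u w(1)] ch_ge_1[OF u gu[OF g]] by auto
        have "(ch u w)\<^sup>2 \<le> (exp 1 * ch u (\<gamma> p))\<^sup>2" using c pos by (intro power_mono) auto
        then have "(ch u w)\<^sup>2 \<le> exp 2 * (ch u (\<gamma> p))\<^sup>2" by (simp add: power_mult_distrib exp_double[symmetric])
        then have "1 / (ch u (\<gamma> p))\<^sup>2 \<le> exp 2 / (ch u w)\<^sup>2" using pos by (simp add: field_simps)
        then show ?thesis using True by (simp add: ennreal_leI)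
      qed simp
    qed
    finally show ?thesis .
  qed
  have V: "0 < V" "V < \<infinity>"
  proof -
    show "0 < V" unfolding V_def by (rule emeasure_hcball_pos)
    have "V = (\<integral>\<^sup>+w. indicator (hcball \<i> 1) w \<partial>hm)" unfolding V_def by (simp add: hcball_sets)
    also have "\<dots> \<le> (\<integral>\<^sup>+w. ennreal ((cosh 1)\<^sup>2) * ennreal (1 / (ch \<i> w)\<^sup>2) \<partial>hm)"
    proof (rule nn_integral_mono)
      fix w
      show "indicator (hcball \<i> 1) w \<le> ennreal ((cosh 1)\<^sup>2) * ennreal (1 / (ch \<i> w)\<^sup>2)"
      proof (cases "w \<in> hcball \<i> 1")
        case True
        then have w: "w \<in> upper" "hdist \<i> w \<le> 1" by (auto simp: hcball_def)
        have iu: "\<i> \<in> upper" by simp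
        have "ch \<i> w \<le> cosh 1" using w hdist_nonneg[OF iu w(1)] ch_cosh[OF iu w(1)] by (simp add: cosh_le_iff_nonneg)
        then have "(ch \<i> w)\<^sup>2 \<le> (cosh 1)\<^sup>2" "0 < ch \<i> w" using ch_ge_1[OF iu w(1)] by (auto intro: power_mono)
        then have "1 \<le> (cosh 1)\<^sup>2 * (1 / (ch \<i> w)\<^sup>2)" by (simp add: field_simps)
        then have "ennreal 1 \<le> ennreal ((cosh 1)\<^sup>2 * (1 / (ch \<i> w)\<^sup>2))" by (rule ennreal_leI)
        also have "\<dots> = ennreal ((cosh 1)\<^sup>2) * ennreal (1 / (ch \<i> w)\<^sup>2)" by (rule ennreal_mult) auto
        finally show ?thesis using True by simp
      qed simp
    qed
    also have "\<dots> = ennreal ((cosh 1)\<^sup>2) * area_const" unfolding area_const_def by (rule nn_integral_cmult) measurable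
    also have "\<dots> < \<infinity>" using area_const_finite by (simp add: ennreal_mult_less_top)
    finally show "V < \<infinity>" .
  qed
  have "ennreal (\<Sum>\<gamma>\<in>F. 1 / (ch u (\<gamma> p))\<^sup>2) = (\<Sum>\<gamma>\<in>F. ennreal (1 / (ch u (\<gamma> p))\<^sup>2))"
    by (rule sum_ennreal[symmetric]) simp
  then have "ennreal (\<Sum>\<gamma>\<in>F. 1 / (ch u (\<gamma> p))\<^sup>2) * V = (\<Sum>\<gamma>\<in>F. ennreal (1 / (ch u (\<gamma> p))\<^sup>2) * V)"
    by (simp only: sum_distrib_right)
  also have "\<dots> \<le> (\<Sum>\<gamma>\<in>F. \<integral>\<^sup>+w. ennreal (exp 2 / (ch u w)\<^sup>2) * indicator (B \<gamma>) w \<partial>hm)" by (intro sum_mono one)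
  also have "\<dots> = (\<integral>\<^sup>+w. (\<Sum>\<gamma>\<in>F. ennreal (exp 2 / (ch u w)\<^sup>2) * indicator (B \<gamma>) w) \<partial>hm)"
    by (rule nn_integral_sum[symmetric]) (use Bs in measurable)
  also have "\<dots> \<le> (\<integral>\<^sup>+w. ennreal (real N * exp 2) * ennreal (1 / (ch u w)\<^sup>2) \<partial>hm)"
  proof (rule nn_integral_mono)
    fix w
    have "(\<Sum>\<gamma>\<in>F. ennreal (exp 2 / (ch u w)\<^sup>2) * indicator (B \<gamma>) w) = ennreal (exp 2 / (ch u w)\<^sup>2) * (\<Sum>\<gamma>\<in>F. indicator (B \<gamma>) w)"
      by (simp add: sum_distrib_left)
    also have "(\<Sum>\<gamma>\<in>F. indicator (B \<gamma>) w :: ennreal) = of_nat (card {\<gamma> \<in> F. w \<in> B \<gamma>})"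
      using F(1) by (simp add: indicator_def sum.If_cases Int_def)
    also have "ennreal (exp 2 / (ch u w)\<^sup>2) * of_nat (card {\<gamma> \<in> F. w \<in> B \<gamma>}) \<le> ennreal (exp 2 / (ch u w)\<^sup>2) * ennreal (real N)"
      using mult[of w] by (intro mult_left_mono) (auto simp: ennreal_of_nat_eq_real_of_nat intro: ennreal_leI)
    also have "\<dots> = ennreal (real N * exp 2) * ennreal (1 / (ch u w)\<^sup>2)"
      by (simp add: ennreal_mult[symmetric] mult_ac)
    finally show "(\<Sum>\<gamma>\<in>F. ennreal (exp 2 / (ch u w)\<^sup>2) * indicator (B \<gamma>) w) \<le> ennreal (real N * exp 2) * ennreal (1 / (ch u w)\<^sup>2)" .
  qed
  also have "\<dots> = ennreal (real N * exp 2) * area_const"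
    unfolding nn_integral_ch[OF u, symmetric] by (rule nn_integral_cmult) measurable
  finally have fin: "ennreal (\<Sum>\<gamma>\<in>F. 1 / (ch u (\<gamma> p))\<^sup>2) * V \<le> ennreal (real N * exp 2) * area_const" .
  obtain v where v: "0 < v" "V = ennreal v" using V by (cases V) (auto simp: ennreal_less_zero_iff)
  obtain a where a: "0 \<le> a" "area_const = ennreal a" using area_const_finite by (cases area_const) auto
  have "(\<Sum>\<gamma>\<in>F. 1 / (ch u (\<gamma> p))\<^sup>2) * v \<le> real N * exp 2 * a"
  proof -
    have "0 \<le> (\<Sum>\<gamma>\<in>F. 1 / (ch u (\<gamma> p))\<^sup>2)" by (intro sum_nonneg) simp
    then have "ennreal ((\<Sum>\<gamma>\<in>F. 1 / (ch u (\<gamma> p))\<^sup>2) * v) \<le> ennreal (real N * exp 2 * a)"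
      using fin v(1) a(1) unfolding v(2) a(2) by (simp only: ennreal_mult less_imp_le mult_nonneg_nonneg of_nat_0_le_iff exp_ge_zero)
    then show ?thesis by (subst (asm) ennreal_le_iff) (use a(1) in auto)
  qed
  moreover have "measure hm (hcball \<i> 1) = v" using v by (simp add: measure_def V_def[symmetric])
  moreover have "enn2real area_const = a" unfolding a(2) by (rule enn2real_ennreal[OF a(1)])
  ultimately show ?thesis using v(1) by (simp add: packing_const_def field_simps)
qed

section \<open>The Abel transform and the heat kernel of the half-plane\<close>

lemma distr_plane_radial:
  "distr plane borel (\<lambda>x. (fst x)\<^sup>2 / 2 + (snd x)\<^sup>2 / 2) = density lborel (\<lambda>s. ennreal (2 * pi * indicator {0..} s))"
  (is "?M = ?N")
proof (rule measure_eqI_generator_eq[where E = "range atMost" and \<Omega> = UNIV and A = "\<lambda>n. {..real n}"])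
  have M: "emeasure ?M {..a} = ennreal (2 * pi * max 0 a)" for a
  proof -
    have m: "(\<lambda>x::real \<times> real. (fst x)\<^sup>2 / 2 + (snd x)\<^sup>2 / 2) \<in> borel_measurable plane" by measurable
    have "emeasure ?M {..a} = emeasure lborel {x::real \<times> real. (fst x)\<^sup>2 / 2 + (snd x)\<^sup>2 / 2 \<le> a}"
      using emeasure_distr[OF m, of "{..a}"] by (simp add: vimage_def lborel_prod)
    also have "{x::real \<times> real. (fst x)\<^sup>2 / 2 + (snd x)\<^sup>2 / 2 \<le> a} = (if 0 \<le> a then cball 0 (sqrt (2 * a)) else {})"
      by (auto simp: dist_norm norm_prod_def not_le field_simps add_nonneg_nonneg intro: less_le_trans[of _ 0])
    finally show ?thesis by (simp add: emeasure_cball unit_ball_vol_2 mult_ac)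
  qed
  have "emeasure ?N {..a} = ennreal (2 * pi * max 0 a)" for a
  proof -
    have "emeasure ?N {..a} = (\<integral>\<^sup>+s. ennreal (2 * pi) * indicator {0..a} s \<partial>lborel)"
      by (subst emeasure_density) (auto intro!: nn_integral_cong simp: indicator_def)
    then show ?thesis by (simp add: nn_integral_cmult_indicator emeasure_lborel_Icc_eq ennreal_mult max_def)
  qed
  with M show "emeasure ?M X = emeasure ?N X" if "X \<in> range atMost" for X using that by auto
  show "emeasure ?M {..real n} \<noteq> \<infinity>" for n by (simp add: M)
  show "Int_stable (range (atMost :: real \<Rightarrow> real set))" by (auto simp: Int_stable_def)
qed (auto simp: borel_eq_atMost real_arch_simple intro: UN_I)

text \<open>For a function of c = cosh of the distance this is, up to an elementary factor, the
  integral over a horocycle (\<open>integral_ch_line\<close>).\<close>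

definition Abel :: "(real \<Rightarrow> complex) \<Rightarrow> real \<Rightarrow> complex" where
  "Abel \<psi> c = (\<integral>x. \<psi> (c + x\<^sup>2 / 2) \<partial>lborel)"

text \<open>Two Abel integrals make an integral over the plane of a function of (x^2 + y^2) / 2.
  This quantity is at most a on a disc of area 2 \<pi> a, so the result is 2 \<pi> times a tail
  integral.\<close>

lemma Abel_Abel:
  assumes [measurable]: "\<psi> \<in> borel_measurable borel"
    and int: "integrable lborel (\<lambda>s. indicator {0..} s *\<^sub>R \<psi> (c + s))"
  shows "Abel (Abel \<psi>) c = of_real (2 * pi) * (\<integral>s. indicator {0..} s *\<^sub>R \<psi> (c + s) \<partial>lborel)"
proof -
  have "integrable (density lborel (\<lambda>s. ennreal (2 * pi * indicator {0..} s))) (\<lambda>s. \<psi> (c + s))"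
  proof (subst integrable_density)
    have "integrable lborel (\<lambda>s. (2 * pi) *\<^sub>R (indicator {0..} s *\<^sub>R \<psi> (c + s)))" by (rule integrable_scaleR_right[OF int])
    then show "integrable lborel (\<lambda>s. (2 * pi * indicator {0..} s) *\<^sub>R \<psi> (c + s))" by simp
  qed simp_all
  then have ip: "integrable plane (\<lambda>x. \<psi> (c + ((fst x)\<^sup>2 / 2 + (snd x)\<^sup>2 / 2)))"
    unfolding distr_plane_radial[symmetric] by (subst (asm) integrable_distr_eq) simp_all
  have "Abel (Abel \<psi>) c = (\<integral>x. (\<integral>y. \<psi> (c + (x\<^sup>2 / 2 + y\<^sup>2 / 2)) \<partial>lborel) \<partial>lborel)"
    by (simp add: Abel_def add.assoc)
  also have "\<dots> = (\<integral>x. \<psi> (c + ((fst x)\<^sup>2 / 2 + (snd x)\<^sup>2 / 2)) \<partial>plane)"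
    using lborel_pair.integral_fst'[OF ip] by simp
  also have "\<dots> = (\<integral>s. \<psi> (c + s) \<partial>distr plane borel (\<lambda>x. (fst x)\<^sup>2 / 2 + (snd x)\<^sup>2 / 2))"
    by (subst integral_distr) simp_all
  also have "\<dots> = (\<integral>s. (2 * pi * indicator {0..} s) *\<^sub>R \<psi> (c + s) \<partial>lborel)"
    unfolding distr_plane_radial by (subst integral_density) simp_all
  also have "\<dots> = (\<integral>s. of_real (2 * pi) * (indicator {0..} s *\<^sub>R \<psi> (c + s)) \<partial>lborel)"
    by (simp add: scaleR_conv_of_real mult.assoc)
  also have "\<dots> = of_real (2 * pi) * (\<integral>s. indicator {0..} s *\<^sub>R \<psi> (c + s) \<partial>lborel)"
    by (rule integral_mult_right_zero)
  finally show ?thesis .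
qed

lemma measurable_arcosh [measurable]: "(arcosh :: real \<Rightarrow> real) \<in> borel_measurable borel"
  unfolding arcosh_def[abs_def] by simp

text \<open>The Gaussian exp (- u^2 / (4 z)) in the variable c = cosh u.\<close>

definition gaussC :: "complex \<Rightarrow> real \<Rightarrow> complex" where
  "gaussC z c = exp (- (of_real ((arcosh c)\<^sup>2) / (4 * z)))"

text \<open>In c = cosh u this is u exp (- u^2 / (4 z)) / sinh u, the derivative of -2 z times
  \<open>gaussC\<close> (\<open>deriv_gaussC\<close>). At c = 1 the quotient has the value 0 instead
  of its limit 1.\<close>

definition kerC :: "complex \<Rightarrow> real \<Rightarrow> complex" where
  "kerC z c = of_real (arcosh c / sqrt (c\<^sup>2 - 1)) * gaussC z c"

lemma measurable_gaussC [measurable]: "gaussC z \<in> borel_measurable borel"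
  unfolding gaussC_def[abs_def] by measurable

lemma measurable_kerC [measurable]: "kerC z \<in> borel_measurable borel"
  unfolding kerC_def[abs_def] by measurable

lemma gaussC_cosh: "gaussC z (cosh v) = exp (- (of_real (v\<^sup>2) / (4 * z)))"
proof -
  have "arcosh (cosh v) = \<bar>v\<bar>" using arcosh_cosh_real[of "\<bar>v\<bar>"] by simp
  then show ?thesis by (simp add: gaussC_def)
qed

text \<open>From - b u^2 <= 25 / (4 b) - 5 u with b = Re (1 / z) / 4. The fifth power in
  \<open>norm_gaussC\<close> leaves room for two Abel integrals, each of which costs one power of c
  (\<open>norm_KC\<close>, \<open>nn_integral_KC\<close>).\<close>

definition gauss_bound :: "complex \<Rightarrow> real" where
  "gauss_bound z = exp (25 * (cmod z)\<^sup>2 / Re z)"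

lemma norm_gaussC:
  assumes "0 < Re z" "1 \<le> c"
  shows "cmod (gaussC z c) \<le> gauss_bound z / c ^ 5"
proof -
  define u where "u = arcosh c"
  define b where "b = Re z / (4 * (cmod z)\<^sup>2)"
  have z: "z \<noteq> 0" using assms by auto
  have b: "0 < b" using assms z by (simp add: b_def)
  have u: "0 \<le> u" "cosh u = c" using assms by (simp_all add: u_def)
  have "0 \<le> sinh u" using u(1) by simp
  then have cu: "c \<le> exp u" using cosh_plus_sinh[of u] u(2) by linarith
  have "of_real (u\<^sup>2) / (4 * z) = of_real (u\<^sup>2 / 4) * inverse z" using z by (simp add: field_simps)
  then have "Re (of_real (u\<^sup>2) / (4 * z)) = Re (of_real (u\<^sup>2 / 4) * inverse z)" by (simp only:)
  also have "\<dots> = u\<^sup>2 / 4 * Re (inverse z)"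
    by (simp only: times_complex.sel Re_complex_of_real Im_complex_of_real mult_zero_left diff_zero)
  also have "\<dots> = u\<^sup>2 * b" by (simp add: b_def cmod_power2)
  finally have "Re (of_real (u\<^sup>2) / (4 * z)) = u\<^sup>2 * b" .
  then have "cmod (gaussC z c) = exp (- (u\<^sup>2 * b))" by (simp add: gaussC_def u_def[symmetric])
  also have "\<dots> \<le> exp (25 / (4 * b) + 5 * (- u))"
  proof -
    have "0 \<le> (2 * b * u - 5)\<^sup>2" by simp
    also have "(2 * b * u - 5)\<^sup>2 = 4 * b * (u\<^sup>2 * b - 5 * u + 25 / (4 * b))" using b by (simp add: power2_eq_square field_simps)
    finally have "0 \<le> u\<^sup>2 * b - 5 * u + 25 / (4 * b)" using b by (simp add: zero_le_mult_iff)
    then show ?thesis by simp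
  qed
  also have "exp (5 * (- u)) = (exp (- u)) ^ 5" using exp_of_nat_mult[of 5 "- u"] by simp
  then have "exp (25 / (4 * b) + 5 * (- u)) = exp (25 / (4 * b)) * (exp (- u)) ^ 5" by (simp only: exp_add)
  also have "25 / (4 * b) = 25 * (cmod z)\<^sup>2 / Re z" using assms z by (simp add: b_def field_simps)
  also have "(exp (- u)) ^ 5 \<le> (1 / c) ^ 5"
    using cu assms(2) by (intro power_mono) (auto simp: exp_minus field_simps)
  finally show ?thesis by (simp add: gauss_bound_def power_divide mult_left_mono)
qed

lemma arcosh_over_sqrt: assumes "1 \<le> c" shows "0 \<le> arcosh c / sqrt (c\<^sup>2 - 1)" "arcosh c / sqrt (c\<^sup>2 - 1) \<le> 1"
proof -
  have 0: "0 \<le> arcosh c" using assms by simp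
  have s: "sqrt (c\<^sup>2 - 1) = sinh (arcosh c)" using sinh_arcosh_real[OF assms] by simp
  have "arcosh c \<le> sinh (arcosh c)" using real_le_x_sinh[OF 0] by (simp add: sinh_def exp_minus)
  then show "0 \<le> arcosh c / sqrt (c\<^sup>2 - 1)" "arcosh c / sqrt (c\<^sup>2 - 1) \<le> 1"
    unfolding s using 0 by (auto simp: divide_le_eq)
qed

lemma norm_kerC:
  assumes "0 < Re z" "1 \<le> c"
  shows "cmod (kerC z c) \<le> gauss_bound z / c ^ 5"
proof -
  have "cmod (kerC z c) = arcosh c / sqrt (c\<^sup>2 - 1) * cmod (gaussC z c)"
    unfolding kerC_def norm_mult norm_of_real abs_of_nonneg[OF arcosh_over_sqrt(1)[OF assms(2)]] ..
  also have "\<dots> \<le> 1 * (gauss_bound z / c ^ 5)"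
    using arcosh_over_sqrt[OF assms(2)] norm_gaussC[OF assms] by (intro mult_mono) auto
  finally show ?thesis by simp
qed

lemma isCont_gaussC: assumes "1 < c" shows "isCont (gaussC z) c"
proof (cases "z = 0")
  case True
  then show ?thesis by (simp add: gaussC_def[abs_def])
next
  case False
  then show ?thesis unfolding gaussC_def using assms by (intro continuous_intros) auto
qed

lemma isCont_kerC: assumes "1 < c" shows "isCont (kerC z) c"
proof -
  have "1 < c\<^sup>2" using assms by (simp add: one_less_power)
  then have "sqrt (c\<^sup>2 - 1) \<noteq> 0" by simp
  then show ?thesis unfolding kerC_def by (intro continuous_intros isCont_gaussC) (use assms in auto)
qed

lemma deriv_gaussC:
  assumes "1 < c" "z \<noteq> 0"
  shows "((\<lambda>c. - (2 * z) * gaussC z c) has_vector_derivative kerC z c) (at c)"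
proof -
  have d: "((\<lambda>c. (arcosh c)\<^sup>2) has_real_derivative 2 * arcosh c * (1 / sqrt (c\<^sup>2 - 1))) (at c)"
    using assms by (auto intro!: derivative_eq_intros)
  then have "((\<lambda>c. (arcosh c)\<^sup>2) has_vector_derivative 2 * arcosh c * (1 / sqrt (c\<^sup>2 - 1))) (at c)"
    by (simp add: has_real_derivative_iff_has_vector_derivative)
  then have "((\<lambda>c. complex_of_real ((arcosh c)\<^sup>2)) has_vector_derivative of_real (2 * arcosh c * (1 / sqrt (c\<^sup>2 - 1)))) (at c)"
    by (rule bounded_linear.has_vector_derivative[OF bounded_linear_of_real])
  moreover have "((\<lambda>w. - (2 * z) * exp (- (w / (4 * z)))) has_field_derivative
      (- (2 * z) * (exp (- (of_real ((arcosh c)\<^sup>2) / (4 * z))) * - (1 / (4 * z))))) (at (of_real ((arcosh c)\<^sup>2)))"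
    using assms(2) by (auto intro!: derivative_eq_intros)
  ultimately have "((\<lambda>c. - (2 * z) * exp (- (of_real ((arcosh c)\<^sup>2) / (4 * z)))) has_vector_derivative
      of_real (2 * arcosh c * (1 / sqrt (c\<^sup>2 - 1))) * (- (2 * z) * (exp (- (of_real ((arcosh c)\<^sup>2) / (4 * z))) * - (1 / (4 * z))))) (at c)"
    using field_vector_diff_chain_at unfolding o_def by blast
  moreover have "of_real (2 * arcosh c * (1 / sqrt (c\<^sup>2 - 1))) * (- (2 * z) * (exp (- (of_real ((arcosh c)\<^sup>2) / (4 * z))) * - (1 / (4 * z)))) = kerC z c"
    using assms(2) by (simp add: kerC_def gaussC_def)
  ultimately show ?thesis by (simp add: gaussC_def)
qed

lemma integrable_power_tail:
  assumes "1 \<le> (c::real)"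
  shows "integrable lborel (\<lambda>s. indicator {0..} s * (1 / (c + s) ^ 2))"
proof (rule Bochner_Integration.integrable_bound)
  show "integrable lborel (\<lambda>x::real. 1 / (1 + x\<^sup>2))"
    using integrable_inverse_1_plus_square by (simp add: set_integrable_def inverse_eq_divide)
  show "AE s in lborel. norm (indicator {0..} s * (1 / (c + s) ^ 2)) \<le> norm (1 / (1 + s\<^sup>2))"
  proof (rule AE_I2)
    fix s :: real
    show "norm (indicator {0..} s * (1 / (c + s) ^ 2)) \<le> norm (1 / (1 + s\<^sup>2))"
    proof (cases "0 \<le> s")
      case True
      have "1 + s\<^sup>2 \<le> (1 + s)\<^sup>2" using True by (simp add: power2_sum)
      also have "\<dots> \<le> (c + s)\<^sup>2" using True assms by (intro power_mono) auto
      finally show ?thesis using True by (simp add: add_pos_nonneg frac_le)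
    qed simp
  qed
qed simp

lemma integrable_tail_of_bound:
  fixes \<psi> :: "real \<Rightarrow> complex"
  assumes [measurable]: "\<psi> \<in> borel_measurable borel" and c: "1 \<le> c" and b: "\<And>c. 1 \<le> c \<Longrightarrow> cmod (\<psi> c) \<le> M / c ^ 2"
  shows "integrable lborel (\<lambda>s. indicator {0..} s *\<^sub>R \<psi> (c + s))"
proof (rule Bochner_Integration.integrable_bound)
  show "integrable lborel (\<lambda>s. M * (indicator {0..} s * (1 / (c + s) ^ 2)))" by (intro integrable_mult_right integrable_power_tail c)
  show "AE s in lborel. norm (indicator {0..} s *\<^sub>R \<psi> (c + s)) \<le> norm (M * (indicator {0..} s * (1 / (c + s) ^ 2)))"
  proof (rule AE_I2)
    fix s :: real
    show "norm (indicator {0..} s *\<^sub>R \<psi> (c + s)) \<le> norm (M * (indicator {0..} s * (1 / (c + s) ^ 2)))"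
      using order_trans[OF b[of "c + s"] divide_right_mono[OF abs_ge_self[of M]]] c by (cases "0 \<le> s") auto
  qed
qed simp

lemma kerC_bound2: "0 < Re z \<Longrightarrow> 1 \<le> c \<Longrightarrow> cmod (kerC z c) \<le> gauss_bound z / c ^ 2"
  by (rule order_trans[OF norm_kerC]) (auto intro!: divide_left_mono power_increasing simp: gauss_bound_def)

lemma integral_half_line_FTC:
  fixes f F :: "real \<Rightarrow> complex"
  assumes [measurable]: "f \<in> borel_measurable borel"
    and d: "\<And>s. 0 < s \<Longrightarrow> (F has_vector_derivative f s) (at s)" and c: "\<And>s. 0 < s \<Longrightarrow> isCont f s"
    and int: "integrable lborel (\<lambda>s. indicator {0..} s *\<^sub>R f s)"
    and lim: "(F \<longlongrightarrow> A) (at_right 0)" "(F \<longlongrightarrow> 0) at_top"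
  shows "(\<integral>s. indicator {0..} s *\<^sub>R f s \<partial>lborel) = - A"
proof -
  have "(LBINT s=0..\<infinity>. f s) = 0 - A"
  proof (rule interval_integral_FTC_integrable[where F = F])
    show "set_integrable lborel (einterval 0 \<infinity>) f"
      unfolding set_integrable_def using int
      by (rule integrable_cong_AE_imp) (auto intro!: AE_I[where N = "{0}"] simp: einterval_def indicator_def)
    show "((F \<circ> real_of_ereal) \<longlongrightarrow> A) (at_right 0)" using lim(1) by (simp add: ereal_tendsto_simps1 zero_ereal_def)
    show "((F \<circ> real_of_ereal) \<longlongrightarrow> 0) (at_left \<infinity>)" using lim(2) by (simp add: ereal_tendsto_simps1)
  qed (use d c in auto)
  moreover have "(LBINT s=0..\<infinity>. f s) = (\<integral>s. indicator {0..} s *\<^sub>R f s \<partial>lborel)"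
    unfolding interval_lebesgue_integral_def set_lebesgue_integral_def
    by (simp, rule integral_cong_AE) (auto intro!: AE_I[where N = "{0}"] simp: einterval_def indicator_def)
  ultimately show ?thesis by simp
qed

lemma integral_kerC_tail:
  assumes z: "0 < Re z" and c: "1 \<le> c"
  shows "(\<integral>s. indicator {0..} s *\<^sub>R kerC z (c + s) \<partial>lborel) = 2 * z * gaussC z c"
proof -
  have z0: "z \<noteq> 0" using z by auto
  let ?F = "\<lambda>s. - (2 * z) * gaussC z (c + s)"
  have int: "integrable lborel (\<lambda>s. indicator {0..} s *\<^sub>R kerC z (c + s))"
    by (rule integrable_tail_of_bound[OF measurable_kerC c kerC_bound2[OF z]])
  have "(\<integral>s. indicator {0..} s *\<^sub>R kerC z (c + s) \<partial>lborel) = - (- (2 * z) * gaussC z c)"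
  proof (rule integral_half_line_FTC[where F = ?F, OF _ _ _ int])
    show "(?F has_vector_derivative kerC z (c + s)) (at s)" if "0 < s" for s
    proof -
      have "((\<lambda>c. - (2 * z) * gaussC z c) has_vector_derivative kerC z (c + s)) (at (c + s))"
        using that c by (intro deriv_gaussC z0) auto
      moreover have "((\<lambda>s. c + s) has_vector_derivative 1) (at s)" by (auto intro!: derivative_eq_intros)
      ultimately show ?thesis using vector_diff_chain_at[of "\<lambda>s. c + s" 1 s] unfolding o_def by fastforce
    qed
    show "isCont (\<lambda>s. kerC z (c + s)) s" if "0 < s" for s
      using that c by (intro isCont_o2[OF _ isCont_kerC]) (auto intro!: continuous_intros)
    have cont: "continuous_on {c..} (gaussC z)" unfolding gaussC_def using c z0
      by (intro continuous_intros) auto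
    have "((\<lambda>s. gaussC z (c + s)) \<longlongrightarrow> gaussC z (c + 0)) (at_right 0)"
    proof (rule continuous_on_tendsto_compose[OF cont])
      show "((\<lambda>s. c + s) \<longlongrightarrow> c + 0) (at_right 0)" by (intro tendsto_intros)
      show "\<forall>\<^sub>F s in at_right 0. c + s \<in> {c..}" by (simp add: eventually_at_right_less eventually_mono[OF eventually_at_right_less])
    qed simp
    then show "(?F \<longlongrightarrow> - (2 * z) * gaussC z c) (at_right 0)" by (intro tendsto_intros) simp
    have "((\<lambda>s. gauss_bound z * (1 / (c + s))) \<longlongrightarrow> gauss_bound z * 0) at_top"
      by (intro tendsto_mult tendsto_const tendsto_divide_0[OF tendsto_const] filterlim_at_top_imp_at_infinity
          filterlim_tendsto_add_at_top[OF tendsto_const filterlim_ident])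
    then have lim: "((\<lambda>s. gauss_bound z * (1 / (c + s))) \<longlongrightarrow> 0) at_top" by simp
    have "((\<lambda>s. gaussC z (c + s)) \<longlongrightarrow> 0) at_top"
    proof (rule Lim_null_comparison[OF _ lim])
      show "\<forall>\<^sub>F s in at_top. norm (gaussC z (c + s)) \<le> gauss_bound z * (1 / (c + s))"
        using eventually_ge_at_top[of 0]
      proof eventually_elim
        case (elim s)
        then have cs: "1 \<le> c + s" using c by simp
        have "norm (gaussC z (c + s)) \<le> gauss_bound z / (c + s) ^ 5" by (rule norm_gaussC[OF z cs])
        also have "\<dots> \<le> gauss_bound z / (c + s)"
          using cs power_increasing[of 1 5 "c + s"] by (intro divide_left_mono) (auto simp: gauss_bound_def)
        finally show ?case by simp
      qed
    qed
    then have "(?F \<longlongrightarrow> - (2 * z) * 0) at_top" by (intro tendsto_intros)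
    then show "(?F \<longlongrightarrow> 0) at_top" by simp
  qed measurable
  then show ?thesis by simp
qed

text \<open>The heat kernel of the half-plane as a function of c = cosh of the distance, without the
  factor \<open>heat_coef\<close> (\<open>heat_H_eq\<close>). The constant in front makes its Abel
  transform exactly the Gaussian (\<open>Abel_KC\<close>).\<close>

definition KC :: "complex \<Rightarrow> real \<Rightarrow> complex" where
  "KC z c = 1 / (of_real (4 * pi) * z) * Abel (kerC z) c"

lemma Abel_KC:
  assumes z: "0 < Re z" and c: "1 \<le> c"
  shows "Abel (KC z) c = gaussC z c"
proof -
  have z0: "z \<noteq> 0" using z by auto
  have "Abel (KC z) c = 1 / (of_real (4 * pi) * z) * Abel (Abel (kerC z)) c"
    unfolding KC_def Abel_def[of "\<lambda>c. 1 / (of_real (4 * pi) * z) * Abel (kerC z) c"] Abel_def[of "Abel (kerC z)"]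
    by (rule integral_mult_right_zero)
  also have "Abel (Abel (kerC z)) c = of_real (2 * pi) * (2 * z * gaussC z c)"
    using Abel_Abel[OF measurable_kerC integrable_tail_of_bound[OF measurable_kerC c kerC_bound2[OF z]]]
    by (simp only: integral_kerC_tail[OF z c])
  finally show ?thesis using z0 by simp
qed

lemma integrable_quadratic: "integrable lborel (\<lambda>x::real. 1 / (1 + x\<^sup>2 / 2))"
proof (rule Bochner_Integration.integrable_bound)
  show "integrable lborel (\<lambda>x::real. 2 * (1 / (1 + x\<^sup>2)))"
    using integrable_inverse_1_plus_square by (intro integrable_mult_right) (simp add: set_integrable_def inverse_eq_divide)
  show "AE x in lborel. norm (1 / (1 + (x::real)\<^sup>2 / 2)) \<le> norm (2 * (1 / (1 + x\<^sup>2)))"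
  proof (rule AE_I2)
    fix x :: real
    have p: "0 < 1 + x\<^sup>2" "0 < 1 + x\<^sup>2 / 2" by (auto intro: add_pos_nonneg)
    have "1 / (1 + x\<^sup>2 / 2) \<le> 2 / (1 + x\<^sup>2)" using p by (simp add: field_simps)
    then show "norm (1 / (1 + x\<^sup>2 / 2)) \<le> norm (2 * (1 / (1 + x\<^sup>2)))" using p by simp
  qed
qed simp

definition quad_const :: real where "quad_const = (\<integral>x. 1 / (1 + x\<^sup>2 / 2) \<partial>lborel)"

text \<open>One power of c + x^2 / 2 is given up for integrability in x; the others keep the decay
  in c.\<close>

lemma quad_bound:
  fixes x :: real
  assumes "1 \<le> c"
  shows "1 / (c + x\<^sup>2 / 2) ^ Suc n \<le> 1 / c ^ n * (1 / (1 + x\<^sup>2 / 2))" "1 \<le> c + x\<^sup>2 / 2"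
proof -
  have p: "0 \<le> x\<^sup>2 / 2" by simp
  then show "1 \<le> c + x\<^sup>2 / 2" using assms by linarith
  have "c ^ n * (1 + x\<^sup>2 / 2) \<le> (c + x\<^sup>2 / 2) ^ n * (c + x\<^sup>2 / 2)"
    using assms p by (intro mult_mono power_mono) auto
  then have "c ^ n * (1 + x\<^sup>2 / 2) \<le> (c + x\<^sup>2 / 2) ^ Suc n" by (simp add: mult.commute)
  moreover have "0 < c ^ n * (1 + x\<^sup>2 / 2)" using assms p by (intro mult_pos_pos add_pos_nonneg) auto
  ultimately have "1 / (c + x\<^sup>2 / 2) ^ Suc n \<le> 1 / (c ^ n * (1 + x\<^sup>2 / 2))" by (intro frac_le) auto
  then show "1 / (c + x\<^sup>2 / 2) ^ Suc n \<le> 1 / c ^ n * (1 / (1 + x\<^sup>2 / 2))" by simp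
qed

lemma Abel_kerC_integrand_bound:
  assumes z: "0 < Re z" and c: "1 \<le> c"
  shows "cmod (kerC z (c + x\<^sup>2 / 2)) \<le> gauss_bound z / c ^ 4 * (1 / (1 + x\<^sup>2 / 2))"
proof -
  have "cmod (kerC z (c + x\<^sup>2 / 2)) \<le> gauss_bound z * (1 / (c + x\<^sup>2 / 2) ^ Suc 4)"
    using norm_kerC[OF z quad_bound(2)[OF c, of x]] by simp
  also have "\<dots> \<le> gauss_bound z * (1 / c ^ 4 * (1 / (1 + x\<^sup>2 / 2)))"
    by (intro mult_left_mono quad_bound c) (simp add: gauss_bound_def)
  finally show ?thesis by simp
qed

lemma integrable_Abel_kerC:
  assumes z: "0 < Re z" and c: "1 \<le> c"
  shows "integrable lborel (\<lambda>x. kerC z (c + x\<^sup>2 / 2))"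
proof (rule Bochner_Integration.integrable_bound)
  show "integrable lborel (\<lambda>x. gauss_bound z / c ^ 4 * (1 / (1 + x\<^sup>2 / 2)))" by (intro integrable_mult_right integrable_quadratic)
  show "AE x in lborel. norm (kerC z (c + x\<^sup>2 / 2)) \<le> norm (gauss_bound z / c ^ 4 * (1 / (1 + x\<^sup>2 / 2)))"
    unfolding real_norm_def by (rule AE_I2) (rule order_trans[OF Abel_kerC_integrand_bound[OF z c] abs_ge_self])
qed simp

definition KC_bound :: "complex \<Rightarrow> real" where
  "KC_bound z = cmod (1 / (of_real (4 * pi) * z)) * (gauss_bound z * quad_const)"

lemma norm_KC:
  assumes z: "0 < Re z" and c: "1 \<le> c"
  shows "cmod (KC z c) \<le> KC_bound z / c ^ 4"
proof -
  have "cmod (Abel (kerC z) c) \<le> (\<integral>x. gauss_bound z / c ^ 4 * (1 / (1 + x\<^sup>2 / 2)) \<partial>lborel)"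
    unfolding Abel_def
  proof (rule Bochner_Integration.integral_norm_bound_integral)
    show "integrable lborel (\<lambda>x. gauss_bound z / c ^ 4 * (1 / (1 + x\<^sup>2 / 2)))" by (intro integrable_mult_right integrable_quadratic)
  qed (use integrable_Abel_kerC[OF z c] Abel_kerC_integrand_bound[OF z c] in auto)
  also have "\<dots> = gauss_bound z / c ^ 4 * quad_const" unfolding quad_const_def by (rule integral_mult_right_zero)
  finally have "cmod (Abel (kerC z) c) \<le> gauss_bound z / c ^ 4 * quad_const" .
  from mult_left_mono[OF this norm_ge_zero[of "1 / (of_real (4 * pi) * z)"]]
  have "cmod (KC z c) \<le> cmod (1 / (of_real (4 * pi) * z)) * (gauss_bound z / c ^ 4 * quad_const)"
    unfolding KC_def norm_mult .
  then show ?thesis unfolding KC_bound_def by (simp only: times_divide_eq_right times_divide_eq_left)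
qed

lemma quad_const_nonneg: "0 \<le> quad_const"
  unfolding quad_const_def by (intro integral_nonneg_AE AE_I2) (auto intro: add_nonneg_nonneg)

lemma KC_bound_nonneg: "0 \<le> KC_bound z"
  unfolding KC_bound_def by (intro mult_nonneg_nonneg quad_const_nonneg) (auto simp: gauss_bound_def)

lemma measurable_KC [measurable]: "KC z \<in> borel_measurable borel"
  unfolding KC_def[abs_def] Abel_def by measurable

lemma KC_tendsto:
  assumes z: "0 < Re z" and c: "\<And>n::nat. 1 \<le> c n" "c \<longlonglongrightarrow> l"
  shows "(\<lambda>n. KC z (c n)) \<longlonglongrightarrow> KC z l"
proof -
  have l: "1 \<le> l" by (rule LIMSEQ_le_const[OF c(2)]) (use c(1) in auto)
  have "(\<lambda>n. Abel (kerC z) (c n)) \<longlonglongrightarrow> Abel (kerC z) l"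
    unfolding Abel_def
  proof (rule integral_dominated_convergence[where w = "\<lambda>x. gauss_bound z * (1 / (1 + x\<^sup>2 / 2))"])
    show "integrable lborel (\<lambda>x. gauss_bound z * (1 / (1 + x\<^sup>2 / 2)))" by (intro integrable_mult_right integrable_quadratic)
    \<comment> \<open>\<open>kerC\<close> is not continuous at 1, but this argument occurs in the
      limit only for x = 0.\<close>
    have "AE x in lborel. x \<noteq> (0::real)" by (rule AE_lborel_singleton)
    then show "AE x in lborel. (\<lambda>n. kerC z (c n + x\<^sup>2 / 2)) \<longlonglongrightarrow> kerC z (l + x\<^sup>2 / 2)"
    proof eventually_elim
      case (elim x)
      have "0 < x\<^sup>2 / 2" using elim by simp
      then have "1 < l + x\<^sup>2 / 2" using l by linarith
      then show ?case by (intro isCont_tendsto_compose[OF isCont_kerC] tendsto_intros c)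
    qed
    show "AE x in lborel. norm (kerC z (c n + x\<^sup>2 / 2)) \<le> gauss_bound z * (1 / (1 + x\<^sup>2 / 2))" for n
    proof (rule AE_I2)
      fix x :: real
      have "1 \<le> c n ^ 4" using c(1)[of n] by (rule one_le_power)
      then have "gauss_bound z / c n ^ 4 \<le> gauss_bound z / 1" by (intro divide_left_mono) (auto simp: gauss_bound_def)
      then have "gauss_bound z / c n ^ 4 * (1 / (1 + x\<^sup>2 / 2)) \<le> gauss_bound z * (1 / (1 + x\<^sup>2 / 2))"
        by (intro mult_right_mono) (auto intro: add_nonneg_nonneg)
      then show "norm (kerC z (c n + x\<^sup>2 / 2)) \<le> gauss_bound z * (1 / (1 + x\<^sup>2 / 2))"
        using Abel_kerC_integrand_bound[OF z c(1), of n x] by linarith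
    qed
  qed simp_all
  then show ?thesis unfolding KC_def by (intro tendsto_intros)
qed

lemma integral_half_line_even:
  fixes f :: "real \<Rightarrow> complex"
  assumes f: "integrable lborel (\<lambda>x. f (x\<^sup>2))"
  shows "(\<integral>x. f (x\<^sup>2) \<partial>lborel) = 2 * (\<integral>x. indicator {0<..} x *\<^sub>R f (x\<^sup>2) \<partial>lborel)"
proof -
  have i1: "integrable lborel (\<lambda>x. indicator {0<..} x *\<^sub>R f (x\<^sup>2))" using f by (rule integrable_mult_indicator[rotated]) simp
  have i2: "integrable lborel (\<lambda>x. indicator {0<..} (0 + (-1) * x) *\<^sub>R f ((0 + (-1) * x)\<^sup>2))"
    by (rule lborel_integrable_real_affine[OF i1]) simp
  have "(\<integral>x. indicator {0<..} x *\<^sub>R f (x\<^sup>2) \<partial>lborel) = (\<integral>x. indicator {0<..} (0 + (-1) * x) *\<^sub>R f ((0 + (-1) * x)\<^sup>2) \<partial>lborel)"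
    using lborel_integral_real_affine[of "-1" "\<lambda>x. indicator {0<..} x *\<^sub>R f (x\<^sup>2)" 0] by simp
  moreover have "(\<integral>x. f (x\<^sup>2) \<partial>lborel) = (\<integral>x. indicator {0<..} x *\<^sub>R f (x\<^sup>2) + indicator {0<..} (0 + (-1) * x) *\<^sub>R f ((0 + (-1) * x)\<^sup>2) \<partial>lborel)"
    using f i1 i2
    by (intro integral_cong_AE) (auto intro!: AE_I[where N = "{0}"] simp: indicator_def borel_measurable_integrable)
  ultimately show ?thesis using Bochner_Integration.integral_add[OF i1 i2] by simp
qed

text \<open>The substitution cosh u = cosh \<rho> + x^2 / 2 removes the singularity at u = \<rho>,
  since the square root becomes x / sqrt 2. The integral over x > 0 is half of the even integral
  over the line, hence the factor sqrt 2 / 2.\<close>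

lemma heat_H_integral:
  assumes z: "0 < Re z" and \<rho>: "0 \<le> \<rho>"
  shows "(LINT u:{\<rho><..}|lborel. of_real u * exp (- (of_real u)\<^sup>2 / (4 * z)) / of_real (sqrt (cosh u - cosh \<rho>)))
     = of_real (sqrt 2 / 2) * Abel (kerC z) (cosh \<rho>)"
proof -
  define C where "C = cosh \<rho>"
  have C: "1 \<le> C" by (simp add: C_def cosh_real_ge_1)
  define f where "f u = complex_of_real u * exp (- (of_real u)\<^sup>2 / (4 * z)) / of_real (sqrt (cosh u - C))" for u
  define g where "g x = arcosh (C + x\<^sup>2 / 2)" for x
  define g' where "g' x = x / sqrt ((C + x\<^sup>2 / 2)\<^sup>2 - 1)" for x
  have C1: "1 < C + x\<^sup>2 / 2" if "0 < x" for x
  proof -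
    have "0 < x\<^sup>2 / 2" using that by simp
    then show ?thesis using C by linarith
  qed
  have cg: "cosh (g x) = C + x\<^sup>2 / 2" if "0 < x" for x
    unfolding g_def using C1[OF that] by (intro cosh_arcosh_real) simp
  have fg: "g' x *\<^sub>R f (g x) = of_real (sqrt 2) * kerC z (C + x\<^sup>2 / 2)" if x: "0 < x" for x
  proof -
    have "sqrt (cosh (g x) - C) = x / sqrt 2" using x by (simp add: cg real_sqrt_divide)
    then have "f (g x) = of_real (g x) * exp (- (of_real (g x))\<^sup>2 / (4 * z)) / of_real (x / sqrt 2)" by (simp add: f_def)
    then show ?thesis using x by (simp add: g'_def g_def kerC_def gaussC_def scaleR_conv_of_real)
  qed
  have deriv: "(g has_real_derivative g' x) (at x)" if "0 < ereal x" for x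
  proof -
    have x: "0 < x" using that by simp
    have "((\<lambda>x. C + x\<^sup>2 / 2) has_real_derivative x) (at x)" by (auto intro!: derivative_eq_intros)
    from DERIV_chain2[OF arcosh_real_has_field_derivative[OF C1[OF x]] this]
    show ?thesis unfolding g_def[abs_def] g'_def by simp
  qed
  have contg': "isCont g' x" if "0 < ereal x" for x
  proof -
    have "1 < (C + x\<^sup>2 / 2)\<^sup>2" using C1[of x] that by (simp add: one_less_power)
    then have "sqrt ((C + x\<^sup>2 / 2)\<^sup>2 - 1) \<noteq> 0" by simp
    then show ?thesis unfolding g'_def by (intro continuous_intros) auto
  qed
  have g'0: "0 \<le> g' x" if "0 \<le> ereal x" for x
  proof (cases "x = 0")
    case False
    then have "1 < (C + x\<^sup>2 / 2)\<^sup>2" using C1[of x] that by (simp add: one_less_power)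
    then show ?thesis unfolding g'_def using that by simp
  qed (simp add: g'_def)
  have gpos: "\<rho> < g x" if "0 < x" for x
  proof -
    have "cosh \<rho> < cosh (g x)" using that by (simp add: cg C_def)
    moreover have "0 \<le> g x" unfolding g_def using C1[OF that] by simp
    ultimately show ?thesis using \<rho> by (metis cosh_real_nonneg_less_iff)
  qed
  have contf: "isCont f (g x)" if "0 < ereal x" for x
  proof -
    have x: "0 < x" using that by simp
    have "0 < cosh (g x) - C" using x by (simp add: cg)
    then have "sqrt (cosh (g x) - C) \<noteq> 0" by simp
    moreover have "4 * z \<noteq> 0" using z by auto
    ultimately show ?thesis unfolding f_def
      by (intro continuous_divide) (auto intro!: continuous_intros simp del: of_real_power)
  qed
  have A: "((ereal \<circ> g \<circ> real_of_ereal) \<longlongrightarrow> ereal \<rho>) (at_right 0)"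
  proof -
    have "((\<lambda>x. arcosh (C + x\<^sup>2 / 2)) \<longlongrightarrow> arcosh (C + 0\<^sup>2 / 2)) (at_right 0)"
    proof (rule tendsto_arcosh_strong)
      show "((\<lambda>x. C + x\<^sup>2 / 2) \<longlongrightarrow> C + 0\<^sup>2 / 2) (at_right 0)" by (intro tendsto_intros) simp_all
      show "\<forall>\<^sub>F x in at_right 0. 1 \<le> C + x\<^sup>2 / 2" using C by (intro always_eventually) (simp add: add_increasing2)
    qed (use C in simp)
    then have "(g \<longlongrightarrow> \<rho>) (at_right 0)" using \<rho> by (simp add: g_def[abs_def] C_def arcosh_cosh_real)
    then show ?thesis unfolding zero_ereal_def ereal_tendsto_simps1 ereal_tendsto_simps2 .
  qed
  have B: "((ereal \<circ> g \<circ> real_of_ereal) \<longlongrightarrow> \<infinity>) (at_left \<infinity>)"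
  proof -
    have "filterlim (\<lambda>x::real. x\<^sup>2) at_top at_top" by (rule filterlim_pow_at_top) (auto simp: filterlim_ident)
    then have "filterlim (\<lambda>x::real. (1/2) * x\<^sup>2) at_top at_top" by (intro filterlim_tendsto_pos_mult_at_top[OF tendsto_const]) auto
    then have "filterlim (\<lambda>x. C + (1/2) * x\<^sup>2) at_top at_top" by (rule filterlim_tendsto_add_at_top[OF tendsto_const])
    then have "filterlim g at_top at_top" unfolding g_def[abs_def]
      using filterlim_compose[OF arcosh_real_at_top] by (simp add: field_simps)
    then show ?thesis unfolding ereal_tendsto_simps1 ereal_tendsto_simps2 .
  qed
  have ker_int: "integrable lborel (\<lambda>x. kerC z (C + x\<^sup>2 / 2))" by (rule integrable_Abel_kerC[OF z C])
  have int1: "set_integrable lborel (einterval 0 \<infinity>) (\<lambda>x. g' x *\<^sub>R f (g x))"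
  proof -
    have "integrable lborel (\<lambda>x. indicator {0<..} x *\<^sub>R (of_real (sqrt 2) * kerC z (C + x\<^sup>2 / 2)))"
      by (intro integrable_mult_indicator integrable_mult_right ker_int) simp
    moreover have "indicator (einterval 0 \<infinity>) x *\<^sub>R g' x *\<^sub>R f (g x) = indicator {0<..} x *\<^sub>R (of_real (sqrt 2) * kerC z (C + x\<^sup>2 / 2))" for x
      using fg[of x] by (simp add: einterval_def indicator_def)
    ultimately show ?thesis unfolding set_integrable_def by simp
  qed
  have int2: "set_integrable lborel (einterval (ereal \<rho>) \<infinity>) f"
  proof -
    have "set_integrable lborel (einterval (ereal \<rho>) \<infinity>) (\<lambda>u. norm (f u))"
    proof (rule interval_integral_substitution_nonneg(1)[of 0 \<infinity> g g' "\<lambda>u. norm (f u)" "ereal \<rho>" \<infinity>])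
      show "set_integrable lborel (einterval 0 \<infinity>) (\<lambda>x. norm (f (g x)) * g' x)"
      proof -
        have "set_integrable lborel (einterval 0 \<infinity>) (\<lambda>x. norm (g' x *\<^sub>R f (g x)))" by (rule set_integrable_norm[OF int1])
        moreover have "indicator (einterval 0 \<infinity>) x *\<^sub>R norm (g' x *\<^sub>R f (g x)) = indicator (einterval 0 \<infinity>) x *\<^sub>R (norm (f (g x)) * g' x)" for x
          using g'0[of x] by (simp add: indicator_def einterval_def mult.commute)
        ultimately show ?thesis unfolding set_integrable_def by (simp only: )
      qed
      show "isCont (\<lambda>u. norm (f u)) (g x)" if "0 < ereal x" for x by (intro continuous_norm contf that)
    qed (use deriv contg' g'0 A B in auto)
    moreover have "f \<in> borel_measurable borel"
    proof -
      have [measurable]: "(\<lambda>u::real. cosh u) \<in> borel_measurable borel" by (intro borel_measurable_continuous_onI continuous_intros)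
      show ?thesis unfolding f_def[abs_def] by measurable
    qed
    moreover have "norm (indicator (einterval (ereal \<rho>) \<infinity>) u *\<^sub>R f u) = indicator (einterval (ereal \<rho>) \<infinity>) u *\<^sub>R norm (f u)" for u
      by (simp add: indicator_def)
    ultimately show ?thesis unfolding set_integrable_def
      by (intro integrable_norm_cancel[of lborel "\<lambda>u. indicator (einterval (ereal \<rho>) \<infinity>) u *\<^sub>R f u"]) simp_all
  qed
  have "(LBINT u=ereal \<rho>..\<infinity>. f u) = (LBINT x=0..\<infinity>. g' x *\<^sub>R f (g x))"
    by (rule interval_integral_substitution_integrable[OF _ deriv contf contg' g'0 A B int1 int2]) auto
  also have "\<dots> = (\<integral>x. of_real (sqrt 2) * (indicator {0<..} x *\<^sub>R kerC z (C + x\<^sup>2 / 2)) \<partial>lborel)"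
    unfolding interval_lebesgue_integral_def set_lebesgue_integral_def
    using fg by (simp, intro Bochner_Integration.integral_cong) (auto simp: einterval_def indicator_def)
  also have "\<dots> = of_real (sqrt 2) * (\<integral>x. indicator {0<..} x *\<^sub>R kerC z (C + x\<^sup>2 / 2) \<partial>lborel)" by (rule integral_mult_right_zero)
  also have "\<dots> = of_real (sqrt 2 / 2) * Abel (kerC z) C"
    using integral_half_line_even[of "\<lambda>s. kerC z (C + s / 2)", OF ker_int] by (simp add: Abel_def)
  finally have "(LBINT u=ereal \<rho>..\<infinity>. f u) = of_real (sqrt 2 / 2) * Abel (kerC z) C" .
  moreover have "(LBINT u=ereal \<rho>..\<infinity>. f u) = (LINT u:{\<rho><..}|lborel. f u)"
    unfolding interval_lebesgue_integral_def by (simp add: einterval_def greaterThan_def)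
  ultimately show ?thesis by (simp add: f_def C_def)
qed

definition heat_coef :: "complex \<Rightarrow> complex" where
  "heat_coef z = exp (- z / 4) / (4 * of_real pi * z) powr (3 / 2) * (of_real (4 * pi) * z)"

lemma heat_H_eq:
  assumes z: "0 < Re z" and \<rho>: "0 \<le> \<rho>"
  shows "heat_H z \<rho> = heat_coef z * KC z (cosh \<rho>)"
proof -
  have z0: "z \<noteq> 0" using z by auto
  have s: "complex_of_real (sqrt 2) * of_real (sqrt 2 / 2) = 1" by (simp flip: of_real_mult)
  have "heat_H z \<rho> = of_real (sqrt 2) * exp (- z / 4) / (4 * of_real pi * z) powr (3 / 2) * (of_real (sqrt 2 / 2) * Abel (kerC z) (cosh \<rho>))"
    unfolding heat_H_def heat_H_integral[OF assms] ..
  also have "\<dots> = (complex_of_real (sqrt 2) * of_real (sqrt 2 / 2)) * (exp (- z / 4) / (4 * of_real pi * z) powr (3 / 2) * Abel (kerC z) (cosh \<rho>))"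
    by (simp add: mult_ac)
  also have "\<dots> = heat_coef z * KC z (cosh \<rho>)" unfolding s heat_coef_def KC_def using z0 by simp
  finally show ?thesis .
qed

lemma norm_heat_coef: assumes z: "0 < Re z" shows "cmod (heat_coef z) = exp (- Re z / 4) / sqrt (4 * pi * cmod z)"
proof -
  have z0: "z \<noteq> 0" using z by auto
  define r where "r = 4 * pi * cmod z"
  have r: "0 < r" using z0 by (simp add: r_def)
  have nr: "cmod (4 * of_real pi * z) = r" by (simp add: r_def norm_mult)
  have nz: "4 * of_real pi * z \<noteq> 0" using z0 by simp
  have "cmod ((4 * of_real pi * z) powr (3 / 2)) = r powr (3 / 2)"
    by (subst norm_powr_real_powr') (auto simp: nr)
  then have "cmod (heat_coef z) = exp (- Re z / 4) / r powr (3 / 2) * r"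
    by (simp add: heat_coef_def norm_mult norm_divide r_def)
  also have "r powr (3 / 2) = r * sqrt r" using powr_add[of r 1 "1 / 2"] r by (simp add: powr_half_sqrt)
  also have "exp (- Re z / 4) / (r * sqrt r) * r = exp (- Re z / 4) / sqrt r" using r by simp
  finally show ?thesis by (simp add: r_def)
qed

section \<open>Convolution of radial kernels\<close>

definition hrot :: "real \<Rightarrow> mat4" where
  "hrot \<theta> = (cos \<theta>, sin \<theta>, - sin \<theta>, cos \<theta>)"

lemma hrot_SL2: "hrot \<theta> \<in> SL2"
  using sin_cos_squared_add2[of \<theta>] by (simp add: hrot_def power2_eq_square)

lemma hrot_i: "mob (hrot \<theta>) \<i> = \<i>"
proof -
  have "cmod (of_real (cos \<theta>) - of_real (sin \<theta>) * \<i>) = 1" by (simp add: cmod_def)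
  then have "of_real (cos \<theta>) - of_real (sin \<theta>) * \<i> \<noteq> 0" by auto
  then show ?thesis by (simp add: hrot_def field_simps)
qed

lemma hX_hrot:
  assumes "p \<in> upper"
  shows "hX (mob (hrot \<theta>) p) = cis (- (2 * \<theta>)) * hX p"
proof -
  define c s where "c = cos \<theta>" and "s = sin \<theta>"
  define x y where "x = Re p" and "y = Im p"
  have y: "0 < y" using assms by (simp add: y_def)
  define N M where "N = of_real c * p + of_real s" and "M = of_real (- s) * p + of_real c"
  define D where "D = (cmod M)\<^sup>2"
  have det: "c * c - s * (- s) = 1" using sin_cos_squared_add2[of \<theta>] by (simp add: c_def s_def power2_eq_square)
  have M0: "M \<noteq> 0" using mob_denom_nz[OF det, of p] assms by (simp add: M_def)
  then have D: "0 < D" by (simp add: D_def)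
  have g: "mob (hrot \<theta>) p = N / M" by (simp add: hrot_def N_def M_def c_def s_def)
  have Im: "Im (N / M) = y / D" using Im_mob[OF det, of p] assms by (simp add: N_def M_def D_def y_def)
  have Re: "Re (N / M) = Re (N * cnj M) / D" by (subst complex_div_cnj) (simp add: D_def flip: of_real_power)
  have nm: "(cmod (N / M))\<^sup>2 = (cmod N)\<^sup>2 / D" by (simp add: norm_divide power_divide D_def)
  have 1: "(cmod N)\<^sup>2 - D = (c\<^sup>2 - s\<^sup>2) * (x\<^sup>2 + y\<^sup>2 - 1) + 4 * c * s * x"
    unfolding D_def N_def M_def cmod_power2 by (simp add: x_def[symmetric] y_def[symmetric] power2_eq_square algebra_simps)
  have 2: "Re (N * cnj M) = (c\<^sup>2 - s\<^sup>2) * x - c * s * (x\<^sup>2 + y\<^sup>2 - 1)"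
    unfolding N_def M_def by (simp add: x_def[symmetric] y_def[symmetric] power2_eq_square algebra_simps)
  have cs: "cos (2 * \<theta>) = c\<^sup>2 - s\<^sup>2" "sin (2 * \<theta>) = 2 * s * c" by (simp_all add: cos_double sin_double c_def s_def)
  have nmp: "(cmod p)\<^sup>2 = x\<^sup>2 + y\<^sup>2" by (simp add: cmod_power2 x_def y_def)
  have "Re (hX (mob (hrot \<theta>) p)) = ((cmod N)\<^sup>2 - D) / (2 * y)"
    unfolding g hX_def using D y by (simp add: Im nm field_simps)
  moreover have "Im (hX (mob (hrot \<theta>) p)) = Re (N * cnj M) / y"
    unfolding g hX_def using D y by (simp add: Im Re del: times_complex.sel)
  moreover have "Re (cis (- (2 * \<theta>)) * hX p) = (c\<^sup>2 - s\<^sup>2) * ((x\<^sup>2 + y\<^sup>2 - 1) / (2 * y)) + 2 * s * c * (x / y)"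
    by (simp add: hX_def nmp cs x_def[symmetric] y_def[symmetric])
  moreover have "Im (cis (- (2 * \<theta>)) * hX p) = (c\<^sup>2 - s\<^sup>2) * (x / y) - 2 * s * c * ((x\<^sup>2 + y\<^sup>2 - 1) / (2 * y))"
    by (simp add: hX_def nmp cs x_def[symmetric] y_def[symmetric])
  moreover have "((c\<^sup>2 - s\<^sup>2) * (x\<^sup>2 + y\<^sup>2 - 1) + 4 * c * s * x) / (2 * y) = (c\<^sup>2 - s\<^sup>2) * ((x\<^sup>2 + y\<^sup>2 - 1) / (2 * y)) + 2 * s * c * (x / y)"
    using y by (simp add: field_simps)
  moreover have "((c\<^sup>2 - s\<^sup>2) * x - c * s * (x\<^sup>2 + y\<^sup>2 - 1)) / y = (c\<^sup>2 - s\<^sup>2) * (x / y) - 2 * s * c * ((x\<^sup>2 + y\<^sup>2 - 1) / (2 * y))"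
    using y by (simp add: field_simps)
  ultimately show ?thesis by (simp add: complex_eq_iff 1 2 del: times_complex.sel)
qed

text \<open>Rotations about \<i> multiply \<open>hX\<close> by a unit complex number
  (\<open>hX_hrot\<close>), so \<open>hX p\<close> can be made real and nonnegative. A function
  invariant under these rotations thus depends only on the distance from \<i>
  (\<open>hconv_radial\<close>).\<close>

lemma rotate_to_axis:
  assumes p: "p \<in> upper"
  shows "\<exists>g\<in>SL2. mob g \<i> = \<i> \<and> mob g p = hp (0, hdist \<i> p)"
proof -
  define \<theta> where "\<theta> = Arg (hX p) / 2"
  have iu: "\<i> \<in> upper" by simp
  have "hX (mob (hrot \<theta>) p) = of_real (cmod (hX p))"
  proof (cases "hX p = 0")
    case False
    have "hX p = of_real (cmod (hX p)) * cis (Arg (hX p))" using rcis_cmod_Arg[of "hX p"] by (simp add: rcis_def)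
    then have "cis (- (2 * \<theta>)) * hX p = of_real (cmod (hX p)) * (cis (- (2 * \<theta>)) * cis (Arg (hX p)))" by (metis mult.left_commute)
    also have "cis (- (2 * \<theta>)) * cis (Arg (hX p)) = 1" by (simp add: cis_mult \<theta>_def)
    finally show ?thesis using hX_hrot[OF p] by simp
  qed (simp add: hX_hrot[OF p])
  also have "\<dots> = of_real (sinh (hdist \<i> p))" using norm_hX_sinh[OF p] by simp
  also have "\<dots> = hX (hp (0, hdist \<i> p))"
  proof -
    have "cmod (hp (0, hdist \<i> p)) = exp (hdist \<i> p)" by (simp add: hp_def norm_mult)
    then show ?thesis by (simp add: hX_def complex_eq_iff sinh_def exp_minus field_simps power2_eq_square)
  qed
  finally have eq: "hX (mob (hrot \<theta>) p) = hX (hp (0, hdist \<i> p))" .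
  have "mob (hrot \<theta>) p = hpt (hX (mob (hrot \<theta>) p))" by (rule hpt_hX[symmetric, OF mob_upper[OF hrot_SL2 p]])
  also have "\<dots> = hp (0, hdist \<i> p)" unfolding eq by (rule hpt_hX[OF hp_upper])
  finally show ?thesis using hrot_SL2 hrot_i by blast
qed

text \<open>The points at height exp v form a horocycle. Its parameter y is centred at the real part
  of \<open>hp x\<close> and scaled so that the distance enters in the form used by
  \<open>Abel\<close>.\<close>

lemma ch_line:
  "ch (hp x) (hp (exp (snd x - v) * fst x + exp ((snd x - v) / 2) * y, v)) = cosh (snd x - v) + y\<^sup>2 / 2"
proof -
  define a b where "a = exp ((snd x - v) / 2)" and "b = exp (snd x - v) * fst x"
  have "exp v * b = exp (snd x) * fst x" by (simp add: b_def exp_diff)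
  then have "(exp (snd x) * fst x - exp v * (b + a * y))\<^sup>2 = (exp v * a)\<^sup>2 * y\<^sup>2"
    by (simp add: distrib_left power_mult_distrib mult.assoc)
  moreover have "(exp v * a)\<^sup>2 * exp (- snd x - v) = 1" by (simp add: a_def power2_eq_square mult_exp_exp)
  ultimately have "(exp (snd x) * fst x - exp v * (b + a * y))\<^sup>2 * exp (- snd x - v) = y\<^sup>2"
    by (simp add: mult.assoc mult.left_commute[of _ "y\<^sup>2"])
  then show ?thesis unfolding ch_hp by (simp add: a_def b_def)
qed

lemma nn_integral_ch_line:
  assumes [measurable]: "f \<in> borel_measurable borel"
  shows "(\<integral>\<^sup>+r. f (ch (hp x) (hp (r, v))) \<partial>lborel) = ennreal (exp ((snd x - v) / 2)) * (\<integral>\<^sup>+y. f (cosh (snd x - v) + y\<^sup>2 / 2) \<partial>lborel)"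
proof -
  have [measurable]: "(\<lambda>r. hp (r, v)) \<in> borel_measurable borel" unfolding hp_def by simp
  have "(\<lambda>r. f (ch (hp x) (hp (r, v)))) \<in> borel_measurable borel" by measurable
  from nn_integral_real_affine[OF this, of "exp ((snd x - v) / 2)" "exp (snd x - v) * fst x"]
  show ?thesis unfolding ch_line by simp
qed

lemma integral_ch_line:
  fixes f :: "real \<Rightarrow> complex"
  shows "(\<integral>r. f (ch (hp x) (hp (r, v))) \<partial>lborel) = of_real (exp ((snd x - v) / 2)) * Abel f (cosh (snd x - v))"
  using lborel_integral_real_affine[of "exp ((snd x - v) / 2)" "\<lambda>r. f (ch (hp x) (hp (r, v)))" "exp (snd x - v) * fst x"]
  unfolding ch_line Abel_def by (simp add: scaleR_conv_of_real)

lemma nn_integral_KC: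
  assumes z: "0 < Re z" and c: "1 \<le> c"
  shows "(\<integral>\<^sup>+y. ennreal (cmod (KC z (c + y\<^sup>2 / 2))) \<partial>lborel) \<le> ennreal (KC_bound z / c ^ 3 * quad_const)"
proof -
  have le: "cmod (KC z (c + y\<^sup>2 / 2)) \<le> KC_bound z / c ^ 3 * (1 / (1 + y\<^sup>2 / 2))" for y
  proof -
    have "cmod (KC z (c + y\<^sup>2 / 2)) \<le> KC_bound z * (1 / (c + y\<^sup>2 / 2) ^ Suc 3)"
      using norm_KC[OF z quad_bound(2)[OF c, of y]] by simp
    also have "\<dots> \<le> KC_bound z * (1 / c ^ 3 * (1 / (1 + y\<^sup>2 / 2)))" by (intro mult_left_mono quad_bound c KC_bound_nonneg)
    finally show ?thesis by simp
  qed
  have i: "integrable lborel (\<lambda>y. KC_bound z / c ^ 3 * (1 / (1 + y\<^sup>2 / 2)))" by (intro integrable_mult_right integrable_quadratic)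
  have "(\<integral>\<^sup>+y. ennreal (cmod (KC z (c + y\<^sup>2 / 2))) \<partial>lborel) \<le> (\<integral>\<^sup>+y. ennreal (KC_bound z / c ^ 3 * (1 / (1 + y\<^sup>2 / 2))) \<partial>lborel)"
    by (intro nn_integral_mono ennreal_leI le)
  also have "\<dots> = ennreal (\<integral>y. KC_bound z / c ^ 3 * (1 / (1 + y\<^sup>2 / 2)) \<partial>lborel)"
    by (rule nn_integral_eq_integral[OF i]) (intro AE_I2 mult_nonneg_nonneg divide_nonneg_nonneg, use KC_bound_nonneg c in \<open>auto intro: add_nonneg_nonneg\<close>)
  also have "(\<integral>y. KC_bound z / c ^ 3 * (1 / (1 + y\<^sup>2 / 2)) \<partial>lborel) = KC_bound z / c ^ 3 * quad_const"
    unfolding quad_const_def by (rule integral_mult_right_zero)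
  finally show ?thesis .
qed

definition hconv :: "complex \<Rightarrow> complex \<Rightarrow> complex \<Rightarrow> complex" where
  "hconv z z' p = (\<integral>w. KC z (ch \<i> w) * KC z' (ch w p) \<partial>hm)"

lemma hi: "\<i> = hp (0, 0)" by (simp add: hp_def)

lemma hconv_invariant:
  assumes g: "g \<in> SL2" "mob g \<i> = \<i>" and p: "p \<in> upper"
  shows "hconv z z' (mob g p) = hconv z z' p"
proof -
  have iu: "\<i> \<in> upper" by simp
  have "hconv z z' (mob g p) = (\<integral>w. KC z (ch \<i> (mob g w)) * KC z' (ch (mob g w) (mob g p)) \<partial>hm)"
    unfolding hconv_def
    using integral_hm_mob[OF g(1), of "\<lambda>w. KC z (ch \<i> w) * KC z' (ch w (mob g p))"] by simp
  also have "\<dots> = (\<integral>w. KC z (ch \<i> w) * KC z' (ch w p) \<partial>hm)"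
  proof (rule integral_cong_AE)
    show "AE w in hm. KC z (ch \<i> (mob g w)) * KC z' (ch (mob g w) (mob g p)) = KC z (ch \<i> w) * KC z' (ch w p)"
      using AE_hm_upper
    proof eventually_elim
      case (elim w)
      then show ?case using ch_mob[OF g(1) iu elim] ch_mob[OF g(1) elim p] g(2) by simp
    qed
  qed simp_all
  finally show ?thesis by (simp add: hconv_def)
qed

lemma hconv_radial: assumes p: "p \<in> upper" shows "hconv z z' p = hconv z z' (hp (0, arcosh (ch \<i> p)))"
proof -
  have iu: "\<i> \<in> upper" by simp
  obtain g where g: "g \<in> SL2" "mob g \<i> = \<i>" "mob g p = hp (0, hdist \<i> p)" using rotate_to_axis[OF p] by blast
  have "arcosh (ch \<i> p) = hdist \<i> p" using hdist_nonneg[OF iu p] by (simp add: ch_cosh[OF iu p] arcosh_cosh_real)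
  then show ?thesis using hconv_invariant[OF g(1,2) p, of z z'] g(3) by simp
qed

lemma integrable_ch_power: assumes "u \<in> upper" shows "integrable hm (\<lambda>w. 1 / (ch u w)\<^sup>2)"
  unfolding integrable_iff_bounded using nn_integral_ch[OF assms] area_const_finite by simp

lemma ch_submult: assumes "u \<in> upper" "w \<in> upper" "p \<in> upper" shows "ch u p \<le> 2 * ch u w * ch w p"
proof -
  have "cosh (hdist u p) \<le> cosh (hdist u w + hdist w p)"
    using hdist_triangle[OF assms] assms by (subst cosh_le_iff_nonneg) auto
  also have "\<dots> \<le> 2 * cosh (hdist u w) * cosh (hdist w p)"
  proof -
    have "sinh (hdist u w) * sinh (hdist w p) \<le> cosh (hdist u w) * cosh (hdist w p)"
      using assms by (intro mult_mono sinh_le_cosh_real) auto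
    then show ?thesis by (simp add: cosh_add)
  qed
  finally show ?thesis using assms by (simp add: ch_cosh)
qed

text \<open>By \<open>ch_submult\<close> two of the four powers of decay of each factor give the
  decay in \<open>p\<close>; two further powers of the first factor keep the bound integrable in
  \<open>w\<close>.\<close>

lemma hconv_integrand_bound:
  assumes z: "0 < Re z" "0 < Re z'" and w: "w \<in> upper" "p \<in> upper"
  shows "cmod (KC z (ch \<i> w) * KC z' (ch w p)) \<le> 4 * KC_bound z * KC_bound z' / (ch \<i> p)\<^sup>2 * (1 / (ch \<i> w)\<^sup>2)"
proof -
  have iu: "\<i> \<in> upper" by simp
  define a b d where "a = ch \<i> w" and "b = ch w p" and "d = ch \<i> p"
  have abd: "1 \<le> a" "1 \<le> b" "1 \<le> d" using ch_ge_1 iu w by (auto simp: a_def b_def d_def)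
  have dab: "d \<le> 2 * a * b" unfolding a_def b_def d_def by (rule ch_submult[OF iu w])
  have "d\<^sup>2 \<le> (2 * a * b)\<^sup>2" using dab abd by (intro power_mono) auto
  then have "d\<^sup>2 * a\<^sup>2 \<le> 4 * (a ^ 4 * b\<^sup>2)" using abd
    by (simp add: power_mult_distrib power2_eq_square power4_eq_xxxx mult_right_mono mult_ac)
  also have "\<dots> \<le> 4 * (a ^ 4 * b ^ 4)" using abd by (intro mult_left_mono power_increasing) auto
  finally have le: "d\<^sup>2 * a\<^sup>2 \<le> 4 * (a ^ 4 * b ^ 4)" .
  have "cmod (KC z a * KC z' b) \<le> (KC_bound z / a ^ 4) * (KC_bound z' / b ^ 4)"
    unfolding norm_mult using norm_KC[OF z(1) abd(1)] norm_KC[OF z(2) abd(2)] KC_bound_nonneg abd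
    by (intro mult_mono) auto
  also have "\<dots> = KC_bound z * KC_bound z' * (1 / (a ^ 4 * b ^ 4))" by simp
  also have "\<dots> \<le> KC_bound z * KC_bound z' * (4 / (d\<^sup>2 * a\<^sup>2))"
  proof (intro mult_left_mono mult_nonneg_nonneg KC_bound_nonneg)
    show "1 / (a ^ 4 * b ^ 4) \<le> 4 / (d\<^sup>2 * a\<^sup>2)" using le abd by (simp add: divide_simps)
  qed
  also have "\<dots> = 4 * KC_bound z * KC_bound z' / d\<^sup>2 * (1 / a\<^sup>2)" by simp
  finally show ?thesis unfolding a_def b_def d_def .
qed

lemma hconv_bound:
  assumes z: "0 < Re z" "0 < Re z'" and p: "p \<in> upper"
  shows "integrable hm (\<lambda>w. KC z (ch \<i> w) * KC z' (ch w p))"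
    "cmod (hconv z z' p) \<le> 4 * KC_bound z * KC_bound z' * (\<integral>w. 1 / (ch \<i> w)\<^sup>2 \<partial>hm) / (ch \<i> p)\<^sup>2"
proof -
  have iu: "\<i> \<in> upper" by simp
  let ?B = "\<lambda>w. 4 * KC_bound z * KC_bound z' / (ch \<i> p)\<^sup>2 * (1 / (ch \<i> w)\<^sup>2)"
  have iB: "integrable hm ?B" by (intro integrable_mult_right integrable_ch_power iu)
  have AEb: "AE w in hm. norm (KC z (ch \<i> w) * KC z' (ch w p)) \<le> ?B w"
    using AE_hm_upper by eventually_elim (rule hconv_integrand_bound[OF z _ p])
  show int: "integrable hm (\<lambda>w. KC z (ch \<i> w) * KC z' (ch w p))"
  proof (rule Bochner_Integration.integrable_bound[OF iB])
    show "AE w in hm. norm (KC z (ch \<i> w) * KC z' (ch w p)) \<le> norm (?B w)"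
      using AEb by eventually_elim (erule order_trans, unfold real_norm_def, rule abs_ge_self)
  qed simp
  have "cmod (hconv z z' p) \<le> (\<integral>w. norm (KC z (ch \<i> w) * KC z' (ch w p)) \<partial>hm)"
    unfolding hconv_def by (rule integral_norm_bound)
  also have "\<dots> \<le> (\<integral>w. ?B w \<partial>hm)" by (rule integral_mono_AE[OF integrable_norm[OF int] iB AEb])
  also have "\<dots> = 4 * KC_bound z * KC_bound z' / (ch \<i> p)\<^sup>2 * (\<integral>w. 1 / (ch \<i> w)\<^sup>2 \<partial>hm)" by (rule integral_mult_right_zero)
  finally show "cmod (hconv z z' p) \<le> 4 * KC_bound z * KC_bound z' * (\<integral>w. 1 / (ch \<i> w)\<^sup>2 \<partial>hm) / (ch \<i> p)\<^sup>2" by simp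
qed

text \<open>The convolution in terms of c = cosh of the distance from \<i>, read off on the
  imaginary axis; \<open>hconv_radial\<close> recovers the convolution from it.\<close>

definition hprofile :: "complex \<Rightarrow> complex \<Rightarrow> real \<Rightarrow> complex" where
  "hprofile z z' c = hconv z z' (hp (0, arcosh c))"

lemma ch_i_axis: "1 \<le> c \<Longrightarrow> ch \<i> (hp (0, arcosh c)) = c"
  unfolding hi ch_hp by simp

lemma measurable_hprofile [measurable]: "hprofile z z' \<in> borel_measurable borel"
proof -
  interpret sigma_finite_measure hm by (rule sigma_finite_hm)
  have [measurable]: "(\<lambda>c. hp (0, arcosh c)) \<in> borel_measurable borel" unfolding hp_def by simp
  show ?thesis unfolding hprofile_def[abs_def] hconv_def by measurable
qed

lemma hprofile_tendsto:
  assumes z: "0 < Re z" "0 < Re z'" and c: "\<And>n::nat. 1 \<le> c n" "c \<longlonglongrightarrow> l"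
  shows "(\<lambda>n. hprofile z z' (c n)) \<longlonglongrightarrow> hprofile z z' l"
proof -
  have iu: "\<i> \<in> upper" by simp
  have l: "1 \<le> l" by (rule LIMSEQ_le_const[OF c(2)]) (use c(1) in auto)
  have alim: "(\<lambda>n. arcosh (c n)) \<longlonglongrightarrow> arcosh l"
    by (rule tendsto_arcosh_strong[OF c(2) l]) (use c(1) in simp)
  have plim: "(\<lambda>n. hp (0, arcosh (c n))) \<longlonglongrightarrow> hp (0, arcosh l)" unfolding hp_def by (intro tendsto_mult tendsto_add tendsto_of_real tendsto_exp tendsto_const) (simp_all add: alim)
  show ?thesis unfolding hprofile_def hconv_def
  proof (rule integral_dominated_convergence[where w = "\<lambda>w. 4 * KC_bound z * KC_bound z' * (1 / (ch \<i> w)\<^sup>2)"])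
    show "integrable hm (\<lambda>w. 4 * KC_bound z * KC_bound z' * (1 / (ch \<i> w)\<^sup>2))" by (intro integrable_mult_right integrable_ch_power iu)
    show "AE w in hm. (\<lambda>n. KC z (ch \<i> w) * KC z' (ch w (hp (0, arcosh (c n))))) \<longlonglongrightarrow> KC z (ch \<i> w) * KC z' (ch w (hp (0, arcosh l)))"
      using AE_hm_upper
    proof eventually_elim
      case (elim w)
      have "(\<lambda>n. ch w (hp (0, arcosh (c n)))) \<longlonglongrightarrow> ch w (hp (0, arcosh l))"
        unfolding ch_def by (intro tendsto_intros plim) (use elim in simp)
      then show ?case by (intro tendsto_intros KC_tendsto z ch_ge_1 elim hp_upper)
    qed
    show "AE w in hm. norm (KC z (ch \<i> w) * KC z' (ch w (hp (0, arcosh (c n))))) \<le> 4 * KC_bound z * KC_bound z' * (1 / (ch \<i> w)\<^sup>2)" for n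
      using AE_hm_upper
    proof eventually_elim
      case (elim w)
      have "norm (KC z (ch \<i> w) * KC z' (ch w (hp (0, arcosh (c n))))) \<le> 4 * KC_bound z * KC_bound z' / (c n)\<^sup>2 * (1 / (ch \<i> w)\<^sup>2)"
        using hconv_integrand_bound[OF z elim hp_upper, of "(0, arcosh (c n))"] ch_i_axis[OF c(1)] by simp
      also have "\<dots> \<le> 4 * KC_bound z * KC_bound z' / 1 * (1 / (ch \<i> w)\<^sup>2)"
        using KC_bound_nonneg c(1)[of n] by (intro mult_right_mono divide_left_mono) auto
      finally show ?case by simp
    qed
  qed simp_all
qed

text \<open>Integrate the convolution over the horocycle at height exp v and exchange the integrals.
  For a point of height exp s the second kernel gives a Gaussian in s - v, and the first kernel,
  integrated over the horocycle at that height, gives a Gaussian in s. The exponential factors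
  combine to exp (- v / 2), the factor that relates the left side to \<open>Abel\<close>.\<close>

lemma Abel_hprofile:
  assumes z: "0 < Re z" "0 < Re z'"
  shows "Abel (hprofile z z') (cosh v) = (\<integral>s. gaussC z' (cosh (s - v)) * gaussC z (cosh s) \<partial>lborel)"
proof -
  interpret P: pair_sigma_finite lborel plane ..
  define F where "F r x = KC z (ch \<i> (hp x)) * KC z' (ch (hp x) (hp (r, v)))" for r x
  have [measurable]: "(\<lambda>y. hp (fst y, v)) \<in> borel_measurable (lborel \<Otimes>\<^sub>M plane)"
    unfolding hp_def fst_conv snd_conv by measurable
  have Fm[measurable]: "case_prod F \<in> borel_measurable (lborel \<Otimes>\<^sub>M plane)"
    unfolding F_def[abs_def] case_prod_beta by measurable
  define M' where "M' = KC_bound z' * quad_const"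
  have M': "0 \<le> M'" unfolding M'_def by (intro mult_nonneg_nonneg KC_bound_nonneg quad_const_nonneg)
  \<comment> \<open>Preparation for Fubini: the integral of the second kernel over the horocycle is
    bounded by \<open>M'\<close> up to the explicit exponential, whatever \<open>x\<close>
    is.\<close>
  have inner: "(\<integral>\<^sup>+r. ennreal (cmod (F r x)) \<partial>lborel) \<le> ennreal (cmod (KC z (ch \<i> (hp x)))) * ennreal (exp ((snd x - v) / 2) * M')" for x
  proof -
    have "(\<integral>\<^sup>+r. ennreal (cmod (F r x)) \<partial>lborel)
        = (\<integral>\<^sup>+r. ennreal (cmod (KC z (ch \<i> (hp x)))) * ennreal (cmod (KC z' (ch (hp x) (hp (r, v))))) \<partial>lborel)"
      by (simp add: F_def norm_mult ennreal_mult)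
    also have "\<dots> = ennreal (cmod (KC z (ch \<i> (hp x)))) * (\<integral>\<^sup>+r. ennreal (cmod (KC z' (ch (hp x) (hp (r, v))))) \<partial>lborel)"
    proof (rule nn_integral_cmult)
      have [measurable]: "(\<lambda>r. hp (r, v)) \<in> borel_measurable lborel" unfolding hp_def by simp
      show "(\<lambda>r. ennreal (cmod (KC z' (ch (hp x) (hp (r, v)))))) \<in> borel_measurable lborel" by measurable
    qed
    also have "(\<integral>\<^sup>+r. ennreal (cmod (KC z' (ch (hp x) (hp (r, v))))) \<partial>lborel)
        = ennreal (exp ((snd x - v) / 2)) * (\<integral>\<^sup>+y. ennreal (cmod (KC z' (cosh (snd x - v) + y\<^sup>2 / 2))) \<partial>lborel)"
      by (rule nn_integral_ch_line) simp
    also have "(\<integral>\<^sup>+y. ennreal (cmod (KC z' (cosh (snd x - v) + y\<^sup>2 / 2))) \<partial>lborel) \<le> ennreal M'"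
    proof (rule order_trans[OF nn_integral_KC[OF z(2) cosh_real_ge_1]], rule ennreal_leI)
      have "1 \<le> (cosh (snd x - v)) ^ 3" by (rule one_le_power[OF cosh_real_ge_1])
      then have "KC_bound z' / cosh (snd x - v) ^ 3 \<le> KC_bound z' / 1" using KC_bound_nonneg by (intro divide_left_mono) auto
      then show "KC_bound z' / cosh (snd x - v) ^ 3 * quad_const \<le> M'" unfolding M'_def using quad_const_nonneg by (intro mult_right_mono) auto
    qed
    finally show ?thesis using M' by (simp add: ennreal_mult mult_left_mono)
  qed
  have "(\<integral>\<^sup>+y. ennreal (norm (case_prod F y)) \<partial>(lborel \<Otimes>\<^sub>M plane)) = (\<integral>\<^sup>+x. (\<integral>\<^sup>+r. ennreal (cmod (F r x)) \<partial>lborel) \<partial>plane)"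
    by (subst P.nn_integral_snd[symmetric]) simp_all
  also have "\<dots> \<le> (\<integral>\<^sup>+x. ennreal (cmod (KC z (ch \<i> (hp x)))) * ennreal (exp ((snd x - v) / 2) * M') \<partial>plane)"
    by (intro nn_integral_mono inner)
  also have "\<dots> = (\<integral>\<^sup>+s. (\<integral>\<^sup>+r. ennreal (cmod (KC z (ch \<i> (hp (r, s))))) * ennreal (exp ((s - v) / 2) * M') \<partial>lborel) \<partial>lborel)"
    by (subst lborel_pair.nn_integral_snd[symmetric]) simp_all
  also have "\<dots> \<le> (\<integral>\<^sup>+s. ennreal (exp (- v / 2) * M' * (KC_bound z * quad_const)) * ennreal (1 / (1 + s\<^sup>2 / 2)) \<partial>lborel)"
  proof (rule nn_integral_mono)
    fix s :: real
    have [measurable]: "(\<lambda>r. hp (r, s)) \<in> borel_measurable lborel" unfolding hp_def by simp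
    have c: "1 + s\<^sup>2 / 2 \<le> cosh s" by (rule cosh_ge_quadratic)
    have "(\<integral>\<^sup>+r. ennreal (cmod (KC z (ch \<i> (hp (r, s))))) * ennreal (exp ((s - v) / 2) * M') \<partial>lborel)
        = (\<integral>\<^sup>+r. ennreal (cmod (KC z (ch \<i> (hp (r, s))))) \<partial>lborel) * ennreal (exp ((s - v) / 2) * M')"
      by (rule nn_integral_multc) simp
    also have "(\<integral>\<^sup>+r. ennreal (cmod (KC z (ch \<i> (hp (r, s))))) \<partial>lborel)
        = ennreal (exp (- s / 2)) * (\<integral>\<^sup>+y. ennreal (cmod (KC z (cosh s + y\<^sup>2 / 2))) \<partial>lborel)"
      using nn_integral_ch_line[of "\<lambda>c. ennreal (cmod (KC z c))" "(0, 0)" s] by (simp add: hi)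
    also have "(\<integral>\<^sup>+y. ennreal (cmod (KC z (cosh s + y\<^sup>2 / 2))) \<partial>lborel) \<le> ennreal (KC_bound z * quad_const * (1 / (1 + s\<^sup>2 / 2)))"
    proof (rule order_trans[OF nn_integral_KC[OF z(1) cosh_real_ge_1]], rule ennreal_leI)
      have p: "0 < 1 + s\<^sup>2 / 2" by (intro add_pos_nonneg) auto
      have "1 + s\<^sup>2 / 2 \<le> cosh s ^ 3" using c power_increasing[of 1 3 "cosh s"] cosh_real_ge_1[of s] by simp
      then have "1 / cosh s ^ 3 \<le> 1 / (1 + s\<^sup>2 / 2)" using p by (intro frac_le) auto
      then have "KC_bound z * quad_const * (1 / cosh s ^ 3) \<le> KC_bound z * quad_const * (1 / (1 + s\<^sup>2 / 2))"
        by (intro mult_left_mono mult_nonneg_nonneg KC_bound_nonneg quad_const_nonneg)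
      then show "KC_bound z / cosh s ^ 3 * quad_const \<le> KC_bound z * quad_const * (1 / (1 + s\<^sup>2 / 2))" by simp
    qed
    also have "ennreal (exp (- s / 2)) * ennreal (KC_bound z * quad_const * (1 / (1 + s\<^sup>2 / 2))) * ennreal (exp ((s - v) / 2) * M')
        = ennreal (exp (- v / 2) * M' * (KC_bound z * quad_const)) * ennreal (1 / (1 + s\<^sup>2 / 2))"
    proof -
      have n: "0 \<le> KC_bound z * quad_const" "0 \<le> 1 / (1 + s\<^sup>2 / 2)" by (intro mult_nonneg_nonneg KC_bound_nonneg quad_const_nonneg) (auto intro: add_nonneg_nonneg)
      have e: "exp (- s / 2) * exp ((s - v) / 2) = exp (- v / 2)" by (simp add: exp_add[symmetric] field_simps)
      have "exp (- s / 2) * (KC_bound z * quad_const * (1 / (1 + s\<^sup>2 / 2))) * (exp ((s - v) / 2) * M')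
          = (exp (- s / 2) * exp ((s - v) / 2)) * M' * (KC_bound z * quad_const) * (1 / (1 + s\<^sup>2 / 2))" by (simp only: mult_ac)
      then show ?thesis unfolding e using n M' by (simp only: ennreal_mult[symmetric] mult_nonneg_nonneg exp_ge_zero)
    qed
    finally show "(\<integral>\<^sup>+r. ennreal (cmod (KC z (ch \<i> (hp (r, s))))) * ennreal (exp ((s - v) / 2) * M') \<partial>lborel)
        \<le> ennreal (exp (- v / 2) * M' * (KC_bound z * quad_const)) * ennreal (1 / (1 + s\<^sup>2 / 2))"
      by (simp add: mult_left_mono mult_right_mono)
  qed
  also have "\<dots> = ennreal (exp (- v / 2) * M' * (KC_bound z * quad_const)) * (\<integral>\<^sup>+s. ennreal (1 / (1 + s\<^sup>2 / 2)) \<partial>lborel)"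
    by (rule nn_integral_cmult) simp
  also have "\<dots> < \<infinity>"
  proof -
    have "(\<integral>\<^sup>+s. ennreal (norm (1 / (1 + (s::real)\<^sup>2 / 2))) \<partial>lborel) < \<infinity>" using integrable_quadratic unfolding integrable_iff_bounded by blast
    moreover have "norm (1 / (1 + s\<^sup>2 / 2)) = 1 / (1 + s\<^sup>2 / 2)" for s :: real by (simp add: add_nonneg_nonneg)
    ultimately show ?thesis by (simp add: ennreal_mult_less_top)
  qed
  finally have Fint: "integrable (lborel \<Otimes>\<^sub>M plane) (case_prod F)" by (intro integrableI_bounded) simp_all
  define G where "G r s = KC z (ch \<i> (hp (r, s))) * (of_real (exp ((s - v) / 2)) * gaussC z' (cosh (s - v)))" for r s
  have Fr: "(\<integral>r. F r x \<partial>lborel) = case_prod G x" for x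
    unfolding F_def integral_mult_right_zero integral_ch_line Abel_KC[OF z(2) cosh_real_ge_1]
    by (simp add: G_def case_prod_beta)
  have "(\<integral>r. hconv z z' (hp (r, v)) \<partial>lborel) = (\<integral>r. (\<integral>x. F r x \<partial>plane) \<partial>lborel)"
    unfolding hconv_def hm_def F_def by (subst integral_distr) simp_all
  also have "\<dots> = (\<integral>x. (\<integral>r. F r x \<partial>lborel) \<partial>plane)" by (rule P.Fubini_integral[symmetric, OF Fint])
  also have "\<dots> = (\<integral>s. (\<integral>r. G r s \<partial>lborel) \<partial>lborel)"
    using lborel_pair.integral_snd[of G] P.integrable_snd[OF Fint] unfolding Fr by simp
  also have "\<dots> = (\<integral>s. of_real (exp (- v / 2)) * (gaussC z' (cosh (s - v)) * gaussC z (cosh s)) \<partial>lborel)"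
  proof (rule Bochner_Integration.integral_cong[OF refl])
    fix s :: real
    have "(\<integral>r. G r s \<partial>lborel) = (\<integral>r. KC z (ch \<i> (hp (r, s))) \<partial>lborel) * (of_real (exp ((s - v) / 2)) * gaussC z' (cosh (s - v)))"
      unfolding G_def by (rule integral_mult_left_zero)
    also have "(\<integral>r. KC z (ch \<i> (hp (r, s))) \<partial>lborel) = of_real (exp (- s / 2)) * gaussC z (cosh s)"
      using integral_ch_line[of "KC z" "(0, 0)" s] Abel_KC[OF z(1) cosh_real_ge_1[of s]] by (simp add: hi)
    also have "of_real (exp (- s / 2)) * gaussC z (cosh s) * (of_real (exp ((s - v) / 2)) * gaussC z' (cosh (s - v)))
        = of_real (exp (- s / 2) * exp ((s - v) / 2)) * (gaussC z' (cosh (s - v)) * gaussC z (cosh s))"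
      by (simp only: of_real_mult mult_ac)
    also have "exp (- s / 2) * exp ((s - v) / 2) = exp (- v / 2)" by (simp add: exp_add[symmetric] field_simps)
    finally show "(\<integral>r. G r s \<partial>lborel) = of_real (exp (- v / 2)) * (gaussC z' (cosh (s - v)) * gaussC z (cosh s))" .
  qed
  also have "\<dots> = of_real (exp (- v / 2)) * (\<integral>s. gaussC z' (cosh (s - v)) * gaussC z (cosh s) \<partial>lborel)" by (rule integral_mult_right_zero)
  finally have 1: "(\<integral>r. hconv z z' (hp (r, v)) \<partial>lborel) = of_real (exp (- v / 2)) * (\<integral>s. gaussC z' (cosh (s - v)) * gaussC z (cosh s) \<partial>lborel)" .
  have "(\<integral>r. hconv z z' (hp (r, v)) \<partial>lborel) = (\<integral>r. hprofile z z' (ch (hp (0, 0)) (hp (r, v))) \<partial>lborel)"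
    unfolding hprofile_def hi[symmetric] hconv_radial[OF hp_upper, symmetric] ..
  also have "\<dots> = of_real (exp (- v / 2)) * Abel (hprofile z z') (cosh v)"
    using integral_ch_line[of "hprofile z z'" "(0, 0)" v] by simp
  finally have "of_real (exp (- v / 2)) * Abel (hprofile z z') (cosh v) = of_real (exp (- v / 2)) * (\<integral>s. gaussC z' (cosh (s - v)) * gaussC z (cosh s) \<partial>lborel)"
    using 1 by simp
  then show ?thesis by simp
qed

lemma integrable_Abel:
  fixes \<psi> :: "real \<Rightarrow> complex"
  assumes [measurable]: "\<psi> \<in> borel_measurable borel" and c: "1 \<le> c" and b: "\<And>c. 1 \<le> c \<Longrightarrow> cmod (\<psi> c) \<le> M / c\<^sup>2"
  shows "integrable lborel (\<lambda>x. \<psi> (c + x\<^sup>2 / 2))"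
proof (rule Bochner_Integration.integrable_bound)
  have M: "0 \<le> M" using order_trans[OF norm_ge_zero b[of 1]] by simp
  show "integrable lborel (\<lambda>x. M * (1 / c ^ 1 * (1 / (1 + x\<^sup>2 / 2))))" by (intro integrable_mult_right integrable_quadratic)
  show "AE x in lborel. norm (\<psi> (c + x\<^sup>2 / 2)) \<le> norm (M * (1 / c ^ 1 * (1 / (1 + x\<^sup>2 / 2))))"
  proof (rule AE_I2)
    fix x :: real
    have "norm (\<psi> (c + x\<^sup>2 / 2)) \<le> M * (1 / (c + x\<^sup>2 / 2) ^ Suc 1)"
      using b[OF quad_bound(2)[OF c, of x]] by (simp add: power2_eq_square)
    also have "\<dots> \<le> M * (1 / c ^ 1 * (1 / (1 + x\<^sup>2 / 2)))" by (intro mult_left_mono quad_bound c M)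
    also have "\<dots> \<le> norm (M * (1 / c ^ 1 * (1 / (1 + x\<^sup>2 / 2))))" unfolding real_norm_def by (rule abs_ge_self)
    finally show "norm (\<psi> (c + x\<^sup>2 / 2)) \<le> norm (M * (1 / c ^ 1 * (1 / (1 + x\<^sup>2 / 2))))" .
  qed
qed measurable

text \<open>A second Abel transform shows that the tail integrals of \<psi> vanish, hence also its
  means over [c, c + h). They tend to \<psi> c as h tends to 0.\<close>

lemma Abel_injective:
  fixes \<psi> :: "real \<Rightarrow> complex"
  assumes [measurable]: "\<psi> \<in> borel_measurable borel"
    and b: "\<And>c. 1 \<le> c \<Longrightarrow> cmod (\<psi> c) \<le> M / c\<^sup>2"
    and cont: "\<And>u l. (\<And>n::nat. 1 \<le> u n) \<Longrightarrow> u \<longlonglongrightarrow> l \<Longrightarrow> (\<lambda>n. \<psi> (u n)) \<longlonglongrightarrow> \<psi> l"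
    and A: "\<And>c. 1 \<le> c \<Longrightarrow> Abel \<psi> c = 0"
    and c: "1 \<le> c"
  shows "\<psi> c = 0"
proof -
  have M: "0 \<le> M" using order_trans[OF norm_ge_zero b[of 1]] by simp
  have bM: "cmod (\<psi> u) \<le> M" if "1 \<le> u" for u
  proof -
    have "M / u\<^sup>2 \<le> M / 1" using that M by (intro divide_left_mono) auto
    then show ?thesis using b[OF that] by simp
  qed
  have int: "integrable lborel (\<lambda>s. indicator {0..} s *\<^sub>R \<psi> (u + s))" if "1 \<le> u" for u
    by (rule integrable_tail_of_bound[OF assms(1) that b])
  have tail: "(\<integral>s. indicator {0..} s *\<^sub>R \<psi> (u + s) \<partial>lborel) = 0" if u: "1 \<le> u" for u
  proof -
    have "Abel (Abel \<psi>) u = (\<integral>x. 0 \<partial>(lborel :: real measure))" unfolding Abel_def[of "Abel \<psi>"]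
      by (rule Bochner_Integration.integral_cong[OF refl A]) (rule quad_bound(2)[OF u])
    then show ?thesis using Abel_Abel[OF assms(1) int[OF u]] by simp
  qed
  have piece: "(\<integral>u. indicator {0..<1} u *\<^sub>R \<psi> (c + h * u) \<partial>lborel) = 0" if h: "0 < h" for h :: real
  proof -
    define f where "f = (\<lambda>s. indicator {0..<h} s *\<^sub>R \<psi> (c + s))"
    have ch: "1 \<le> c + h" using c h by simp
    have sh: "(\<integral>s. indicator {h..} s *\<^sub>R \<psi> (c + s) \<partial>lborel) = 0"
    proof -
      have "indicator {h..} (h + s) *\<^sub>R \<psi> (c + (h + s)) = indicator {0..} s *\<^sub>R \<psi> (c + h + s)" for s
        by (simp add: indicator_def add.assoc)
      then show ?thesis
        using lborel_integral_real_affine[of 1 "\<lambda>s. indicator {h..} s *\<^sub>R \<psi> (c + s)" h] tail[OF ch] by simp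
    qed
    have f: "f s = indicator {0..} s *\<^sub>R \<psi> (c + s) - indicator {h..} s *\<^sub>R (indicator {0..} s *\<^sub>R \<psi> (c + s))" for s
      using h by (auto simp: f_def indicator_def)
    have f': "indicator {h..} s *\<^sub>R (indicator {0..} s *\<^sub>R \<psi> (c + s)) = indicator {h..} s *\<^sub>R \<psi> (c + s)" for s
      using h by (auto simp: indicator_def)
    have ih: "integrable lborel (\<lambda>s. indicator {h..} s *\<^sub>R (indicator {0..} s *\<^sub>R \<psi> (c + s)))"
      by (rule integrable_mult_indicator[OF _ int[OF c]]) simp
    have "(\<integral>s. f s \<partial>lborel) = (\<integral>s. indicator {0..} s *\<^sub>R \<psi> (c + s) \<partial>lborel) - (\<integral>s. indicator {h..} s *\<^sub>R (indicator {0..} s *\<^sub>R \<psi> (c + s)) \<partial>lborel)"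
      unfolding f by (rule Bochner_Integration.integral_diff[OF int[OF c] ih])
    then have "(\<integral>s. f s \<partial>lborel) = 0" unfolding f' using tail[OF c] sh by simp
    moreover have "(\<integral>s. f s \<partial>lborel) = h *\<^sub>R (\<integral>u. f (0 + h * u) \<partial>lborel)"
      using lborel_integral_real_affine[of h f 0] h by simp
    moreover have "f (0 + h * u) = indicator {0..<1} u *\<^sub>R \<psi> (c + h * u)" for u
      using h by (simp add: f_def indicator_def zero_le_mult_iff)
    ultimately show ?thesis using h by simp
  qed
  have lim0: "(\<lambda>n. 1 / real (Suc n) * u) \<longlonglongrightarrow> 0" for u
    using tendsto_mult[OF LIMSEQ_inverse_real_of_nat tendsto_const[of u]] by (simp add: inverse_eq_divide)
  have "(\<lambda>n. (\<integral>u. indicator {0..<1} u *\<^sub>R \<psi> (c + 1 / real (Suc n) * u) \<partial>lborel)) \<longlonglongrightarrow> (\<integral>u. indicator {0..<1} u *\<^sub>R \<psi> c \<partial>(lborel :: real measure))"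
  proof (rule integral_dominated_convergence[where w = "\<lambda>u. M * indicator {0..<1} u"])
    show "integrable lborel (\<lambda>u::real. M * indicator {0..<1} u)" by (intro integrable_mult_right integrable_real_indicator) auto
    show "AE u in lborel. (\<lambda>n. indicator {0..<1} u *\<^sub>R \<psi> (c + 1 / real (Suc n) * u)) \<longlonglongrightarrow> indicator {0..<1} u *\<^sub>R \<psi> c"
    proof (rule AE_I2)
      fix u :: real
      show "(\<lambda>n. indicator {0..<1} u *\<^sub>R \<psi> (c + 1 / real (Suc n) * u)) \<longlonglongrightarrow> indicator {0..<1} u *\<^sub>R \<psi> c"
      proof (cases "0 \<le> u")
        case True
        have "(\<lambda>n. \<psi> (c + 1 / real (Suc n) * u)) \<longlonglongrightarrow> \<psi> c"
        proof (rule cont)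
          show "1 \<le> c + 1 / real (Suc n) * u" for n
          proof -
            have "0 \<le> 1 / real (Suc n) * u" using True by simp
            then show ?thesis using c by linarith
          qed
          show "(\<lambda>n. c + 1 / real (Suc n) * u) \<longlonglongrightarrow> c" using tendsto_add[OF tendsto_const[of c] lim0[of u]] by simp
        qed
        then show ?thesis by (intro tendsto_intros)
      qed simp
    qed
    show "AE u in lborel. norm (indicator {0..<1} u *\<^sub>R \<psi> (c + 1 / real (Suc n) * u)) \<le> M * indicator {0..<1} u" for n
    proof (rule AE_I2)
      fix u :: real
      show "norm (indicator {0..<1} u *\<^sub>R \<psi> (c + 1 / real (Suc n) * u)) \<le> M * indicator {0..<1} u"
      proof (cases "u \<in> {0..<1}")
        case True
        then have "0 \<le> 1 / real (Suc n) * u" by simp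
        then have "1 \<le> c + 1 / real (Suc n) * u" using c by linarith
        then show ?thesis using True bM by simp
      qed simp
    qed
  qed measurable
  moreover have "(\<integral>u. indicator {0..<1} u *\<^sub>R \<psi> (c + 1 / real (Suc n) * u) \<partial>lborel) = 0" for n by (rule piece) simp
  ultimately have "(\<integral>u. indicator {0..<1} u *\<^sub>R \<psi> c \<partial>(lborel :: real measure)) = 0" by (simp add: LIMSEQ_const_iff)
  then show ?thesis by simp
qed

lemma norm_KC_square: "0 < Re z \<Longrightarrow> 1 \<le> c \<Longrightarrow> norm (KC z c) \<le> KC_bound z / c\<^sup>2"
  by (rule order_trans[OF norm_KC]) (use KC_bound_nonneg in \<open>auto intro!: divide_left_mono power_increasing\<close>)

text \<open>After \<open>x\<close> is moved to \<i>, both sides are functions of the distance with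
  the same Abel transform, by \<open>Abel_hprofile\<close>, the hypothesis on Gaussians and
  \<open>Abel_KC\<close>; so \<open>Abel_injective\<close> identifies them.\<close>

lemma KC_convolution:
  assumes z: "0 < Re z" "0 < Re z'" "0 < Re z''"
    and G: "\<And>v. (\<integral>s. gaussC z' (cosh (s - v)) * gaussC z (cosh s) \<partial>lborel) = I * gaussC z'' (cosh v)"
    and x: "x \<in> upper" and y: "y \<in> upper"
  shows "(\<integral>w. KC z (ch x w) * KC z' (ch w y) \<partial>hm) = I * KC z'' (ch x y)"
proof -
  have iu: "\<i> \<in> upper" by simp
  define M where "M = 4 * KC_bound z * KC_bound z' * (\<integral>w. 1 / (ch \<i> w)\<^sup>2 \<partial>hm)"
  have b1: "cmod (hprofile z z' c) \<le> M / c\<^sup>2" if "1 \<le> c" for c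
    using hconv_bound(2)[OF z(1,2) hp_upper, of "(0, arcosh c)"] by (simp add: hprofile_def M_def ch_i_axis[OF that])
  note b2 = norm_KC_square[OF z(3)]
  have eq: "hprofile z z' c - I * KC z'' c = 0" if c: "1 \<le> c" for c
  proof (rule Abel_injective[of "\<lambda>c. hprofile z z' c - I * KC z'' c" "M + cmod I * KC_bound z''", OF _ _ _ _ c])
    fix c :: real assume c: "1 \<le> c"
    have "cmod (hprofile z z' c - I * KC z'' c) \<le> cmod (hprofile z z' c) + cmod I * cmod (KC z'' c)"
      using norm_triangle_ineq4[of "hprofile z z' c" "I * KC z'' c"] by (simp add: norm_mult)
    also have "\<dots> \<le> M / c\<^sup>2 + cmod I * (KC_bound z'' / c\<^sup>2)"
      by (intro add_mono mult_left_mono b1 b2 c) simp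
    finally show "cmod (hprofile z z' c - I * KC z'' c) \<le> (M + cmod I * KC_bound z'') / c\<^sup>2" by (simp add: add_divide_distrib)
    have "Abel (\<lambda>c. hprofile z z' c - I * KC z'' c) c = Abel (hprofile z z') c - I * Abel (KC z'') c"
      unfolding Abel_def using integrable_Abel[OF measurable_hprofile c b1] integrable_Abel[OF measurable_KC c b2]
      by (subst Bochner_Integration.integral_diff) simp_all
    also have "\<dots> = 0" using Abel_hprofile[OF z(1,2), of "arcosh c"] G[of "arcosh c"] Abel_KC[OF z(3) c] c by simp
    finally show "Abel (\<lambda>c. hprofile z z' c - I * KC z'' c) c = 0" .
  next
    fix u :: "nat \<Rightarrow> real" and l assume "\<And>n. 1 \<le> u n" "u \<longlonglongrightarrow> l"
    then show "(\<lambda>n. hprofile z z' (u n) - I * KC z'' (u n)) \<longlonglongrightarrow> hprofile z z' l - I * KC z'' l"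
      by (intro tendsto_intros hprofile_tendsto KC_tendsto z)
  qed simp
  define g where "g = aff x"
  define p where "p = mob (minv g) y"
  have g: "g \<in> SL2" "mob g \<i> = x" using x by (auto simp: g_def mob_aff_i)
  have p: "p \<in> upper" "mob g p = y" using mob_upper[OF minv_SL2[OF g(1)] y] mob_minv(1)[OF g(1) y] by (auto simp: p_def)
  have "(\<integral>w. KC z (ch x w) * KC z' (ch w y) \<partial>hm) = (\<integral>w. KC z (ch x (mob g w)) * KC z' (ch (mob g w) y) \<partial>hm)"
    by (rule integral_hm_mob[OF g(1), of "\<lambda>w. KC z (ch x w) * KC z' (ch w y)", symmetric]) simp
  also have "\<dots> = (\<integral>w. KC z (ch \<i> w) * KC z' (ch w p) \<partial>hm)"
  proof (rule integral_cong_AE)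
    show "AE w in hm. KC z (ch x (mob g w)) * KC z' (ch (mob g w) y) = KC z (ch \<i> w) * KC z' (ch w p)"
      using AE_hm_upper
    proof eventually_elim
      case (elim w)
      then show ?case using ch_mob[OF g(1) iu elim] ch_mob[OF g(1) elim p(1)] g(2) p(2) by simp
    qed
  qed simp_all
  also have "\<dots> = hprofile z z' (ch \<i> p)" unfolding hconv_def[symmetric] hprofile_def by (rule hconv_radial[OF p(1)])
  also have "\<dots> = I * KC z'' (ch \<i> p)" using eq[OF ch_ge_1[OF iu p(1)]] by simp
  also have "ch \<i> p = ch x y" using ch_mob[OF g(1) iu p(1)] g(2) p(2) by simp
  finally show ?thesis .
qed

section \<open>Gaussian integrals and the semigroup laws\<close>

definition gauss_int :: "complex \<Rightarrow> complex" where
  "gauss_int z = (\<integral>u. exp (- (of_real (u\<^sup>2) / (2 * z))) \<partial>lborel)"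

text \<open>With s = v / 2 + u the two squares add up to 2 u^2 + v^2 / 2.\<close>

lemma gauss_conv_same:
  assumes z: "0 < Re z"
  shows "(\<integral>s. gaussC z (cosh (s - v)) * gaussC z (cosh s) \<partial>lborel) = gauss_int z * gaussC (2 * z) (cosh v)"
proof -
  have z0: "z \<noteq> 0" using z by auto
  have eq: "gaussC z (cosh (v / 2 + 1 * u - v)) * gaussC z (cosh (v / 2 + 1 * u)) = exp (- (of_real (u\<^sup>2) / (2 * z))) * gaussC (2 * z) (cosh v)" for u
  proof -
    have "of_real ((v / 2 + 1 * u - v)\<^sup>2) / (4 * z) + of_real ((v / 2 + 1 * u)\<^sup>2) / (4 * z)
        = of_real (u\<^sup>2) / (2 * z) + of_real (v\<^sup>2) / (4 * (2 * z))"
      using z0 by (simp add: field_simps power2_eq_square)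
    then show ?thesis unfolding gaussC_cosh mult_exp_exp by (simp only: minus_add_distrib[symmetric])
  qed
  have "(\<integral>s. gaussC z (cosh (s - v)) * gaussC z (cosh s) \<partial>lborel)
      = (\<integral>u. gaussC z (cosh (v / 2 + 1 * u - v)) * gaussC z (cosh (v / 2 + 1 * u)) \<partial>lborel)"
    using lborel_integral_real_affine[of 1 "\<lambda>s. gaussC z (cosh (s - v)) * gaussC z (cosh s)" "v / 2"] by simp
  also have "\<dots> = gauss_int z * gaussC (2 * z) (cosh v)" unfolding eq gauss_int_def by (rule integral_mult_left_zero)
  finally show ?thesis .
qed

text \<open>On exp (- s / z) the Abel transform acts as multiplication by
  \<open>gauss_int z\<close>, so \<open>Abel_Abel\<close> evaluates its square. Later only the
  modulus enters (\<open>norm_gauss_int\<close>), and no branch of the square root is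
  chosen.\<close>

lemma gauss_int_square:
  assumes z: "0 < Re z"
  shows "(gauss_int z)\<^sup>2 = of_real (2 * pi) * z"
proof -
  have z0: "z \<noteq> 0" using z by auto
  define \<psi> where "\<psi> s = exp (- (of_real s / z))" for s :: real
  have [measurable]: "\<psi> \<in> borel_measurable borel" unfolding \<psi>_def[abs_def] by measurable
  define a where "a = Re (1 / z)"
  have a: "0 < a" using z z0 by (simp add: a_def Re_divide sum_power2_gt_zero_iff complex_eq_iff)
  have nm: "cmod (\<psi> s) = exp (- (s * a))" for s
  proof -
    have "Re (of_real s / z) = s * a" by (simp add: a_def Re_divide)
    then show ?thesis unfolding \<psi>_def norm_exp_eq_Re by simp
  qed
  have int: "integrable lborel (\<lambda>s. indicator {0..} s *\<^sub>R \<psi> s)"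
  proof (rule Bochner_Integration.integrable_bound)
    show "integrable lborel (\<lambda>s. indicator {0..} s *\<^sub>R exp (- (s * a)))"
      using integrable_I0i_exp_mscale[OF a] unfolding set_integrable_def
      by (rule integrable_cong_AE_imp) (auto intro!: AE_I[where N = "{0}"] simp: indicator_def)
    show "AE s in lborel. norm (indicator {0..} s *\<^sub>R \<psi> s) \<le> norm (indicator {0..} s *\<^sub>R exp (- (s * a)))"
      by (intro AE_I2) (simp add: nm)
  qed simp
  have "(\<integral>s. indicator {0..} s *\<^sub>R \<psi> s \<partial>lborel) = - (- z)"
  proof (rule integral_half_line_FTC[where F = "\<lambda>s. - z * \<psi> s", OF _ _ _ int])
    show "((\<lambda>s. - z * \<psi> s) has_vector_derivative \<psi> s) (at s)" for s
    proof -
      have "((\<lambda>w. - z * exp (- (w / z))) has_field_derivative exp (- (of_real s / z))) (at (of_real s))"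
        using z0 by (auto intro!: derivative_eq_intros)
      from has_vector_derivative_real_field[OF this] show ?thesis unfolding \<psi>_def .
    qed
    show "isCont \<psi> s" for s unfolding \<psi>_def using z0 by (intro continuous_intros) auto
    have "((\<lambda>s. - z * \<psi> s) \<longlongrightarrow> - z * \<psi> 0) (at_right 0)"
      unfolding \<psi>_def using z0 by (intro tendsto_intros) auto
    then show "((\<lambda>s. - z * \<psi> s) \<longlongrightarrow> - z) (at_right 0)" by (simp add: \<psi>_def)
    have "filterlim (\<lambda>s. s * a) at_top at_top" using a by (intro filterlim_at_top_mult_tendsto_pos[OF tendsto_const] filterlim_ident)
    then have "((\<lambda>s. exp (- (s * a))) \<longlongrightarrow> 0) at_top"
      by (intro filterlim_compose[OF exp_at_bot]) (simp add: filterlim_uminus_at_bot)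
    then have "(\<psi> \<longlongrightarrow> 0) at_top" by (rule Lim_null_comparison[rotated]) (simp add: nm)
    then have "((\<lambda>s. - z * \<psi> s) \<longlongrightarrow> - z * 0) at_top" by (intro tendsto_intros)
    then show "((\<lambda>s. - z * \<psi> s) \<longlongrightarrow> 0) at_top" by simp
  qed fact
  then have I: "(\<integral>s. indicator {0..} s *\<^sub>R \<psi> (0 + s) \<partial>lborel) = z" by simp
  have A: "Abel \<psi> c = \<psi> c * gauss_int z" for c
  proof -
    have "\<psi> (c + x\<^sup>2 / 2) = \<psi> c * exp (- (of_real (x\<^sup>2) / (2 * z)))" for x
      unfolding \<psi>_def mult_exp_exp by (simp add: add_divide_distrib)
    then show ?thesis unfolding Abel_def gauss_int_def by simp
  qed
  have "Abel (Abel \<psi>) 0 = (gauss_int z)\<^sup>2"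
  proof -
    have "Abel (Abel \<psi>) 0 = (\<integral>x. \<psi> (0 + x\<^sup>2 / 2) * gauss_int z \<partial>lborel)" unfolding Abel_def[of "Abel \<psi>"] A ..
    also have "\<dots> = Abel \<psi> 0 * gauss_int z" unfolding Abel_def by (rule integral_mult_left_zero)
    finally show ?thesis by (simp add: A \<psi>_def power2_eq_square)
  qed
  moreover have "Abel (Abel \<psi>) 0 = of_real (2 * pi) * z"
    using Abel_Abel[of \<psi> 0] int I by simp
  ultimately show ?thesis by simp
qed

lemma norm_gauss_int: "0 < Re z \<Longrightarrow> cmod (gauss_int z) = sqrt (2 * pi * cmod z)"
proof -
  assume "0 < Re z"
  then have "(cmod (gauss_int z))\<^sup>2 = 2 * pi * cmod z"
    using gauss_int_square[of z] by (simp add: norm_power[symmetric] norm_mult)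
  then show ?thesis by (metis norm_ge_zero real_sqrt_unique)
qed

text \<open>Write 1 / (4 z) as \<alpha> - \<i> \<beta>. Centred at v / 2, the product is a real
  Gaussian in u times a phase that is linear in u, and its integral is a value of the characteristic
  function of the normal distribution. The exponent simplifies because (\<alpha>^2 + \<beta>^2) /
  \<alpha> = 1 / (4 Re z).\<close>

lemma gauss_conv_cnj:
  assumes z: "0 < Re z"
  shows "(\<integral>s. gaussC (cnj z) (cosh (s - v)) * gaussC z (cosh s) \<partial>lborel)
    = of_real (sqrt (2 * pi * (cmod z)\<^sup>2 / Re z)) * gaussC (of_real (2 * Re z)) (cosh v)"
proof -
  define m where "m = (cmod z)\<^sup>2"
  define \<alpha> \<beta> where "\<alpha> = Re z / (4 * m)" and "\<beta> = Im z / (4 * m)"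
  have z0: "z \<noteq> 0" using z by auto
  have m: "0 < m" using z0 by (simp add: m_def)
  have \<alpha>: "0 < \<alpha>" using z m by (simp add: \<alpha>_def)
  have mm: "m = (Re z)\<^sup>2 + (Im z)\<^sup>2" by (simp add: m_def cmod_power2)
  have inv: "1 / (4 * z) = Complex \<alpha> (- \<beta>)" "1 / (4 * cnj z) = Complex \<alpha> \<beta>"
    using m z0 by (auto simp: complex_eq_iff Re_divide Im_divide \<alpha>_def \<beta>_def mm cmod_power2 power2_eq_square field_simps)
  \<comment> \<open>The substitution s = v / 2 + u / (2 r) turns the real part of the Gaussian into
    the standard normal weight exp (- u^2 / 2).\<close>
  define r where "r = sqrt \<alpha>"
  have r: "0 < r" "r\<^sup>2 = \<alpha>" using \<alpha> by (auto simp: r_def)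
  define C where "C = exp (- (\<alpha> * v\<^sup>2 / 2))"
  have eq: "gaussC (cnj z) (cosh (v / 2 + (1 / (2 * r)) * u - v)) * gaussC z (cosh (v / 2 + (1 / (2 * r)) * u))
      = of_real (C * sqrt (2 * pi)) * (std_normal_density u *\<^sub>R iexp (\<beta> * v / r * u))" for u
  proof -
    define k where "k = (1 / (2 * r)) * u"
    have k2: "4 * \<alpha> * k\<^sup>2 = u\<^sup>2" using r by (simp add: k_def power_divide power_mult_distrib flip: r(2))
    have "gaussC (cnj z) (cosh (v / 2 + k - v)) = exp (- (of_real ((v / 2 + k - v)\<^sup>2) * Complex \<alpha> \<beta>))"
      unfolding gaussC_cosh inv(2)[symmetric] by simp
    moreover have "gaussC z (cosh (v / 2 + k)) = exp (- (of_real ((v / 2 + k)\<^sup>2) * Complex \<alpha> (- \<beta>)))"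
      unfolding gaussC_cosh inv(1)[symmetric] by simp
    ultimately have "gaussC (cnj z) (cosh (v / 2 + k - v)) * gaussC z (cosh (v / 2 + k))
       = exp (- (of_real ((v / 2 + k - v)\<^sup>2) * Complex \<alpha> \<beta>) + - (of_real ((v / 2 + k)\<^sup>2) * Complex \<alpha> (- \<beta>)))"
      by (simp only: mult_exp_exp)
    also have "- (of_real ((v / 2 + k - v)\<^sup>2) * Complex \<alpha> \<beta>) + - (of_real ((v / 2 + k)\<^sup>2) * Complex \<alpha> (- \<beta>))
        = of_real (- (\<alpha> * v\<^sup>2 / 2) - u\<^sup>2 / 2) + \<i> * of_real (2 * \<beta> * v * k)"
      unfolding k2[symmetric] by (simp add: complex_eq_iff power2_eq_square algebra_simps)
    also have "2 * \<beta> * v * k = \<beta> * v / r * u" using r by (simp add: k_def)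
    also have "exp (of_real (- (\<alpha> * v\<^sup>2 / 2) - u\<^sup>2 / 2) + \<i> * of_real (\<beta> * v / r * u)) = of_real (C * exp (- u\<^sup>2 / 2)) * iexp (\<beta> * v / r * u)"
    proof -
      have e: "exp (- (\<alpha> * v\<^sup>2 / 2) - u\<^sup>2 / 2) = C * exp (- u\<^sup>2 / 2)" by (simp add: C_def mult_exp_exp)
      show ?thesis by (simp only: exp_add exp_of_real e)
    qed
    also have "C * exp (- u\<^sup>2 / 2) = C * sqrt (2 * pi) * std_normal_density u" by (simp add: std_normal_density_def)
    finally show ?thesis unfolding k_def by (simp add: scaleR_conv_of_real)
  qed
  have "(\<integral>s. gaussC (cnj z) (cosh (s - v)) * gaussC z (cosh s) \<partial>lborel)
      = (1 / (2 * r)) *\<^sub>R (\<integral>u. gaussC (cnj z) (cosh (v / 2 + (1 / (2 * r)) * u - v)) * gaussC z (cosh (v / 2 + (1 / (2 * r)) * u)) \<partial>lborel)"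
    using lborel_integral_real_affine[of "1 / (2 * r)" "\<lambda>s. gaussC (cnj z) (cosh (s - v)) * gaussC z (cosh s)" "v / 2"] r by simp
  also have "\<dots> = (1 / (2 * r)) *\<^sub>R (of_real (C * sqrt (2 * pi)) * (\<integral>u. std_normal_density u *\<^sub>R iexp (\<beta> * v / r * u) \<partial>lborel))"
    unfolding eq integral_mult_right_zero ..
  also have "(\<integral>u. std_normal_density u *\<^sub>R iexp (\<beta> * v / r * u) \<partial>lborel) = char std_normal_distribution (\<beta> * v / r)"
    unfolding char_def by (subst integral_density) auto
  also have "\<dots> = of_real (exp (- ((\<beta> * v / r)\<^sup>2) / 2))" by (simp only: char_std_normal_distribution)
  also have "(1 / (2 * r)) *\<^sub>R (of_real (C * sqrt (2 * pi)) * complex_of_real (exp (- ((\<beta> * v / r)\<^sup>2) / 2)))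
      = of_real (sqrt (2 * pi) / (2 * r)) * of_real (C * exp (- ((\<beta> * v / r)\<^sup>2) / 2))"
    by (simp add: scaleR_conv_of_real)
  also have "C * exp (- ((\<beta> * v / r)\<^sup>2) / 2) = exp (- (v\<^sup>2 / (4 * (2 * Re z))))"
  proof -
    have "m * m = m * ((Re z)\<^sup>2 + (Im z)\<^sup>2)" using mm by simp
    then have "\<alpha>\<^sup>2 + \<beta>\<^sup>2 = 1 / (16 * m)"
      using m by (simp add: \<alpha>_def \<beta>_def power_divide power_mult_distrib add_divide_distrib[symmetric] mm[symmetric] power2_eq_square[of m])
    then have ab: "(\<alpha>\<^sup>2 + \<beta>\<^sup>2) / \<alpha> = 1 / (4 * Re z)" using m z by (simp add: \<alpha>_def)
    have "\<alpha> * v\<^sup>2 / 2 + (\<beta> * v / r)\<^sup>2 / 2 = (\<alpha> + \<beta>\<^sup>2 / \<alpha>) * v\<^sup>2 / 2"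
      by (simp add: power_divide power_mult_distrib r(2) field_simps)
    also have "\<alpha> + \<beta>\<^sup>2 / \<alpha> = (\<alpha>\<^sup>2 + \<beta>\<^sup>2) / \<alpha>" using \<alpha> by (simp add: field_simps power2_eq_square)
    finally have "\<alpha> * v\<^sup>2 / 2 + (\<beta> * v / r)\<^sup>2 / 2 = v\<^sup>2 / (4 * (2 * Re z))" unfolding ab by simp
    then show ?thesis unfolding C_def mult_exp_exp by (simp add: minus_add_distrib[symmetric] del: minus_add_distrib)
  qed
  also have "sqrt (2 * pi) / (2 * r) = sqrt (2 * pi * (cmod z)\<^sup>2 / Re z)"
  proof -
    have "2 * pi * (cmod z)\<^sup>2 / Re z = 2 * pi / (4 * \<alpha>)" using m z by (simp add: \<alpha>_def m_def)
    moreover have "sqrt (4 * \<alpha>) = 2 * r" by (simp add: real_sqrt_mult r_def)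
    ultimately show ?thesis by (simp only: real_sqrt_divide)
  qed
  also have "of_real (exp (- (v\<^sup>2 / (4 * (2 * Re z))))) = gaussC (of_real (2 * Re z)) (cosh v)"
    unfolding gaussC_cosh by (simp add: exp_of_real[symmetric])
  finally show ?thesis .
qed

lemma KC_cnj: "KC (cnj z) c = cnj (KC z c)"
proof -
  have g: "gaussC (cnj z) u = cnj (gaussC z u)" for u unfolding gaussC_def by (simp add: exp_cnj)
  then have "kerC (cnj z) u = cnj (kerC z u)" for u by (simp add: kerC_def)
  then show ?thesis unfolding KC_def Abel_def by simp
qed

lemma KC_square:
  assumes "0 < Re z" "x \<in> upper" "y \<in> upper"
  shows "(\<integral>w. KC z (ch x w) * KC z (ch w y) \<partial>hm) = gauss_int z * KC (2 * z) (ch x y)"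
  using assms by (intro KC_convolution gauss_conv_same) auto

lemma KC_abs_square:
  assumes "0 < Re z" "x \<in> upper" "y \<in> upper"
  shows "(\<integral>w. KC z (ch x w) * cnj (KC z (ch w y)) \<partial>hm)
    = of_real (sqrt (2 * pi * (cmod z)\<^sup>2 / Re z)) * KC (of_real (2 * Re z)) (ch x y)"
  unfolding KC_cnj[symmetric] using assms by (intro KC_convolution gauss_conv_cnj) auto

section \<open>Orbit sums, unfolding and the diagonal bound\<close>

lemma sum_le_imp_abs_summable:
  fixes f :: "'a \<Rightarrow> real"
  assumes f: "\<And>x. x \<in> A \<Longrightarrow> 0 \<le> f x" and B: "\<And>F. finite F \<Longrightarrow> F \<subseteq> A \<Longrightarrow> sum f F \<le> B"
  shows "Infinite_Set_Sum.abs_summable_on f A" "infsetsum f A \<le> B"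
proof -
  have s: "f summable_on A"
  proof (rule nonneg_bdd_above_summable_on[OF f])
    show "bdd_above (sum f ` {F. F \<subseteq> A \<and> finite F})" by (rule bdd_aboveI2[where M = B]) (auto intro: B)
  qed
  have "(\<lambda>x. norm (f x)) summable_on A" by (rule summable_on_cong[THEN iffD1, OF _ s]) (simp add: f)
  then show a: "Infinite_Set_Sum.abs_summable_on f A" using abs_summable_equivalent by blast
  have "infsum f A \<le> B" by (rule infsum_le_finite_sums[OF s]) (rule B)
  then show "infsetsum f A \<le> B" by (simp add: infsetsum_infsum[OF a])
qed

lemma measurable_count_space_pair:
  assumes "countable A" and f: "\<And>a. a \<in> A \<Longrightarrow> (\<lambda>x. f x a) \<in> measurable M N"
  shows "(\<lambda>p. f (fst p) (snd p)) \<in> measurable (M \<Otimes>\<^sub>M count_space A) N"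
  by (rule measurable_compose_countable'[where I = A and g = snd and f = "\<lambda>a p. f (fst p) a"])
    (auto intro: measurable_compose[OF measurable_fst f] assms)

lemma measurable_infsetsum:
  fixes f :: "'a \<Rightarrow> 'b \<Rightarrow> 'c :: {banach, second_countable_topology}"
  assumes "countable A" "\<And>a. a \<in> A \<Longrightarrow> (\<lambda>x. f x a) \<in> borel_measurable M"
  shows "(\<lambda>x. infsetsum (f x) A) \<in> borel_measurable M"
proof -
  interpret sigma_finite_measure "count_space A" by (rule sigma_finite_measure_count_space_countable) fact
  show ?thesis unfolding infsetsum_def
    by (rule borel_measurable_lebesgue_integral) (use measurable_count_space_pair[OF assms] in \<open>simp add: case_prod_beta\<close>)
qed

context fuchsian_group
begin

text \<open>Group elements are restricted to the half-plane, whereas a representing matrix acts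
  measurably on the whole space of \<open>hm\<close>.\<close>

definition mrep :: "(complex \<Rightarrow> complex) \<Rightarrow> mat4" where
  "mrep \<gamma> = (SOME g. g \<in> SL2 \<and> (\<forall>w\<in>upper. \<gamma> w = mob g w))"

lemma mrep: assumes "\<gamma> \<in> \<Gamma>" shows "mrep \<gamma> \<in> SL2" "w \<in> upper \<Longrightarrow> mob (mrep \<gamma>) w = \<gamma> w"
proof -
  have "\<exists>g. g \<in> SL2 \<and> (\<forall>w\<in>upper. \<gamma> w = mob g w)" using mob_rep[OF assms] by metis
  then have "mrep \<gamma> \<in> SL2 \<and> (\<forall>w\<in>upper. \<gamma> w = mob (mrep \<gamma>) w)" unfolding mrep_def by (rule someI_ex)
  then show "mrep \<gamma> \<in> SL2" "w \<in> upper \<Longrightarrow> mob (mrep \<gamma>) w = \<gamma> w" by (simp_all del: upper_iff)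
qed

lemma ch_inv: "\<gamma> \<in> \<Gamma> \<Longrightarrow> w \<in> upper \<Longrightarrow> x \<in> upper \<Longrightarrow> ch (\<gamma> w) (\<gamma> x) = ch w x"
  using ch_mob[OF mrep(1)] mrep(2) by metis

lemma ch_ginv: "\<gamma> \<in> \<Gamma> \<Longrightarrow> w \<in> upper \<Longrightarrow> x \<in> upper \<Longrightarrow> ch (\<gamma> w) x = ch w (ginv \<gamma> x)"
  using ch_inv[of \<gamma> w "ginv \<gamma> x"] ginv_right[of \<gamma> x] in_upper[OF ginv_in] by simp

definition orbit_sum :: "(real \<Rightarrow> 'b :: {banach, second_countable_topology}) \<Rightarrow> complex \<Rightarrow> complex \<Rightarrow> 'b" where
  "orbit_sum k w x = infsetsum (\<lambda>\<gamma>. k (ch w (\<gamma> x))) \<Gamma>"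

lemma packing_bound:
  assumes x: "x \<in> upper"
  shows "\<exists>C. \<forall>w\<in>upper. Infinite_Set_Sum.abs_summable_on (\<lambda>\<gamma>. 1 / (ch w (\<gamma> x))\<^sup>2) \<Gamma> \<and> orbit_sum (\<lambda>c. 1 / c\<^sup>2) w x \<le> C"
proof (intro exI ballI conjI)
  fix w assume w: "w \<in> upper"
  note p = sum_le_imp_abs_summable[of \<Gamma> "\<lambda>\<gamma>. 1 / (ch w (\<gamma> x))\<^sup>2", OF _ packing[OF w x order_refl]]
  show "Infinite_Set_Sum.abs_summable_on (\<lambda>\<gamma>. 1 / (ch w (\<gamma> x))\<^sup>2) \<Gamma>"
    "orbit_sum (\<lambda>c. 1 / c\<^sup>2) w x \<le> real (card {\<gamma> \<in> \<Gamma>. hdist x (\<gamma> x) \<le> 2}) * packing_const"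
    unfolding orbit_sum_def using p by auto
qed

lemma orbit_sum_bound:
  fixes k :: "real \<Rightarrow> 'b :: {banach, second_countable_topology}"
  assumes b: "\<And>c. 1 \<le> c \<Longrightarrow> norm (k c) \<le> M / c\<^sup>2" and x: "x \<in> upper" and w: "w \<in> upper"
  shows "Infinite_Set_Sum.abs_summable_on (\<lambda>\<gamma>. k (ch w (\<gamma> x))) \<Gamma>"
    "norm (orbit_sum k w x) \<le> M * orbit_sum (\<lambda>c. 1 / c\<^sup>2) w x"
proof -
  have le: "norm (k (ch w (\<gamma> x))) \<le> M * (1 / (ch w (\<gamma> x))\<^sup>2)" if "\<gamma> \<in> \<Gamma>" for \<gamma>
    using b[OF ch_ge_1[OF w in_upper[OF that x]]] by simp
  have s: "Infinite_Set_Sum.abs_summable_on (\<lambda>\<gamma>. M * (1 / (ch w (\<gamma> x))\<^sup>2)) \<Gamma>"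
    using packing_bound[OF x] w by (intro abs_summable_on_cmult_right) (auto simp del: upper_iff)
  show k: "Infinite_Set_Sum.abs_summable_on (\<lambda>\<gamma>. k (ch w (\<gamma> x))) \<Gamma>"
  proof (rule abs_summable_on_comparison_test[OF s])
    fix \<gamma> assume "\<gamma> \<in> \<Gamma>"
    then show "norm (k (ch w (\<gamma> x))) \<le> norm (M * (1 / (ch w (\<gamma> x))\<^sup>2))"
      using order_trans[OF le abs_ge_self] by (simp only: real_norm_def)
  qed
  have "norm (orbit_sum k w x) \<le> infsetsum (\<lambda>\<gamma>. norm (k (ch w (\<gamma> x)))) \<Gamma>"
    unfolding orbit_sum_def by (rule norm_infsetsum_bound)
  also have "\<dots> \<le> infsetsum (\<lambda>\<gamma>. M * (1 / (ch w (\<gamma> x))\<^sup>2)) \<Gamma>"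
  proof (rule infsetsum_mono)
    show "Infinite_Set_Sum.abs_summable_on (\<lambda>\<gamma>. norm (k (ch w (\<gamma> x)))) \<Gamma>" by (rule abs_summable_on_normI[OF k])
  qed (use s le in auto)
  also have "\<dots> = M * orbit_sum (\<lambda>c. 1 / c\<^sup>2) w x" unfolding orbit_sum_def infsetsum_def by (rule integral_mult_right_zero)
  finally show "norm (orbit_sum k w x) \<le> M * orbit_sum (\<lambda>c. 1 / c\<^sup>2) w x" .
qed

lemma orbit_sum_swap:
  assumes "w \<in> upper" "x \<in> upper"
  shows "infsetsum (\<lambda>\<gamma>. k (ch (\<gamma> w) x)) \<Gamma> = orbit_sum k w x"
proof -
  have "infsetsum (\<lambda>\<gamma>. k (ch (\<gamma> w) x)) \<Gamma> = infsetsum (\<lambda>\<gamma>. k (ch w (ginv \<gamma> x))) \<Gamma>"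
    by (rule infsetsum_cong) (simp_all add: ch_ginv assms del: upper_iff)
  also have "\<dots> = orbit_sum k w x" unfolding orbit_sum_def
    by (rule infsetsum_reindex_bij_betw[OF bij_ginv, of "\<lambda>\<gamma>. k (ch w (\<gamma> x))"])
  finally show ?thesis .
qed

lemma orbit_sum_invariant:
  assumes \<delta>: "\<delta> \<in> \<Gamma>" and w: "w \<in> upper" and x: "x \<in> upper"
  shows "orbit_sum k (\<delta> w) x = orbit_sum k w x" "orbit_sum k w (\<delta> x) = orbit_sum k w x"
proof -
  have "orbit_sum k (\<delta> w) x = infsetsum (\<lambda>\<gamma>. k (ch w (compose upper (ginv \<delta>) \<gamma> x))) \<Gamma>"
    unfolding orbit_sum_def
    by (rule infsetsum_cong) (simp_all add: ch_ginv[OF \<delta> w in_upper[OF _ x]] compose_apply[OF x])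
  also have "\<dots> = orbit_sum k w x" unfolding orbit_sum_def
    by (rule infsetsum_reindex_bij_betw[OF bij_compose_left[OF ginv_in[OF \<delta>]], of "\<lambda>\<gamma>. k (ch w (\<gamma> x))"])
  finally show "orbit_sum k (\<delta> w) x = orbit_sum k w x" .
  have "orbit_sum k w (\<delta> x) = infsetsum (\<lambda>\<gamma>. k (ch w (compose upper \<gamma> \<delta> x))) \<Gamma>"
    unfolding orbit_sum_def by (simp add: compose_apply[OF x])
  also have "\<dots> = orbit_sum k w x" unfolding orbit_sum_def
    by (rule infsetsum_reindex_bij_betw[OF bij_compose_right[OF \<delta>], of "\<lambda>\<gamma>. k (ch w (\<gamma> x))"])
  finally show "orbit_sum k w (\<delta> x) = orbit_sum k w x" .
qed

lemma measurable_orbit_sum [measurable]: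
  fixes k :: "real \<Rightarrow> 'b :: {banach, second_countable_topology}"
  assumes [measurable]: "k \<in> borel_measurable borel"
  shows "(\<lambda>w. orbit_sum k w x) \<in> borel_measurable hm"
  unfolding orbit_sum_def by (rule measurable_infsetsum[OF countable_group]) measurable

text \<open>A substitute for a fundamental domain: the weights of the points
  \<open>\<gamma> w\<close>, over all \<open>\<gamma>\<close> in the group, add up to 1
  (\<open>weight_sum\<close>). So \<open>fold_measure\<close> is the area of the quotient, spread
  over the half-plane.\<close>

definition weight :: "complex \<Rightarrow> real" where
  "weight w = 1 / (ch w \<i>)\<^sup>2 / orbit_sum (\<lambda>c. 1 / c\<^sup>2) w \<i>"

definition fold_measure :: "complex measure" where
  "fold_measure = density hm (\<lambda>w. ennreal (weight w))"

lemma measurable_weight [measurable]: "weight \<in> borel_measurable hm"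
  unfolding weight_def[abs_def] by measurable

lemma sets_fold_measure [measurable_cong, simp]: "sets fold_measure = sets hm"
  by (simp add: fold_measure_def)

lemma weight_sum:
  assumes w: "w \<in> upper"
  shows "(\<integral>\<^sup>+\<gamma>. ennreal (weight (\<gamma> w)) \<partial>count_space \<Gamma>) = 1"
proof -
  have iu: "\<i> \<in> upper" by simp
  define N where "N = orbit_sum (\<lambda>c. 1 / c\<^sup>2) w \<i>"
  have s: "Infinite_Set_Sum.abs_summable_on (\<lambda>\<gamma>. 1 / (ch w (\<gamma> \<i>))\<^sup>2) \<Gamma>" using packing_bound[OF iu] w by (auto simp del: upper_iff)
  have N: "0 < N"
  proof -
    let ?id = "restrict (\<lambda>z. z) upper :: complex \<Rightarrow> complex"
    have "infsetsum (\<lambda>\<gamma>. 1 / (ch w (\<gamma> \<i>))\<^sup>2) {?id} \<le> infsetsum (\<lambda>\<gamma>. 1 / (ch w (\<gamma> \<i>))\<^sup>2) \<Gamma>"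
      by (rule infsetsum_mono_neutral_left[OF _ s]) (auto simp: id_in)
    then have "1 / (ch w \<i>)\<^sup>2 \<le> N" by (simp add: N_def orbit_sum_def)
    moreover have "0 < ch w \<i>" using ch_ge_1[OF w iu] by simp
    ultimately show ?thesis by (smt (verit) divide_pos_pos zero_less_power)
  qed
  have eq: "weight (\<gamma> w) = 1 / (ch (\<gamma> w) \<i>)\<^sup>2 / N" if "\<gamma> \<in> \<Gamma>" for \<gamma>
    unfolding weight_def N_def orbit_sum_invariant(1)[OF that w iu] ..
  have s': "Infinite_Set_Sum.abs_summable_on (\<lambda>\<gamma>. 1 / (ch (\<gamma> w) \<i>)\<^sup>2) \<Gamma>"
  proof -
    have "Infinite_Set_Sum.abs_summable_on (\<lambda>\<gamma>. 1 / (ch w (ginv \<gamma> \<i>))\<^sup>2) \<Gamma>"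
      using abs_summable_on_reindex_bij_betw[OF bij_ginv, of "\<lambda>\<gamma>. 1 / (ch w (\<gamma> \<i>))\<^sup>2"] s by simp
    then show ?thesis by (rule abs_summable_on_cong[THEN iffD1, rotated -1]) (simp_all add: ch_ginv[OF _ w iu])
  qed
  have "(\<integral>\<^sup>+\<gamma>. ennreal (weight (\<gamma> w)) \<partial>count_space \<Gamma>) = (\<integral>\<^sup>+\<gamma>. ennreal (1 / (ch (\<gamma> w) \<i>)\<^sup>2 / N) \<partial>count_space \<Gamma>)"
    by (rule nn_integral_cong) (simp add: eq)
  also have "\<dots> = ennreal (\<integral>\<gamma>. 1 / (ch (\<gamma> w) \<i>)\<^sup>2 / N \<partial>count_space \<Gamma>)"
  proof (rule nn_integral_eq_integral)
    show "integrable (count_space \<Gamma>) (\<lambda>\<gamma>. 1 / (ch (\<gamma> w) \<i>)\<^sup>2 / N)"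
      using s' unfolding abs_summable_on_def by (intro integrable_divide_zero)
  qed (use N in auto)
  also have "(\<integral>\<gamma>. 1 / (ch (\<gamma> w) \<i>)\<^sup>2 / N \<partial>count_space \<Gamma>) = infsetsum (\<lambda>\<gamma>. 1 / (ch (\<gamma> w) \<i>)\<^sup>2) \<Gamma> / N"
    unfolding infsetsum_def by (rule integral_divide_zero)
  also have "infsetsum (\<lambda>\<gamma>. 1 / (ch (\<gamma> w) \<i>)\<^sup>2) \<Gamma> = N" unfolding N_def by (rule orbit_sum_swap[OF w iu])
  finally show ?thesis using N by simp
qed

lemma sigma_finite_fold: "sigma_finite_measure fold_measure"
proof -
  interpret sigma_finite_measure hm by (rule sigma_finite_hm)
  show ?thesis unfolding fold_measure_def by (subst sigma_finite_iff_density_finite) auto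
qed

lemma sigma_finite_count: "sigma_finite_measure (count_space \<Gamma>)"
  by (rule sigma_finite_measure_count_space_countable[OF countable_group])

abbreviation "group_fold \<equiv> count_space \<Gamma> \<Otimes>\<^sub>M fold_measure"

abbreviation "action \<equiv> \<lambda>p. mob (mrep (fst p)) (snd p)"

lemma measurable_action [measurable]: "action \<in> measurable (count_space \<Gamma> \<Otimes>\<^sub>M hm) hm"
  by (rule measurable_pair_measure_countable1[OF countable_group]) (simp add: measurable_mob_hm)

text \<open>Invariance of \<open>hm\<close> moves the action from the set to the weight; after sum
  and integral are exchanged, the sum of the weights along an orbit remains, which is 1.\<close>

lemma distr_fold: "distr group_fold hm action = hm"
proof (rule measure_eqI)
  interpret C: sigma_finite_measure "count_space \<Gamma>" by (rule sigma_finite_count)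
  interpret F: sigma_finite_measure fold_measure by (rule sigma_finite_fold)
  interpret H: sigma_finite_measure hm by (rule sigma_finite_hm)
  interpret P: pair_sigma_finite "count_space \<Gamma>" hm ..
  fix A assume "A \<in> sets (distr group_fold hm action)"
  then have A[measurable]: "A \<in> sets hm" by simp
  have [measurable]: "action \<in> measurable group_fold hm"
    using measurable_action by (simp cong: measurable_cong_sets sets_pair_measure_cong)
  define G where "G = (\<lambda>\<gamma> w. ennreal (weight (mob (mrep (ginv \<gamma>)) w)) * indicator A w)"
  have G: "(\<integral>\<^sup>+w. indicator A (mob (mrep \<gamma>) w) \<partial>fold_measure) = (\<integral>\<^sup>+w. G \<gamma> w \<partial>hm)" if \<gamma>: "\<gamma> \<in> \<Gamma>" for \<gamma>
  proof -
    have m[measurable]: "mob (mrep \<gamma>) \<in> measurable hm hm" "mob (mrep (ginv \<gamma>)) \<in> measurable hm hm" by (rule measurable_mob_hm)+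
    have Gm: "G \<gamma> \<in> borel_measurable hm" unfolding G_def by measurable
    have "(\<integral>\<^sup>+w. indicator A (mob (mrep \<gamma>) w) \<partial>fold_measure) = (\<integral>\<^sup>+w. ennreal (weight w) * indicator A (mob (mrep \<gamma>) w) \<partial>hm)"
      unfolding fold_measure_def by (subst nn_integral_density) simp_all
    also have "\<dots> = (\<integral>\<^sup>+w. G \<gamma> (mob (mrep \<gamma>) w) \<partial>hm)"
    proof (rule nn_integral_cong_AE)
      show "AE w in hm. ennreal (weight w) * indicator A (mob (mrep \<gamma>) w) = G \<gamma> (mob (mrep \<gamma>) w)"
        using AE_hm_upper
      proof eventually_elim
        case (elim w)
        have "mob (mrep (ginv \<gamma>)) (mob (mrep \<gamma>) w) = w"
          using mrep(2)[OF \<gamma> elim] mrep(2)[OF ginv_in[OF \<gamma>] in_upper[OF \<gamma> elim]] ginv_left[OF \<gamma> elim] by simp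
        then show ?case by (simp add: G_def)
      qed
    qed
    also have "\<dots> = (\<integral>\<^sup>+w. G \<gamma> w \<partial>hm)" by (rule nn_integral_hm_mob[OF mrep(1)[OF \<gamma>] Gm])
    finally show ?thesis .
  qed
  have "emeasure (distr group_fold hm action) A
      = (\<integral>\<^sup>+w. indicator A w \<partial>distr group_fold hm action)"
    by (rule nn_integral_indicator[symmetric]) (use A in simp)
  also have "\<dots> = (\<integral>\<^sup>+p. indicator A (action p) \<partial>group_fold)"
    by (rule nn_integral_distr) simp_all
  also have "\<dots> = (\<integral>\<^sup>+\<gamma>. (\<integral>\<^sup>+w. indicator A (mob (mrep \<gamma>) w) \<partial>fold_measure) \<partial>count_space \<Gamma>)"
    by (subst F.nn_integral_fst[symmetric]) simp_all
  also have "\<dots> = (\<integral>\<^sup>+\<gamma>. (\<integral>\<^sup>+w. G \<gamma> w \<partial>hm) \<partial>count_space \<Gamma>)"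
    by (rule nn_integral_cong) (simp add: G)
  also have "\<dots> = (\<integral>\<^sup>+w. (\<integral>\<^sup>+\<gamma>. G \<gamma> w \<partial>count_space \<Gamma>) \<partial>hm)"
  proof (rule P.Fubini'[symmetric])
    show "case_prod G \<in> borel_measurable (count_space \<Gamma> \<Otimes>\<^sub>M hm)"
    proof (rule measurable_pair_measure_countable1[OF countable_group])
      fix \<gamma>
      have [measurable]: "mob (mrep (ginv \<gamma>)) \<in> measurable hm hm" by (rule measurable_mob_hm)
      show "(\<lambda>w. case_prod G (\<gamma>, w)) \<in> borel_measurable hm" unfolding G_def by simp
    qed
  qed
  also have "\<dots> = (\<integral>\<^sup>+w. indicator A w \<partial>hm)"
  proof (rule nn_integral_cong_AE)
    show "AE w in hm. (\<integral>\<^sup>+\<gamma>. G \<gamma> w \<partial>count_space \<Gamma>) = indicator A w"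
      using AE_hm_upper
    proof eventually_elim
      case (elim w)
      have "(\<integral>\<^sup>+\<gamma>. G \<gamma> w \<partial>count_space \<Gamma>) = (\<integral>\<^sup>+\<gamma>. ennreal (weight (ginv \<gamma> w)) * indicator A w \<partial>count_space \<Gamma>)"
        by (rule nn_integral_cong) (simp add: G_def mrep(2)[OF ginv_in elim])
      also have "\<dots> = (\<integral>\<^sup>+\<gamma>. ennreal (weight (ginv \<gamma> w)) \<partial>count_space \<Gamma>) * indicator A w"
        by (rule nn_integral_multc) simp
      also have "(\<integral>\<^sup>+\<gamma>. ennreal (weight (ginv \<gamma> w)) \<partial>count_space \<Gamma>) = (\<integral>\<^sup>+\<gamma>. ennreal (weight (\<gamma> w)) \<partial>count_space \<Gamma>)"
        by (rule nn_integral_bij_count_space[OF bij_ginv])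
      finally show ?case by (simp add: weight_sum[OF elim])
    qed
  qed
  finally show "emeasure (distr group_fold hm action) A = emeasure hm A"
    unfolding nn_integral_indicator[OF A] .
qed simp

lemma AE_fold_upper: "AE w in fold_measure. w \<in> upper"
  unfolding fold_measure_def using AE_hm_upper by (subst AE_density) (auto simp del: upper_iff)

lemma integral_fold:
  fixes h :: "complex \<Rightarrow> complex"
  assumes h: "integrable hm h"
  shows "integrable fold_measure (\<lambda>w. infsetsum (\<lambda>\<gamma>. h (mob (mrep \<gamma>) w)) \<Gamma>)"
    "(\<integral>w. h w \<partial>hm) = (\<integral>w. infsetsum (\<lambda>\<gamma>. h (mob (mrep \<gamma>) w)) \<Gamma> \<partial>fold_measure)"
proof -
  interpret C: sigma_finite_measure "count_space \<Gamma>" by (rule sigma_finite_count)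
  interpret F: sigma_finite_measure fold_measure by (rule sigma_finite_fold)
  interpret P: pair_sigma_finite "count_space \<Gamma>" fold_measure ..
  have m: "action \<in> measurable group_fold hm"
    using measurable_action by (simp cong: measurable_cong_sets sets_pair_measure_cong)
  have hm: "h \<in> borel_measurable hm" using h by simp
  define f where "f = (\<lambda>\<gamma> w. h (mob (mrep \<gamma>) w))"
  have i: "integrable group_fold (case_prod f)"
    using integrable_distr_eq[OF m hm] h unfolding distr_fold by (simp add: f_def split_beta')
  have e: "(\<integral>w. h w \<partial>hm) = (\<integral>p. case_prod f p \<partial>group_fold)"
    using integral_distr[OF m hm] unfolding distr_fold by (simp add: f_def split_beta')
  show "integrable fold_measure (\<lambda>w. infsetsum (\<lambda>\<gamma>. h (mob (mrep \<gamma>) w)) \<Gamma>)"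
    using P.integrable_snd[OF i] unfolding infsetsum_def f_def .
  show "(\<integral>w. h w \<partial>hm) = (\<integral>w. infsetsum (\<lambda>\<gamma>. h (mob (mrep \<gamma>) w)) \<Gamma> \<partial>fold_measure)"
    unfolding e P.integral_snd[OF i, symmetric] unfolding infsetsum_def f_def ..
qed

text \<open>Unfolding: since the second orbit sum is invariant, the first one is absorbed when
  \<open>fold_measure\<close> is replaced by \<open>hm\<close>. The second sum is then exchanged
  with the integral by Fubini, with \<open>packing_bound\<close> controlling the absolute
  values.\<close>

lemma fold_product:
  fixes k k' :: "real \<Rightarrow> complex"
  assumes [measurable]: "k \<in> borel_measurable borel" "k' \<in> borel_measurable borel"
    and b: "\<And>c. 1 \<le> c \<Longrightarrow> norm (k c) \<le> M / c\<^sup>2" and b': "\<And>c. 1 \<le> c \<Longrightarrow> norm (k' c) \<le> M' / c\<^sup>2"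
    and x: "x \<in> upper" and y: "y \<in> upper"
  shows "integrable fold_measure (\<lambda>w. orbit_sum k w x * orbit_sum k' w y)"
    "(\<integral>w. orbit_sum k w x * orbit_sum k' w y \<partial>fold_measure) = infsetsum (\<lambda>\<gamma>. \<integral>w. k (ch x w) * k' (ch w (\<gamma> y)) \<partial>hm) \<Gamma>"
proof -
  interpret C: sigma_finite_measure "count_space \<Gamma>" by (rule sigma_finite_count)
  interpret H: sigma_finite_measure hm by (rule sigma_finite_hm)
  interpret P: pair_sigma_finite hm "count_space \<Gamma>" ..
  have M': "0 \<le> M'" using order_trans[OF norm_ge_zero b'[of 1]] by simp
  have M: "0 \<le> M" using order_trans[OF norm_ge_zero b[of 1]] by simp
  obtain C where C: "\<forall>w\<in>upper. Infinite_Set_Sum.abs_summable_on (\<lambda>\<gamma>. 1 / (ch w (\<gamma> y))\<^sup>2) \<Gamma> \<and> orbit_sum (\<lambda>c. 1 / c\<^sup>2) w y \<le> C"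
    using packing_bound[OF y] by auto
  \<comment> \<open>Stated for arbitrary \<open>k''\<close>, since it serves both for
    \<open>k'\<close> and for its absolute value.\<close>
  have S': "norm (orbit_sum k'' w y) \<le> M' * C" if w: "w \<in> upper" and k'': "\<And>c. 1 \<le> c \<Longrightarrow> norm (k'' c) \<le> M' / c\<^sup>2"
    for k'' :: "real \<Rightarrow> 'b :: {banach, second_countable_topology}" and w
    using orbit_sum_bound(2)[OF k'' y w] mult_left_mono[OF _ M', of "orbit_sum (\<lambda>c. 1 / c\<^sup>2) w y" C] C w
    by (auto simp del: upper_iff)
  define h where "h w = k (ch x w) * orbit_sum k' w y" for w
  have dom: "integrable hm (\<lambda>w. M * (M' * C) * (1 / (ch x w)\<^sup>2))" by (intro integrable_mult_right integrable_ch_power x)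
  have kb: "norm (k (ch x w)) * s \<le> norm (M * (M' * C) * (1 / (ch x w)\<^sup>2))" if "w \<in> upper" "0 \<le> s" "s \<le> M' * C" for w s
  proof -
    have "norm (k (ch x w)) * s \<le> (M / (ch x w)\<^sup>2) * (M' * C)"
      using b[OF ch_ge_1[OF x that(1)]] that M by (intro mult_mono) auto
    also have "\<dots> = M * (M' * C) * (1 / (ch x w)\<^sup>2)" by simp
    also have "\<dots> \<le> norm \<dots>" unfolding real_norm_def by (rule abs_ge_self)
    finally show ?thesis .
  qed
  have hi: "integrable hm h"
  proof (rule Bochner_Integration.integrable_bound[OF dom])
    show "AE w in hm. norm (h w) \<le> norm (M * (M' * C) * (1 / (ch x w)\<^sup>2))"
      using AE_hm_upper
    proof eventually_elim
      case (elim w)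
      show ?case unfolding h_def norm_mult[of "k (ch x w)"] by (rule kb[OF elim norm_ge_zero S'[OF elim b']])
    qed
  qed (simp add: h_def[abs_def])
  have AE: "AE w in fold_measure. infsetsum (\<lambda>\<gamma>. h (mob (mrep \<gamma>) w)) \<Gamma> = orbit_sum k w x * orbit_sum k' w y"
    using AE_fold_upper
  proof eventually_elim
    case (elim w)
    have "infsetsum (\<lambda>\<gamma>. h (mob (mrep \<gamma>) w)) \<Gamma> = infsetsum (\<lambda>\<gamma>. k (ch (\<gamma> w) x) * orbit_sum k' w y) \<Gamma>"
      by (rule infsetsum_cong) (simp_all add: h_def mrep(2)[OF _ elim] orbit_sum_invariant(1)[OF _ elim y] ch_commute)
    also have "\<dots> = infsetsum (\<lambda>\<gamma>. k (ch (\<gamma> w) x)) \<Gamma> * orbit_sum k' w y" unfolding infsetsum_def by (rule integral_mult_left_zero)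
    finally show ?case by (simp add: orbit_sum_swap[OF elim x])
  qed
  have [measurable]: "(\<lambda>w. orbit_sum k w x) \<in> borel_measurable fold_measure" "(\<lambda>w. orbit_sum k' w y) \<in> borel_measurable fold_measure"
    unfolding measurable_cong_sets[OF sets_fold_measure refl] by measurable
  have hfm: "(\<lambda>w. infsetsum (\<lambda>\<gamma>. h (mob (mrep \<gamma>) w)) \<Gamma>) \<in> borel_measurable fold_measure"
    using integral_fold(1)[OF hi] by simp
  show "integrable fold_measure (\<lambda>w. orbit_sum k w x * orbit_sum k' w y)"
    using integrable_cong_AE[OF hfm _ AE] integral_fold(1)[OF hi] by simp
  have 1: "(\<integral>w. orbit_sum k w x * orbit_sum k' w y \<partial>fold_measure) = (\<integral>w. h w \<partial>hm)"
    unfolding integral_fold(2)[OF hi] by (rule integral_cong_AE[symmetric]) (use AE hfm in auto)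
  define f where "f = (\<lambda>w \<gamma>. k (ch x w) * k' (ch w (\<gamma> y)))"
  have "(\<lambda>p. f (fst p) (snd p)) \<in> borel_measurable (hm \<Otimes>\<^sub>M count_space \<Gamma>)"
    by (rule measurable_count_space_pair[OF countable_group]) (simp add: f_def)
  then have fm: "case_prod f \<in> borel_measurable (hm \<Otimes>\<^sub>M count_space \<Gamma>)" by (simp add: case_prod_beta)
  have norm_f: "(\<integral>\<gamma>. norm (f w \<gamma>) \<partial>count_space \<Gamma>) = norm (k (ch x w)) * orbit_sum (\<lambda>c. norm (k' c)) w y" for w
    unfolding f_def norm_mult orbit_sum_def infsetsum_def by (rule integral_mult_right_zero)
  have fi: "integrable (hm \<Otimes>\<^sub>M count_space \<Gamma>) (case_prod f)"
  proof (rule P.Fubini_integrable[OF fm])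
    have "integrable hm (\<lambda>w. norm (k (ch x w)) * orbit_sum (\<lambda>c. norm (k' c)) w y)"
    proof (rule Bochner_Integration.integrable_bound[OF dom])
      show "AE w in hm. norm (norm (k (ch x w)) * orbit_sum (\<lambda>c. norm (k' c)) w y) \<le> norm (M * (M' * C) * (1 / (ch x w)\<^sup>2))"
        using AE_hm_upper
      proof eventually_elim
        case (elim w)
        have "norm (orbit_sum (\<lambda>c. norm (k' c)) w y) \<le> M' * C" by (rule S'[OF elim]) (simp add: b')
        moreover have "norm (norm (k (ch x w))) = norm (k (ch x w))" by simp
        ultimately show ?case unfolding norm_mult[of "norm (k (ch x w))"] by (simp only:) (rule kb[OF elim norm_ge_zero])
      qed
    qed simp
    then show "integrable hm (\<lambda>w. \<integral>\<gamma>. norm (case_prod f (w, \<gamma>)) \<partial>count_space \<Gamma>)" by (simp add: norm_f)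
    show "AE w in hm. integrable (count_space \<Gamma>) (\<lambda>\<gamma>. case_prod f (w, \<gamma>))"
      using AE_hm_upper
    proof eventually_elim
      case (elim w)
      show ?case using orbit_sum_bound(1)[OF b' y elim] by (simp add: f_def abs_summable_on_def)
    qed
  qed
  have "(\<integral>w. h w \<partial>hm) = (\<integral>w. (\<integral>\<gamma>. f w \<gamma> \<partial>count_space \<Gamma>) \<partial>hm)"
    unfolding h_def f_def orbit_sum_def infsetsum_def by simp
  also have "\<dots> = (\<integral>\<gamma>. (\<integral>w. f w \<gamma> \<partial>hm) \<partial>count_space \<Gamma>)" by (rule P.Fubini_integral[symmetric, OF fi])
  finally show "(\<integral>w. orbit_sum k w x * orbit_sum k' w y \<partial>fold_measure) = infsetsum (\<lambda>\<gamma>. \<integral>w. k (ch x w) * k' (ch w (\<gamma> y)) \<partial>hm) \<Gamma>"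
    unfolding 1 f_def infsetsum_def .
qed

text \<open>Unfolding turns \<open>KC_square\<close> into a formula for the integral of the product
  of two orbit sums, and \<open>KC_abs_square\<close> into one for the integral of the squared
  modulus. The inequality 2 |a b| <= |a|^2 + |b|^2 under the integral connects them.\<close>

lemma orbit_sum_KC_diagonal_bound:
  assumes z: "0 < Re z" and x: "x \<in> upper" and y: "y \<in> upper"
  shows "cmod (gauss_int z) * cmod (orbit_sum (KC (2 * z)) x y)
    \<le> sqrt (2 * pi * (cmod z)\<^sup>2 / Re z) *
      ((cmod (orbit_sum (KC (of_real (2 * Re z))) x x) + cmod (orbit_sum (KC (of_real (2 * Re z))) y y)) / 2)"
proof -
  define S where "S = (\<lambda>w p. orbit_sum (KC z) w p)"
  define I where "I = sqrt (2 * pi * (cmod z)\<^sup>2 / Re z)"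
  have I: "0 \<le> I" using z by (simp add: I_def)
  note b = norm_KC_square[OF z]
  have b': "norm (cnj (KC z c)) \<le> KC_bound z / c\<^sup>2" if "1 \<le> c" for c using b[OF that] by simp
  note fp = fold_product[OF measurable_KC measurable_KC b b x y]
  have km: "(\<lambda>c. cnj (KC z c)) \<in> borel_measurable borel"
    by (rule measurable_compose[OF measurable_KC borel_measurable_continuous_onI[OF continuous_on_cnj[OF continuous_on_id]]])
  have cnjS: "orbit_sum (\<lambda>c. cnj (KC z c)) w p = cnj (S w p)" for w p
    unfolding S_def orbit_sum_def infsetsum_def by simp
  have diag: "integrable fold_measure (\<lambda>w. (cmod (S w p))\<^sup>2)"
    "complex_of_real (\<integral>w. (cmod (S w p))\<^sup>2 \<partial>fold_measure) = of_real I * orbit_sum (KC (of_real (2 * Re z))) p p" if p: "p \<in> upper" for p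
  proof -
    note f = fold_product[OF measurable_KC km b b' p p, unfolded cnjS, folded S_def]
    have e: "S w p * cnj (S w p) = of_real ((cmod (S w p))\<^sup>2)" for w by (rule complex_norm_square[symmetric])
    show "integrable fold_measure (\<lambda>w. (cmod (S w p))\<^sup>2)"
      using f(1) unfolding e by (rule complex_of_real_integrable_eq[THEN iffD1])
    have "complex_of_real (\<integral>w. (cmod (S w p))\<^sup>2 \<partial>fold_measure) = infsetsum (\<lambda>\<gamma>. \<integral>w. KC z (ch p w) * cnj (KC z (ch w (\<gamma> p))) \<partial>hm) \<Gamma>"
      using f(2) unfolding e integral_complex_of_real .
    also have "\<dots> = infsetsum (\<lambda>\<gamma>. of_real I * KC (of_real (2 * Re z)) (ch p (\<gamma> p))) \<Gamma>"
      by (rule infsetsum_cong) (use KC_abs_square[OF z p in_upper[OF _ p]] in \<open>simp_all add: I_def\<close>)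
    also have "\<dots> = of_real I * orbit_sum (KC (of_real (2 * Re z))) p p" unfolding orbit_sum_def infsetsum_def by (rule integral_mult_right_zero)
    finally show "complex_of_real (\<integral>w. (cmod (S w p))\<^sup>2 \<partial>fold_measure) = of_real I * orbit_sum (KC (of_real (2 * Re z))) p p" .
  qed
  have d: "(\<integral>w. (cmod (S w p))\<^sup>2 \<partial>fold_measure) = I * cmod (orbit_sum (KC (of_real (2 * Re z))) p p)" if p: "p \<in> upper" for p
  proof -
    have "0 \<le> (\<integral>w. (cmod (S w p))\<^sup>2 \<partial>fold_measure)" by (rule integral_nonneg_AE) simp
    then have "(\<integral>w. (cmod (S w p))\<^sup>2 \<partial>fold_measure) = cmod (complex_of_real (\<integral>w. (cmod (S w p))\<^sup>2 \<partial>fold_measure))" by simp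
    then show ?thesis unfolding diag(2)[OF p] using I by (simp add: norm_mult)
  qed
  have "infsetsum (\<lambda>\<gamma>. \<integral>w. KC z (ch x w) * KC z (ch w (\<gamma> y)) \<partial>hm) \<Gamma> = infsetsum (\<lambda>\<gamma>. gauss_int z * KC (2 * z) (ch x (\<gamma> y))) \<Gamma>"
    by (rule infsetsum_cong) (use KC_square[OF z x in_upper[OF _ y]] in simp_all)
  also have "\<dots> = gauss_int z * orbit_sum (KC (2 * z)) x y" unfolding orbit_sum_def infsetsum_def by (rule integral_mult_right_zero)
  finally have "gauss_int z * orbit_sum (KC (2 * z)) x y = (\<integral>w. S w x * S w y \<partial>fold_measure)" using fp(2) by (simp add: S_def)
  then have "cmod (gauss_int z) * cmod (orbit_sum (KC (2 * z)) x y) = cmod (\<integral>w. S w x * S w y \<partial>fold_measure)" by (metis norm_mult)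
  also have "\<dots> \<le> (\<integral>w. ((cmod (S w x))\<^sup>2 + (cmod (S w y))\<^sup>2) / 2 \<partial>fold_measure)"
  proof (rule Bochner_Integration.integral_norm_bound_integral)
    show "integrable fold_measure (\<lambda>w. S w x * S w y)" using fp(1) by (simp add: S_def)
    show "integrable fold_measure (\<lambda>w. ((cmod (S w x))\<^sup>2 + (cmod (S w y))\<^sup>2) / 2)" using diag(1) x y by (simp del: upper_iff)
    show "cmod (S w x * S w y) \<le> ((cmod (S w x))\<^sup>2 + (cmod (S w y))\<^sup>2) / 2" for w
      using sum_squares_bound[of "cmod (S w x)" "cmod (S w y)"] by (simp add: norm_mult)
  qed
  also have "\<dots> = I * ((cmod (orbit_sum (KC (of_real (2 * Re z))) x x) + cmod (orbit_sum (KC (of_real (2 * Re z))) y y)) / 2)"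
    using diag(1) x y by (simp add: d distrib_left del: upper_iff)
  finally show ?thesis by (simp add: I_def)
qed

lemma heat_kernel_eq:
  assumes z: "0 < Re z" and X: "X \<in> surf \<Gamma>" and Y: "Y \<in> surf \<Gamma>"
  shows "heat_kernel \<Gamma> z X Y = heat_coef z * orbit_sum (KC z) (lift_pt X) (lift_pt Y)"
proof -
  define x y where "x = lift_pt X" and "y = lift_pt Y"
  have u: "x \<in> upper" "y \<in> upper" using lift_pt X Y by (auto simp: x_def y_def simp del: upper_iff)
  note b = norm_KC_square[OF z]
  have "heat_kernel \<Gamma> z X Y = (\<Sum>\<^sub>\<infinity>\<gamma>\<in>\<Gamma>. heat_coef z * KC z (ch x (\<gamma> y)))"
    unfolding heat_kernel_def x_def[symmetric] y_def[symmetric]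
  proof (rule infsum_cong)
    fix \<gamma> assume "\<gamma> \<in> \<Gamma>"
    then have "\<gamma> y \<in> upper" by (rule in_upper) (rule u)
    then show "heat_H z (hdist x (\<gamma> y)) = heat_coef z * KC z (ch x (\<gamma> y))"
      using heat_H_eq[OF z hdist_nonneg] ch_cosh u by metis
  qed
  also have "\<dots> = heat_coef z * (\<Sum>\<^sub>\<infinity>\<gamma>\<in>\<Gamma>. KC z (ch x (\<gamma> y)))" by (rule infsum_cmult_right')
  also have "(\<Sum>\<^sub>\<infinity>\<gamma>\<in>\<Gamma>. KC z (ch x (\<gamma> y))) = orbit_sum (KC z) x y"
    unfolding orbit_sum_def by (rule infsetsum_infsum[OF orbit_sum_bound(1)[OF b u(2,1)], symmetric])
  finally show ?thesis unfolding x_def y_def .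
qed

text \<open>This is the previous bound at z / 2. The Gaussian constants and the moduli of
  \<open>heat_coef\<close> at z and at Re z cancel exactly, so no dependence on Im z is
  left.\<close>

theorem heat_kernel_diagonal_bound:
  assumes z: "0 < Re z" and X: "X \<in> surf \<Gamma>" and Y: "Y \<in> surf \<Gamma>"
  shows "cmod (heat_kernel \<Gamma> z X Y)
    \<le> (cmod (heat_kernel \<Gamma> (of_real (Re z)) X X) + cmod (heat_kernel \<Gamma> (of_real (Re z)) Y Y)) / 2"
proof -
  define \<zeta> where "\<zeta> = z / 2"
  define t where "t = Re z"
  define m where "m = cmod \<zeta>"
  have t: "0 < t" "Re \<zeta> = t / 2" "0 < Re \<zeta>" "2 * \<zeta> = z" "2 * Re \<zeta> = t" using z by (simp_all add: t_def \<zeta>_def)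
  have m: "0 < m" using t by (auto simp: m_def)
  have cz: "cmod z = 2 * m" by (simp add: m_def \<zeta>_def norm_divide)
  have xy: "lift_pt X \<in> upper" "lift_pt Y \<in> upper" using lift_pt X Y by (auto simp del: upper_iff)
  define S where "S = (cmod (orbit_sum (KC (of_real t)) (lift_pt X) (lift_pt X)) + cmod (orbit_sum (KC (of_real t)) (lift_pt Y) (lift_pt Y))) / 2"
  have "sqrt (2 * pi * m) * cmod (orbit_sum (KC z) (lift_pt X) (lift_pt Y)) \<le> sqrt (2 * pi * m\<^sup>2 / (t / 2)) * S"
    using orbit_sum_KC_diagonal_bound[OF t(3) xy, unfolded norm_gauss_int[OF t(3)] t(4,5) m_def[symmetric] S_def[symmetric]] unfolding t(2) .
  also have "2 * pi * m\<^sup>2 / (t / 2) = (2 * pi * m) * (2 * m / t)" using t by (simp add: power2_eq_square field_simps)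
  finally have "sqrt (2 * pi * m) * cmod (orbit_sum (KC z) (lift_pt X) (lift_pt Y)) \<le> sqrt (2 * pi * m) * (sqrt (2 * m / t) * S)"
    by (simp only: real_sqrt_mult mult.assoc)
  then have le: "cmod (orbit_sum (KC z) (lift_pt X) (lift_pt Y)) \<le> sqrt (2 * m / t) * S" using m by simp
  have ct: "cmod (heat_coef (of_real t)) = exp (- t / 4) / sqrt (4 * pi * t)" using norm_heat_coef[of "of_real t"] t by simp
  have cc: "cmod (heat_coef z) * sqrt (2 * m / t) = cmod (heat_coef (of_real t))"
  proof -
    have "sqrt (2 * m / t) / sqrt (4 * pi * (2 * m)) = 1 / sqrt (4 * pi * t)"
    proof -
      have "2 * m / t / (4 * pi * (2 * m)) = 1 / (4 * pi * t)" using m by (simp add: field_simps)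
      then show ?thesis by (metis real_sqrt_divide real_sqrt_one)
    qed
    then show ?thesis unfolding ct norm_heat_coef[OF z] cz t_def[symmetric] by (metis mult.commute mult_1 times_divide_eq_left times_divide_eq_right)
  qed
  have "cmod (heat_kernel \<Gamma> z X Y) \<le> cmod (heat_coef z) * (sqrt (2 * m / t) * S)"
    unfolding heat_kernel_eq[OF z X Y] norm_mult by (intro mult_left_mono le) simp
  also have "\<dots> = cmod (heat_coef (of_real t)) * S" using cc by (simp only: mult.assoc[symmetric])
  also have "\<dots> = (cmod (heat_kernel \<Gamma> (of_real t) X X) + cmod (heat_kernel \<Gamma> (of_real t) Y Y)) / 2"
    using t by (simp add: heat_kernel_eq X Y S_def norm_mult distrib_left)
  finally show ?thesis unfolding t_def .
qed

end

section \<open>Convergence of orbit sums and heat kernels\<close>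

lemma quartic_tail:
  fixes k :: "real \<Rightarrow> complex"
  assumes b: "\<And>c. 1 \<le> c \<Longrightarrow> cmod (k c) \<le> M / c ^ 4" and a: "\<And>x. x \<in> S \<Longrightarrow> 1 \<le> a x"
    and C: "\<And>F. finite F \<Longrightarrow> F \<subseteq> S \<Longrightarrow> (\<Sum>x\<in>F. 1 / (a x)\<^sup>2) \<le> C"
    and F: "F \<subseteq> S" and R: "1 \<le> R" "\<And>x. x \<in> S - F \<Longrightarrow> R \<le> a x"
  shows "Infinite_Set_Sum.abs_summable_on (\<lambda>x. k (a x)) S"
    "cmod (infsetsum (\<lambda>x. k (a x)) S - infsetsum (\<lambda>x. k (a x)) F) \<le> M * C / R\<^sup>2"
proof -
  have M: "0 \<le> M" using order_trans[OF norm_ge_zero b[of 1]] by simp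
  \<comment> \<open>Of the four powers of decay, two are kept for the packing sum and two give the
    factor 1 / Q^2.\<close>
  have le: "cmod (k (a x)) \<le> M / Q\<^sup>2 * (1 / (a x)\<^sup>2)" if "x \<in> S" "1 \<le> Q" "Q \<le> a x" for x Q
  proof -
    have "Q\<^sup>2 * (a x)\<^sup>2 \<le> (a x)\<^sup>2 * (a x)\<^sup>2" using that by (intro mult_right_mono power_mono) auto
    then have "M / (a x) ^ 4 \<le> M / (Q\<^sup>2 * (a x)\<^sup>2)" using that M by (intro divide_left_mono) (auto simp: power4_eq_xxxx power2_eq_square)
    then show ?thesis using b[OF a[OF that(1)]] by simp
  qed
  have bound: "(\<Sum>x\<in>E. cmod (k (a x))) \<le> M / Q\<^sup>2 * C" if "finite E" "E \<subseteq> S" "1 \<le> Q" "\<And>x. x \<in> E \<Longrightarrow> Q \<le> a x" for E Q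
  proof -
    have "(\<Sum>x\<in>E. cmod (k (a x))) \<le> (\<Sum>x\<in>E. M / Q\<^sup>2 * (1 / (a x)\<^sup>2))" using that by (intro sum_mono le) auto
    also have "\<dots> = M / Q\<^sup>2 * (\<Sum>x\<in>E. 1 / (a x)\<^sup>2)" by (rule sum_distrib_left[symmetric])
    also have "\<dots> \<le> M / Q\<^sup>2 * C" using C[OF that(1,2)] M by (intro mult_left_mono) auto
    finally show ?thesis .
  qed
  have "Infinite_Set_Sum.abs_summable_on (\<lambda>x. cmod (k (a x))) S"
  proof (rule sum_le_imp_abs_summable(1))
    show "(\<Sum>x\<in>F. cmod (k (a x))) \<le> M / 1\<^sup>2 * C" if "finite F" "F \<subseteq> S" for F
      by (rule bound[OF that]) (use that a in auto)
  qed simp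
  then show s: "Infinite_Set_Sum.abs_summable_on (\<lambda>x. k (a x)) S" by simp
  have "cmod (infsetsum (\<lambda>x. k (a x)) S - infsetsum (\<lambda>x. k (a x)) F) = cmod (infsetsum (\<lambda>x. k (a x)) (S - F))"
    by (simp add: infsetsum_Diff[OF s F])
  also have "\<dots> \<le> infsetsum (\<lambda>x. cmod (k (a x))) (S - F)" by (rule norm_infsetsum_bound)
  also have "\<dots> \<le> M / R\<^sup>2 * C"
  proof (rule sum_le_imp_abs_summable(2))
    show "(\<Sum>x\<in>E. cmod (k (a x))) \<le> M / R\<^sup>2 * C" if "finite E" "E \<subseteq> S - F" for E
      by (rule bound[OF that(1)]) (use that R in auto)
  qed simp
  finally show "cmod (infsetsum (\<lambda>x. k (a x)) S - infsetsum (\<lambda>x. k (a x)) F) \<le> M * C / R\<^sup>2" by simp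
qed

text \<open>The terms with \<open>a \<sigma> \<le> R\<close> are finitely many and are matched by
  \<open>\<Theta> j\<close> with terms of the sum over \<open>T j\<close>. By \<open>exh\<close> all
  terms of that sum left over have \<open>b j \<gamma>\<close> at least R, so both tails are of
  order 1 / R^2, uniformly in j.\<close>

lemma infsetsum_convergence:
  fixes k :: "real \<Rightarrow> complex" and \<Theta> :: "nat \<Rightarrow> 'b \<Rightarrow> 'c"
  assumes bk: "\<And>c. 1 \<le> c \<Longrightarrow> cmod (k c) \<le> M / c ^ 4"
    and cont: "\<And>u l. (\<And>n::nat. 1 \<le> u n) \<Longrightarrow> u \<longlonglongrightarrow> l \<Longrightarrow> (\<lambda>n. k (u n)) \<longlonglongrightarrow> k l"
    and a1: "\<And>\<sigma>. \<sigma> \<in> S \<Longrightarrow> 1 \<le> a \<sigma>" and b1: "\<And>j \<gamma>. \<gamma> \<in> T j \<Longrightarrow> 1 \<le> b j \<gamma>"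
    and \<Theta>: "\<And>j \<sigma>. \<sigma> \<in> S \<Longrightarrow> \<Theta> j \<sigma> \<in> T j" "\<And>\<sigma>. \<sigma> \<in> S \<Longrightarrow> (\<lambda>j. b j (\<Theta> j \<sigma>)) \<longlonglongrightarrow> a \<sigma>"
    and inj: "\<And>F. finite F \<Longrightarrow> F \<subseteq> S \<Longrightarrow> \<forall>\<^sub>F j in sequentially. inj_on (\<Theta> j) F"
    and fin: "\<And>R. finite {\<sigma> \<in> S. a \<sigma> \<le> R}"
    and exh: "\<And>R. \<forall>\<^sub>F j in sequentially. {\<gamma> \<in> T j. b j \<gamma> \<le> R} \<subseteq> \<Theta> j ` {\<sigma> \<in> S. a \<sigma> \<le> R}"
    and Ca: "\<And>F. finite F \<Longrightarrow> F \<subseteq> S \<Longrightarrow> (\<Sum>\<sigma>\<in>F. 1 / (a \<sigma>)\<^sup>2) \<le> C"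
    and Cb: "\<forall>\<^sub>F j in sequentially. \<forall>F. finite F \<longrightarrow> F \<subseteq> T j \<longrightarrow> (\<Sum>\<gamma>\<in>F. 1 / (b j \<gamma>)\<^sup>2) \<le> C"
  shows "(\<lambda>j. infsetsum (\<lambda>\<gamma>. k (b j \<gamma>)) (T j)) \<longlonglongrightarrow> infsetsum (\<lambda>\<sigma>. k (a \<sigma>)) S"
proof (rule tendstoI)
  fix e :: real assume e: "0 < e"
  have "((\<lambda>R::real. M * C / R\<^sup>2) \<longlongrightarrow> 0) at_top"
    by (rule tendsto_divide_0[OF tendsto_const filterlim_at_top_imp_at_infinity[OF filterlim_pow_at_top[OF _ filterlim_ident]]]) simp
  then have "\<forall>\<^sub>F R in at_top. M * C / R\<^sup>2 < e / 3" using e by (intro order_tendstoD) auto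
  then have "\<forall>\<^sub>F R in at_top. M * C / R\<^sup>2 < e / 3 \<and> 1 \<le> R" using eventually_ge_at_top by (rule eventually_conj)
  then obtain R where R: "M * C / R\<^sup>2 < e / 3" "1 \<le> R" using eventually_happens' trivial_limit_at_top_linorder by blast
  define F where "F = {\<sigma> \<in> S. a \<sigma> \<le> R}"
  have F: "finite F" "F \<subseteq> S" using fin by (auto simp: F_def)
  have SF: "cmod (infsetsum (\<lambda>\<sigma>. k (a \<sigma>)) S - infsetsum (\<lambda>\<sigma>. k (a \<sigma>)) F) < e / 3"
  proof -
    have "cmod (infsetsum (\<lambda>\<sigma>. k (a \<sigma>)) S - infsetsum (\<lambda>\<sigma>. k (a \<sigma>)) F) \<le> M * C / R\<^sup>2"
    proof (rule quartic_tail(2)[OF _ _ _ F(2) R(2)])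
      show "R \<le> a \<sigma>" if "\<sigma> \<in> S - F" for \<sigma> using that by (auto simp: F_def)
    qed (fact bk a1 Ca)+
    then show ?thesis using R(1) by linarith
  qed
  have "(\<lambda>j. \<Sum>\<sigma>\<in>F. k (b j (\<Theta> j \<sigma>))) \<longlonglongrightarrow> (\<Sum>\<sigma>\<in>F. k (a \<sigma>))"
    by (intro tendsto_sum cont b1 \<Theta>) (use F in auto)
  then have ev1: "\<forall>\<^sub>F j in sequentially. dist (\<Sum>\<sigma>\<in>F. k (b j (\<Theta> j \<sigma>))) (\<Sum>\<sigma>\<in>F. k (a \<sigma>)) < e / 3"
    using e by (intro tendstoD) auto
  show "\<forall>\<^sub>F j in sequentially. dist (infsetsum (\<lambda>\<gamma>. k (b j \<gamma>)) (T j)) (infsetsum (\<lambda>\<sigma>. k (a \<sigma>)) S) < e"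
    using ev1 inj[OF F] exh[of R] Cb
  proof eventually_elim
    case (elim j)
    have sub: "\<Theta> j ` F \<subseteq> T j" using \<Theta>(1) F(2) by blast
    have "R \<le> b j \<gamma>" if "\<gamma> \<in> T j - \<Theta> j ` F" for \<gamma>
    proof (rule ccontr)
      assume "\<not> R \<le> b j \<gamma>"
      then have "\<gamma> \<in> {\<gamma> \<in> T j. b j \<gamma> \<le> R}" using that by auto
      then show False using elim(3) that unfolding F_def by blast
    qed
    then have "cmod (infsetsum (\<lambda>\<gamma>. k (b j \<gamma>)) (T j) - infsetsum (\<lambda>\<gamma>. k (b j \<gamma>)) (\<Theta> j ` F)) \<le> M * C / R\<^sup>2"
      by (intro quartic_tail(2)[OF bk b1 _ sub R(2)]) (use elim(4) in auto)
    also have "\<dots> < e / 3" by (rule R(1))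
    also have "infsetsum (\<lambda>\<gamma>. k (b j \<gamma>)) (\<Theta> j ` F) = (\<Sum>\<sigma>\<in>F. k (b j (\<Theta> j \<sigma>)))"
      using F(1) by (simp add: infsetsum_finite sum.reindex[OF elim(2)])
    finally have 1: "cmod (infsetsum (\<lambda>\<gamma>. k (b j \<gamma>)) (T j) - (\<Sum>\<sigma>\<in>F. k (b j (\<Theta> j \<sigma>)))) < e / 3" .
    have 2: "cmod ((\<Sum>\<sigma>\<in>F. k (b j (\<Theta> j \<sigma>))) - (\<Sum>\<sigma>\<in>F. k (a \<sigma>))) < e / 3" using elim(1) by (simp add: dist_norm)
    have 3: "cmod ((\<Sum>\<sigma>\<in>F. k (a \<sigma>)) - infsetsum (\<lambda>\<sigma>. k (a \<sigma>)) S) < e / 3"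
      using SF F(1) by (simp add: norm_minus_commute)
    have "cmod (infsetsum (\<lambda>\<gamma>. k (b j \<gamma>)) (T j) - infsetsum (\<lambda>\<sigma>. k (a \<sigma>)) S) < e / 3 + e / 3 + e / 3"
      by (rule norm_diff_triangle_less[OF norm_diff_triangle_less[OF 1 2] 3])
    then show ?case by (simp add: dist_norm)
  qed
qed

context near_isom_dev
begin

text \<open>The approximating matrices match elements of \<open>G\<close> with elements of
  \<open>H j\<close>. From \<open>exhaustion\<close> come both the fact that all elements of bounded
  displacement are matched and a packing constant independent of j, since \<open>H j\<close>
  eventually has no more elements than \<open>G\<close> that move the second point by at most
  2.\<close>

lemma orbit_sum_convergence:
  fixes k :: "real \<Rightarrow> complex"
  assumes bk: "\<And>c. 1 \<le> c \<Longrightarrow> cmod (k c) \<le> M / c ^ 4"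
    and cont: "\<And>u l. (\<And>n::nat. 1 \<le> u n) \<Longrightarrow> u \<longlonglongrightarrow> l \<Longrightarrow> (\<lambda>n. k (u n)) \<longlonglongrightarrow> k l"
    and x: "x \<in> upper" "y \<in> upper" and u: "\<And>j. u j \<in> upper" "u \<longlonglongrightarrow> A x" and v: "\<And>j. v j \<in> upper" "v \<longlonglongrightarrow> A y"
  shows "(\<lambda>j. fuchsian_group.orbit_sum (H j) k (frame j (u j)) (frame j (v j))) \<longlonglongrightarrow> N.orbit_sum k x y"
proof -
  define \<Theta> where "\<Theta> j \<sigma> = (SOME \<gamma>. \<gamma> \<in> H j \<and> (\<forall>w\<in>upper. frame j (mob (appr \<sigma> j) w) = \<gamma> (frame j w)))" for j \<sigma>
  have \<Theta>: "\<Theta> j \<sigma> \<in> H j \<and> (\<forall>w\<in>upper. frame j (mob (appr \<sigma> j) w) = \<Theta> j \<sigma> (frame j w))" if "\<sigma> \<in> G" for j \<sigma>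
  proof -
    have "\<exists>\<gamma>. \<gamma> \<in> H j \<and> (\<forall>w\<in>upper. frame j (mob (appr \<sigma> j) w) = \<gamma> (frame j w))"
      using appr(1)[OF that, of j] unfolding Mat_def by blast
    then show ?thesis unfolding \<Theta>_def by (rule someI_ex)
  qed
  have \<Theta>I: "\<gamma> = \<Theta> j \<sigma>" if s: "\<sigma> \<in> G" and g: "\<gamma> \<in> H j" and e: "\<And>w. w \<in> upper \<Longrightarrow> \<gamma> (frame j w) = frame j (mob (appr \<sigma> j) w)" for \<gamma> j \<sigma>
  proof (rule fuchsian_group.group_ext[OF fH g])
    show "\<Theta> j \<sigma> \<in> H j" using \<Theta>[OF s] by simp
    fix z assume z: "z \<in> upper"
    have "mob (minv (aff (c j))) z \<in> upper" by (rule mob_upper[OF minv_SL2[OF aff_c] z])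
    then show "\<gamma> z = \<Theta> j \<sigma> z" using e \<Theta>[OF s] mob_minv(1)[OF aff_c z] by metis
  qed
  define a b where "a \<sigma> = ch x (\<sigma> y)" and "b j \<gamma> = ch (frame j (u j)) (\<gamma> (frame j (v j)))" for \<sigma> \<gamma> j
  have Au: "A x \<in> upper" "A y \<in> upper" using hiso_upper[OF A] x by blast+
  have uu: "frame j (u j) \<in> upper" "frame j (v j) \<in> upper" for j using mob_upper[OF aff_c] u v by blast+
  have lim: "(\<lambda>j. mob (appr \<sigma> j) (v j)) \<longlonglongrightarrow> A (\<sigma> y)" if s: "\<sigma> \<in> G" for \<sigma>
  proof -
    have Aw: "A (\<sigma> y) \<in> upper" by (rule hiso_upper[OF A N.in_upper[OF s x(2)]])
    have m: "mob (appr \<sigma> j) w \<in> upper" if "w \<in> upper" for j w by (rule mob_upper[OF Mat_SL2[OF appr(1)[OF s]] that])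
    have "(\<lambda>j. hdist (A (\<sigma> y)) (mob (appr \<sigma> j) (A y)) + hdist (A y) (v j)) \<longlonglongrightarrow> hdist (A (\<sigma> y)) (A (\<sigma> y)) + hdist (A y) (A y)"
      by (intro tendsto_add tendsto_hdist tendsto_const appr(2)[OF s x(2)] v(2) always_eventually allI m Au Aw v(1))
    then have l0: "(\<lambda>j. hdist (A (\<sigma> y)) (mob (appr \<sigma> j) (A y)) + hdist (A y) (v j)) \<longlonglongrightarrow> 0" using Au Aw by (simp del: upper_iff)
    have "(\<lambda>j. hdist (A (\<sigma> y)) (mob (appr \<sigma> j) (v j))) \<longlonglongrightarrow> 0"
    proof (rule tendsto_sandwich[OF _ _ tendsto_const l0])
      show "\<forall>\<^sub>F j in sequentially. 0 \<le> hdist (A (\<sigma> y)) (mob (appr \<sigma> j) (v j))"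
        by (intro always_eventually allI hdist_nonneg Aw m v)
      show "\<forall>\<^sub>F j in sequentially. hdist (A (\<sigma> y)) (mob (appr \<sigma> j) (v j)) \<le> hdist (A (\<sigma> y)) (mob (appr \<sigma> j) (A y)) + hdist (A y) (v j)"
      proof (intro always_eventually allI)
        fix j
        show "hdist (A (\<sigma> y)) (mob (appr \<sigma> j) (v j)) \<le> hdist (A (\<sigma> y)) (mob (appr \<sigma> j) (A y)) + hdist (A y) (v j)"
          using hdist_triangle[OF Aw m[OF Au(2), of j] m[OF v(1), of j j]] hdist_mob[OF Mat_SL2[OF appr(1)[OF s, of j]] Au(2) v(1), of j] by simp
      qed
    qed
    then show ?thesis by (rule hdist_tendsto_0[OF _ Aw]) (intro always_eventually allI m v)
  qed
  have b_mob: "b j \<gamma> = ch (u j) (mob g (v j))" if "g \<in> SL2" "\<And>w. w \<in> upper \<Longrightarrow> frame j (mob g w) = \<gamma> (frame j w)" for j \<gamma> g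
    unfolding b_def using that(2)[OF v(1), of j] ch_mob[OF aff_c u(1)[of j] mob_upper[OF that(1) v(1)[of j]], of j] by simp
  define N0 where "N0 = card {\<sigma> \<in> G. hdist y (\<sigma> y) \<le> 2}"
  define C where "C = real N0 * packing_const"
  \<comment> \<open>The first point is left free: with \<open>u\<close> this is the matching of
    terms, with \<open>v\<close> itself it is the count behind the packing constant.\<close>
  have evexh: "\<forall>\<^sub>F j in sequentially. {\<gamma> \<in> H j. hdist (frame j (u' j)) (\<gamma> (frame j (v j))) \<le> R} \<subseteq> \<Theta> j ` {\<sigma> \<in> G. hdist x' (\<sigma> y) \<le> R}"
    if u': "\<And>j. u' j \<in> upper" "u' \<longlonglongrightarrow> A x'" and x': "x' \<in> upper" for u' x' R
    using exhaustion[OF x' x(2) u' v, of R]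
  proof eventually_elim
    case (elim j)
    show ?case
    proof
      fix \<gamma> assume "\<gamma> \<in> {\<gamma> \<in> H j. hdist (frame j (u' j)) (\<gamma> (frame j (v j))) \<le> R}"
      then have g: "\<gamma> \<in> H j" "hdist (frame j (u' j)) (\<gamma> (frame j (v j))) \<le> R" by auto
      obtain m where m: "m \<in> Mat j" "\<forall>w\<in>upper. frame j (mob m w) = \<gamma> (frame j w)" using Mat_rep[OF g(1)] by auto
      have "hdist (u' j) (mob m (v j)) \<le> R"
        using g(2) m(2) v(1)[of j] hdist_mob[OF aff_c u'(1)[of j] mob_upper[OF Mat_SL2[OF m(1)] v(1)[of j]], of j] by (simp del: upper_iff)
      then obtain \<sigma> where s: "\<sigma> \<in> G" "hdist x' (\<sigma> y) \<le> R" "\<forall>w\<in>upper. mob m w = mob (appr \<sigma> j) w" using elim m(1) by blast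
      have "\<gamma> = \<Theta> j \<sigma>" by (rule \<Theta>I[OF s(1) g(1)]) (use m(2) s(3) in \<open>simp del: upper_iff\<close>)
      then show "\<gamma> \<in> \<Theta> j ` {\<sigma> \<in> G. hdist x' (\<sigma> y) \<le> R}" using s by blast
    qed
  qed
  have ch_le: "{\<gamma> \<in> T. ch p (\<gamma> q) \<le> R} = {\<gamma> \<in> T. hdist p (\<gamma> q) \<le> arcosh R}"
    if R: "1 \<le> R" and p: "p \<in> upper" and q: "\<And>\<gamma>. \<gamma> \<in> T \<Longrightarrow> \<gamma> q \<in> upper" for R p q and T :: "(complex \<Rightarrow> complex) set"
  proof -
    have "ch p (\<gamma> q) \<le> R \<longleftrightarrow> hdist p (\<gamma> q) \<le> arcosh R" if g: "\<gamma> \<in> T" for \<gamma>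
    proof -
      have "cosh (hdist p (\<gamma> q)) \<le> cosh (arcosh R) \<longleftrightarrow> hdist p (\<gamma> q) \<le> arcosh R"
        using R hdist_nonneg[OF p q[OF g]] by (intro cosh_le_iff_nonneg) auto
      then show ?thesis using ch_cosh[OF p q[OF g]] R by simp
    qed
    then show ?thesis by blast
  qed
  have a1: "1 \<le> a \<sigma>" if "\<sigma> \<in> G" for \<sigma> unfolding a_def by (rule ch_ge_1[OF x(1) N.in_upper[OF that x(2)]])
  have b1: "1 \<le> b j \<gamma>" if "\<gamma> \<in> H j" for j \<gamma> unfolding b_def by (rule ch_ge_1[OF uu(1) fuchsian_group.in_upper[OF fH that uu(2)]])
  have "(\<lambda>j. infsetsum (\<lambda>\<gamma>. k (b j \<gamma>)) (H j)) \<longlonglongrightarrow> infsetsum (\<lambda>\<sigma>. k (a \<sigma>)) G"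
  proof (rule infsetsum_convergence[OF bk cont a1 b1, where \<Theta> = \<Theta> and C = C])
    show "\<Theta> j \<sigma> \<in> H j" if "\<sigma> \<in> G" for j \<sigma> using \<Theta>[OF that] by simp
    show "(\<lambda>j. b j (\<Theta> j \<sigma>)) \<longlonglongrightarrow> a \<sigma>" if s: "\<sigma> \<in> G" for \<sigma>
    proof -
      have Aw: "A (\<sigma> y) \<in> upper" by (rule hiso_upper[OF A N.in_upper[OF s x(2)]])
      have m: "mob (appr \<sigma> j) (v j) \<in> upper" for j by (rule mob_upper[OF Mat_SL2[OF appr(1)[OF s]] v(1)])
      have e: "b j (\<Theta> j \<sigma>) = cosh (hdist (u j) (mob (appr \<sigma> j) (v j)))" for j
        using b_mob[OF Mat_SL2[OF appr(1)[OF s, of j]], of j "\<Theta> j \<sigma>"] \<Theta>[OF s, of j] ch_cosh[OF u(1)[of j] m[of j]] by (simp del: upper_iff)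
      have "(\<lambda>j. cosh (hdist (u j) (mob (appr \<sigma> j) (v j)))) \<longlonglongrightarrow> cosh (hdist (A x) (A (\<sigma> y)))"
        by (intro tendsto_cosh tendsto_hdist u(2) lim[OF s] Au Aw always_eventually allI u(1) m)
      also have "cosh (hdist (A x) (A (\<sigma> y))) = a \<sigma>"
        unfolding a_def hiso_hdist[OF A x(1) N.in_upper[OF s x(2)]] by (rule ch_cosh[OF x(1) N.in_upper[OF s x(2)], symmetric])
      finally show ?thesis unfolding e .
    qed
    show "finite {\<sigma> \<in> G. a \<sigma> \<le> R}" for R
    proof (cases "1 \<le> R")
      case True
      have "{\<sigma> \<in> G. ch x (\<sigma> y) \<le> R} = {\<sigma> \<in> G. hdist x (\<sigma> y) \<le> arcosh R}"
        by (rule ch_le[OF True x(1)]) (rule N.in_upper[OF _ x(2)])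
      then show ?thesis unfolding a_def using N.finite_near[OF x, of "arcosh R"] by simp
    next
      case False
      then have "{\<sigma> \<in> G. a \<sigma> \<le> R} = {}" using a1 by fastforce
      then show ?thesis by (simp only: finite.emptyI)
    qed
    show "\<forall>\<^sub>F j in sequentially. {\<gamma> \<in> H j. b j \<gamma> \<le> R} \<subseteq> \<Theta> j ` {\<sigma> \<in> G. a \<sigma> \<le> R}" for R
    proof (cases "1 \<le> R")
      case True
      have 1: "{\<sigma> \<in> G. ch x (\<sigma> y) \<le> R} = {\<sigma> \<in> G. hdist x (\<sigma> y) \<le> arcosh R}"
        by (rule ch_le[OF True x(1)]) (rule N.in_upper[OF _ x(2)])
      have 2: "{\<gamma> \<in> H j. ch (frame j (u j)) (\<gamma> (frame j (v j))) \<le> R}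
          = {\<gamma> \<in> H j. hdist (frame j (u j)) (\<gamma> (frame j (v j))) \<le> arcosh R}" for j
        by (rule ch_le[OF True uu(1)]) (rule fuchsian_group.in_upper[OF fH _ uu(2)])
      show ?thesis unfolding a_def b_def 1 2 by (rule evexh[OF u x(1)])
    next
      case False
      then have "{\<gamma> \<in> H j. b j \<gamma> \<le> R} = {}" for j using b1 by fastforce
      then show ?thesis by (simp only: empty_subsetI eventually_True)
    qed
    show "\<forall>\<^sub>F j in sequentially. inj_on (\<Theta> j) F" if F: "finite F" "F \<subseteq> G" for F
    proof -
      have "\<forall>\<^sub>F j in sequentially. \<Theta> j \<sigma> = \<Theta> j \<tau> \<longrightarrow> \<sigma> = \<tau>" if st: "\<sigma> \<in> F" "\<tau> \<in> F" for \<sigma> \<tau>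
      proof (cases "\<sigma> = \<tau>")
        case False
        have G: "\<sigma> \<in> G" "\<tau> \<in> G" using st F by auto
        obtain w where w: "w \<in> upper" "\<sigma> w \<noteq> \<tau> w" using N.group_ext[OF G] False by blast
        have up: "\<sigma> w \<in> upper" "\<tau> w \<in> upper" using N.in_upper G w by blast+
        have Aup: "A (\<sigma> w) \<in> upper" "A (\<tau> w) \<in> upper" using hiso_upper[OF A] up by blast+
        have "hdist (A (\<sigma> w)) (A (\<tau> w)) \<noteq> 0" unfolding hiso_hdist[OF A up] using w(2) hdist_eq_0_iff[OF up] by simp
        then have ne: "A (\<sigma> w) - A (\<tau> w) \<noteq> 0" using hdist_self by auto
        have "(\<lambda>j. mob (appr \<sigma> j) (A w) - mob (appr \<tau> j) (A w)) \<longlonglongrightarrow> A (\<sigma> w) - A (\<tau> w)"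
          by (intro tendsto_diff appr(2) G w)
        then have "\<forall>\<^sub>F j in sequentially. mob (appr \<sigma> j) (A w) - mob (appr \<tau> j) (A w) \<noteq> 0"
          by (rule tendsto_imp_eventually_ne[OF _ ne])
        then show ?thesis
        proof eventually_elim
          case (elim j)
          have Aw: "A w \<in> upper" by (rule hiso_upper[OF A w(1)])
          have "\<Theta> j \<sigma> \<noteq> \<Theta> j \<tau>"
          proof
            assume "\<Theta> j \<sigma> = \<Theta> j \<tau>"
            then have "frame j (mob (appr \<sigma> j) (A w)) = frame j (mob (appr \<tau> j) (A w))"
              using \<Theta>[OF G(1), of j] \<Theta>[OF G(2), of j] Aw by (simp del: upper_iff)
            then have "mob (minv (aff (c j))) (frame j (mob (appr \<sigma> j) (A w))) = mob (minv (aff (c j))) (frame j (mob (appr \<tau> j) (A w)))" by (rule arg_cong)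
            then have "mob (appr \<sigma> j) (A w) = mob (appr \<tau> j) (A w)"
              unfolding mob_minv(2)[OF aff_c mob_upper[OF Mat_SL2[OF appr(1)[OF G(1)]] Aw]] mob_minv(2)[OF aff_c mob_upper[OF Mat_SL2[OF appr(1)[OF G(2)]] Aw]] .
            then show False using elim by simp
          qed
          then show ?case by simp
        qed
      qed simp
      then have "\<forall>\<^sub>F j in sequentially. \<forall>\<sigma>\<in>F. \<forall>\<tau>\<in>F. \<Theta> j \<sigma> = \<Theta> j \<tau> \<longrightarrow> \<sigma> = \<tau>"
        using F(1) by (simp add: eventually_ball_finite_distrib)
      then show ?thesis unfolding inj_on_def .
    qed
    show "(\<Sum>\<sigma>\<in>E. 1 / (a \<sigma>)\<^sup>2) \<le> C" if "finite E" "E \<subseteq> G" for E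
      unfolding a_def C_def N0_def by (rule N.packing[OF x(1) x(2) order_refl that])
    show "\<forall>\<^sub>F j in sequentially. \<forall>F. finite F \<longrightarrow> F \<subseteq> H j \<longrightarrow> (\<Sum>\<gamma>\<in>F. 1 / (b j \<gamma>)\<^sup>2) \<le> C"
      using evexh[OF v x(2), of 2]
    proof eventually_elim
      case (elim j)
      have f: "finite {\<sigma> \<in> G. hdist y (\<sigma> y) \<le> 2}" by (rule N.finite_near[OF x(2) x(2)])
      have "card {\<gamma> \<in> H j. hdist (frame j (v j)) (\<gamma> (frame j (v j))) \<le> 2} \<le> card (\<Theta> j ` {\<sigma> \<in> G. hdist y (\<sigma> y) \<le> 2})"
        by (rule card_mono[OF finite_imageI[OF f] elim])
      also have "\<dots> \<le> N0" unfolding N0_def by (rule card_image_le[OF f])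
      finally show ?case unfolding b_def C_def using fuchsian_group.packing[OF fH uu] by blast
    qed
  qed
  then show ?thesis unfolding N.orbit_sum_def fuchsian_group.orbit_sum_def[OF fH] a_def b_def .
qed

end

context fuchsian_group
begin

text \<open>\<open>heat_kernel\<close> is defined through the arbitrary lifts
  \<open>lift_pt\<close>; this allows the lifts that converge in the frame to be used
  instead.\<close>

lemma orbit_sum_lift:
  assumes "a \<in> upper" "b \<in> upper"
  shows "orbit_sum k (lift_pt (orb \<Gamma> a)) (lift_pt (orb \<Gamma> b)) = orbit_sum k a b"
proof -
  have lift: "\<exists>\<gamma>\<in>\<Gamma>. lift_pt (orb \<Gamma> w) = \<gamma> w" if "w \<in> upper" for w
  proof -
    have "lift_pt (orb \<Gamma> w) \<in> orb \<Gamma> (lift_pt (orb \<Gamma> w))" by (rule orb_self[OF lift_pt(1)[OF orb_in_surf[OF that]]])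
    then have "lift_pt (orb \<Gamma> w) \<in> orb \<Gamma> w" unfolding lift_pt(2)[OF orb_in_surf[OF that]] .
    then show ?thesis by (auto simp: orb_def)
  qed
  obtain \<gamma> \<delta> where g: "\<gamma> \<in> \<Gamma>" "lift_pt (orb \<Gamma> a) = \<gamma> a" "\<delta> \<in> \<Gamma>" "lift_pt (orb \<Gamma> b) = \<delta> b" using lift assms by blast
  show ?thesis unfolding g(2,4)
    using orbit_sum_invariant(1)[OF g(1) assms(1) in_upper[OF g(3) assms(2)], of k] orbit_sum_invariant(2)[OF g(3) assms, of k] by simp
qed

lemma measurable_heat_kernel:
  assumes t: "0 < t" and X: "X \<in> surf \<Gamma>" "Y \<in> surf \<Gamma>"
  shows "(\<lambda>s. heat_kernel \<Gamma> (Complex t s) X Y) \<in> borel_measurable borel"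
proof -
  have cont: "continuous_on UNIV (Complex t)" unfolding Complex_eq by (intro continuous_intros)
  have cx[measurable]: "Complex t \<in> borel_measurable borel" by (rule borel_measurable_continuous_onI[OF cont])
  have nz: "Complex t s \<noteq> 0" for s using t by (simp add: complex_eq_iff)
  have "continuous_on UNIV (\<lambda>s. heat_coef (Complex t s))"
    unfolding heat_coef_def
  proof (intro continuous_on_mult continuous_on_divide continuous_on_powr_complex continuous_on_exp continuous_on_minus continuous_on_const cont)
    show "UNIV \<subseteq> {s. 0 \<le> Re (4 * complex_of_real pi * Complex t s) \<or> Im (4 * complex_of_real pi * Complex t s) \<noteq> 0}" using t by auto
  qed (use nz in auto)
  then have [measurable]: "(\<lambda>s. heat_coef (Complex t s)) \<in> borel_measurable borel" by (rule borel_measurable_continuous_onI)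
  have [measurable]: "(\<lambda>s. KC (Complex t s) c) \<in> borel_measurable borel" for c
    unfolding KC_def Abel_def kerC_def gaussC_def by measurable
  have [measurable]: "(\<lambda>s. orbit_sum (KC (Complex t s)) (lift_pt X) (lift_pt Y)) \<in> borel_measurable borel"
    unfolding orbit_sum_def by (rule measurable_infsetsum[OF countable_group]) measurable
  have "heat_kernel \<Gamma> (Complex t s) X Y = heat_coef (Complex t s) * orbit_sum (KC (Complex t s)) (lift_pt X) (lift_pt Y)" for s
    by (rule heat_kernel_eq[OF _ X]) (simp add: t)
  then show ?thesis by simp
qed

end

context near_isom_dev
begin

text \<open>Choose the lifts at exact distance from \<open>A (lift_pt X)\<close> in the frame. This
  distance tends to 0 because \<open>P j (A (lift_pt X))\<close> approaches
  \<open>\<phi> j X\<close> and \<open>\<phi> j\<close> is almost isometric near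
  \<open>X\<close>.\<close>

lemma lift_convergence:
  assumes X: "X \<in> surf G" "\<And>n. Xs n \<in> surf G" "(\<lambda>n. qdist (Xs n) X) \<longlonglongrightarrow> 0"
  shows "\<exists>u. (\<forall>j. u j \<in> upper \<and> orb (H j) (frame j (u j)) = \<phi> j (Xs j)) \<and> u \<longlonglongrightarrow> A (lift_pt X)"
proof -
  define x where "x = lift_pt X"
  have x: "x \<in> upper" "orb G x = X" using N.lift_pt[OF X(1)] by (auto simp: x_def simp del: upper_iff)
  have Ax: "A x \<in> upper" by (rule hiso_upper[OF A x(1)])
  define w where "w j = frame j (A x)" for j
  have w: "w j \<in> upper" for j unfolding w_def by (rule mob_upper[OF aff_c Ax])
  have "\<exists>a\<in>upper. orb (H j) a = \<phi> j (Xs j) \<and> hdist (w j) a = qdist (orb (H j) (w j)) (\<phi> j (Xs j))" for j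
    using fuchsian_group.qdist_lift[OF fH w maps[OF X(2)[of j]]] by blast
  then obtain a where a: "\<And>j. a j \<in> upper" "\<And>j. orb (H j) (a j) = \<phi> j (Xs j)" "\<And>j. hdist (w j) (a j) = qdist (P j (A x)) (\<phi> j (Xs j))"
    unfolding P_eq w_def by metis
  define u where "u j = mob (minv (aff (c j))) (a j)" for j
  have u: "u j \<in> upper" "frame j (u j) = a j" for j
    unfolding u_def by (rule mob_upper[OF minv_SL2[OF aff_c] a(1)], rule mob_minv(1)[OF aff_c a(1)])
  have hu: "hdist (A x) (u j) = qdist (P j (A x)) (\<phi> j (Xs j))" for j
    using hdist_mob[OF aff_c Ax u(1), of j j] a(3)[of j] by (simp add: u(2) w_def)
  have l1: "(\<lambda>j. qdist (P j (A x)) (\<phi> j X)) \<longlonglongrightarrow> 0"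
    using P_lim[OF Ax X(1)] unfolding JA[OF x(1)] x(2) N.qdist_self[OF X(1)] .
  define R where "R = qdist p X + 1"
  have R: "0 \<le> R" using N.qdist_nonneg[OF p X(1)] by (simp add: R_def)
  have "\<forall>\<^sub>F j in sequentially. qdist (Xs j) X < 1" using order_tendstoD(2)[OF X(3), of 1] by simp
  then have ev: "\<forall>\<^sub>F j in sequentially. qdist (\<phi> j X) (\<phi> j (Xs j)) \<le> 2 * qdist (Xs j) X"
    using near[of "1 / 2" R, OF _ _ R, simplified]
  proof eventually_elim
    case (elim j)
    have "qdist p (Xs j) \<le> R" "qdist p X \<le> R"
      using N.qdist_triangle[OF p X(1) X(2)[of j]] elim(1) by (simp_all add: R_def N.qdist_commute)
    then have "qdist (\<phi> j X) (\<phi> j (Xs j)) \<le> (1 + 1 / 2) * qdist X (Xs j)"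
      using elim(2) X(1) X(2)[of j] unfolding near_isom_def by blast
    then show ?case using N.qdist_nonneg[OF X(1) X(2)[of j]] by (simp add: N.qdist_commute)
  qed
  have l2: "(\<lambda>j. qdist (P j (A x)) (\<phi> j X) + 2 * qdist (Xs j) X) \<longlonglongrightarrow> 0 + 2 * 0" by (intro tendsto_intros l1 X(3))
  have "(\<lambda>j. hdist (A x) (u j)) \<longlonglongrightarrow> 0"
  proof (rule tendsto_sandwich[OF _ _ tendsto_const])
    show "(\<lambda>j. qdist (P j (A x)) (\<phi> j X) + 2 * qdist (Xs j) X) \<longlonglongrightarrow> 0" using l2 by simp
    show "\<forall>\<^sub>F j in sequentially. 0 \<le> hdist (A x) (u j)" by (intro always_eventually allI hdist_nonneg Ax u)
    show "\<forall>\<^sub>F j in sequentially. hdist (A x) (u j) \<le> qdist (P j (A x)) (\<phi> j X) + 2 * qdist (Xs j) X"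
      using ev
    proof eventually_elim
      case (elim j)
      have "qdist (P j (A x)) (\<phi> j (Xs j)) \<le> qdist (P j (A x)) (\<phi> j X) + qdist (\<phi> j X) (\<phi> j (Xs j))"
        by (rule fuchsian_group.qdist_triangle[OF fH P_surf[OF Ax] maps[OF X(1)] maps[OF X(2)]])
      then show ?case unfolding hu using elim by linarith
    qed
  qed
  then have "u \<longlonglongrightarrow> A x" by (rule hdist_tendsto_0[OF _ Ax]) (intro always_eventually allI u)
  then show ?thesis using u a(2) unfolding x_def by metis
qed

lemma heat_kernel_convergence:
  assumes z: "0 < Re z"
    and X: "X \<in> surf G" "\<And>n. Xs n \<in> surf G" "(\<lambda>n. qdist (Xs n) X) \<longlonglongrightarrow> 0"
    and Y: "Y \<in> surf G" "\<And>n. Ys n \<in> surf G" "(\<lambda>n. qdist (Ys n) Y) \<longlonglongrightarrow> 0"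
  shows "(\<lambda>n. heat_kernel (H n) z (\<phi> n (Xs n)) (\<phi> n (Ys n))) \<longlonglongrightarrow> heat_kernel G z X Y"
proof -
  obtain u where u: "\<And>j. u j \<in> upper" "\<And>j. orb (H j) (frame j (u j)) = \<phi> j (Xs j)" "u \<longlonglongrightarrow> A (lift_pt X)"
    using lift_convergence[OF X] by auto
  obtain v where v: "\<And>j. v j \<in> upper" "\<And>j. orb (H j) (frame j (v j)) = \<phi> j (Ys j)" "v \<longlonglongrightarrow> A (lift_pt Y)"
    using lift_convergence[OF Y] by auto
  have eq: "heat_kernel (H n) z (\<phi> n (Xs n)) (\<phi> n (Ys n))
      = heat_coef z * fuchsian_group.orbit_sum (H n) (KC z) (frame n (u n)) (frame n (v n))" for n
    unfolding fuchsian_group.heat_kernel_eq[OF fH z maps[OF X(2)] maps[OF Y(2)]] unfolding u(2)[symmetric] v(2)[symmetric]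
      fuchsian_group.orbit_sum_lift[OF fH mob_upper[OF aff_c u(1)] mob_upper[OF aff_c v(1)]] ..
  show ?thesis unfolding eq N.heat_kernel_eq[OF z X(1) Y(1)]
    by (intro tendsto_mult tendsto_const orbit_sum_convergence[OF norm_KC[OF z] KC_tendsto[OF z]] N.lift_pt(1) X(1) Y(1) u(1,3) v(1,3))
qed

end

text \<open>The subsequence comes from the geometry alone and depends neither on z nor on the
  points. This matters because z runs along the whole line of integration.\<close>

lemma (in near_isom_seq) heat_kernel_subseq:
  "\<exists>k. strict_mono (k :: nat \<Rightarrow> nat) \<and> (\<forall>z X Y Xs Ys. 0 < Re z \<longrightarrow> X \<in> surf G \<longrightarrow> Y \<in> surf G \<longrightarrow>
     (\<forall>n. Xs n \<in> surf G) \<longrightarrow> (\<forall>n. Ys n \<in> surf G) \<longrightarrow> (\<lambda>n. qdist (Xs n) X) \<longlonglongrightarrow> 0 \<longrightarrow> (\<lambda>n. qdist (Ys n) Y) \<longlonglongrightarrow> 0 \<longrightarrow>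
     (\<lambda>n. heat_kernel (H (k n)) z (\<phi> (k n) (Xs (k n))) (\<phi> (k n) (Ys (k n)))) \<longlonglongrightarrow> heat_kernel G z X Y)"
proof -
  obtain k J where k: "strict_mono k" "near_isom_lim G (\<lambda>n. H (k n)) (\<lambda>n. \<phi> (k n)) p J" using limit_exists by auto
  interpret L: near_isom_lim G "\<lambda>n. H (k n)" "\<lambda>n. \<phi> (k n)" p J by (rule k(2))
  obtain A where A: "hiso A" "\<forall>y\<in>upper. J (A y) = orb G y" using L.global_isometry by auto
  interpret D: near_isom_dev G "\<lambda>n. H (k n)" "\<lambda>n. \<phi> (k n)" p J A
    by unfold_locales (use A in \<open>simp_all del: upper_iff\<close>)
  show ?thesis
  proof (intro exI[of _ k] conjI allI impI k(1))
    fix z :: complex and X Y Xs Ys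
    assume a: "0 < Re z" "X \<in> surf G" "Y \<in> surf G" "\<forall>n. Xs n \<in> surf G" "\<forall>n. Ys n \<in> surf G"
      "(\<lambda>n. qdist (Xs n) X) \<longlonglongrightarrow> 0" "(\<lambda>n. qdist (Ys n) Y) \<longlonglongrightarrow> 0"
    show "(\<lambda>n. heat_kernel (H (k n)) z (\<phi> (k n) (Xs (k n))) (\<phi> (k n) (Ys (k n)))) \<longlonglongrightarrow> heat_kernel G z X Y"
    proof (rule D.heat_kernel_convergence[OF a(1,2) _ _ a(3)])
      show "(\<lambda>n. qdist (Xs (k n)) X) \<longlonglongrightarrow> 0" using LIMSEQ_subseq_LIMSEQ[OF a(6) k(1)] by (simp add: o_def)
      show "(\<lambda>n. qdist (Ys (k n)) Y) \<longlonglongrightarrow> 0" using LIMSEQ_subseq_LIMSEQ[OF a(7) k(1)] by (simp add: o_def)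
    qed (use a(4,5) in auto)
  qed
qed

section \<open>The integral along the vertical line\<close>

context fuchsian_group
begin

definition diag_bound :: "real \<Rightarrow> complex set \<Rightarrow> complex set \<Rightarrow> real" where
  "diag_bound t X Y = (cmod (heat_kernel \<Gamma> (of_real t) X X) + cmod (heat_kernel \<Gamma> (of_real t) Y Y)) / 2"

text \<open>On the line |exp (T z)| is exp (T t) and |z| is at least t; the kernel is bounded by
  \<open>heat_kernel_diagonal_bound\<close>.\<close>

lemma norm_heat_integrand:
  assumes t: "0 < t" and X: "X \<in> surf \<Gamma>" and Y: "Y \<in> surf \<Gamma>"
  shows "cmod (heat_integrand f T \<Gamma> X Y (Complex t s)) \<le> diag_bound t X Y * (exp (T * t) / t * cmod (laplace f (Complex t s)))"
proof -
  have k: "cmod (heat_kernel \<Gamma> (Complex t s) X Y) \<le> diag_bound t X Y"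
    using heat_kernel_diagonal_bound[of "Complex t s", OF _ X Y] t by (simp add: diag_bound_def)
  have e: "cmod (exp (of_real T * Complex t s)) = exp (T * t)" by (simp add: norm_exp_eq_Re)
  have "t \<le> cmod (Complex t s)" using abs_Re_le_cmod[of "Complex t s"] t by simp
  then have "exp (T * t) / cmod (Complex t s) \<le> exp (T * t) / t" using t by (intro divide_left_mono mult_pos_pos) auto
  then have "(exp (T * t) / cmod (Complex t s)) * cmod (laplace f (Complex t s)) \<le> exp (T * t) / t * cmod (laplace f (Complex t s))"
    by (rule mult_right_mono) simp
  then have "cmod (heat_kernel \<Gamma> (Complex t s) X Y) * ((exp (T * t) / cmod (Complex t s)) * cmod (laplace f (Complex t s)))
      \<le> diag_bound t X Y * (exp (T * t) / t * cmod (laplace f (Complex t s)))"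
    by (rule mult_mono[OF k]) (use t in \<open>auto simp: diag_bound_def\<close>)
  then show ?thesis unfolding heat_integrand_def norm_mult norm_divide e by (simp add: mult_ac)
qed

lemma measurable_heat_integrand:
  assumes t: "0 < t" and X: "X \<in> surf \<Gamma>" "Y \<in> surf \<Gamma>"
    and L: "(\<lambda>s. laplace f (Complex t s)) \<in> borel_measurable lborel"
  shows "(\<lambda>s. heat_integrand f T \<Gamma> X Y (Complex t s)) \<in> borel_measurable lborel"
proof -
  have "continuous_on UNIV (Complex t)" unfolding Complex_eq by (intro continuous_intros)
  then have [measurable]: "Complex t \<in> borel_measurable borel" by (rule borel_measurable_continuous_onI)
  note [measurable] = measurable_heat_kernel[OF t X] L[unfolded measurable_lborel1]
  show ?thesis unfolding heat_integrand_def by measurable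
qed

lemma integrable_heat_integrand:
  assumes t: "0 < t" and X: "X \<in> surf \<Gamma>" "Y \<in> surf \<Gamma>" and L: "integrable lborel (\<lambda>s. laplace f (Complex t s))"
  shows "vline_integrable t (heat_integrand f T \<Gamma> X Y)"
  unfolding vline_integrable_def
proof (rule Bochner_Integration.integrable_bound)
  show "integrable lborel (\<lambda>s. diag_bound t X Y * (exp (T * t) / t * cmod (laplace f (Complex t s))))"
    by (intro integrable_mult_right integrable_norm L)
  show "AE s in lborel. norm (heat_integrand f T \<Gamma> X Y (Complex t s)) \<le> norm (diag_bound t X Y * (exp (T * t) / t * cmod (laplace f (Complex t s))))"
    unfolding real_norm_def by (intro AE_I2) (rule order_trans[OF norm_heat_integrand[OF t X] abs_ge_self])
qed (rule measurable_heat_integrand[OF t X borel_measurable_integrable[OF L]])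

text \<open>The constant family is an admissible sequence; it yields the continuity of the limit
  integral in the two points.\<close>

lemma near_isom_const: assumes "p \<in> surf \<Gamma>" shows "near_isom_seq \<Gamma> (\<lambda>_. \<Gamma>) (\<lambda>_ X. X) p"
proof unfold_locales
  show "\<forall>\<^sub>F j in sequentially. near_isom \<Gamma> \<Gamma> (\<lambda>X. X) p R \<delta>" if d: "0 < \<delta>" for \<delta> R
  proof (intro always_eventually allI)
    have "(1 - \<delta>) * qdist X Y \<le> qdist X Y" "qdist X Y \<le> (1 + \<delta>) * qdist X Y" if "X \<in> surf \<Gamma>" "Y \<in> surf \<Gamma>" for X Y
      using qdist_nonneg[OF that] d by (auto simp: algebra_simps)
    moreover have "qdist p Y \<le> 2 * qdist p Y" if "Y \<in> surf \<Gamma>" for Y using qdist_nonneg[OF assms that] by simp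
    ultimately show "near_isom \<Gamma> \<Gamma> (\<lambda>X. X) p R \<delta>" unfolding near_isom_def by blast
  qed
qed (use assms fuchsian in auto)

end

lemma (in near_isom_seq) vline_subseq:
  assumes t: "0 < t" and L: "integrable lborel (\<lambda>s. laplace f (Complex t s))"
    and X: "X \<in> surf G" "\<And>n. Xs n \<in> surf G" "(\<lambda>n. qdist (Xs n) X) \<longlonglongrightarrow> 0"
    and Y: "Y \<in> surf G" "\<And>n. Ys n \<in> surf G" "(\<lambda>n. qdist (Ys n) Y) \<longlonglongrightarrow> 0"
  shows "\<exists>k. strict_mono (k :: nat \<Rightarrow> nat) \<and>
    (\<lambda>n. vline_integral t (heat_integrand f T (H (k n)) (\<phi> (k n) (Xs (k n))) (\<phi> (k n) (Ys (k n)))))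
      \<longlonglongrightarrow> vline_integral t (heat_integrand f T G X Y)"
proof -
  obtain k where k: "strict_mono (k :: nat \<Rightarrow> nat)"
    and conv: "\<And>z X Y Xs Ys. 0 < Re z \<Longrightarrow> X \<in> surf G \<Longrightarrow> Y \<in> surf G \<Longrightarrow> (\<And>n. Xs n \<in> surf G) \<Longrightarrow> (\<And>n. Ys n \<in> surf G) \<Longrightarrow>
       (\<lambda>n. qdist (Xs n) X) \<longlonglongrightarrow> 0 \<Longrightarrow> (\<lambda>n. qdist (Ys n) Y) \<longlonglongrightarrow> 0 \<Longrightarrow>
       (\<lambda>n. heat_kernel (H (k n)) z (\<phi> (k n) (Xs (k n))) (\<phi> (k n) (Ys (k n)))) \<longlonglongrightarrow> heat_kernel G z X Y"
    using heat_kernel_subseq by auto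
  define B where "B n = fuchsian_group.diag_bound (H (k n)) t (\<phi> (k n) (Xs (k n))) (\<phi> (k n) (Ys (k n)))" for n
  \<comment> \<open>The diagonal kernels at the real time t converge by the case z = t, hence are
    bounded; so one multiple of |L(f)| dominates all integrands.\<close>
  have "(\<lambda>n. (cmod (heat_kernel (H (k n)) (of_real t) (\<phi> (k n) (Xs (k n))) (\<phi> (k n) (Xs (k n)))) +
      cmod (heat_kernel (H (k n)) (of_real t) (\<phi> (k n) (Ys (k n))) (\<phi> (k n) (Ys (k n))))) / 2)
      \<longlonglongrightarrow> (cmod (heat_kernel G (of_real t) X X) + cmod (heat_kernel G (of_real t) Y Y)) / 2"
    by (intro tendsto_divide tendsto_add tendsto_norm tendsto_const conv X Y) (simp_all add: t)
  then have "convergent B" unfolding B_def fuchsian_group.diag_bound_def[OF fH] by (rule convergentI)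
  then have "Bseq B" by (rule convergent_imp_Bseq)
  then obtain K where K: "0 < K" "\<And>n. norm (B n) \<le> K" by (auto elim: BseqE)
  have BK: "B n \<le> K" for n using K(2)[of n] by simp
  have "(\<lambda>n. (LINT s|lborel. heat_integrand f T (H (k n)) (\<phi> (k n) (Xs (k n))) (\<phi> (k n) (Ys (k n))) (Complex t s) * \<i>))
      \<longlonglongrightarrow> (LINT s|lborel. heat_integrand f T G X Y (Complex t s) * \<i>)"
  proof (rule integral_dominated_convergence[where w = "\<lambda>s. K * (exp (T * t) / t * cmod (laplace f (Complex t s)))"])
    note Lm = borel_measurable_integrable[OF L]
    show "(\<lambda>s. heat_integrand f T G X Y (Complex t s) * \<i>) \<in> borel_measurable lborel"
      by (intro borel_measurable_times N.measurable_heat_integrand t X Y Lm borel_measurable_const)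
    show "(\<lambda>s. heat_integrand f T (H (k n)) (\<phi> (k n) (Xs (k n))) (\<phi> (k n) (Ys (k n))) (Complex t s) * \<i>) \<in> borel_measurable lborel" for n
      by (intro borel_measurable_times fuchsian_group.measurable_heat_integrand[OF fH] t maps X Y Lm borel_measurable_const)
    show "integrable lborel (\<lambda>s. K * (exp (T * t) / t * cmod (laplace f (Complex t s))))"
      by (intro integrable_mult_right integrable_norm L)
    show "AE s in lborel. (\<lambda>n. heat_integrand f T (H (k n)) (\<phi> (k n) (Xs (k n))) (\<phi> (k n) (Ys (k n))) (Complex t s) * \<i>)
        \<longlonglongrightarrow> heat_integrand f T G X Y (Complex t s) * \<i>"
    proof (rule AE_I2)
      fix s
      have "(\<lambda>n. heat_kernel (H (k n)) (Complex t s) (\<phi> (k n) (Xs (k n))) (\<phi> (k n) (Ys (k n)))) \<longlonglongrightarrow> heat_kernel G (Complex t s) X Y"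
        by (intro conv X Y) (simp add: t)
      then show "(\<lambda>n. heat_integrand f T (H (k n)) (\<phi> (k n) (Xs (k n))) (\<phi> (k n) (Ys (k n))) (Complex t s) * \<i>)
          \<longlonglongrightarrow> heat_integrand f T G X Y (Complex t s) * \<i>"
        unfolding heat_integrand_def times_divide_eq_right[symmetric] mult.assoc by (rule tendsto_mult[OF _ tendsto_const])
    qed
    show "AE s in lborel. norm (heat_integrand f T (H (k n)) (\<phi> (k n) (Xs (k n))) (\<phi> (k n) (Ys (k n))) (Complex t s) * \<i>)
        \<le> K * (exp (T * t) / t * cmod (laplace f (Complex t s)))" for n
    proof (rule AE_I2)
      fix s
      have "norm (heat_integrand f T (H (k n)) (\<phi> (k n) (Xs (k n))) (\<phi> (k n) (Ys (k n))) (Complex t s) * \<i>)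
          = norm (heat_integrand f T (H (k n)) (\<phi> (k n) (Xs (k n))) (\<phi> (k n) (Ys (k n))) (Complex t s))" by (simp add: norm_mult)
      also have "\<dots> \<le> B n * (exp (T * t) / t * cmod (laplace f (Complex t s)))"
        unfolding B_def by (rule fuchsian_group.norm_heat_integrand[OF fH t maps[OF X(2)] maps[OF Y(2)]])
      also have "\<dots> \<le> K * (exp (T * t) / t * cmod (laplace f (Complex t s)))"
        by (rule mult_right_mono[OF BK]) (use t in simp)
      finally show "norm (heat_integrand f T (H (k n)) (\<phi> (k n) (Xs (k n))) (\<phi> (k n) (Ys (k n))) (Complex t s) * \<i>)
          \<le> K * (exp (T * t) / t * cmod (laplace f (Complex t s)))" .
    qed
  qed
  then have "(\<lambda>n. vline_integral t (heat_integrand f T (H (k n)) (\<phi> (k n) (Xs (k n))) (\<phi> (k n) (Ys (k n)))))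
      \<longlonglongrightarrow> vline_integral t (heat_integrand f T G X Y)"
    unfolding vline_integral_def by (rule tendsto_mult[OF tendsto_const])
  then show ?thesis using k by blast
qed

context elliptically_degenerating
begin

text \<open>If uniformity fails, there are multi-orders \<open>q n\<close> with all entries at least
  n and pairs in \<open>C\<close> at which the two integrals stay at least \<open>e\<close> apart.
  Along a subsequence the pairs converge, and then both integrals tend to the limit integral at the
  limit pair.\<close>

lemma vline_uniform:
  assumes t: "0 < t" and L: "integrable lborel (\<lambda>s. laplace f (Complex t s))"
    and C: "compactin (prod_topology (surf_top \<Gamma>_inf) (surf_top \<Gamma>_inf)) C"
  shows "uniform_limit C (\<lambda>q (x, y). vline_integral t (heat_integrand f T (\<Gamma> q) (\<phi> q x) (\<phi> q y)))
     (\<lambda>(x, y). vline_integral t (heat_integrand f T \<Gamma>_inf x y)) (orders_to_infinity Q)"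
proof (rule ccontr)
  interpret N: fuchsian_group \<Gamma>_inf by (rule fg_inf)
  define V where "V q x y = vline_integral t (heat_integrand f T (\<Gamma> q) (\<phi> q x) (\<phi> q y))" for q x y
  define W where "W x y = vline_integral t (heat_integrand f T \<Gamma>_inf x y)" for x y
  assume "\<not> ?thesis"
  then have "\<not> (\<forall>e>0. \<forall>\<^sub>F q in orders_to_infinity Q. \<forall>c\<in>C. dist (V q (fst c) (snd c)) (W (fst c) (snd c)) < e)"
    by (simp add: uniform_limit_iff V_def W_def case_prod_beta)
  then obtain e where e: "0 < e" "\<And>N. \<exists>q\<in>Q. (\<forall>k. N \<le> q k) \<and> (\<exists>c\<in>C. \<not> dist (V q (fst c) (snd c)) (W (fst c) (snd c)) < e)"
    unfolding eventually_orders_to_infinity by meson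
  have "\<forall>n. \<exists>q c. q \<in> Q \<and> (\<forall>k. n \<le> q k) \<and> c \<in> C \<and> \<not> dist (V q (fst c) (snd c)) (W (fst c) (snd c)) < e"
    using e(2) by blast
  then obtain q c where q: "\<And>n. q n \<in> Q" "\<And>n k. n \<le> q n k" and c: "\<And>n. c n \<in> C"
    and far: "\<And>n. \<not> dist (V (q n) (fst (c n)) (snd (c n))) (W (fst (c n)) (snd (c n))) < e" by metis
  have C1: "compactin (surf_top \<Gamma>_inf) (fst ` C)" and C2: "compactin (surf_top \<Gamma>_inf) (snd ` C)"
    using image_compactin[OF C continuous_map_fst] image_compactin[OF C continuous_map_snd] by auto
  have sub: "fst ` C \<subseteq> surf \<Gamma>_inf" "snd ` C \<subseteq> surf \<Gamma>_inf"
    using compactin_subset_topspace[OF C1] compactin_subset_topspace[OF C2] by simp_all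
  have cf: "fst (c n) \<in> fst ` C" "snd (c n) \<in> snd ` C" for n using c[of n] by auto
  obtain x r1 where r1: "x \<in> fst ` C" "strict_mono (r1 :: nat \<Rightarrow> nat)" "(\<lambda>n. qdist (fst (c (r1 n))) x) \<longlonglongrightarrow> 0"
    by (rule N.compactin_seq[OF C1, of "\<lambda>n. fst (c n)", OF cf(1)])
  obtain y r2 where r2: "y \<in> snd ` C" "strict_mono (r2 :: nat \<Rightarrow> nat)" "(\<lambda>n. qdist (snd (c (r1 (r2 n)))) y) \<longlonglongrightarrow> 0"
    by (rule N.compactin_seq[OF C2, of "\<lambda>n. snd (c (r1 n))", OF cf(2)])
  define r where "r n = r1 (r2 n)" for n
  have r: "strict_mono r" using strict_mono_o[OF r1(2) r2(2)] by (simp add: r_def[abs_def] o_def)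
  define Xs Ys where "Xs n = fst (c (r n))" and "Ys n = snd (c (r n))" for n
  have x: "x \<in> surf \<Gamma>_inf" and y: "y \<in> surf \<Gamma>_inf" using r1(1) r2(1) sub by auto
  have Xs: "Xs n \<in> surf \<Gamma>_inf" and Ys: "Ys n \<in> surf \<Gamma>_inf" for n
    using cf sub unfolding Xs_def Ys_def by blast+
  have Xl: "(\<lambda>n. qdist (Xs n) x) \<longlonglongrightarrow> 0" using LIMSEQ_subseq_LIMSEQ[OF r1(3) r2(2)] by (simp add: Xs_def r_def o_def)
  have Yl: "(\<lambda>n. qdist (Ys n) y) \<longlonglongrightarrow> 0" using r2(3) by (simp add: Ys_def r_def)
  \<comment> \<open>The entries of \<open>q (r n)\<close> are at least n, so whatever holds
    eventually for the filter holds eventually along the sequence.\<close>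
  have ev: "\<forall>\<^sub>F n in sequentially. P (q (r n))" if P: "eventually P (orders_to_infinity Q)" for P
  proof -
    obtain n0 where n0: "\<forall>q\<in>Q. (\<forall>k. n0 \<le> q k) \<longrightarrow> P q" using P[unfolded eventually_orders_to_infinity] by blast
    have "P (q (r n))" if "n0 \<le> n" for n
    proof -
      have "n0 \<le> q (r n) k" for k using that seq_suble[OF r, of n] q(2)[of "r n" k] by linarith
      then show ?thesis using n0 q(1) by blast
    qed
    then show ?thesis unfolding eventually_sequentially by blast
  qed
  have S1: "near_isom_seq \<Gamma>_inf (\<lambda>n. \<Gamma> (q (r n))) (\<lambda>n. \<phi> (q (r n))) x"
  proof (intro near_isom_seq.intro near_isom_seq_axioms.intro)
    show "\<forall>\<^sub>F j in sequentially. near_isom \<Gamma>_inf (\<Gamma> (q (r j))) (\<phi> (q (r j))) x R \<delta>" if "0 < \<delta>" "\<delta> \<le> 1 / 2" "0 \<le> R" for \<delta> R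
      by (rule ev[OF eventually_near_isom[OF x that]])
  qed (use fg_inf x fg q(1) \<phi>_in_surf in auto)
  obtain k where k: "strict_mono (k :: nat \<Rightarrow> nat)" "(\<lambda>n. V (q (r (k n))) (Xs (k n)) (Ys (k n))) \<longlonglongrightarrow> W x y"
    using near_isom_seq.vline_subseq[OF S1 t L x Xs Xl y Ys Yl, of T] unfolding V_def W_def by auto
  have Xl': "(\<lambda>n. qdist (Xs (k n)) x) \<longlonglongrightarrow> 0" "(\<lambda>n. qdist (Ys (k n)) y) \<longlonglongrightarrow> 0"
    using LIMSEQ_subseq_LIMSEQ[OF Xl k(1)] LIMSEQ_subseq_LIMSEQ[OF Yl k(1)] by (simp_all add: o_def)
  \<comment> \<open>The constant family, applied to the same moving points, gives continuity of the
    limit integral along them.\<close>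
  obtain m where m: "strict_mono (m :: nat \<Rightarrow> nat)" "(\<lambda>n. W (Xs (k (m n))) (Ys (k (m n)))) \<longlonglongrightarrow> W x y"
    using near_isom_seq.vline_subseq[OF N.near_isom_const[OF x] t L x Xs Xl'(1) y Ys Xl'(2), of T] unfolding W_def by auto
  have "(\<lambda>n. V (q (r (k (m n)))) (Xs (k (m n))) (Ys (k (m n)))) \<longlonglongrightarrow> W x y"
    using LIMSEQ_subseq_LIMSEQ[OF k(2) m(1)] by (simp add: o_def)
  then have "(\<lambda>n. dist (V (q (r (k (m n)))) (Xs (k (m n))) (Ys (k (m n)))) (W (Xs (k (m n))) (Ys (k (m n))))) \<longlonglongrightarrow> dist (W x y) (W x y)"
    by (rule tendsto_dist[OF _ m(2)])
  then have "\<forall>\<^sub>F n in sequentially. dist (V (q (r (k (m n)))) (Xs (k (m n))) (Ys (k (m n)))) (W (Xs (k (m n))) (Ys (k (m n)))) < e"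
    using e(1) by (intro order_tendstoD(2)) auto
  then obtain n where "dist (V (q (r (k (m n)))) (Xs (k (m n))) (Ys (k (m n)))) (W (Xs (k (m n))) (Ys (k (m n)))) < e"
    unfolding eventually_sequentially by auto
  then show False using far[of "r (k (m n))"] by (simp add: Xs_def Ys_def)
qed

end

theorem theorem7p1:
  fixes f :: "real \<Rightarrow> complex" and t T \<epsilon> :: real
    and Q :: "('m::finite \<Rightarrow> nat) set"
    and \<Gamma> :: "('m \<Rightarrow> nat) \<Rightarrow> (complex \<Rightarrow> complex) set"
    and \<Gamma>_inf :: "(complex \<Rightarrow> complex) set"
    and apex :: "('m \<Rightarrow> nat) \<Rightarrow> 'm \<Rightarrow> complex set"
    and \<kappa> :: "('m \<Rightarrow> nat) \<Rightarrow> 'm \<Rightarrow> real \<times> real \<Rightarrow> complex set"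
    and \<sigma> :: "'m \<Rightarrow> complex \<Rightarrow> complex set"
    and \<phi> :: "('m \<Rightarrow> nat) \<Rightarrow> complex set \<Rightarrow> complex set"
    and x y :: "complex set"
  assumes f_measurable: "f \<in> borel_measurable (lebesgue_on {0<..})"
    and t_pos: "0 < t"
    and laplace_exists:
      "\<And>s. set_integrable lebesgue {0<..} (\<lambda>u. f u * exp (- Complex t s * of_real u))"
    and laplace_L1: "integrable lborel (\<lambda>s. laplace f (Complex t s))"
    and family: "elliptically_degenerating Q \<Gamma> \<Gamma>_inf apex \<kappa> \<sigma> \<phi>"
    and eps: "0 < \<epsilon>" "\<epsilon> < 1/2"
    and x_away: "x \<in> surf \<Gamma>_inf - (\<Union>k. \<sigma> k ` cusp_dom \<epsilon>)"
    and y_away: "y \<in> surf \<Gamma>_inf - (\<Union>k. \<sigma> k ` cusp_dom \<epsilon>)"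
    and T_pos: "0 < T"
  shows "(\<forall>q \<in> Q. vline_integrable t (heat_integrand f T (\<Gamma> q) (\<phi> q x) (\<phi> q y))) \<and>
    vline_integrable t (heat_integrand f T \<Gamma>_inf x y) \<and>
    ((\<lambda>q. vline_integral t (heat_integrand f T (\<Gamma> q) (\<phi> q x) (\<phi> q y)))
       \<longlongrightarrow> vline_integral t (heat_integrand f T \<Gamma>_inf x y)) (orders_to_infinity Q) \<and>
    (\<forall>C. compactin (prod_topology (surf_top \<Gamma>_inf) (surf_top \<Gamma>_inf)) C \<longrightarrow>
       uniform_limit C
         (\<lambda>q (x', y'). vline_integral t (heat_integrand f T (\<Gamma> q) (\<phi> q x') (\<phi> q y')))
         (\<lambda>(x', y'). vline_integral t (heat_integrand f T \<Gamma>_inf x' y'))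
         (orders_to_infinity Q))"
proof -
  interpret elliptically_degenerating Q \<Gamma> \<Gamma>_inf apex \<kappa> \<sigma> \<phi> by (rule family)
  interpret N: fuchsian_group \<Gamma>_inf by (rule fg_inf)
  have x: "x \<in> surf \<Gamma>_inf" and y: "y \<in> surf \<Gamma>_inf" using x_away y_away by auto
  note unif = vline_uniform[OF t_pos laplace_L1, of _ T]
  \<comment> \<open>Convergence at the given pair is uniform convergence on the one-point
    set.\<close>
  have "compactin (prod_topology (surf_top \<Gamma>_inf) (surf_top \<Gamma>_inf)) {(x, y)}"
    using x y by (intro finite_imp_compactin) auto
  from tendsto_uniform_limitI[OF unif[OF this], of "(x, y)"]
  have "((\<lambda>q. vline_integral t (heat_integrand f T (\<Gamma> q) (\<phi> q x) (\<phi> q y)))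
       \<longlongrightarrow> vline_integral t (heat_integrand f T \<Gamma>_inf x y)) (orders_to_infinity Q)" by simp
  moreover have "vline_integrable t (heat_integrand f T (\<Gamma> q) (\<phi> q x) (\<phi> q y))" if q: "q \<in> Q" for q
    by (rule fuchsian_group.integrable_heat_integrand[OF fg[OF q] t_pos \<phi>_in_surf[OF q x] \<phi>_in_surf[OF q y] laplace_L1])
  ultimately show ?thesis using unif N.integrable_heat_integrand[OF t_pos x y laplace_L1] by blast
qed

end
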